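(* Let $G$ be a compact connected abelian Lie group and let $\Gamma\subset SO(3)$ be a finite subgroup, acting on $S^2$ by rotations. Let $\xi_1$ and $\xi_2$ be $\Gamma$-equivariant principal $G$-bundles over $S^2$. If $\xi_1$ and $\xi_2$ have the same isotropy representations, then $c(\xi_1)\equiv c(\xi_2) \pmod{|\Gamma|}$, i.e. $c(\xi_1)-c(\xi_2)\in |\Gamma|\cdot\pi_2(BG)$.
   Context: A $\Gamma$-equivariant principal $G$-bundle $\xi=(E,X,p,G,\Gamma)$ over a left $\Gamma$-space $X$ is a locally trivial principal (right) $G$-bundle $p:E\to X$ such that $E$ is a left $\Gamma$-space, $p$ is $\Gamma$-equivariant and $\gamma(e\cdot g)=(\gamma e)\cdot g$ for all $\gamma\in\Gamma$, $g\in G$, $e\in E$. Isotropy representations: for $x\in X$ with stabilizer $\Gamma_x$ and $e\in p^{-1}(x)$, let $\alpha_x:\Gamma_x\to G$ be the homomorphism defined by $\gamma e=e\cdot\alpha_x(\gamma)$ for $\gamma\in\Gamma_x$. It is independent of the choice of $e$ up to conjugation in $G$. Two bundles $\xi_1,\xi_2$ over $X$ have the same isotropy representations if for every $x\in X$ the homomorphisms $\Gamma_x\to G$ attached to $\xi_1$ and to $\xi_2$ are conjugate in $G$. Chern class: $c(\xi)\in[S^2,BG]=\pi_2(BG)=\pi_1(G)$ is the class of the classifying map of the underlying (non-equivariant) principal $G$-bundle of $\xi$ over $S^2$. *)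

theory Defs
  imports "HOL-Analysis.Analysis" "HOL-Algebra.Group_Action"
begin

section \<open>Lie groups\<close>

record 'a tgroup = "'a monoid" +
  gtop :: "'a topology"

definition topological_group :: "('a, 'm) tgroup_scheme \<Rightarrow> bool" where
  "topological_group G \<longleftrightarrow>
     group G \<and> topspace (gtop G) = carrier G \<and>
     continuous_map (prod_topology (gtop G) (gtop G)) (gtop G) (\<lambda>(x, y). x \<otimes>\<^bsub>G\<^esub> y) \<and>
     continuous_map (gtop G) (gtop G) (\<lambda>x. m_inv G x)"

text \<open>Charts take values in \<^const>\<open>Euclidean_space\<close> \<open>n\<close>, so that dimension \<open>0\<close> is covered.
  A function on an open subset of this space is of class \<open>C\<^sup>k\<close> if its iterated partial
  derivatives up to order \<open>k\<close> exist and are continuous.\<close>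

primrec Ck_on :: "nat \<Rightarrow> nat \<Rightarrow> (nat \<Rightarrow> real) set \<Rightarrow> ((nat \<Rightarrow> real) \<Rightarrow> real) \<Rightarrow> bool" where
  "Ck_on 0 n U f \<longleftrightarrow> continuous_map (subtopology (Euclidean_space n) U) euclideanreal f"
| "Ck_on (Suc k) n U f \<longleftrightarrow>
     continuous_map (subtopology (Euclidean_space n) U) euclideanreal f \<and>
     (\<forall>i<n. (\<forall>x\<in>U. (\<lambda>t. f (x(i := t))) differentiable at (x i)) \<and>
            Ck_on k n U (\<lambda>x. deriv (\<lambda>t. f (x(i := t))) (x i)))"

definition smooth_on :: "nat \<Rightarrow> nat \<Rightarrow> (nat \<Rightarrow> real) set \<Rightarrow> ((nat \<Rightarrow> real) \<Rightarrow> nat \<Rightarrow> real) \<Rightarrow> bool" where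
  "smooth_on n m U f \<longleftrightarrow> (\<forall>j<m. \<forall>k. Ck_on k n U (\<lambda>x. f x j))"

type_synonym 'a chart = "'a set \<times> ('a \<Rightarrow> nat \<Rightarrow> real)"

definition is_chart :: "nat \<Rightarrow> 'a topology \<Rightarrow> 'a chart \<Rightarrow> bool" where
  "is_chart n X = (\<lambda>(U, \<phi>).
     openin X U \<and> openin (Euclidean_space n) (\<phi> ` U) \<and>
     homeomorphic_map (subtopology X U) (subtopology (Euclidean_space n) (\<phi> ` U)) \<phi>)"

definition smooth_atlas :: "nat \<Rightarrow> 'a topology \<Rightarrow> 'a chart set \<Rightarrow> bool" where
  "smooth_atlas n X A \<longleftrightarrow>
     (\<forall>c\<in>A. is_chart n X c) \<and> (\<Union>(U, \<phi>)\<in>A. U) = topspace X \<and>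
     (\<forall>(U, \<phi>)\<in>A. \<forall>(V, \<psi>)\<in>A. smooth_on n n (\<phi> ` (U \<inter> V)) (\<lambda>z. \<psi> (inv_into U \<phi> z)))"

definition smooth_map ::
    "nat \<Rightarrow> 'a topology \<Rightarrow> 'a chart set \<Rightarrow> nat \<Rightarrow> 'b topology \<Rightarrow> 'b chart set \<Rightarrow> ('a \<Rightarrow> 'b) \<Rightarrow> bool" where
  "smooth_map n X A m Y B f \<longleftrightarrow>
     continuous_map X Y f \<and>
     (\<forall>(U, \<phi>)\<in>A. \<forall>(V, \<psi>)\<in>B.
        smooth_on n m (\<phi> ` {x \<in> U. f x \<in> V}) (\<lambda>z. \<psi> (f (inv_into U \<phi> z))))"

definition prod_atlas :: "nat \<Rightarrow> 'a chart set \<Rightarrow> 'b chart set \<Rightarrow> ('a \<times> 'b) chart set" where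
  "prod_atlas n A B =
     {(U \<times> V, \<lambda>(x, y) i. if i < n then \<phi> x i else \<psi> y (i - n)) | U \<phi> V \<psi>. (U, \<phi>) \<in> A \<and> (V, \<psi>) \<in> B}"

definition lie_group :: "('a, 'm) tgroup_scheme \<Rightarrow> bool" where
  "lie_group G \<longleftrightarrow>
     topological_group G \<and> Hausdorff_space (gtop G) \<and> second_countable (gtop G) \<and>
     (\<exists>n A. smooth_atlas n (gtop G) A \<and>
        smooth_map (n + n) (prod_topology (gtop G) (gtop G)) (prod_atlas n A A) n (gtop G) A
          (\<lambda>(x, y). x \<otimes>\<^bsub>G\<^esub> y) \<and>
        smooth_map n (gtop G) A n (gtop G) A (\<lambda>x. m_inv G x))"

section \<open>Principal bundles\<close>

record ('e, 'x, 'g) pbundle =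
  total_space :: "'e topology"
  base_space :: "'x topology"
  bproj :: "'e \<Rightarrow> 'x"
  ract :: "'e \<Rightarrow> 'g \<Rightarrow> 'e"

definition right_space :: "('g, 'm) tgroup_scheme \<Rightarrow> 'e topology \<Rightarrow> ('e \<Rightarrow> 'g \<Rightarrow> 'e) \<Rightarrow> bool" where
  "right_space G E r \<longleftrightarrow>
     continuous_map (prod_topology E (gtop G)) E (\<lambda>(e, g). r e g) \<and>
     (\<forall>e\<in>topspace E. r e \<one>\<^bsub>G\<^esub> = e) \<and>
     (\<forall>e\<in>topspace E. \<forall>g\<in>carrier G. \<forall>h\<in>carrier G. r e (g \<otimes>\<^bsub>G\<^esub> h) = r (r e g) h)"

definition left_space :: "('c, 'm) tgroup_scheme \<Rightarrow> 'x topology \<Rightarrow> ('c \<Rightarrow> 'x \<Rightarrow> 'x) \<Rightarrow> bool" where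
  "left_space \<Gamma> X l \<longleftrightarrow>
     continuous_map (prod_topology (gtop \<Gamma>) X) X (\<lambda>(\<gamma>, x). l \<gamma> x) \<and>
     (\<forall>x\<in>topspace X. l \<one>\<^bsub>\<Gamma>\<^esub> x = x) \<and>
     (\<forall>x\<in>topspace X. \<forall>\<gamma>\<in>carrier \<Gamma>. \<forall>\<delta>\<in>carrier \<Gamma>. l (\<gamma> \<otimes>\<^bsub>\<Gamma>\<^esub> \<delta>) x = l \<gamma> (l \<delta> x))"

definition principal_bundle ::
    "('g, 'm) tgroup_scheme \<Rightarrow> ('e, 'x, 'g, 'z) pbundle_scheme \<Rightarrow> bool" where
  "principal_bundle G \<xi> \<longleftrightarrow>
     topological_group G \<and> right_space G (total_space \<xi>) (ract \<xi>) \<and>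
     continuous_map (total_space \<xi>) (base_space \<xi>) (bproj \<xi>) \<and>
     (\<forall>e\<in>topspace (total_space \<xi>). \<forall>g\<in>carrier G. bproj \<xi> (ract \<xi> e g) = bproj \<xi> e) \<and>
     (\<forall>x\<in>topspace (base_space \<xi>). \<exists>U \<Phi>. openin (base_space \<xi>) U \<and> x \<in> U \<and>
        homeomorphic_map (prod_topology (subtopology (base_space \<xi>) U) (gtop G))
          (subtopology (total_space \<xi>) {e \<in> topspace (total_space \<xi>). bproj \<xi> e \<in> U}) \<Phi> \<and>
        (\<forall>u\<in>U. \<forall>g\<in>carrier G. bproj \<xi> (\<Phi> (u, g)) = u \<and>
           (\<forall>h\<in>carrier G. \<Phi> (u, g \<otimes>\<^bsub>G\<^esub> h) = ract \<xi> (\<Phi> (u, g)) h)))"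

text \<open>Isomorphism of principal bundles over the identity of the common base.\<close>

definition bundle_iso ::
    "('g, 'm) tgroup_scheme \<Rightarrow> ('e, 'x, 'g, 'z) pbundle_scheme \<Rightarrow> ('f, 'x, 'g, 'w) pbundle_scheme \<Rightarrow> bool" where
  "bundle_iso G \<xi> \<eta> \<longleftrightarrow> base_space \<xi> = base_space \<eta> \<and>
     (\<exists>\<phi>. homeomorphic_map (total_space \<xi>) (total_space \<eta>) \<phi> \<and>
        (\<forall>e\<in>topspace (total_space \<xi>). bproj \<eta> (\<phi> e) = bproj \<xi> e \<and>
           (\<forall>g\<in>carrier G. \<phi> (ract \<xi> e g) = ract \<eta> (\<phi> e) g)))"

definition pullback_bundle ::
    "'x topology \<Rightarrow> ('x \<Rightarrow> 'b) \<Rightarrow> ('e, 'b, 'g, 'z) pbundle_scheme \<Rightarrow> ('x \<times> 'e, 'x, 'g) pbundle" where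
  "pullback_bundle X f \<zeta> =
     \<lparr>total_space = subtopology (prod_topology X (total_space \<zeta>)) {(x, e). f x = bproj \<zeta> e},
      base_space = X, bproj = fst, ract = (\<lambda>(x, e) g. (x, ract \<zeta> e g))\<rparr>"

text \<open>A universal bundle \<open>EG \<rightarrow> BG\<close>; statements about \<open>BG\<close> are made for an arbitrary one.\<close>

definition universal_bundle ::
    "('g, 'm) tgroup_scheme \<Rightarrow> ('e, 'b, 'g, 'z) pbundle_scheme \<Rightarrow> bool" where
  "universal_bundle G \<zeta> \<longleftrightarrow> principal_bundle G \<zeta> \<and> contractible_space (total_space \<zeta>)"

definition classifying_map ::
    "('g, 'm) tgroup_scheme \<Rightarrow> ('e, 'b, 'g, 'z) pbundle_scheme \<Rightarrow> ('f, 'x, 'g, 'w) pbundle_scheme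
      \<Rightarrow> ('x \<Rightarrow> 'b) \<Rightarrow> bool" where
  "classifying_map G \<zeta> \<xi> f \<longleftrightarrow>
     continuous_map (base_space \<xi>) (base_space \<zeta>) f \<and>
     bundle_iso G (pullback_bundle (base_space \<xi>) f \<zeta>) \<xi>"

section \<open>Equivariant principal bundles\<close>

record ('e, 'x, 'g, 'c) eqbundle = "('e, 'x, 'g) pbundle" +
  lact :: "'c \<Rightarrow> 'e \<Rightarrow> 'e"

definition equivariant_bundle ::
    "('g, 'm) tgroup_scheme \<Rightarrow> ('c, 'n) tgroup_scheme \<Rightarrow> ('c \<Rightarrow> 'x \<Rightarrow> 'x)
      \<Rightarrow> ('e, 'x, 'g, 'c, 'z) eqbundle_scheme \<Rightarrow> bool" where
  "equivariant_bundle G \<Gamma> act \<xi> \<longleftrightarrow>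
     topological_group \<Gamma> \<and> left_space \<Gamma> (base_space \<xi>) act \<and>
     principal_bundle G \<xi> \<and> left_space \<Gamma> (total_space \<xi>) (lact \<xi>) \<and>
     (\<forall>\<gamma>\<in>carrier \<Gamma>. \<forall>e\<in>topspace (total_space \<xi>).
        bproj \<xi> (lact \<xi> \<gamma> e) = act \<gamma> (bproj \<xi> e) \<and>
        (\<forall>g\<in>carrier G. lact \<xi> \<gamma> (ract \<xi> e g) = ract \<xi> (lact \<xi> \<gamma> e) g))"

definition isotropy_rep ::
    "('g, 'm) tgroup_scheme \<Rightarrow> ('e, 'x, 'g, 'c, 'z) eqbundle_scheme \<Rightarrow> 'e \<Rightarrow> 'c \<Rightarrow> 'g" where
  "isotropy_rep G \<xi> e \<gamma> = (THE g. g \<in> carrier G \<and> lact \<xi> \<gamma> e = ract \<xi> e g)"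

definition same_isotropy_reps ::
    "('g, 'm) tgroup_scheme \<Rightarrow> ('c, 'n) tgroup_scheme \<Rightarrow> ('c \<Rightarrow> 'x \<Rightarrow> 'x)
      \<Rightarrow> ('e, 'x, 'g, 'c, 'z) eqbundle_scheme \<Rightarrow> ('f, 'x, 'g, 'c, 'w) eqbundle_scheme \<Rightarrow> bool" where
  "same_isotropy_reps G \<Gamma> act \<xi>1 \<xi>2 \<longleftrightarrow>
     (\<forall>x\<in>topspace (base_space \<xi>1).
      \<forall>e1\<in>topspace (total_space \<xi>1). \<forall>e2\<in>topspace (total_space \<xi>2).
        bproj \<xi>1 e1 = x \<and> bproj \<xi>2 e2 = x \<longrightarrow>
        (\<exists>h\<in>carrier G. \<forall>\<gamma>\<in>stabilizer \<Gamma> act x.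
           isotropy_rep G \<xi>2 e2 \<gamma> = h \<otimes>\<^bsub>G\<^esub> isotropy_rep G \<xi>1 e1 \<gamma> \<otimes>\<^bsub>G\<^esub> m_inv G h))"

section \<open>The second homotopy group and the Chern class\<close>

definition square :: "(real \<times> real) topology" where
  "square = top_of_set ({0..1} \<times> {0..1})"

definition square_boundary :: "(real \<times> real) set" where
  "square_boundary = {(s, t) \<in> {0..1} \<times> {0..1}. s \<in> {0, 1} \<or> t \<in> {0, 1}}"

definition square_homotopic ::
    "'b topology \<Rightarrow> 'b \<Rightarrow> (real \<times> real \<Rightarrow> 'b) \<Rightarrow> (real \<times> real \<Rightarrow> 'b) \<Rightarrow> bool" where
  "square_homotopic X b = homotopic_with (\<lambda>h. h ` square_boundary \<subseteq> {b}) square X"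

definition square_concat :: "(real \<times> real \<Rightarrow> 'b) \<Rightarrow> (real \<times> real \<Rightarrow> 'b) \<Rightarrow> real \<times> real \<Rightarrow> 'b" where
  "square_concat f g = (\<lambda>(s, t). if s \<le> 1/2 then f (2 * s, t) else g (2 * s - 1, t))"

text \<open>Elements of \<open>\<pi>\<^sub>2(X, b)\<close> are homotopy classes, as sets of maps, of maps of pairs from the
  square and its boundary to \<open>(X, b)\<close>.\<close>

definition pi2 :: "'b topology \<Rightarrow> 'b \<Rightarrow> (real \<times> real \<Rightarrow> 'b) set monoid" where
  "pi2 X b =
     \<lparr>carrier = {Collect (square_homotopic X b f) | f.
        continuous_map square X f \<and> f ` square_boundary \<subseteq> {b}},
      monoid.mult = (\<lambda>c d. {h. \<exists>f\<in>c. \<exists>g\<in>d. square_homotopic X b (square_concat f g) h}),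
      one = Collect (square_homotopic X b (\<lambda>_. b))\<rparr>"

definition S2 :: "(real^3) topology" where
  "S2 = top_of_set (sphere 0 1)"

text \<open>The identification of the square with boundary collapsed and the sphere: the radial
  homeomorphism \<open>(x, y) \<mapsto> (x/m, y/m)\<close> from the open square \<open>(-1,1)\<^sup>2\<close> to the plane, with
  \<open>m = (1-x\<^sup>2)(1-y\<^sup>2)\<close>, followed by inverse stereographic projection from the south pole
  (cleared of denominators). It preserves the standard orientations and sends the boundary to
  the south pole.\<close>

definition square_to_S2 :: "real \<times> real \<Rightarrow> real^3" where
  "square_to_S2 = (\<lambda>(s, t).
     let x = 2 * s - 1; y = 2 * t - 1; m = (1 - x\<^sup>2) * (1 - y\<^sup>2) in
     (1 / (m\<^sup>2 + x\<^sup>2 + y\<^sup>2)) *\<^sub>R vector [2 * m * x, 2 * m * y, m\<^sup>2 - x\<^sup>2 - y\<^sup>2])"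

text \<open>The Chern class of a bundle \<open>\<xi>\<close> over the sphere is the element of \<open>\<pi>\<^sub>2(BG, b)\<close> whose image
  under the map \<open>\<pi>\<^sub>2(BG, b) \<rightarrow> [S\<^sup>2, BG]\<close> that forgets base points is the class of the classifying
  maps of \<open>\<xi>\<close>. It is well defined for connected \<open>G\<close>, since then \<open>BG\<close> is simply connected.\<close>

definition chern_class ::
    "('g, 'm) tgroup_scheme \<Rightarrow> ('e, 'b, 'g, 'z) pbundle_scheme \<Rightarrow> 'b
      \<Rightarrow> ('f, real^3, 'g, 'w) pbundle_scheme \<Rightarrow> (real \<times> real \<Rightarrow> 'b) set" where
  "chern_class G \<zeta> b \<xi> =
     (THE c. c \<in> carrier (pi2 (base_space \<zeta>) b) \<and>
        (\<exists>f g. f \<circ> square_to_S2 \<in> c \<and> homotopic_with (\<lambda>_. True) S2 (base_space \<zeta>) f g \<and>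
           classifying_map G \<zeta> \<xi> g))"

section \<open>Rotation groups\<close>

definition SO3 :: "(real^3^3) tgroup" where
  "SO3 = \<lparr>carrier = {A. rotation_matrix A}, monoid.mult = (**), one = mat 1,
          gtop = top_of_set {A. rotation_matrix A}\<rparr>"

definition top_subgroup :: "('a, 'm) tgroup_scheme \<Rightarrow> 'a set \<Rightarrow> ('a, 'm) tgroup_scheme" where
  "top_subgroup G H = G\<lparr>carrier := H, gtop := subtopology (gtop G) H\<rparr>"

end

theory Submission
  imports Defs "HOL-Algebra.Sylow"
begin

text \<open>
  A lift to the total space of the square with collapsed boundary moves along a single fibre on the
  boundary; its displacement there is a map \<open>w\<close> from the boundary of the square to \<open>G\<close>. Modulo
  maps that extend over the square, and with pointwise multiplication as group law, \<open>w\<close> is an element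
  of \<open>\<pi>\<^sub>1(G)\<close>; it determines the bundle, and for a universal bundle it identifies \<open>\<pi>\<^sub>2(BG)\<close> with
  \<open>\<pi>\<^sub>1(G)\<close>. So the Chern classes can be compared through clutching maps.

  By Bezout and Sylow it suffices to treat a subgroup of prime power order. It has a central rotation,
  whose axis it preserves, so it is cyclic or dihedral about that axis. Let \<open>C\<close> be the cyclic part,
  of order \<open>n\<close>. Because the isotropy representations at the pole agree, there is a \<open>C\<close>-equivariant
  isomorphism between the two bundles over each hemisphere, and the two isomorphisms differ along the
  equator by a map \<open>u\<close> with \<open>u(\<zeta> z) = u(z)\<close>, so that \<open>u\<close> is an \<open>n\<close>-th power in \<open>\<pi>\<^sub>1(G)\<close>. If
  there is a half turn \<open>\<tau>\<close> exchanging the hemispheres, the isomorphism over the southern one is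
  taken to be the \<open>\<tau>\<close>-translate of the other. Then also \<open>u(cnj z) = u(z)\<^sup>-\<^sup>1\<close>, and \<open>u = 1\<close> at the fixed
  points of the half turns since the isotropy representations agree there; hence the restriction of
  \<open>u\<close> to one of \<open>2n\<close> arcs is a loop, and \<open>u\<close> is its \<open>2n\<close>-th power.
\<close>

section \<open>Principal bundles of abelian topological groups\<close>

text \<open>A tetrahedral, octahedral or icosahedral group preserves no axis, so invariant pairs of
  hemispheres exist only after restricting to smaller subgroups. Commutativity of \<open>G\<close>
  makes the comparison possible: conjugate isotropy representations are equal, and the quotient of
  two transition functions is unaffected by factors that both bundles share.

  The delicate step is the equivariant isomorphism over a hemisphere. Lifts chosen without regard to
  the rotation fail to be invariant by cocycles of a cyclic group with values in the maps from the
  disc to \<open>G\<close>; the quotient of the two cocycles is trivial at the centre. Averaging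
  would need division by \<open>n\<close> in \<open>G\<close>. Instead the contraction of the disc
  to its centre is spread over \<open>n\<close> sectors, which gives an explicit coboundary.

  \<open>BG\<close> is the base of an arbitrary bundle with contractible total space and is reached
  only through lifts of maps on compact metric spaces. As \<open>chern_class\<close> involves free
  homotopies, clutching maps must also be compared when the boundary of the square moves.\<close>

lemma continuous_map_compose_top_of_set:
  assumes "continuous_map (top_of_set S) Y f" "continuous_on S' g" "g ` S' \<subseteq> S"
  shows "continuous_map (top_of_set S') Y (\<lambda>x. f (g x))"
  using continuous_map_compose[of "top_of_set S'" "top_of_set S" g Y f] assms
  by (auto simp: o_def)

lemma continuous_map_paste:
  assumes "closedin X A" "closedin X B" "topspace X \<subseteq> A \<union> B"
    and "continuous_map (subtopology X A) Y f" "continuous_map (subtopology X B) Y g"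
    and "\<And>x. x \<in> A \<Longrightarrow> x \<in> B \<Longrightarrow> f x = g x"
  shows "continuous_map X Y (\<lambda>x. if x \<in> A then f x else g x)"
proof (rule pasting_lemma_closed[where I = "UNIV :: bool set" and T = "\<lambda>b. if b then A else B"
      and f = "\<lambda>b. if b then f else g"])
  fix x assume "x \<in> topspace X"
  then show "\<exists>j. j \<in> UNIV \<and> x \<in> (if j then A else B) \<and> (if x \<in> A then f x else g x) = (if j then f else g) x"
    using assms(3) by (intro exI[of _ "x \<in> A"]) auto
qed (use assms in \<open>auto split: if_splits\<close>)

locale abelian_topological_group = comm_group G for G :: "('g, 'm) tgroup_scheme" (structure) +
  assumes topological: "topological_group G"
begin

lemma topspace_gtop [simp]: "topspace (gtop G) = carrier G"
  using topological by (simp add: topological_group_def)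

lemma continuous_carrier:
  "continuous_map X (gtop G) f \<Longrightarrow> x \<in> topspace X \<Longrightarrow> f x \<in> carrier G"
  by (metis Pi_iff continuous_map_def topspace_gtop)

lemma continuous_mult:
  assumes "continuous_map X (gtop G) f" "continuous_map X (gtop G) g"
  shows "continuous_map X (gtop G) (\<lambda>x. f x \<otimes> g x)"
proof -
  have "continuous_map X (prod_topology (gtop G) (gtop G)) (\<lambda>x. (f x, g x))"
    using assms by (simp add: continuous_map_pairedI)
  moreover have "continuous_map (prod_topology (gtop G) (gtop G)) (gtop G) (\<lambda>(x, y). x \<otimes> y)"
    using topological by (simp add: topological_group_def)
  ultimately show ?thesis
    using continuous_map_compose by (fastforce simp: o_def)
qed

lemma continuous_inv:
  assumes "continuous_map X (gtop G) f"
  shows "continuous_map X (gtop G) (\<lambda>x. inv (f x))"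
proof -
  have "continuous_map (gtop G) (gtop G) (\<lambda>x. inv x)"
    using topological by (simp add: topological_group_def)
  with assms show ?thesis
    using continuous_map_compose by (fastforce simp: o_def)
qed

lemma continuous_pow:
  assumes "continuous_map X (gtop G) f"
  shows "continuous_map X (gtop G) (\<lambda>x. f x [^] (n::nat))"
  by (induction n) (auto intro: continuous_mult assms)

end

text \<open>\<open>\<Psi>\<close> is only the group coordinate of the inverse chart: the base
  coordinate is \<open>bproj\<close>, so a chart can be used through \<open>\<Phi>\<close> and
  \<open>\<Psi>\<close> without unpacking a homeomorphism of products.\<close>

definition trivializes ::
    "('g, 'm) tgroup_scheme \<Rightarrow> ('e, 'x, 'g, 'z) pbundle_scheme \<Rightarrow> 'x set
      \<Rightarrow> ('x \<times> 'g \<Rightarrow> 'e) \<Rightarrow> ('e \<Rightarrow> 'g) \<Rightarrow> bool" where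
  "trivializes G \<xi> U \<Phi> \<Psi> \<longleftrightarrow> openin (base_space \<xi>) U \<and>
    continuous_map (prod_topology (subtopology (base_space \<xi>) U) (gtop G)) (total_space \<xi>) \<Phi> \<and>
    continuous_map (subtopology (total_space \<xi>) {e \<in> topspace (total_space \<xi>). bproj \<xi> e \<in> U}) (gtop G) \<Psi> \<and>
    (\<forall>u\<in>U. \<forall>g\<in>carrier G. bproj \<xi> (\<Phi> (u, g)) = u) \<and>
    (\<forall>u\<in>U. \<forall>g\<in>carrier G. \<forall>h\<in>carrier G. \<Phi> (u, g \<otimes>\<^bsub>G\<^esub> h) = ract \<xi> (\<Phi> (u, g)) h) \<and>
    (\<forall>u\<in>U. \<forall>g\<in>carrier G. \<Psi> (\<Phi> (u, g)) = g) \<and>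
    (\<forall>e\<in>topspace (total_space \<xi>). bproj \<xi> e \<in> U \<longrightarrow> \<Phi> (bproj \<xi> e, \<Psi> e) = e)"

lemma trivializesD:
  assumes "trivializes G \<xi> U \<Phi> \<Psi>"
  shows "openin (base_space \<xi>) U"
    "continuous_map (prod_topology (subtopology (base_space \<xi>) U) (gtop G)) (total_space \<xi>) \<Phi>"
    "continuous_map (subtopology (total_space \<xi>) {e \<in> topspace (total_space \<xi>). bproj \<xi> e \<in> U}) (gtop G) \<Psi>"
    "\<And>u g. u \<in> U \<Longrightarrow> g \<in> carrier G \<Longrightarrow> bproj \<xi> (\<Phi> (u, g)) = u"
    "\<And>u g h. u \<in> U \<Longrightarrow> g \<in> carrier G \<Longrightarrow> h \<in> carrier G \<Longrightarrow> \<Phi> (u, g \<otimes>\<^bsub>G\<^esub> h) = ract \<xi> (\<Phi> (u, g)) h"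
    "\<And>u g. u \<in> U \<Longrightarrow> g \<in> carrier G \<Longrightarrow> \<Psi> (\<Phi> (u, g)) = g"
    "\<And>e. e \<in> topspace (total_space \<xi>) \<Longrightarrow> bproj \<xi> e \<in> U \<Longrightarrow> \<Phi> (bproj \<xi> e, \<Psi> e) = e"
  using assms unfolding trivializes_def by blast+

text \<open>The difference of two points of one fibre. The value
  \<open>isotropy_rep G \<xi> e \<gamma>\<close> is the difference of \<open>e\<close> and its image
  under \<open>\<gamma>\<close>; displacements of lifts and transition functions are further
  instances.\<close>

definition translation ::
    "('g, 'm) tgroup_scheme \<Rightarrow> ('e, 'x, 'g, 'z) pbundle_scheme \<Rightarrow> 'e \<Rightarrow> 'e \<Rightarrow> 'g" where
  "translation G \<xi> e e' = (THE g. g \<in> carrier G \<and> e' = ract \<xi> e g)"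

context abelian_topological_group
begin

context
  fixes \<xi> :: "('e, 'x, 'g, 'z) pbundle_scheme"
  assumes pb: "principal_bundle G \<xi>"
begin

lemma continuous_ract:
  assumes "continuous_map X (total_space \<xi>) F" "continuous_map X (gtop G) h"
  shows "continuous_map X (total_space \<xi>) (\<lambda>x. ract \<xi> (F x) (h x))"
proof -
  have "continuous_map X (prod_topology (total_space \<xi>) (gtop G)) (\<lambda>x. (F x, h x))"
    using assms by (simp add: continuous_map_pairedI)
  moreover have "continuous_map (prod_topology (total_space \<xi>) (gtop G)) (total_space \<xi>) (\<lambda>(e, g). ract \<xi> e g)"
    using pb by (simp add: principal_bundle_def right_space_def)
  ultimately show ?thesis
    using continuous_map_compose by (fastforce simp: o_def)
qed

lemma ract_one: "e \<in> topspace (total_space \<xi>) \<Longrightarrow> ract \<xi> e \<one> = e"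
  using pb by (simp add: principal_bundle_def right_space_def)

lemma ract_mult:
  "\<lbrakk>e \<in> topspace (total_space \<xi>); g \<in> carrier G; h \<in> carrier G\<rbrakk>
    \<Longrightarrow> ract \<xi> e (g \<otimes> h) = ract \<xi> (ract \<xi> e g) h"
  using pb by (simp add: principal_bundle_def right_space_def)

lemma ract_closed:
  assumes "e \<in> topspace (total_space \<xi>)" "g \<in> carrier G"
  shows "ract \<xi> e g \<in> topspace (total_space \<xi>)"
proof -
  have "continuous_map (prod_topology (total_space \<xi>) (gtop G)) (total_space \<xi>) (\<lambda>(e, g). ract \<xi> e g)"
    using pb by (simp add: principal_bundle_def right_space_def)
  then show ?thesis
    using continuous_map_image_subset_topspace[of _ _ "\<lambda>(e, g). ract \<xi> e g"] assms by fastforce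
qed

lemma bproj_ract:
  "\<lbrakk>e \<in> topspace (total_space \<xi>); g \<in> carrier G\<rbrakk> \<Longrightarrow> bproj \<xi> (ract \<xi> e g) = bproj \<xi> e"
  using pb by (simp add: principal_bundle_def)

lemma continuous_bproj: "continuous_map (total_space \<xi>) (base_space \<xi>) (bproj \<xi>)"
  using pb by (simp add: principal_bundle_def)

lemma bproj_closed:
  "e \<in> topspace (total_space \<xi>) \<Longrightarrow> bproj \<xi> e \<in> topspace (base_space \<xi>)"
  using continuous_map_image_subset_topspace[OF continuous_bproj] by blast

lemma local_trivialization:
  assumes "x \<in> topspace (base_space \<xi>)"
  shows "\<exists>U \<Phi> \<Psi>. x \<in> U \<and> trivializes G \<xi> U \<Phi> \<Psi>"
proof -
  obtain U \<Phi> where U: "openin (base_space \<xi>) U" "x \<in> U"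
    and hom: "homeomorphic_map (prod_topology (subtopology (base_space \<xi>) U) (gtop G))
          (subtopology (total_space \<xi>) {e \<in> topspace (total_space \<xi>). bproj \<xi> e \<in> U}) \<Phi>"
    and eqs: "\<forall>u\<in>U. \<forall>g\<in>carrier G. bproj \<xi> (\<Phi> (u, g)) = u \<and>
           (\<forall>h\<in>carrier G. \<Phi> (u, g \<otimes>\<^bsub>G\<^esub> h) = ract \<xi> (\<Phi> (u, g)) h)"
    using pb assms unfolding principal_bundle_def by meson
  obtain \<Theta> where \<Theta>: "homeomorphic_maps (prod_topology (subtopology (base_space \<xi>) U) (gtop G))
          (subtopology (total_space \<xi>) {e \<in> topspace (total_space \<xi>). bproj \<xi> e \<in> U}) \<Phi> \<Theta>"
    using hom homeomorphic_map_maps by blast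
  have UB: "U \<subseteq> topspace (base_space \<xi>)"
    using U openin_subset by blast
  have c1: "continuous_map (prod_topology (subtopology (base_space \<xi>) U) (gtop G)) (total_space \<xi>) \<Phi>"
    using \<Theta> unfolding homeomorphic_maps_def continuous_map_in_subtopology by blast
  have c2: "continuous_map (subtopology (total_space \<xi>) {e \<in> topspace (total_space \<xi>). bproj \<xi> e \<in> U})
     (prod_topology (subtopology (base_space \<xi>) U) (gtop G)) \<Theta>"
    using \<Theta> unfolding homeomorphic_maps_def by blast
  have c3: "continuous_map (subtopology (total_space \<xi>) {e \<in> topspace (total_space \<xi>). bproj \<xi> e \<in> U}) (gtop G) (snd \<circ> \<Theta>)"
    using c2 continuous_map_compose continuous_map_snd by blast
  have i1: "\<Theta> (\<Phi> (u, g)) = (u, g)" if "u \<in> U" "g \<in> carrier G" for u g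
    using \<Theta> that UB unfolding homeomorphic_maps_def by auto
  have i2: "\<Phi> (\<Theta> e) = e" if "e \<in> topspace (total_space \<xi>)" "bproj \<xi> e \<in> U" for e
    using \<Theta> that UB unfolding homeomorphic_maps_def by auto
  \<comment> \<open>The chart respects projections, so the first component of
    \<open>\<Theta> e\<close> can only be \<open>bproj \<xi> e\<close>.\<close>
  have i3: "\<Phi> (bproj \<xi> e, snd (\<Theta> e)) = e" if e: "e \<in> topspace (total_space \<xi>)" "bproj \<xi> e \<in> U" for e
  proof -
    have "\<Theta> e \<in> topspace (prod_topology (subtopology (base_space \<xi>) U) (gtop G))"
      using continuous_map_image_subset_topspace[OF c2] e by auto
    then obtain u g where ug: "\<Theta> e = (u, g)" "u \<in> U" "g \<in> carrier G"
      by (cases "\<Theta> e") auto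
    then have "bproj \<xi> e = u"
      using i2[OF e] eqs by metis
    then show ?thesis
      using ug i2[OF e] by simp
  qed
  have "trivializes G \<xi> U \<Phi> (snd \<circ> \<Theta>)"
    unfolding trivializes_def using U(1) c1 c3 eqs i1 i3 by simp
  then show ?thesis
    using U by blast
qed

lemma ract_right_cancel:
  assumes "e \<in> topspace (total_space \<xi>)" "g \<in> carrier G" "h \<in> carrier G" "ract \<xi> e g = ract \<xi> e h"
  shows "g = h"
proof -
  obtain U \<Phi> \<Psi> where U: "bproj \<xi> e \<in> U" and tr: "trivializes G \<xi> U \<Phi> \<Psi>"
    using local_trivialization[OF bproj_closed[OF assms(1)]] by blast
  note t = trivializesD[OF tr]
  have P: "\<Psi> e \<in> carrier G"
    using continuous_carrier[OF t(3)] assms U by simp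
  have "\<Psi> e \<otimes> g = \<Psi> e \<otimes> h"
    using t(5)[OF U P] t(6)[OF U] t(7)[OF assms(1) U] assms P by (metis m_closed)
  then show ?thesis
    using P assms by simp
qed

lemma ract_transitive:
  assumes "e \<in> topspace (total_space \<xi>)" "e' \<in> topspace (total_space \<xi>)" "bproj \<xi> e = bproj \<xi> e'"
  shows "\<exists>g\<in>carrier G. e' = ract \<xi> e g"
proof -
  obtain U \<Phi> \<Psi> where U: "bproj \<xi> e \<in> U" and tr: "trivializes G \<xi> U \<Phi> \<Psi>"
    using local_trivialization[OF bproj_closed[OF assms(1)]] by blast
  note t = trivializesD[OF tr]
  have P: "\<Psi> e \<in> carrier G" "\<Psi> e' \<in> carrier G"
    using continuous_carrier[OF t(3)] assms U by auto
  have "ract \<xi> e (inv (\<Psi> e) \<otimes> \<Psi> e') = \<Phi> (bproj \<xi> e, \<Psi> e \<otimes> (inv (\<Psi> e) \<otimes> \<Psi> e'))"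
    using t(5)[OF U] t(7)[OF assms(1) U] P by simp
  also have "\<dots> = e'"
    using P t(7)[OF assms(2)] U assms(3) by (simp flip: m_assoc)
  finally show ?thesis
    using P by (metis inv_closed m_closed)
qed

lemma translation_ract:
  assumes "e \<in> topspace (total_space \<xi>)" "g \<in> carrier G"
  shows "translation G \<xi> e (ract \<xi> e g) = g"
  unfolding translation_def
  by (rule the_equality) (use assms ract_right_cancel in auto)

lemma
  assumes "e \<in> topspace (total_space \<xi>)" "e' \<in> topspace (total_space \<xi>)" "bproj \<xi> e = bproj \<xi> e'"
  shows translation_closed: "translation G \<xi> e e' \<in> carrier G"
    and ract_translation: "ract \<xi> e (translation G \<xi> e e') = e'"
  using ract_transitive[OF assms] assms(1) translation_ract by auto

lemma local_section:
  assumes "x \<in> topspace (base_space \<xi>)"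
  shows "\<exists>U s. openin (base_space \<xi>) U \<and> x \<in> U \<and>
    continuous_map (subtopology (base_space \<xi>) U) (total_space \<xi>) s \<and> (\<forall>u\<in>U. bproj \<xi> (s u) = u)"
proof -
  obtain U \<Phi> \<Psi> where U: "x \<in> U" and tr: "trivializes G \<xi> U \<Phi> \<Psi>"
    using local_trivialization[OF assms(1)] by blast
  note t = trivializesD[OF tr]
  have "continuous_map (subtopology (base_space \<xi>) U) (total_space \<xi>) (\<Phi> \<circ> (\<lambda>u. (u, \<one>)))"
    by (rule continuous_map_compose[OF _ t(2)]) (simp add: continuous_map_pairedI)
  then show ?thesis
    using t U by (intro exI[of _ U] exI[of _ "\<Phi> \<circ> (\<lambda>u. (u, \<one>))"]) simp
qed

text \<open>Continuity is local, and inside one trivialization the difference is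
  \<open>inv (\<Psi> (F y)) \<otimes> \<Psi> (F' y)\<close>, because the chart turns the right
  action into multiplication.\<close>

lemma continuous_translation:
  assumes F: "continuous_map X (total_space \<xi>) F" and F': "continuous_map X (total_space \<xi>) F'"
    and eq: "\<And>x. x \<in> topspace X \<Longrightarrow> bproj \<xi> (F x) = bproj \<xi> (F' x)"
  shows "continuous_map X (gtop G) (\<lambda>x. translation G \<xi> (F x) (F' x))"
proof -
  have Fx: "F x \<in> topspace (total_space \<xi>)" "F' x \<in> topspace (total_space \<xi>)" if "x \<in> topspace X" for x
    using F F' that by (auto simp: continuous_map_def)
  have "\<exists>W. openin X W \<and> x \<in> W \<and> continuous_map (subtopology X W) (gtop G) (\<lambda>x. translation G \<xi> (F x) (F' x))"
    if x: "x \<in> topspace X" for x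
  proof -
    obtain U \<Phi> \<Psi> where U: "bproj \<xi> (F x) \<in> U" and tr: "trivializes G \<xi> U \<Phi> \<Psi>"
      using local_trivialization[OF bproj_closed[OF Fx(1)[OF x]]] by blast
    note t = trivializesD[OF tr]
    define W where "W = {y \<in> topspace X. bproj \<xi> (F y) \<in> U}"
    have "continuous_map X (base_space \<xi>) (bproj \<xi> \<circ> F)"
      using F continuous_bproj continuous_map_compose by blast
    then have W: "openin X W"
      using t(1) openin_continuous_map_preimage[of X "base_space \<xi>" "bproj \<xi> \<circ> F" U] by (simp add: W_def)
    have WU: "continuous_map (subtopology X W) (subtopology (total_space \<xi>) {e \<in> topspace (total_space \<xi>). bproj \<xi> e \<in> U}) F"
      "continuous_map (subtopology X W) (subtopology (total_space \<xi>) {e \<in> topspace (total_space \<xi>). bproj \<xi> e \<in> U}) F'"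
      using F F' Fx eq by (auto simp: continuous_map_in_subtopology W_def continuous_map_from_subtopology)
    have "continuous_map (subtopology X W) (gtop G) (\<lambda>y. inv (\<Psi> (F y)) \<otimes> \<Psi> (F' y))"
      using continuous_map_compose[OF WU(1) t(3)] continuous_map_compose[OF WU(2) t(3)]
      by (intro continuous_mult continuous_inv) (auto simp: o_def)
    moreover have "inv (\<Psi> (F y)) \<otimes> \<Psi> (F' y) = translation G \<xi> (F y) (F' y)"
      if "y \<in> topspace (subtopology X W)" for y
    proof -
      have y: "y \<in> topspace X" "bproj \<xi> (F y) \<in> U" "bproj \<xi> (F' y) = bproj \<xi> (F y)"
        using that eq by (auto simp: W_def)
      have P: "\<Psi> (F y) \<in> carrier G" "\<Psi> (F' y) \<in> carrier G"
        using continuous_carrier[OF t(3)] y Fx by auto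
      have "ract \<xi> (F y) (inv (\<Psi> (F y)) \<otimes> \<Psi> (F' y)) = \<Phi> (bproj \<xi> (F y), \<Psi> (F y) \<otimes> (inv (\<Psi> (F y)) \<otimes> \<Psi> (F' y)))"
        using t(5)[OF y(2)] t(7)[OF _ y(2)] P Fx y by simp
      also have "\<dots> = F' y"
        using P t(7)[of "F' y"] Fx y by (simp flip: m_assoc)
      finally show ?thesis
        using translation_ract[of "F y"] Fx y P by (metis inv_closed m_closed)
    qed
    ultimately have "continuous_map (subtopology X W) (gtop G) (\<lambda>y. translation G \<xi> (F y) (F' y))"
      by (rule continuous_map_eq)
    then show ?thesis
      using W U x by (auto simp: W_def)
  qed
  then obtain W where W: "\<And>x. x \<in> topspace X \<Longrightarrow> openin X (W x) \<and> x \<in> W x \<and>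
      continuous_map (subtopology X (W x)) (gtop G) (\<lambda>x. translation G \<xi> (F x) (F' x))"
    by metis
  show ?thesis
    by (rule pasting_lemma[where I = "topspace X" and T = W and f = "\<lambda>_ x. translation G \<xi> (F x) (F' x)"])
      (use W in auto)
qed

end

end

section \<open>Homotopy lifting\<close>

definition lifts ::
    "('e, 'x, 'g, 'z) pbundle_scheme \<Rightarrow> 'a topology \<Rightarrow> ('a \<Rightarrow> 'x) \<Rightarrow> ('a \<Rightarrow> 'e) \<Rightarrow> bool" where
  "lifts \<xi> X f F \<longleftrightarrow> continuous_map X (total_space \<xi>) F \<and> (\<forall>x\<in>topspace X. bproj \<xi> (F x) = f x)"

lemma lifts_continuous: "lifts \<xi> X f F \<Longrightarrow> continuous_map X (total_space \<xi>) F"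
  by (simp add: lifts_def)

lemma lifts_bproj: "lifts \<xi> X f F \<Longrightarrow> x \<in> topspace X \<Longrightarrow> bproj \<xi> (F x) = f x"
  by (simp add: lifts_def)

lemma lifts_closed: "lifts \<xi> X f F \<Longrightarrow> x \<in> topspace X \<Longrightarrow> F x \<in> topspace (total_space \<xi>)"
  using continuous_map_image_subset_topspace[of X "total_space \<xi>" F] by (auto simp: lifts_def)

lemma lifts_compose:
  assumes "lifts \<xi> (top_of_set S) f F" "continuous_on S' g" "g ` S' \<subseteq> S"
  shows "lifts \<xi> (top_of_set S') (\<lambda>x. f (g x)) (\<lambda>x. F (g x))"
  using assms continuous_map_compose_top_of_set[of S _ F S' g] by (auto simp: lifts_def)

context abelian_topological_group
begin

context
  fixes \<xi> :: "('e, 'x, 'g, 'z) pbundle_scheme"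
  assumes pb: "principal_bundle G \<xi>"
begin

lemma lifts_ract:
  assumes "lifts \<xi> X f F" "continuous_map X (gtop G) h"
  shows "lifts \<xi> X f (\<lambda>x. ract \<xi> (F x) (h x))"
  using assms continuous_ract[OF pb, of X F h] bproj_ract[OF pb] lifts_closed[OF assms(1)]
    continuous_carrier[OF assms(2)] by (simp add: lifts_def)

lemma continuous_translation_lifts:
  assumes "lifts \<xi> X f F" "lifts \<xi> X f F'"
  shows "continuous_map X (gtop G) (\<lambda>x. translation G \<xi> (F x) (F' x))"
  by (rule continuous_translation[OF pb]) (use assms in \<open>auto simp: lifts_def\<close>)

lemma ract_translation_lifts:
  assumes "lifts \<xi> X f F" "lifts \<xi> X f F'" "x \<in> topspace X"
  shows "ract \<xi> (F x) (translation G \<xi> (F x) (F' x)) = F' x"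
  using ract_translation[OF pb] lifts_closed[OF assms(1,3)] lifts_closed[OF assms(2,3)]
    lifts_bproj[OF assms(1,3)] lifts_bproj[OF assms(2,3)] by simp

text \<open>One step of Steenrod's covering homotopy argument: the lift is pushed up from the graph of \<open>\<tau>\<close>
  to the graph of \<open>\<tau>'\<close> inside a single trivialization.\<close>

lemma lift_extend_step:
  fixes X :: "'a::metric_space set" and c d :: real and \<tau> \<tau>' \<kappa> :: "'a \<Rightarrow> real"
  assumes f: "continuous_map (top_of_set (X \<times> {c..d})) (base_space \<xi>) f"
    and \<tau>: "continuous_on X \<tau>" "continuous_on X \<tau>'" "continuous_on X \<kappa>"
    and le: "\<And>x. x \<in> X \<Longrightarrow> c \<le> \<tau> x \<and> \<tau> x \<le> \<tau>' x \<and> \<tau>' x \<le> d"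
    and eq: "\<And>x. x \<in> X \<Longrightarrow> \<kappa> x > 0 \<Longrightarrow> \<tau>' x = \<tau> x"
    and U: "openin (base_space \<xi>) U"
    and s: "continuous_map (subtopology (base_space \<xi>) U) (total_space \<xi>) s" "\<And>u. u \<in> U \<Longrightarrow> bproj \<xi> (s u) = u"
    and fU: "\<And>x t. x \<in> X \<Longrightarrow> \<kappa> x \<le> 0 \<Longrightarrow> t \<in> {c..d} \<Longrightarrow> f (x, t) \<in> U"
    and F: "lifts \<xi> (top_of_set {z. fst z \<in> X \<and> c \<le> snd z \<and> snd z \<le> \<tau> (fst z)}) f F"
  shows "\<exists>F'. lifts \<xi> (top_of_set {z. fst z \<in> X \<and> c \<le> snd z \<and> snd z \<le> \<tau>' (fst z)}) f F' \<and>
     (\<forall>z. fst z \<in> X \<and> c \<le> snd z \<and> snd z \<le> \<tau> (fst z) \<longrightarrow> F' z = F z)"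
proof -
  define Y where "Y = {z. fst z \<in> X \<and> c \<le> snd z \<and> snd z \<le> \<tau> (fst z)}"
  define Y' where "Y' = {z. fst z \<in> X \<and> c \<le> snd z \<and> snd z \<le> \<tau>' (fst z)}"
  define A where "A = {z\<in>Y'. snd z \<le> \<tau> (fst z)}"
  define C where "C = {z\<in>Y'. \<tau> (fst z) \<le> snd z \<and> \<kappa> (fst z) \<le> 0}"
  define r where "r z = (fst z, \<tau> (fst z))" for z :: "'a \<times> real"
  \<comment> \<open>The local section over \<open>f z\<close>, translated by the group element that
    carries \<open>s\<close> to the given lift at the foot \<open>r z\<close> on the graph of
    \<open>\<tau>\<close>. This correction is constant along vertical segments.\<close>
  define K where "K z = ract \<xi> (s (f z)) (translation G \<xi> (s (f (r z))) (F (r z)))" for z :: "'a \<times> real"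
  note F = F[folded Y_def]
  have AY: "A = Y"
    using le unfolding A_def Y_def Y'_def by force
  have c\<tau>: "continuous_on Y' (\<lambda>z. \<tau> (fst z))" "continuous_on Y' (\<lambda>z. \<kappa> (fst z))"
    by (auto intro!: continuous_intros continuous_on_compose2[OF \<tau>(1)] continuous_on_compose2[OF \<tau>(3)] simp: Y'_def)
  have "closedin (top_of_set Y') (Y' \<inter> (\<lambda>z. \<tau> (fst z) - snd z) -` {0..})"
    by (intro continuous_closedin_preimage continuous_intros c\<tau> closed_atLeast closed_atMost)
  also have "Y' \<inter> (\<lambda>z. \<tau> (fst z) - snd z) -` {0..} = A"
    by (auto simp: A_def)
  finally have clA: "closedin (top_of_set Y') A" .
  have "closedin (top_of_set Y') ((Y' \<inter> (\<lambda>z. \<tau> (fst z) - snd z) -` {..0}) \<inter> (Y' \<inter> (\<lambda>z. \<kappa> (fst z)) -` {..0}))"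
    by (rule closedin_Int; intro continuous_closedin_preimage continuous_intros c\<tau> closed_atLeast closed_atMost)
  also have "((Y' \<inter> (\<lambda>z. \<tau> (fst z) - snd z) -` {..0}) \<inter> (Y' \<inter> (\<lambda>z. \<kappa> (fst z)) -` {..0})) = C"
    by (auto simp: C_def)
  finally have clC: "closedin (top_of_set Y') C" .
  have C: "fst z \<in> X" "snd z \<in> {c..d}" "\<kappa> (fst z) \<le> 0" "r z \<in> Y" "f z \<in> U" "f (r z) \<in> U" if "z \<in> C" for z
  proof -
    show 1: "fst z \<in> X" "snd z \<in> {c..d}" "\<kappa> (fst z) \<le> 0" "r z \<in> Y"
      using that le by (auto simp: C_def Y'_def Y_def r_def intro: order_trans)
    show "f z \<in> U"
      using fU[OF 1(1,3,2)] by simp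
    show "f (r z) \<in> U"
      using fU[OF 1(1,3), of "\<tau> (fst z)"] le[OF 1(1)] by (auto simp: r_def)
  qed
  have CY: "C \<subseteq> Y'" by (auto simp: C_def)
  have cr: "continuous_on C r"
    unfolding r_def using continuous_on_subset[OF c\<tau>(1) CY] by (intro continuous_intros)
  have cf: "continuous_map (top_of_set C) (base_space \<xi>) (\<lambda>z. f (id z))"
    by (rule continuous_map_compose_top_of_set[OF f]) (use C in \<open>auto simp: mem_Times_iff\<close>)
  have cfr: "continuous_map (top_of_set C) (base_space \<xi>) (\<lambda>z. f (r z))"
    by (rule continuous_map_compose_top_of_set[OF f cr]) (use C(1,4) le in \<open>fastforce simp: mem_Times_iff r_def\<close>)
  have csf: "continuous_map (top_of_set C) (total_space \<xi>) (\<lambda>z. s (f z))"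
    using continuous_map_compose[OF _ s(1), of "top_of_set C" f] cf C(5)
    by (auto simp: continuous_map_in_subtopology o_def)
  have csfr: "continuous_map (top_of_set C) (total_space \<xi>) (\<lambda>z. s (f (r z)))"
    using continuous_map_compose[OF _ s(1), of "top_of_set C" "\<lambda>z. f (r z)"] cfr C(6)
    by (auto simp: continuous_map_in_subtopology o_def)
  have cFr: "continuous_map (top_of_set C) (total_space \<xi>) (\<lambda>z. F (r z))"
    by (rule continuous_map_compose_top_of_set[OF lifts_continuous[OF F] cr]) (use C(4) in auto)
  have ctr: "continuous_map (top_of_set C) (gtop G) (\<lambda>z. translation G \<xi> (s (f (r z))) (F (r z)))"
    by (rule continuous_translation[OF pb csfr cFr]) (use C(4,6) s(2) lifts_bproj[OF F] in auto)
  have cK: "continuous_map (top_of_set C) (total_space \<xi>) K"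
    unfolding K_def by (rule continuous_ract[OF pb csf ctr])
  have sE: "s u \<in> topspace (total_space \<xi>)" if "u \<in> U" for u
    using continuous_map_image_subset_topspace[OF s(1)] that openin_subset[OF U] by auto
  have pK: "bproj \<xi> (K z) = f z" if "z \<in> C" for z
    unfolding K_def using bproj_ract[OF pb sE[OF C(5)[OF that]]] s(2)[OF C(5)[OF that]]
      continuous_carrier[OF ctr] that by simp
  \<comment> \<open>On the graph of \<open>\<tau>\<close> the foot of \<open>z\<close> is
    \<open>z\<close> itself, so the correction carries \<open>s (f z)\<close> to
    \<open>F z\<close>.\<close>
  have agree: "F z = K z" if "z \<in> A" "z \<in> C" for z
  proof -
    have rz: "r z = z"
      using that by (auto simp: r_def A_def C_def prod_eq_iff)
    show ?thesis
      unfolding K_def rz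
      using ract_translation[OF pb sE[OF C(5)[OF that(2)]], of "F z"] s(2)[OF C(5)[OF that(2)]]
        lifts_closed[OF F, of z] lifts_bproj[OF F, of z] that(1) AY by simp
  qed
  have cov: "Y' \<subseteq> A \<union> C"
  proof
    fix z assume z: "z \<in> Y'"
    show "z \<in> A \<union> C"
    proof (cases "snd z \<le> \<tau> (fst z)")
      case False
      then have "\<not> \<kappa> (fst z) > 0"
        using z eq[of "fst z"] by (auto simp: Y'_def)
      then show ?thesis
        using False z by (auto simp: C_def)
    qed (use z in \<open>auto simp: A_def\<close>)
  qed
  define F' where "F' z = (if z \<in> A then F z else K z)" for z
  have AC: "top_of_set (Y' \<inter> A) = top_of_set Y" "top_of_set (Y' \<inter> C) = top_of_set C"
    using closedin_subset[OF clA] closedin_subset[OF clC] AY by (auto simp: Int_absorb1)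
  have "continuous_map (top_of_set Y') (total_space \<xi>) F'"
    unfolding F'_def
    by (rule continuous_map_paste[OF clA clC])
      (use cov agree lifts_continuous[OF F] cK AC in \<open>auto simp: subtopology_subtopology\<close>)
  moreover have "bproj \<xi> (F' z) = f z" if "z \<in> Y'" for z
  proof (cases "z \<in> A")
    case True
    then show ?thesis
      using lifts_bproj[OF F, of z] AY by (simp add: F'_def)
  next
    case False
    then show ?thesis
      using pK[of z] cov that by (auto simp: F'_def)
  qed
  moreover have "F' z = F z" if "z \<in> Y" for z
    using that AY by (simp add: F'_def)
  ultimately show ?thesis
    unfolding Y_def[symmetric] Y'_def[symmetric] lifts_def by (intro exI[of _ F']) (auto simp: Y_def)
qed

end

end

context abelian_topological_group
begin

context
  fixes \<xi> :: "('e, 'x, 'g, 'z) pbundle_scheme"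
  assumes pb: "principal_bundle G \<xi>"
begin

text \<open>The bumps \<open>\<psi>\<close>, normalized, form a partition of unity. Adding a centre
  \<open>k\<close> to \<open>S\<close> raises the graph of \<open>\<tau> S\<close> only over the
  ball of \<open>k\<close>, where \<open>f\<close> stays in one \<open>U\<close> during the whole
  slab, so a single extension step suffices. The graph is at height \<open>c\<close> for the empty
  set and at height \<open>d\<close> for \<open>N\<close>.\<close>

lemma lift_extend_slab:
  fixes X :: "'a::metric_space set" and c d :: real
  assumes f: "continuous_map (top_of_set (X \<times> {c..d})) (base_space \<xi>) f" and "c \<le> d"
    and N: "finite N" "\<And>i. i \<in> N \<Longrightarrow> \<epsilon> i > 0" "X \<subseteq> (\<Union>i\<in>N. ball i (\<epsilon> i))"
    and U: "\<And>i. i \<in> N \<Longrightarrow> \<exists>U s. openin (base_space \<xi>) U \<and>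
      continuous_map (subtopology (base_space \<xi>) U) (total_space \<xi>) s \<and> (\<forall>u\<in>U. bproj \<xi> (s u) = u) \<and>
      (\<forall>x\<in>X. \<forall>t\<in>{c..d}. dist i x \<le> \<epsilon> i \<longrightarrow> f (x, t) \<in> U)"
    and F0: "lifts \<xi> (top_of_set X) (\<lambda>x. f (x, c)) F0"
  shows "\<exists>F. lifts \<xi> (top_of_set (X \<times> {c..d})) f F \<and> (\<forall>x\<in>X. F (x, c) = F0 x)"
proof -
  define \<psi> where "\<psi> i x = max 0 (\<epsilon> i - dist i x)" for i x :: 'a
  define \<tau> where "\<tau> S x = c + (d - c) * ((\<Sum>i\<in>S. \<psi> i x) / (\<Sum>i\<in>N. \<psi> i x))" for S :: "'a set" and x :: 'a
  have pos: "(\<Sum>i\<in>N. \<psi> i x) > 0" if x: "x \<in> X" for x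
  proof -
    obtain i where "i \<in> N" "dist i x < \<epsilon> i"
      using N(3)[unfolded subset_iff UN_iff mem_ball] x by blast
    then show ?thesis
      using N(1) by (intro sum_pos2[of N i]) (auto simp: \<psi>_def)
  qed
  have c\<tau>: "continuous_on X (\<tau> S)" for S
    unfolding \<tau>_def \<psi>_def
    by (intro continuous_intros) (use pos in \<open>force simp: \<psi>_def\<close>)
  have mono: "c \<le> \<tau> S x \<and> \<tau> S x \<le> \<tau> S' x \<and> \<tau> S' x \<le> d" if "S \<subseteq> S'" "S' \<subseteq> N" "x \<in> X" for S S' x
  proof -
    have 0: "0 \<le> (\<Sum>i\<in>S. \<psi> i x)"
      by (intro sum_nonneg) (simp add: \<psi>_def)
    have 1: "(\<Sum>i\<in>S. \<psi> i x) \<le> (\<Sum>i\<in>S'. \<psi> i x)" "(\<Sum>i\<in>S'. \<psi> i x) \<le> (\<Sum>i\<in>N. \<psi> i x)"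
      using that N(1) by (auto intro!: sum_mono2 simp: \<psi>_def finite_subset)
    have "(\<Sum>i\<in>S'. \<psi> i x) / (\<Sum>i\<in>N. \<psi> i x) \<le> 1"
      using 1 pos[OF that(3)] by simp
    from mult_left_mono[OF this, of "d - c"] show ?thesis
      using 0 1 pos[OF that(3)] \<open>c \<le> d\<close> unfolding \<tau>_def
      by (auto intro!: mult_left_mono divide_right_mono mult_nonneg_nonneg)
  qed
  have "\<exists>F. lifts \<xi> (top_of_set {z. fst z \<in> X \<and> c \<le> snd z \<and> snd z \<le> \<tau> S (fst z)}) f F \<and> (\<forall>x\<in>X. F (x, c) = F0 x)"
    if "finite S" "S \<subseteq> N" for S
    using that
  proof (induction S rule: finite_induct)
    case empty
    have *: "{z. fst z \<in> X \<and> c \<le> snd z \<and> snd z \<le> \<tau> {} (fst z)} = X \<times> {c}"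
      by (auto simp: \<tau>_def)
    have "lifts \<xi> (top_of_set (X \<times> {c})) f (\<lambda>z. F0 (fst z))"
      using lifts_compose[OF F0 continuous_on_fst[OF continuous_on_id], of "X \<times> {c}"] by (auto simp: lifts_def)
    then show ?case
      unfolding * by (intro exI[of _ "\<lambda>z. F0 (fst z)"]) simp
  next
    case (insert k S)
    then obtain F where F: "lifts \<xi> (top_of_set {z. fst z \<in> X \<and> c \<le> snd z \<and> snd z \<le> \<tau> S (fst z)}) f F"
      "\<forall>x\<in>X. F (x, c) = F0 x" by auto
    obtain U s where Us: "openin (base_space \<xi>) U"
      "continuous_map (subtopology (base_space \<xi>) U) (total_space \<xi>) s" "\<forall>u\<in>U. bproj \<xi> (s u) = u"
      "\<forall>x\<in>X. \<forall>t\<in>{c..d}. dist k x \<le> \<epsilon> k \<longrightarrow> f (x, t) \<in> U"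
      using U[of k] insert.prems by auto
    have "\<exists>F'. lifts \<xi> (top_of_set {z. fst z \<in> X \<and> c \<le> snd z \<and> snd z \<le> \<tau> (insert k S) (fst z)}) f F' \<and>
     (\<forall>z. fst z \<in> X \<and> c \<le> snd z \<and> snd z \<le> \<tau> S (fst z) \<longrightarrow> F' z = F z)"
    \<comment> \<open>This \<open>\<kappa>\<close> is positive exactly outside the closed ball of
      \<open>k\<close>; there \<open>\<psi> k\<close> vanishes and the two graphs coincide.\<close>
    proof (rule lift_extend_step[OF pb f c\<tau> c\<tau> _ _ _ Us(1,2) _ _ F(1), where \<kappa> = "\<lambda>x. dist k x - \<epsilon> k"])
      show "continuous_on X (\<lambda>x. dist k x - \<epsilon> k)"
        by (intro continuous_intros)
      show "c \<le> \<tau> S x \<and> \<tau> S x \<le> \<tau> (insert k S) x \<and> \<tau> (insert k S) x \<le> d" if "x \<in> X" for x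
        using mono[of S "insert k S" x] insert.prems that by auto
      show "\<tau> (insert k S) x = \<tau> S x" if "x \<in> X" "0 < dist k x - \<epsilon> k" for x
        using that insert.hyps by (simp add: \<tau>_def \<psi>_def)
    qed (use Us in auto)
    then obtain F' where F': "lifts \<xi> (top_of_set {z. fst z \<in> X \<and> c \<le> snd z \<and> snd z \<le> \<tau> (insert k S) (fst z)}) f F'"
      "\<And>z. fst z \<in> X \<and> c \<le> snd z \<and> snd z \<le> \<tau> S (fst z) \<Longrightarrow> F' z = F z" by blast
    have "\<forall>x\<in>X. F' (x, c) = F0 x"
      using F'(2) F(2) mono[of S S] insert.prems by simp
    then show ?case
      using F'(1) by blast
  qed
  from this[OF N(1)] obtain F where F:
    "lifts \<xi> (top_of_set {z. fst z \<in> X \<and> c \<le> snd z \<and> snd z \<le> \<tau> N (fst z)}) f F" "\<forall>x\<in>X. F (x, c) = F0 x"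
    by auto
  have "{z. fst z \<in> X \<and> c \<le> snd z \<and> snd z \<le> \<tau> N (fst z)} = X \<times> {c..d}"
    using pos by (force simp: \<tau>_def)
  then show ?thesis
    using F by auto
qed

text \<open>Compactness of \<open>X\<close> gives lifts over short time intervals: finitely many
  balls cover \<open>X\<close>, and the least of their radii bounds the length in time. The
  bisection argument \<open>Bolzano\<close> then joins short intervals to \<open>{0..1}\<close>, in
  place of a Lebesgue number.\<close>

lemma homotopy_lifting:
  fixes X :: "'a::metric_space set" and f :: "'a \<times> real \<Rightarrow> 'x"
  assumes X: "compact X"
    and f: "continuous_map (top_of_set (X \<times> {0..1})) (base_space \<xi>) f"
    and F0: "lifts \<xi> (top_of_set X) (\<lambda>x. f (x, 0)) F0"
  shows "\<exists>F. lifts \<xi> (top_of_set (X \<times> {0..1})) f F \<and> (\<forall>x\<in>X. F (x, 0) = F0 x)"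
proof -
  define P where "P c d \<longleftrightarrow> (0 \<le> c \<and> c \<le> d \<and> d \<le> 1 \<longrightarrow>
    (\<forall>F0. lifts \<xi> (top_of_set X) (\<lambda>x. f (x, c)) F0 \<longrightarrow>
      (\<exists>F. lifts \<xi> (top_of_set (X \<times> {c..d})) f F \<and> (\<forall>x\<in>X. F (x, c) = F0 x))))" for c d
  have "P 0 1"
  proof (rule Bolzano)
    show "(0::real) \<le> 1" by simp
  next
    fix a b c :: real
    assume ab: "P a b" and bc: "P b c" and le: "a \<le> b" "b \<le> c"
    show "P a c"
      unfolding P_def
    proof (intro impI allI)
      fix F0
      assume ac: "0 \<le> a \<and> a \<le> c \<and> c \<le> 1" and F0: "lifts \<xi> (top_of_set X) (\<lambda>x. f (x, a)) F0"
      obtain F1 where F1: "lifts \<xi> (top_of_set (X \<times> {a..b})) f F1" "\<forall>x\<in>X. F1 (x, a) = F0 x"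
        using ab F0 le ac unfolding P_def by auto
      have "lifts \<xi> (top_of_set X) (\<lambda>x. f (x, b)) (\<lambda>x. F1 (x, b))"
        by (rule lifts_compose[OF F1(1)]) (use le in \<open>auto intro: continuous_intros\<close>)
      then obtain F2 where F2: "lifts \<xi> (top_of_set (X \<times> {b..c})) f F2" "\<forall>x\<in>X. F2 (x, b) = F1 (x, b)"
        using bc le ac unfolding P_def by (smt (verit, best))
      define F where "F z = (if z \<in> X \<times> {a..b} then F1 z else F2 z)" for z
      have cl: "closedin (top_of_set (X \<times> {a..c})) (X \<times> {a..b})" "closedin (top_of_set (X \<times> {a..c})) (X \<times> {b..c})"
        using le by (auto intro!: closedin_Times simp: closed_subset)
      have "continuous_map (top_of_set (X \<times> {a..c})) (total_space \<xi>) F"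
        unfolding F_def
      proof (rule continuous_map_paste[OF cl])
        show "topspace (top_of_set (X \<times> {a..c})) \<subseteq> X \<times> {a..b} \<union> X \<times> {b..c}" by auto
        have "X \<times> {a..c} \<inter> X \<times> {a..b} = X \<times> {a..b}" "X \<times> {a..c} \<inter> X \<times> {b..c} = X \<times> {b..c}"
          using le by auto
        then show "continuous_map (subtopology (top_of_set (X \<times> {a..c})) (X \<times> {a..b})) (total_space \<xi>) F1"
          "continuous_map (subtopology (top_of_set (X \<times> {a..c})) (X \<times> {b..c})) (total_space \<xi>) F2"
          using lifts_continuous[OF F1(1)] lifts_continuous[OF F2(1)] by (simp_all add: subtopology_subtopology)
        show "F1 z = F2 z" if "z \<in> X \<times> {a..b}" "z \<in> X \<times> {b..c}" for z
          using that F2(2) by (auto dest: antisym)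
      qed
      moreover have "bproj \<xi> (F z) = f z" if "z \<in> X \<times> {a..c}" for z
        using that lifts_bproj[OF F1(1), of z] lifts_bproj[OF F2(1), of z] by (cases z) (auto simp: F_def)
      ultimately have "lifts \<xi> (top_of_set (X \<times> {a..c})) f F"
        by (simp add: lifts_def)
      moreover have "\<forall>x\<in>X. F (x, a) = F0 x"
        using F1(2) le by (simp add: F_def)
      ultimately show "\<exists>F. lifts \<xi> (top_of_set (X \<times> {a..c})) f F \<and> (\<forall>x\<in>X. F (x, a) = F0 x)"
        by blast
    qed
  next
    fix t :: real
    assume t: "0 \<le> t" "t \<le> 1"
    have "\<exists>e. e > 0 \<and> (\<exists>U s. openin (base_space \<xi>) U \<and>
      continuous_map (subtopology (base_space \<xi>) U) (total_space \<xi>) s \<and> (\<forall>u\<in>U. bproj \<xi> (s u) = u) \<and>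
      (\<forall>y\<in>X. \<forall>t'\<in>{0..1}. dist x y \<le> e \<and> dist t t' \<le> e \<longrightarrow> f (y, t') \<in> U))" if "x \<in> X" for x
    proof -
      have "f (x, t) \<in> topspace (base_space \<xi>)"
        using continuous_map_image_subset_topspace[OF f] that t by auto
      then obtain U s where Us: "openin (base_space \<xi>) U" "f (x, t) \<in> U"
        "continuous_map (subtopology (base_space \<xi>) U) (total_space \<xi>) s" "\<forall>u\<in>U. bproj \<xi> (s u) = u"
        using local_section[OF pb] by blast
      define W where "W = {z \<in> X \<times> {0..1}. f z \<in> U}"
      have "openin (top_of_set (X \<times> {0..1})) W"
        using openin_continuous_map_preimage[OF f Us(1)] by (simp add: W_def)
      moreover have "(x, t) \<in> W"
        using that t Us(2) by (simp add: W_def)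
      ultimately obtain e where "e > 0" and W: "\<forall>z\<in>X \<times> {0..1}. dist z (x, t) < e \<longrightarrow> z \<in> W"
        unfolding openin_euclidean_subtopology_iff by meson
      then have e: "e > 0" "\<And>z. z \<in> X \<times> {0..1} \<Longrightarrow> dist z (x, t) < e \<Longrightarrow> f z \<in> U"
        unfolding W_def by blast+
      \<comment> \<open>Each coordinate stays within \<open>e/3\<close>, so the distance in the
        product is at most two thirds of \<open>e\<close>.\<close>
      have "f (y, t') \<in> U" if "y \<in> X" "t' \<in> {0..1}" "dist x y \<le> e/3" "dist t t' \<le> e/3" for y t'
      proof -
        have "dist (y, t') (x, t) \<le> dist y x + dist t' t"
          by (simp add: dist_prod_def sqrt_sum_squares_le_sum)
        also have "\<dots> < e"
          using that \<open>e > 0\<close> by (simp add: dist_commute)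
        finally show ?thesis
          using e(2) that by auto
      qed
      then show ?thesis
        using e(1) Us by (intro exI[of _ "e/3"] conjI exI[of _ U] exI[of _ s]) simp_all
    qed
    then obtain \<epsilon> where \<epsilon>: "\<And>x. x \<in> X \<Longrightarrow> \<epsilon> x > 0" "\<And>x. x \<in> X \<Longrightarrow> \<exists>U s. openin (base_space \<xi>) U \<and>
      continuous_map (subtopology (base_space \<xi>) U) (total_space \<xi>) s \<and> (\<forall>u\<in>U. bproj \<xi> (s u) = u) \<and>
      (\<forall>y\<in>X. \<forall>t'\<in>{0..1}. dist x y \<le> \<epsilon> x \<and> dist t t' \<le> \<epsilon> x \<longrightarrow> f (y, t') \<in> U)"
      by metis
    obtain N where N: "N \<subseteq> X" "finite N" "X \<subseteq> (\<Union>i\<in>N. ball i (\<epsilon> i))"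
      using compactE_image[OF X, of X "\<lambda>i. ball i (\<epsilon> i)"] \<epsilon>(1) by force
    define \<delta> where "\<delta> = Min (insert 1 (\<epsilon> ` N))"
    have \<delta>: "\<delta> > 0" "\<And>i. i \<in> N \<Longrightarrow> \<delta> \<le> \<epsilon> i"
      unfolding \<delta>_def using N \<epsilon>(1) by auto
    have "P a b" if ab: "a \<le> t" "t \<le> b" "b - a < \<delta>" for a b
      unfolding P_def
    proof (intro impI allI)
      fix F0
      assume ac: "0 \<le> a \<and> a \<le> b \<and> b \<le> 1" and F0: "lifts \<xi> (top_of_set X) (\<lambda>x. f (x, a)) F0"
      show "\<exists>F. lifts \<xi> (top_of_set (X \<times> {a..b})) f F \<and> (\<forall>x\<in>X. F (x, a) = F0 x)"
      proof (rule lift_extend_slab[OF _ _ N(2) _ N(3) _ F0])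
        show "continuous_map (top_of_set (X \<times> {a..b})) (base_space \<xi>) f"
          by (rule continuous_map_compose_top_of_set[OF f continuous_on_id]) (use ac in auto)
        show "a \<le> b" using ac by simp
        show "\<epsilon> i > 0" if "i \<in> N" for i using \<epsilon>(1) N(1) that by auto
        fix i assume i: "i \<in> N"
        have *: "dist t t' \<le> \<epsilon> i" "t' \<in> {0..1}" if "t' \<in> {a..b}" for t'
          using that ab \<delta>(2)[OF i] ac by (auto simp: dist_real_def)
        have "i \<in> X"
          using i N(1) by blast
        then obtain U s where Us: "openin (base_space \<xi>) U"
          "continuous_map (subtopology (base_space \<xi>) U) (total_space \<xi>) s" "\<forall>u\<in>U. bproj \<xi> (s u) = u"
          "\<forall>y\<in>X. \<forall>t'\<in>{0..1}. dist i y \<le> \<epsilon> i \<and> dist t t' \<le> \<epsilon> i \<longrightarrow> f (y, t') \<in> U"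
          using \<epsilon>(2) by meson
        show "\<exists>U s. openin (base_space \<xi>) U \<and>
            continuous_map (subtopology (base_space \<xi>) U) (total_space \<xi>) s \<and> (\<forall>u\<in>U. bproj \<xi> (s u) = u) \<and>
            (\<forall>x\<in>X. \<forall>t\<in>{a..b}. dist i x \<le> \<epsilon> i \<longrightarrow> f (x, t) \<in> U)"
          using Us * by (intro exI[of _ U] exI[of _ s]) simp
      qed
    qed
    then show "\<exists>d>0. \<forall>a b. a \<le> t \<and> t \<le> b \<and> b - a < d \<longrightarrow> P a b"
      using \<delta>(1) by blast
  qed
  then show ?thesis
    using F0 unfolding P_def by simp
qed

text \<open>Moving along segments from \<open>x0\<close> is a homotopy from the constant map
  \<open>f x0\<close> to \<open>f\<close>. The constant map has a lift, and the covering homotopy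
  ends at a lift of \<open>f\<close>.\<close>

lemma lift_exists_starlike:
  fixes X :: "'a::real_normed_vector set"
  assumes X: "compact X" "\<And>x t. x \<in> X \<Longrightarrow> t \<in> {0..1} \<Longrightarrow> t *\<^sub>R x + (1 - t) *\<^sub>R x0 \<in> X" "X \<noteq> {}"
    and f: "continuous_map (top_of_set X) (base_space \<xi>) f"
  shows "\<exists>F. lifts \<xi> (top_of_set X) f F"
proof -
  define g where "g z = f (snd z *\<^sub>R fst z + (1 - snd z) *\<^sub>R x0)" for z :: "'a \<times> real"
  have x0: "x0 \<in> X"
    using X(2)[of _ 0] X(3) by auto
  have "f x0 \<in> topspace (base_space \<xi>)"
    using continuous_map_image_subset_topspace[OF f] x0 by auto
  then obtain U s where "f x0 \<in> U" "openin (base_space \<xi>) U" 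
      "continuous_map (subtopology (base_space \<xi>) U) (total_space \<xi>) s" "\<forall>u\<in>U. bproj \<xi> (s u) = u"
    using local_section[OF pb] by blast
  then have e: "s (f x0) \<in> topspace (total_space \<xi>)" "bproj \<xi> (s (f x0)) = f x0"
    using continuous_map_image_subset_topspace[of "subtopology (base_space \<xi>) U" "total_space \<xi>" s]
      openin_subset[of "base_space \<xi>" U] by auto
  have "continuous_map (top_of_set (X \<times> {0..1})) (base_space \<xi>) g"
    unfolding g_def
    by (rule continuous_map_compose_top_of_set[OF f]) (use X(2) in \<open>auto intro!: continuous_intros\<close>)
  moreover have "lifts \<xi> (top_of_set X) (\<lambda>x. g (x, 0)) (\<lambda>x. s (f x0))"
    using e by (simp add: lifts_def g_def)
  ultimately obtain F where F: "lifts \<xi> (top_of_set (X \<times> {0..1})) g F"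
    using homotopy_lifting[OF X(1)] by blast
  have "lifts \<xi> (top_of_set X) (\<lambda>x. g (x, 1)) (\<lambda>x. F (x, 1))"
    by (rule lifts_compose[OF F]) (auto intro: continuous_intros)
  then show ?thesis
    by (auto simp: g_def)
qed

end

end

section \<open>The square and the disc\<close>

text \<open>A continuous map from a compact space to a Hausdorff space is closed, hence a quotient
  map onto its image.\<close>

lemma quotient_extension:
  fixes q :: "'a::t2_space \<Rightarrow> 'b::metric_space"
  assumes S: "compact S" "continuous_on S q" and h: "continuous_map (top_of_set S) X h"
    and eq: "\<And>x y. x \<in> S \<Longrightarrow> y \<in> S \<Longrightarrow> q x = q y \<Longrightarrow> h x = h y"
  shows "\<exists>T. continuous_map (top_of_set (q ` S)) X T \<and> (\<forall>x\<in>S. T (q x) = h x)"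
proof -
  define T where "T y = h (SOME x. x \<in> S \<and> q x = y)" for y
  have T: "T (q x) = h x" if "x \<in> S" for x
    unfolding T_def using someI_ex[of "\<lambda>x'. x' \<in> S \<and> q x' = q x"] that eq by blast
  have cq: "continuous_map (top_of_set S) (top_of_set (q ` S)) q"
    using S(2) by simp
  have "closed_map (top_of_set S) (top_of_set (q ` S)) q"
    by (rule continuous_imp_closed_map[OF cq])
      (use S(1) in \<open>auto simp: compact_space_subtopology intro: Hausdorff_space_subtopology\<close>)
  then have "quotient_map (top_of_set S) (top_of_set (q ` S)) q"
    by (intro continuous_closed_imp_quotient_map[OF cq]) auto
  moreover have "continuous_map (top_of_set S) X (T \<circ> q)"
    by (rule continuous_map_eq[OF h]) (simp add: T)
  ultimately have "continuous_map (top_of_set (q ` S)) X T"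
    by (rule continuous_compose_quotient_map)
  with T show ?thesis by blast
qed

lemma cis_turn_eqD:
  assumes "cis (2 * pi * a) = cis (2 * pi * b)" "a \<in> {0..1}" "b \<in> {0..1}"
  shows "a = b \<or> a = 0 \<and> b = 1 \<or> a = 1 \<and> b = 0"
proof -
  have "sin (2 * pi * a) = sin (2 * pi * b) \<and> cos (2 * pi * a) = cos (2 * pi * b)"
    using assms(1) by (simp add: cis.ctr)
  then obtain n :: int where "2 * pi * a = 2 * pi * b + 2 * pi * of_int n"
    unfolding sin_cos_eq_iff by (auto simp: mult_ac)
  then have "2 * pi * (a - b) = 2 * pi * of_int n"
    by (simp add: algebra_simps)
  then have n: "a - b = of_int n"
    by simp
  then have "of_int n \<le> (1::real)" "of_int n \<ge> (-1::real)"
    using assms by auto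
  then have "n = 0 \<or> n = 1 \<or> n = -1"
    by linarith
  then show ?thesis
    using n assms by auto
qed

lemma polar_coordinates:
  obtains \<theta> where "\<theta> \<in> {0..1}" "z = of_real (cmod z) * cis (2 * pi * \<theta>)"
proof
  show "Arg2pi z / (2 * pi) \<in> {0..1}"
    using Arg2pi[of z] by (auto simp: field_simps)
  show "z = of_real (cmod z) * cis (2 * pi * (Arg2pi z / (2 * pi)))"
    using Arg2pi[of z] by (simp add: cis_conv_exp mult.commute is_Arg_def)
qed

text \<open>Polar coordinates: the disc is a rectangle with the edge of radius 0 collapsed and the
  edges of angle 0 and 1 (in turns) glued. Maps on the disc are constructed below in this
  form.\<close>

lemma disc_extension:
  assumes h: "continuous_map (top_of_set ({0..1} \<times> {0..1})) X h"
    and per: "\<And>r. r \<in> {0..1} \<Longrightarrow> h (0, r) = h (1, r)"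
    and ctr: "\<And>\<theta>. \<theta> \<in> {0..1} \<Longrightarrow> h (\<theta>, 0) = c"
  shows "\<exists>T. continuous_map (top_of_set (cball 0 1)) X T \<and>
    (\<forall>\<theta>\<in>{0..1}. \<forall>r\<in>{0..1}. T (of_real r * cis (2 * pi * \<theta>)) = h (\<theta>, r))"
proof -
  define q where "q z = of_real (snd z) * cis (2 * pi * fst z)" for z :: "real \<times> real"
  have img: "q ` ({0..1} \<times> {0..1}) = cball 0 1"
  proof (intro equalityI subsetI)
    fix z :: complex assume "z \<in> cball 0 1"
    moreover obtain \<theta> where "\<theta> \<in> {0..1}" "z = of_real (cmod z) * cis (2 * pi * \<theta>)"
      by (rule polar_coordinates)
    ultimately show "z \<in> q ` ({0..1} \<times> {0..1})"
      by (intro image_eqI[of _ _ "(\<theta>, cmod z)"]) (auto simp: q_def)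
  qed (auto simp: q_def norm_mult)
  have "\<exists>T. continuous_map (top_of_set (q ` ({0..1} \<times> {0..1}))) X T \<and> (\<forall>x\<in>{0..1} \<times> {0..1}. T (q x) = h x)"
  proof (rule quotient_extension[OF _ _ h])
    show "compact ({0..1} \<times> {0..1::real} :: (real \<times> real) set)"
      by (intro compact_Times compact_Icc)
    show "continuous_on ({0..1} \<times> {0..1}) q"
      unfolding q_def by (intro continuous_intros)
    fix x y :: "real \<times> real"
    assume xy: "x \<in> {0..1} \<times> {0..1}" "y \<in> {0..1} \<times> {0..1}" "q x = q y"
    obtain a r b r' where [simp]: "x = (a, r)" "y = (b, r')"
      by (cases x; cases y) auto
    have "cmod (q x) = cmod (q y)"
      using xy by simp
    then have [simp]: "r' = r"
      using xy by (simp add: q_def norm_mult)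
    show "h x = h y"
    proof (cases "r = 0")
      case True
      then show ?thesis using xy ctr by auto
    next
      case False
      then have "cis (2 * pi * a) = cis (2 * pi * b)"
        using xy by (simp add: q_def)
      then have "a = b \<or> a = 0 \<and> b = 1 \<or> a = 1 \<and> b = 0"
        using cis_turn_eqD xy by auto
      then show ?thesis
        using per[of r] xy by auto
    qed
  qed
  then show ?thesis
    unfolding img by (fastforce simp: q_def)
qed

lemma circle_extension:
  assumes h: "continuous_map (top_of_set {0..1}) X h" and per: "h 0 = h 1"
  shows "\<exists>T. continuous_map (top_of_set (sphere 0 1)) X T \<and> (\<forall>\<theta>\<in>{0..1}. T (cis (2 * pi * \<theta>)) = h \<theta>)"
proof -
  define q where "q \<theta> = cis (2 * pi * \<theta>)" for \<theta> :: real
  have img: "q ` {0..1} = sphere 0 1"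
  proof (intro equalityI subsetI)
    fix z :: complex assume "z \<in> sphere 0 1"
    moreover obtain \<theta> where "\<theta> \<in> {0..1}" "z = of_real (cmod z) * cis (2 * pi * \<theta>)"
      by (rule polar_coordinates)
    ultimately show "z \<in> q ` {0..1}"
      by (intro image_eqI[of _ _ \<theta>]) (auto simp: q_def)
  qed (auto simp: q_def)
  have "\<exists>T. continuous_map (top_of_set (q ` {0..1})) X T \<and> (\<forall>x\<in>{0..1}. T (q x) = h x)"
  proof (rule quotient_extension[OF _ _ h])
    show "continuous_on {0..1} q"
      unfolding q_def by (intro continuous_intros)
    show "h x = h y" if "x \<in> {0..1}" "y \<in> {0..1}" "q x = q y" for x y
      using cis_turn_eqD[of x y] that per by (auto simp: q_def)
  qed simp
  then show ?thesis
    unfolding img by (simp add: q_def)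
qed

section \<open>Coordinates on the square and its boundary\<close>

abbreviation unit_square :: "(real \<times> real) set" where
  "unit_square \<equiv> {0..1} \<times> {0..1}"

lemma square_boundary_subset: "square_boundary \<subseteq> unit_square"
  by (auto simp: square_boundary_def)

lemma topspace_square [simp]: "topspace square = unit_square"
  by (simp add: square_def)

lemma compact_unit_square: "compact unit_square"
  by (intro compact_Times compact_Icc)

lemma continuous_map_boundary:
  "continuous_map square X f \<Longrightarrow> continuous_map (top_of_set square_boundary) X f"
  using continuous_map_compose_top_of_set[of unit_square X f square_boundary "\<lambda>x. x"]
    square_boundary_subset by (auto simp: square_def)

text \<open>In coordinates \<open>x, y \<in> [-1,1]\<close> the denominator has square
  \<open>x\<^sup>2 + y\<^sup>2 + (1 - x\<^sup>2)(1 - y\<^sup>2) = 1 + x\<^sup>2y\<^sup>2\<close>, so the map is the radial projection on the boundary.\<close>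

definition square_to_disc :: "real \<times> real \<Rightarrow> complex" where
  "square_to_disc z = Complex (2 * fst z - 1) (2 * snd z - 1) /
     of_real (sqrt (1 + (2 * fst z - 1)\<^sup>2 * (2 * snd z - 1)\<^sup>2))"

text \<open>Radial projection of the circle to the boundary of
  \<open>[-1,1] \<times> [-1,1]\<close>, by division by the maximum norm, followed by rescaling to
  the unit square.\<close>

definition circle_to_square :: "complex \<Rightarrow> real \<times> real" where
  "circle_to_square z = (1/2 + Re z / (2 * max \<bar>Re z\<bar> \<bar>Im z\<bar>), 1/2 + Im z / (2 * max \<bar>Re z\<bar> \<bar>Im z\<bar>))"

lemma continuous_square_to_disc: "continuous_on S square_to_disc"
proof -
  have "1 + (2 * fst z - 1)\<^sup>2 * (2 * snd z - 1)\<^sup>2 > (0::real)" for z :: "real \<times> real"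
    by (smt (verit) mult_nonneg_nonneg zero_le_power2)
  then have "sqrt (1 + (2 * fst z - 1)\<^sup>2 * (2 * snd z - 1)\<^sup>2) \<noteq> 0" for z :: "real \<times> real"
    by (metis less_numeral_extra(3) real_sqrt_gt_0_iff)
  then show ?thesis
    unfolding square_to_disc_def Complex_eq
    by (intro continuous_intros) auto
qed

lemma cmod_square_to_disc:
  "cmod (square_to_disc (s, t)) = sqrt (((2 * s - 1)\<^sup>2 + (2 * t - 1)\<^sup>2) / (1 + (2 * s - 1)\<^sup>2 * (2 * t - 1)\<^sup>2))"
proof -
  have "1 + (2 * s - 1)\<^sup>2 * (2 * t - 1)\<^sup>2 > (0::real)"
    by (smt (verit) mult_nonneg_nonneg zero_le_power2)
  then show ?thesis
    by (simp add: square_to_disc_def cmod_def power_divide flip: real_sqrt_divide add_divide_distrib)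
qed

lemma square_to_disc_in: "z \<in> unit_square \<Longrightarrow> square_to_disc z \<in> cball 0 1"
proof -
  assume z: "z \<in> unit_square"
  obtain s t where [simp]: "z = (s, t)" by (cases z)
  have "(2 * s - 1)\<^sup>2 \<le> 1\<^sup>2" "(2 * t - 1)\<^sup>2 \<le> 1\<^sup>2"
    using z by (auto simp: abs_square_le_1)
  then have "0 \<le> (1 - (2 * s - 1)\<^sup>2) * (1 - (2 * t - 1)\<^sup>2)"
    by simp
  also have "\<dots> = 1 + (2 * s - 1)\<^sup>2 * (2 * t - 1)\<^sup>2 - ((2 * s - 1)\<^sup>2 + (2 * t - 1)\<^sup>2)"
    by (simp add: algebra_simps)
  finally have "(2 * s - 1)\<^sup>2 + (2 * t - 1)\<^sup>2 \<le> 1 + (2 * s - 1)\<^sup>2 * (2 * t - 1)\<^sup>2"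
    by simp
  then have "((2 * s - 1)\<^sup>2 + (2 * t - 1)\<^sup>2) / (1 + (2 * s - 1)\<^sup>2 * (2 * t - 1)\<^sup>2) \<le> 1"
    by (smt (verit) divide_le_eq_1 mult_nonneg_nonneg zero_le_power2)
  then show ?thesis
    using cmod_square_to_disc[of s t] by simp
qed

lemma square_boundary_cases:
  assumes "z \<in> square_boundary"
  shows "(2 * fst z - 1)\<^sup>2 = 1 \<or> (2 * snd z - 1)\<^sup>2 = 1"
  using assms by (auto simp: square_boundary_def)

lemma square_to_disc_boundary: "z \<in> square_boundary \<Longrightarrow> square_to_disc z \<in> sphere 0 1"
proof -
  assume z: "z \<in> square_boundary"
  have "1 + a\<^sup>2 \<noteq> 0" for a :: real
    by (smt (verit) zero_le_power2)
  then have "cmod (square_to_disc z) = 1"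
    using square_boundary_cases[OF z] cmod_square_to_disc[of "fst z" "snd z"] by (auto simp: add.commute)
  then show ?thesis by simp
qed

lemma circle_to_square_in:
  assumes "z \<in> sphere 0 1" shows "circle_to_square z \<in> square_boundary"
proof -
  have *: "max \<bar>a\<bar> \<bar>b\<bar> > 0 \<Longrightarrow> \<bar>a\<bar> \<le> max \<bar>a\<bar> \<bar>b\<bar> \<Longrightarrow>
     0 \<le> 1/2 + a / (2 * max \<bar>a\<bar> \<bar>b\<bar>) \<and> 1/2 + a / (2 * max \<bar>a\<bar> \<bar>b\<bar>) \<le> (1::real)" for a b
    by (simp add: field_simps) linarith
  have bd: "(u, v) \<in> square_boundary" if "0 \<le> u \<and> u \<le> 1" "0 \<le> v \<and> v \<le> 1" "u \<in> {0, 1} \<or> v \<in> {0, 1}" for u v :: real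
    using that by (auto simp: square_boundary_def)
  have pos: "max \<bar>Re z\<bar> \<bar>Im z\<bar> > 0"
    using assms complex_eq_iff[of z 0] by (auto simp: max_def)
  have "max \<bar>Re z\<bar> \<bar>Im z\<bar> = \<bar>Re z\<bar> \<or> max \<bar>Re z\<bar> \<bar>Im z\<bar> = \<bar>Im z\<bar>"
    by linarith
  then have "1/2 + Re z / (2 * max \<bar>Re z\<bar> \<bar>Im z\<bar>) \<in> {0, 1} \<or> 1/2 + Im z / (2 * max \<bar>Re z\<bar> \<bar>Im z\<bar>) \<in> {0, 1}"
    using pos by (auto simp: field_simps abs_if split: if_splits)
  then show ?thesis
    unfolding circle_to_square_def
    using bd[OF *[OF pos] *[of "Im z" "Re z", unfolded max.commute[of "\<bar>Im z\<bar>"], OF pos]] by simp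
qed

lemma continuous_circle_to_square: "continuous_on (sphere 0 1) circle_to_square"
proof -
  have "max \<bar>Re z\<bar> \<bar>Im z\<bar> > 0" if "z \<in> sphere 0 1" for z
    using that complex_eq_iff[of z 0] by (auto simp: max_def)
  then show ?thesis
    unfolding circle_to_square_def by (intro continuous_intros) fastforce+
qed

lemma circle_to_square_to_disc:
  assumes "z \<in> square_boundary" shows "circle_to_square (square_to_disc z) = z"
proof -
  obtain s t where [simp]: "z = (s, t)" by (cases z)
  define k where "k = 1 / sqrt (1 + (2 * s - 1)\<^sup>2 * (2 * t - 1)\<^sup>2)"
  have "1 + (2 * s - 1)\<^sup>2 * (2 * t - 1)\<^sup>2 > (0::real)"
    by (smt (verit) mult_nonneg_nonneg zero_le_power2)
  then have k: "k > 0" by (simp add: k_def)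
  have ReIm: "Re (square_to_disc z) = k * (2 * s - 1)" "Im (square_to_disc z) = k * (2 * t - 1)"
    by (simp_all add: square_to_disc_def k_def Re_divide_of_real Im_divide_of_real)
  have st: "\<bar>2 * s - 1\<bar> \<le> 1" "\<bar>2 * t - 1\<bar> \<le> 1" "\<bar>2 * s - 1\<bar> = 1 \<or> \<bar>2 * t - 1\<bar> = 1"
    using assms by (auto simp: square_boundary_def abs_if)
  have "max \<bar>k * (2 * s - 1)\<bar> \<bar>k * (2 * t - 1)\<bar> = k * max \<bar>2 * s - 1\<bar> \<bar>2 * t - 1\<bar>"
    using k by (simp add: abs_mult max_mult_distrib_left)
  also have "max \<bar>2 * s - 1\<bar> \<bar>2 * t - 1\<bar> = 1"
    using st by linarith
  finally have "max \<bar>k * (2 * s - 1)\<bar> \<bar>k * (2 * t - 1)\<bar> = k" by simp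
  then show ?thesis
    unfolding circle_to_square_def ReIm using k by (simp add: field_simps)
qed

text \<open>The square is a cone over its boundary: the homotopy parameter becomes the radius of a
  disc, and the constant value at parameter 0 its apex. This turns null-homotopies of boundary maps
  into extensions over the square.\<close>

lemma square_cone_extension:
  fixes H :: "(real \<times> real) \<times> real \<Rightarrow> 'b"
  assumes H: "continuous_map (top_of_set (square_boundary \<times> {0..1})) X H"
    and c: "\<And>z. z \<in> square_boundary \<Longrightarrow> H (z, 0) = c"
  shows "\<exists>T. continuous_map square X T \<and> (\<forall>z\<in>square_boundary. T z = H (z, 1))"
proof -
  define h where "h p = H (circle_to_square (cis (2 * pi * fst p)), snd p)" for p :: "real \<times> real"
  have "continuous_map (top_of_set unit_square) X h"
    unfolding h_def
    by (rule continuous_map_compose_top_of_set[OF H])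
      (auto intro!: continuous_intros continuous_on_compose2[OF continuous_circle_to_square] circle_to_square_in
        simp del: circle_to_square_def)
  moreover have "h (0, r) = h (1, r)" for r
    by (simp add: h_def)
  moreover have "h (\<theta>, 0) = c" for \<theta>
    by (simp add: h_def c circle_to_square_in)
  ultimately obtain T where T: "continuous_map (top_of_set (cball 0 1)) X T"
    "\<forall>\<theta>\<in>{0..1}. \<forall>r\<in>{0..1}. T (of_real r * cis (2 * pi * \<theta>)) = h (\<theta>, r)"
    using disc_extension[of X h c] by blast
  have "continuous_map square X (\<lambda>z. T (square_to_disc z))"
    unfolding square_def
    by (rule continuous_map_compose_top_of_set[OF T(1) continuous_square_to_disc])
      (use square_to_disc_in in blast)
  moreover have "T (square_to_disc z) = H (z, 1)" if z: "z \<in> square_boundary" for z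
  proof -
    obtain \<theta> where \<theta>: "\<theta> \<in> {0..1}" "square_to_disc z = of_real (cmod (square_to_disc z)) * cis (2 * pi * \<theta>)"
      by (rule polar_coordinates)
    have 1: "square_to_disc z = cis (2 * pi * \<theta>)"
      using \<theta>(2) square_to_disc_boundary[OF z] by simp
    then have "T (square_to_disc z) = h (\<theta>, 1)"
      using T(2) \<theta>(1) by (metis atLeastAtMost_iff mult_1 of_real_1 order_refl zero_le_one)
    then show ?thesis
      by (simp add: h_def circle_to_square_to_disc[OF z] flip: 1)
  qed
  ultimately show ?thesis by blast
qed

section \<open>Clutching maps\<close>

text \<open>The two definitions below model \<open>\<pi>\<^sub>1(G)\<close> by maps on the boundary of the square, without base points:
  constants extend over the square, so they are trivial.\<close>

definition clutching ::
    "('g, 'm) tgroup_scheme \<Rightarrow> ('e, 'x, 'g, 'z) pbundle_scheme \<Rightarrow> (real \<times> real \<Rightarrow> 'x)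
      \<Rightarrow> (real \<times> real \<Rightarrow> 'g) \<Rightarrow> bool" where
  "clutching G \<xi> f w \<longleftrightarrow> continuous_map (top_of_set square_boundary) (gtop G) w \<and>
    (\<exists>F. \<exists>e\<in>topspace (total_space \<xi>). lifts \<xi> square f F \<and> (\<forall>z\<in>square_boundary. F z = ract \<xi> e (w z)))"

definition boundary_equiv ::
    "('g, 'm) tgroup_scheme \<Rightarrow> (real \<times> real \<Rightarrow> 'g) \<Rightarrow> (real \<times> real \<Rightarrow> 'g) \<Rightarrow> bool" where
  "boundary_equiv G w w' \<longleftrightarrow>
    (\<exists>h. continuous_map square (gtop G) h \<and> (\<forall>z\<in>square_boundary. w z = w' z \<otimes>\<^bsub>G\<^esub> h z))"

lemma corner_in_boundary [simp]: "(0, 0) \<in> square_boundary"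
  by (simp add: square_boundary_def)

lemma clutching_continuous: "clutching G \<xi> f w \<Longrightarrow> continuous_map (top_of_set square_boundary) (gtop G) w"
  by (simp add: clutching_def)

context abelian_topological_group
begin

lemma boundary_carrier:
  "continuous_map (top_of_set square_boundary) (gtop G) w \<Longrightarrow> z \<in> square_boundary \<Longrightarrow> w z \<in> carrier G"
  using continuous_carrier by fastforce

lemma square_carrier:
  "continuous_map square (gtop G) h \<Longrightarrow> z \<in> square_boundary \<Longrightarrow> h z \<in> carrier G"
  using continuous_carrier[of square h z] square_boundary_subset by auto

lemma boundary_equiv_eq:
  assumes "\<And>z. z \<in> square_boundary \<Longrightarrow> w z = w' z" "continuous_map (top_of_set square_boundary) (gtop G) w"
  shows "boundary_equiv G w w'"
  unfolding boundary_equiv_def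
  by (rule exI[of _ "\<lambda>_. \<one>"]) (use assms boundary_carrier[OF assms(2)] in auto)

lemma boundary_equiv_sym:
  assumes "boundary_equiv G w w'" "continuous_map (top_of_set square_boundary) (gtop G) w'"
  shows "boundary_equiv G w' w"
proof -
  obtain h where h: "continuous_map square (gtop G) h" "\<forall>z\<in>square_boundary. w z = w' z \<otimes> h z"
    using assms by (auto simp: boundary_equiv_def)
  have "w' z = w z \<otimes> inv (h z)" if "z \<in> square_boundary" for z
    using h(2) square_carrier[OF h(1) that] boundary_carrier[OF assms(2) that] that by (simp add: m_assoc)
  then show ?thesis
    unfolding boundary_equiv_def using continuous_inv[OF h(1)] by blast
qed

lemma boundary_equiv_mult:
  assumes "boundary_equiv G w w'" "boundary_equiv G v v'"
    "continuous_map (top_of_set square_boundary) (gtop G) w'" "continuous_map (top_of_set square_boundary) (gtop G) v'"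
  shows "boundary_equiv G (\<lambda>z. w z \<otimes> v z) (\<lambda>z. w' z \<otimes> v' z)"
proof -
  obtain h where h: "continuous_map square (gtop G) h" "\<forall>z\<in>square_boundary. w z = w' z \<otimes> h z"
    using assms by (auto simp: boundary_equiv_def)
  obtain k where k: "continuous_map square (gtop G) k" "\<forall>z\<in>square_boundary. v z = v' z \<otimes> k z"
    using assms by (auto simp: boundary_equiv_def)
  have "w z \<otimes> v z = (w' z \<otimes> v' z) \<otimes> (h z \<otimes> k z)" if "z \<in> square_boundary" for z
    using h(2) k(2) square_carrier[OF h(1) that] square_carrier[OF k(1) that]
      boundary_carrier[OF assms(3) that] boundary_carrier[OF assms(4) that] that by (simp add: m_ac)
  then show ?thesis
    unfolding boundary_equiv_def using continuous_mult[OF h(1) k(1)] by blast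
qed

section \<open>Existence, change and uniqueness of clutching maps\<close>

context
  fixes \<xi> :: "('e, 'x, 'g, 'z) pbundle_scheme"
  assumes pb: "principal_bundle G \<xi>"
begin

lemma clutching_exists:
  assumes f: "continuous_map square (base_space \<xi>) f" and b: "\<And>z. z \<in> square_boundary \<Longrightarrow> f z = b"
  shows "\<exists>w. clutching G \<xi> f w"
proof -
  have "\<exists>F. lifts \<xi> square f F"
    unfolding square_def
    by (rule lift_exists_starlike[OF pb compact_unit_square, of "(0, 0)"])
      (use f in \<open>auto simp: square_def mult_le_one\<close>)
  then obtain F where F: "lifts \<xi> square f F" by blast
  have e: "F (0, 0) \<in> topspace (total_space \<xi>)"
    using lifts_closed[OF F] by simp
  have cF: "continuous_map (top_of_set square_boundary) (total_space \<xi>) F"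
    using continuous_map_boundary[OF lifts_continuous[OF F]] .
  have pF: "bproj \<xi> (F z) = b" "F z \<in> topspace (total_space \<xi>)" if "z \<in> square_boundary" for z
    using lifts_bproj[OF F, of z] lifts_closed[OF F, of z] b that square_boundary_subset by auto
  have "continuous_map (top_of_set square_boundary) (gtop G) (\<lambda>z. translation G \<xi> (F (0, 0)) (F z))"
    by (rule continuous_translation[OF pb _ cF]) (use e pF in auto)
  moreover have "\<forall>z\<in>square_boundary. F z = ract \<xi> (F (0, 0)) (translation G \<xi> (F (0, 0)) (F z))"
    using ract_translation[OF pb e] pF by simp
  ultimately show ?thesis
    unfolding clutching_def using F e by (intro exI conjI bexI) assumption+
qed

text \<open>Translating the lift by \<open>h\<close> on the whole square changes its boundary
  displacement by \<open>h\<close>. With \<open>clutching_unique\<close>, the clutching maps of a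
  map that is constant on the boundary form exactly one class of
  \<open>boundary_equiv\<close>.\<close>

lemma clutching_cong_equiv:
  assumes "clutching G \<xi> f w" "boundary_equiv G w' w"
  shows "clutching G \<xi> f w'"
proof -
  obtain F e where F: "lifts \<xi> square f F" "e \<in> topspace (total_space \<xi>)"
    "\<forall>z\<in>square_boundary. F z = ract \<xi> e (w z)" and w: "continuous_map (top_of_set square_boundary) (gtop G) w"
    using assms(1) by (auto simp: clutching_def)
  obtain h where h: "continuous_map square (gtop G) h" "\<forall>z\<in>square_boundary. w' z = w z \<otimes> h z"
    using assms(2) by (auto simp: boundary_equiv_def)
  have "continuous_map (top_of_set square_boundary) (gtop G) w'"
    by (rule continuous_map_eq[OF continuous_mult[OF w continuous_map_boundary[OF h(1)]]]) (use h(2) in auto)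
  moreover have "ract \<xi> (F z) (h z) = ract \<xi> e (w' z)" if "z \<in> square_boundary" for z
    using F h(2) that ract_mult[OF pb F(2) boundary_carrier[OF w that] square_carrier[OF h(1) that]] by simp
  moreover have "lifts \<xi> square f (\<lambda>z. ract \<xi> (F z) (h z))"
    using lifts_ract[OF pb F(1) h(1)] .
  ultimately show ?thesis
    unfolding clutching_def using F(2) by (intro conjI exI bexI) auto
qed

text \<open>Two reference points in the fibre differ by a constant \<open>g\<close>. Translating the
  lift by \<open>inv g\<close> absorbs it, by commutativity, so the same \<open>w\<close> serves for
  every reference point. This allows lifts of different maps to be glued or compared at a common
  \<open>e\<close>.\<close>

lemma clutching_at:
  assumes "clutching G \<xi> f w" and e: "e \<in> topspace (total_space \<xi>)" "bproj \<xi> e = f (0, 0)"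
  shows "\<exists>F. lifts \<xi> square f F \<and> (\<forall>z\<in>square_boundary. F z = ract \<xi> e (w z))"
proof -
  obtain F e' where F: "lifts \<xi> square f F" "e' \<in> topspace (total_space \<xi>)"
    "\<forall>z\<in>square_boundary. F z = ract \<xi> e' (w z)" and w: "continuous_map (top_of_set square_boundary) (gtop G) w"
    using assms(1) by (auto simp: clutching_def)
  have "bproj \<xi> e' = bproj \<xi> (F (0, 0))"
    using F bproj_ract[OF pb F(2) boundary_carrier[OF w]] by simp
  also have "\<dots> = f (0, 0)"
    using lifts_bproj[OF F(1)] by simp
  finally obtain g where g: "g \<in> carrier G" "e' = ract \<xi> e g"
    using ract_transitive[OF pb e(1) F(2)] e(2) by auto
  have "ract \<xi> (F z) (inv g) = ract \<xi> e (w z)" if z: "z \<in> square_boundary" for z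
  proof -
    note wz = boundary_carrier[OF w z]
    have "ract \<xi> (F z) (inv g) = ract \<xi> e (g \<otimes> (w z \<otimes> inv g))"
      using F(3) z g wz e(1) by (simp add: ract_mult[OF pb] ract_closed[OF pb])
    also have "g \<otimes> (w z \<otimes> inv g) = w z"
      using g wz m_lcomm[of g "w z" "inv g"] by simp
    finally show ?thesis .
  qed
  moreover have "lifts \<xi> square f (\<lambda>z. ract \<xi> (F z) (inv g))"
    by (rule lifts_ract[OF pb F(1)]) (use g in simp)
  ultimately show ?thesis by blast
qed

text \<open>At every time the boundary lies over a single point \<open>\<eta> t\<close>, so the
  lifted homotopy has a displacement at every time. Displacements at times 0 and 1 are joined by a
  homotopy in \<open>G\<close>, and their quotient therefore extends over the square. The point
  \<open>\<eta> t\<close> may move, so free homotopies are covered.\<close>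

lemma clutching_homotopy:
  fixes H :: "(real \<times> real) \<times> real \<Rightarrow> 'x"
  assumes H: "continuous_map (top_of_set (unit_square \<times> {0..1})) (base_space \<xi>) H"
    and \<eta>: "\<And>z t. z \<in> square_boundary \<Longrightarrow> t \<in> {0..1} \<Longrightarrow> H (z, t) = \<eta> t"
    and w0: "clutching G \<xi> (\<lambda>z. H (z, 0)) w0" and w1: "clutching G \<xi> (\<lambda>z. H (z, 1)) w1"
  shows "boundary_equiv G w1 w0"
proof -
  note cw = clutching_continuous[OF w0] clutching_continuous[OF w1]
  obtain F0 e0 where F0: "lifts \<xi> square (\<lambda>z. H (z, 0)) F0" "e0 \<in> topspace (total_space \<xi>)"
    "\<forall>z\<in>square_boundary. F0 z = ract \<xi> e0 (w0 z)"
    using w0 by (auto simp: clutching_def)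
  obtain L where L: "lifts \<xi> (top_of_set (unit_square \<times> {0..1})) H L" "\<forall>z\<in>unit_square. L (z, 0) = F0 z"
    using homotopy_lifting[OF pb compact_unit_square H] F0(1) unfolding square_def by blast
  have LE: "L (z, t) \<in> topspace (total_space \<xi>)" "bproj \<xi> (L (z, t)) = H (z, t)"
    if "z \<in> unit_square" "t \<in> {0..1}" for z t
    using lifts_closed[OF L(1), of "(z, t)"] lifts_bproj[OF L(1), of "(z, t)"] that by auto
  note bs = subsetD[OF square_boundary_subset]
  have corner: "(0, 0) \<in> unit_square" by simp
  \<comment> \<open>Measured against the lift at the corner of the square at the same time, which
    lies in the same moving fibre.\<close>
  define W where "W p = translation G \<xi> (L ((0, 0), snd p)) (L p)" for p :: "(real \<times> real) \<times> real"
  have cW: "continuous_map (top_of_set (square_boundary \<times> {0..1})) (gtop G) W"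
    unfolding W_def
  proof (rule continuous_translation[OF pb])
    show "continuous_map (top_of_set (square_boundary \<times> {0..1})) (total_space \<xi>) (\<lambda>p. L ((0, 0), snd p))"
      by (rule continuous_map_compose_top_of_set[OF lifts_continuous[OF L(1)]]) (auto intro!: continuous_intros)
    show "continuous_map (top_of_set (square_boundary \<times> {0..1})) (total_space \<xi>) (\<lambda>p. L p)"
      by (rule continuous_map_compose_top_of_set[OF lifts_continuous[OF L(1)]]) (use bs in \<open>auto intro!: continuous_intros\<close>)
    show "bproj \<xi> (L ((0, 0), snd p)) = bproj \<xi> (L p)" if pp: "p \<in> topspace (top_of_set (square_boundary \<times> {0..1}))" for p
    proof -
      obtain z t where p: "p = (z, t)" "z \<in> square_boundary" "t \<in> {0..1}"
        using pp by (cases p) auto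
      show ?thesis
        using LE(2)[OF corner p(3)] LE(2)[OF bs[OF p(2)] p(3)] \<eta>[OF p(2,3)] \<eta>[OF corner_in_boundary p(3)] p(1)
        by simp
    qed
  qed
  have LW: "L (z, t) = ract \<xi> (L ((0, 0), t)) (W (z, t))" "W (z, t) \<in> carrier G"
    if "z \<in> square_boundary" "t \<in> {0..1}" for z t
  proof -
    have eq: "bproj \<xi> (L ((0, 0), t)) = bproj \<xi> (L (z, t))"
      using LE(2)[OF corner that(2)] LE(2)[OF bs[OF that(1)] that(2)] \<eta>[OF that] \<eta>[OF corner_in_boundary that(2)]
      by simp
    show "L (z, t) = ract \<xi> (L ((0, 0), t)) (W (z, t))" "W (z, t) \<in> carrier G"
      using ract_translation[OF pb LE(1)[OF corner that(2)] LE(1)[OF bs[OF that(1)] that(2)] eq]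
        translation_closed[OF pb LE(1)[OF corner that(2)] LE(1)[OF bs[OF that(1)] that(2)] eq]
      by (simp_all add: W_def)
  qed
  \<comment> \<open>Divided by its value at time 0, the displacement starts at the constant
    \<open>\<one>\<close>; the cone construction then extends its value at time 1.\<close>
  have "\<exists>T. continuous_map square (gtop G) T \<and> (\<forall>z\<in>square_boundary. T z = W (z, 1) \<otimes> inv (W (fst (z, 1::real), 0)))"
  proof -
    have "continuous_map (top_of_set (square_boundary \<times> {0..1})) (gtop G) (\<lambda>p. W (fst p, 0))"
      by (rule continuous_map_compose_top_of_set[OF cW]) (auto intro!: continuous_intros)
    then have "continuous_map (top_of_set (square_boundary \<times> {0..1})) (gtop G) (\<lambda>p. W p \<otimes> inv (W (fst p, 0)))"
      by (intro continuous_mult continuous_inv cW)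
    from square_cone_extension[OF this, of \<one>] show ?thesis
      using LW(2)[of _ 0] by simp
  qed
  then obtain T where T: "continuous_map square (gtop G) T" "\<And>z. z \<in> square_boundary \<Longrightarrow> T z = W (z, 1) \<otimes> inv (W (z, 0))"
    by auto
  obtain F1 where F1: "lifts \<xi> square (\<lambda>z. H (z, 1)) F1" "\<forall>z\<in>square_boundary. F1 z = ract \<xi> (L ((0, 0), 1)) (w1 z)"
    using clutching_at[OF w1 LE(1)[OF corner, of 1]] LE(2)[OF corner, of 1] by auto
  have L1: "lifts \<xi> square (\<lambda>z. H (z, 1)) (\<lambda>z. L (z, 1))"
    unfolding square_def
    using lifts_compose[OF L(1), of unit_square "\<lambda>z. (z, 1)"] by (simp add: image_subset_iff continuous_on_Pair)
  \<comment> \<open>At time 1 both lifts cover the same map on the whole square, so their difference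
    is already defined and continuous there.\<close>
  define k where "k z = translation G \<xi> (L (z, 1)) (F1 z)" for z
  have ck: "continuous_map square (gtop G) k"
    unfolding k_def by (rule continuous_translation_lifts[OF pb L1 F1(1)])
  have g: "inv (w0 (0, 0)) \<in> carrier G"
    using boundary_carrier[OF cw(1)] by simp
  have "w1 z = w0 z \<otimes> (T z \<otimes> (inv (w0 (0, 0)) \<otimes> k z))" if z: "z \<in> square_boundary" for z
  proof -
    note c = boundary_carrier[OF cw(1) z] boundary_carrier[OF cw(2) z] boundary_carrier[OF cw(1) corner_in_boundary]
      LW(2)[OF z, of 0] LW(2)[OF z, of 1] square_carrier[OF ck z]
    have "ract \<xi> (L ((0, 0), 1)) (w1 z) = F1 z"
      using F1 z by simp
    also have "\<dots> = ract \<xi> (L (z, 1)) (k z)"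
      unfolding k_def using ract_translation_lifts[OF pb L1 F1(1), of z] bs[OF z] by simp
    also have "\<dots> = ract \<xi> (L ((0, 0), 1)) (W (z, 1) \<otimes> k z)"
      using LW(1)[OF z, of 1] ract_mult[OF pb LE(1)[OF corner, of 1] c(5)] c(6) by simp
    finally have 1: "w1 z = W (z, 1) \<otimes> k z"
      using ract_right_cancel[OF pb LE(1)[OF corner, of 1]] c by simp
    have "ract \<xi> e0 (w0 z) = L (z, 0)"
      using bspec[OF L(2) bs[OF z]] bspec[OF F0(3) z] by simp
    also have "\<dots> = ract \<xi> (ract \<xi> e0 (w0 (0, 0))) (W (z, 0))"
      using LW(1)[OF z, of 0] L(2) F0(3) by simp
    also have "\<dots> = ract \<xi> e0 (w0 (0, 0) \<otimes> W (z, 0))"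
      using ract_mult[OF pb F0(2) c(3)] c(4) by simp
    finally have 2: "w0 z = w0 (0, 0) \<otimes> W (z, 0)"
      using ract_right_cancel[OF pb F0(2)] c by simp
    have "w0 z \<otimes> (T z \<otimes> (inv (w0 (0, 0)) \<otimes> k z)) =
        (W (z, 1) \<otimes> k z) \<otimes> ((w0 (0, 0) \<otimes> inv (w0 (0, 0))) \<otimes> (W (z, 0) \<otimes> inv (W (z, 0))))"
      unfolding T(2)[OF z] 2 using c by (simp add: m_ac del: r_inv l_inv)
    then show ?thesis
      using 1 c by simp
  qed
  moreover have "continuous_map square (gtop G) (\<lambda>z. T z \<otimes> (inv (w0 (0, 0)) \<otimes> k z))"
    by (intro continuous_mult T(1) ck) (use g in simp)
  ultimately show ?thesis
    unfolding boundary_equiv_def by blast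
qed

lemma clutching_unique:
  assumes f: "continuous_map square (base_space \<xi>) f" "\<And>z. z \<in> square_boundary \<Longrightarrow> f z = b"
    and w: "clutching G \<xi> f w0" "clutching G \<xi> f w1"
  shows "boundary_equiv G w1 w0"
proof -
  have "continuous_map (top_of_set (unit_square \<times> {0..1})) (base_space \<xi>) (\<lambda>p. f (fst p))"
    by (rule continuous_map_compose_top_of_set[of unit_square]) (use f in \<open>auto simp: square_def intro!: continuous_intros\<close>)
  from clutching_homotopy[OF this, of "\<lambda>_. b" w0 w1] show ?thesis
    using f w by simp
qed

text \<open>\<open>\<rho>\<close> retracts the square onto the union of its left, top and right edges.\<close>

lemma normalized_boundary_map:
  assumes w: "continuous_map (top_of_set square_boundary) (gtop G) w"
  shows "\<exists>w0. continuous_map (top_of_set square_boundary) (gtop G) w0 \<and> boundary_equiv G w0 w \<and>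
    (\<forall>z\<in>square_boundary. fst z = 0 \<or> fst z = 1 \<or> snd z = 1 \<longrightarrow> w0 z = \<one>)"
proof -
  \<comment> \<open>A coordinate along the three edges: it runs from -2 to -1 up the left edge, from
    -1 to 1 along the top and from 1 to 2 down the right edge. The formula extends it to the square,
    and \<open>\<rho>\<close> reads the point of the edges off its value.\<close>
  define y where "y z = (2 * fst z - 1) * (2 - snd z)" for z :: "real \<times> real"
  define \<rho> where "\<rho> z = ((max (-1) (min 1 (y z)) + 1) / 2, 1 - max 0 (\<bar>y z\<bar> - 1))" for z
  have c\<rho>: "continuous_on unit_square \<rho>"
    unfolding \<rho>_def y_def by (intro continuous_intros) auto
  have img: "\<rho> ` unit_square \<subseteq> square_boundary"
  proof (rule image_subsetI)
    fix z :: "real \<times> real" assume z: "z \<in> unit_square"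
    obtain s t where [simp]: "z = (s, t)" by (cases z)
    have st: "s \<in> {0..1}" "t \<in> {0..1}" using z by auto
    have "\<bar>y (s, t)\<bar> \<le> 1 * 2"
      unfolding y_def abs_mult using st by (intro mult_mono) auto
    then show "\<rho> z \<in> square_boundary"
      by (auto simp: \<rho>_def square_boundary_def max_def min_def abs_if)
  qed
  have fixed: "\<rho> z = z" if "z \<in> square_boundary" "fst z = 0 \<or> fst z = 1 \<or> snd z = 1" for z
  proof -
    obtain s t where [simp]: "z = (s, t)" by (cases z)
    have "0 \<le> s" "s \<le> 1" "0 \<le> t" "t \<le> 1" using that by (auto simp: square_boundary_def)
    with that(2) show ?thesis
      by (auto simp: \<rho>_def y_def max_def min_def)
  qed
  have h: "continuous_map square (gtop G) (\<lambda>z. inv (w (\<rho> z)))"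
    unfolding square_def
    by (intro continuous_inv continuous_map_compose_top_of_set[OF w c\<rho> img])
  define w0 where "w0 z = w z \<otimes> inv (w (\<rho> z))" for z
  have "continuous_map (top_of_set square_boundary) (gtop G) w0"
    unfolding w0_def by (intro continuous_mult w continuous_map_boundary[OF h])
  moreover have "boundary_equiv G w0 w"
    unfolding boundary_equiv_def w0_def using h by blast
  moreover have "w0 z = \<one>" if "z \<in> square_boundary" "fst z = 0 \<or> fst z = 1 \<or> snd z = 1" for z
    using fixed[OF that] boundary_carrier[OF w that(1)] by (simp add: w0_def)
  ultimately show ?thesis by blast
qed

text \<open>If both displacements are trivial on the vertical edges, the lifts agree on the seam and
  can be concatenated. Along the bottom edge the result runs through \<open>w\<close> and then
  through \<open>w'\<close>; a homotopy in the manner of Eckmann and Hilton turns this into the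
  pointwise product.\<close>

lemma clutching_concat_normalized:
  assumes f: "\<And>z. z \<in> square_boundary \<Longrightarrow> f z = b" and f': "\<And>z. z \<in> square_boundary \<Longrightarrow> f' z = b"
    and w: "clutching G \<xi> f w" and w': "clutching G \<xi> f' w'"
    and n: "\<And>z. z \<in> square_boundary \<Longrightarrow> fst z = 0 \<or> fst z = 1 \<or> snd z = 1 \<Longrightarrow> w z = \<one>"
      "\<And>z. z \<in> square_boundary \<Longrightarrow> fst z = 0 \<or> fst z = 1 \<or> snd z = 1 \<Longrightarrow> w' z = \<one>"
  shows "clutching G \<xi> (square_concat f f') (\<lambda>z. w z \<otimes> w' z)"
proof -
  note cw = clutching_continuous[OF w] clutching_continuous[OF w']
  obtain F e where F: "lifts \<xi> square f F" "e \<in> topspace (total_space \<xi>)"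
    "\<forall>z\<in>square_boundary. F z = ract \<xi> e (w z)"
    using w by (auto simp: clutching_def)
  have "bproj \<xi> e = f (0, 0)"
    using bproj_ract[OF pb F(2) boundary_carrier[OF cw(1) corner_in_boundary]] F(3) lifts_bproj[OF F(1), of "(0, 0)"]
    by simp
  then obtain F' where F': "lifts \<xi> square f' F'" "\<forall>z\<in>square_boundary. F' z = ract \<xi> e (w' z)"
    using clutching_at[OF w' F(2)] f f' by (metis corner_in_boundary)
  define K where "K z = (if z \<in> {0..1/2} \<times> {0..1} then F (2 * fst z, snd z) else F' (2 * fst z - 1, snd z))" for z
  have K: "K (s, t) = (if s \<le> 1/2 then F (2 * s, t) else F' (2 * s - 1, t))" if "(s, t) \<in> unit_square" for s t
    using that by (auto simp: K_def)
  have "continuous_map (top_of_set unit_square) (total_space \<xi>) K"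
    unfolding K_def
  proof (rule continuous_map_paste[where B = "{1/2..1} \<times> {0..1}"])
    show "closedin (top_of_set unit_square) ({0..1/2} \<times> {0..1})" "closedin (top_of_set unit_square) ({1/2..1} \<times> {0..1})"
      by (auto intro!: closed_subset closed_Times)
    have "continuous_map (top_of_set ({0..1/2} \<times> {0..1})) (total_space \<xi>) (\<lambda>z. F (2 * fst z, snd z))"
      by (rule continuous_map_compose_top_of_set[OF lifts_continuous[OF F(1), unfolded square_def]])
        (auto intro!: continuous_intros)
    moreover have "continuous_map (top_of_set ({1/2..1} \<times> {0..1})) (total_space \<xi>) (\<lambda>z. F' (2 * fst z - 1, snd z))"
      by (rule continuous_map_compose_top_of_set[OF lifts_continuous[OF F'(1), unfolded square_def]])
        (auto intro!: continuous_intros)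
    moreover have "unit_square \<inter> {0..1/2} \<times> {0..1} = {0..1/2} \<times> {0..1}" "unit_square \<inter> {1/2..1} \<times> {0..1} = {1/2..1} \<times> {0..1}"
      by auto
    ultimately show "continuous_map (subtopology (top_of_set unit_square) ({0..1/2} \<times> {0..1})) (total_space \<xi>) (\<lambda>z. F (2 * fst z, snd z))"
      "continuous_map (subtopology (top_of_set unit_square) ({1/2..1} \<times> {0..1})) (total_space \<xi>) (\<lambda>z. F' (2 * fst z - 1, snd z))"
      by (simp_all only: subtopology_subtopology)
    show "F (2 * fst z, snd z) = F' (2 * fst z - 1, snd z)"
      if zz: "z \<in> {0..1/2} \<times> {0..1}" "z \<in> {1/2..1} \<times> {0..1}" for z
    proof -
      obtain t where z: "z = (1/2, t)" "t \<in> {0..1}"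
        using zz by (cases z) auto
      then have "(1, t) \<in> square_boundary" "(0, t) \<in> square_boundary"
        by (auto simp: square_boundary_def)
      then show ?thesis
        using F(3) F'(2) n(1)[of "(1, t)"] n(2)[of "(0, t)"] z by simp
    qed
  qed auto
  moreover have "bproj \<xi> (K z) = square_concat f f' z" if z: "z \<in> unit_square" for z
  proof -
    obtain s t where [simp]: "z = (s, t)" by (cases z)
    show ?thesis
      using z K[of s t] lifts_bproj[OF F(1), of "(2 * s, t)"] lifts_bproj[OF F'(1), of "(2 * s - 1, t)"]
      by (auto simp: square_concat_def)
  qed
  ultimately have lK: "lifts \<xi> square (square_concat f f') K"
    by (simp add: lifts_def square_def)
  \<comment> \<open>At height 0 the pair \<open>u\<close>, \<open>v\<close> first moves
    \<open>u\<close> from 0 to 1 and then \<open>v\<close>, as in the concatenation; at height 1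
    both are the first coordinate, as in the pointwise product.\<close>
  define u where "u z = min 1 ((2 - snd z) * fst z)" for z :: "real \<times> real"
  define v where "v z = 1 - min 1 ((2 - snd z) * (1 - fst z))" for z :: "real \<times> real"
  have uv: "(u z, 0) \<in> square_boundary" "(v z, 0) \<in> square_boundary" "(fst z, 0) \<in> square_boundary" if "z \<in> unit_square" for z
    using that by (auto simp: u_def v_def square_boundary_def)
  \<comment> \<open>Trivial on the left, right and top edges; on the bottom edge it is the
    concatenation divided by the pointwise product.\<close>
  define h where "h z = (w (u z, 0) \<otimes> w' (v z, 0)) \<otimes> inv (w (fst z, 0) \<otimes> w' (fst z, 0))" for z
  have cuv: "continuous_on unit_square u" "continuous_on unit_square v"
    unfolding u_def v_def by (intro continuous_intros)+
  have ch: "continuous_map square (gtop G) h"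
    unfolding h_def square_def
    by (intro continuous_mult continuous_inv continuous_map_compose_top_of_set[OF cw(1)]
          continuous_map_compose_top_of_set[OF cw(2)])
      (use uv cuv in \<open>auto intro!: continuous_intros\<close>)
  define W where "W z = (w z \<otimes> w' z) \<otimes> h z" for z
  have KW: "K z = ract \<xi> e (W z)" if z: "z \<in> square_boundary" for z
  proof -
    obtain s t where [simp]: "z = (s, t)" by (cases z)
    have st: "0 \<le> s" "s \<le> 1" "0 \<le> t" "t \<le> 1" "s = 0 \<or> s = 1 \<or> t = 0 \<or> t = 1"
      using z by (auto simp: square_boundary_def)
    have zin: "z \<in> unit_square" using st by simp
    note c = boundary_carrier[OF cw(1)] boundary_carrier[OF cw(2)]
    have bd: "(0, a) \<in> square_boundary" "(1, a) \<in> square_boundary" "(a, 0) \<in> square_boundary" "(a, 1) \<in> square_boundary"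
      if "0 \<le> a" "a \<le> 1" for a :: real
      using that by (auto simp: square_boundary_def)
    have one: "w (0, a) = \<one>" "w (1, a) = \<one>" "w (a, 1) = \<one>" "w' (0, a) = \<one>" "w' (1, a) = \<one>" "w' (a, 1) = \<one>"
      if "0 \<le> a" "a \<le> 1" for a :: real
      using n(1)[of "(0, a)"] n(1)[of "(1, a)"] n(1)[of "(a, 1)"] n(2)[of "(0, a)"] n(2)[of "(1, a)"] n(2)[of "(a, 1)"]
        bd[OF that] by simp_all
    have F_bd: "F (a, c) = ract \<xi> e (w (a, c))" "F' (a, c) = ract \<xi> e (w' (a, c))" if "(a, c) \<in> square_boundary" for a c
      using F(3) F'(2) that by auto
    show ?thesis
    proof (cases "t = 0")
      case False
      then have J: "s = 0 \<or> s = 1 \<or> t = 1"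
        using st by auto
      have "w z = \<one>" "w' z = \<one>"
        using n[OF z] J by auto
      moreover have "h z = \<one>"
      proof -
        have cs: "w (s, 0) \<in> carrier G" "w' (s, 0) \<in> carrier G"
          using c bd(3)[OF st(1,2)] by auto
        consider "s = 0" | "s = 1" | "t = 1" using J by blast
        then show ?thesis
        proof cases
          case 1
          then have "u z = 0" "v z = 0" using st by (auto simp: u_def v_def)
          then show ?thesis using 1 one[of 0] by (simp add: h_def)
        next
          case 2
          then have "u z = 1" "v z = 1" using st by (auto simp: u_def v_def)
          then show ?thesis using 2 one[of 0] by (simp add: h_def)
        next
          case 3
          then have "u z = s" "v z = s" using st by (auto simp: u_def v_def)
          then show ?thesis using cs by (simp add: h_def)
        qed
      qed
      ultimately have "W z = \<one>" by (simp add: W_def)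
      moreover have "K z = ract \<xi> e \<one>"
      proof (cases "s \<le> 1/2")
        case True
        then have "(2 * s, t) \<in> square_boundary" "2 * s = 0 \<or> 2 * s = 1 \<or> t = 1"
          using st J by (auto simp: square_boundary_def)
        then show ?thesis
          using True K[of s t] zin F_bd(1) n(1)[of "(2 * s, t)"] by simp
      next
        case False
        then have "(2 * s - 1, t) \<in> square_boundary" "2 * s - 1 = 0 \<or> 2 * s - 1 = 1 \<or> t = 1"
          using st J by (auto simp: square_boundary_def)
        then show ?thesis
          using False K[of s t] zin F_bd(2) n(2)[of "(2 * s - 1, t)"] by auto
      qed
      ultimately show ?thesis by simp
    next
      case True
      have cs: "w (s, 0) \<in> carrier G" "w' (s, 0) \<in> carrier G" "w (u z, 0) \<in> carrier G" "w' (v z, 0) \<in> carrier G"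
        using c bd(3)[OF st(1,2)] uv[OF zin] by auto
      then have "W z = w (u z, 0) \<otimes> w' (v z, 0)"
        unfolding W_def h_def using True by (simp add: m_lcomm[of "w (s, 0) \<otimes> w' (s, 0)"])
      moreover have "K z = ract \<xi> e (w (u z, 0) \<otimes> w' (v z, 0))"
      proof (cases "s \<le> 1/2")
        case le: True
        then have "u z = 2 * s" "v z = 0" using st \<open>t = 0\<close> by (auto simp: u_def v_def)
        then show ?thesis
          using le K[of s t] zin F_bd(1)[of "2 * s" 0] bd(3)[of "2 * s"] one(4)[of 0] st \<open>t = 0\<close> cs by simp
      next
        case le: False
        then have "u z = 1" "v z = 2 * s - 1" using st \<open>t = 0\<close> by (auto simp: u_def v_def)
        then show ?thesis
          using le K[of s t] zin F_bd(2)[of "2 * s - 1" 0] bd(3)[of "2 * s - 1"] one(2)[of 0] st \<open>t = 0\<close> cs by simp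
      qed
      ultimately show ?thesis by simp
    qed
  qed
  have cW: "continuous_map (top_of_set square_boundary) (gtop G) W"
    unfolding W_def by (intro continuous_mult cw continuous_map_boundary[OF ch])
  have "clutching G \<xi> (square_concat f f') W"
    unfolding clutching_def using cW lK F(2) KW by blast
  moreover have "boundary_equiv G W (\<lambda>z. w z \<otimes> w' z)"
    unfolding boundary_equiv_def W_def using ch by blast
  ultimately show ?thesis
    using clutching_cong_equiv boundary_equiv_sym[OF _ continuous_mult[OF cw]] by blast
qed

lemma clutching_concat:
  assumes f: "\<And>z. z \<in> square_boundary \<Longrightarrow> f z = b" and f': "\<And>z. z \<in> square_boundary \<Longrightarrow> f' z = b"
    and w: "clutching G \<xi> f w" and w': "clutching G \<xi> f' w'"
  shows "clutching G \<xi> (square_concat f f') (\<lambda>z. w z \<otimes> w' z)"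
proof -
  note cw = clutching_continuous[OF w] clutching_continuous[OF w']
  obtain w0 where w0: "continuous_map (top_of_set square_boundary) (gtop G) w0" "boundary_equiv G w0 w"
    "\<forall>z\<in>square_boundary. fst z = 0 \<or> fst z = 1 \<or> snd z = 1 \<longrightarrow> w0 z = \<one>"
    using normalized_boundary_map[OF cw(1)] by blast
  obtain w0' where w0': "continuous_map (top_of_set square_boundary) (gtop G) w0'" "boundary_equiv G w0' w'"
    "\<forall>z\<in>square_boundary. fst z = 0 \<or> fst z = 1 \<or> snd z = 1 \<longrightarrow> w0' z = \<one>"
    using normalized_boundary_map[OF cw(2)] by blast
  have "clutching G \<xi> (square_concat f f') (\<lambda>z. w0 z \<otimes> w0' z)"
    by (rule clutching_concat_normalized[OF f f' clutching_cong_equiv[OF w w0(2)] clutching_cong_equiv[OF w' w0'(2)]])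
      (use w0(3) w0'(3) in auto)
  moreover have "boundary_equiv G (\<lambda>z. w z \<otimes> w' z) (\<lambda>z. w0 z \<otimes> w0' z)"
    using boundary_equiv_mult[OF boundary_equiv_sym[OF w0(2) cw(1)] boundary_equiv_sym[OF w0'(2) cw(2)] w0(1) w0'(1)] .
  ultimately show ?thesis
    using clutching_cong_equiv by blast
qed

end

end

section \<open>The second homotopy group of a universal base\<close>

text \<open>Blows the middle square \<open>[1/4, 3/4] \<times> [1/4, 3/4]\<close> up to the whole
  square and pushes the surrounding collar to the boundary.\<close>

definition square_stretch :: "real \<times> real \<Rightarrow> real \<times> real" where
  "square_stretch z = (max 0 (min 1 (2 * fst z - 1/2)), max 0 (min 1 (2 * snd z - 1/2)))"

text \<open>Equal to 1 on the middle square that \<open>square_stretch\<close> blows up, and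
  decreasing to 0 at the boundary; wherever it is below 1 the stretched point is a boundary
  point.\<close>

definition square_collar :: "real \<times> real \<Rightarrow> real" where
  "square_collar z = min 1 (4 * min (min (fst z) (1 - fst z)) (min (snd z) (1 - snd z)))"

lemma square_collar_range: "z \<in> unit_square \<Longrightarrow> square_collar z \<in> {0..1}"
  by (auto simp: square_collar_def)

lemma square_collar_boundary: "z \<in> square_boundary \<Longrightarrow> square_collar z = 0"
  by (auto simp: square_collar_def square_boundary_def)

lemma square_stretch_in: "square_stretch z \<in> unit_square"
  by (auto simp: square_stretch_def)

lemma square_stretch_collar:
  assumes "z \<in> unit_square" "square_collar z \<noteq> 1"
  shows "square_stretch z \<in> square_boundary"
proof -
  have "fst z < 1/4 \<or> fst z > 3/4 \<or> snd z < 1/4 \<or> snd z > 3/4"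
    using assms(2) unfolding square_collar_def by (auto simp: min_def split: if_splits)
  then have "fst (square_stretch z) = 0 \<or> fst (square_stretch z) = 1 \<or> snd (square_stretch z) = 0 \<or> snd (square_stretch z) = 1"
    by (auto simp: square_stretch_def)
  then show ?thesis
    using square_stretch_in[of z] by (cases "square_stretch z") (auto simp: square_boundary_def)
qed

lemma continuous_square_stretch: "continuous_on S square_stretch"
  unfolding square_stretch_def by (intro continuous_intros) auto

lemma continuous_square_collar: "continuous_on S square_collar"
  unfolding square_collar_def by (intro continuous_intros)

text \<open>The straight-line homotopy from the identity to \<open>square_stretch\<close> keeps the
  boundary in itself, since a coordinate equal to 0 or 1 is not changed by the stretching.\<close>

lemma square_homotopic_stretch:
  assumes f: "continuous_map square X f" and b: "\<And>z. z \<in> square_boundary \<Longrightarrow> f z = b"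
  shows "square_homotopic X b f (\<lambda>z. f (square_stretch z))"
  unfolding square_homotopic_def homotopic_with_def
proof (intro exI conjI allI ballI)
  define m where "m p = (1 - fst p) *\<^sub>R snd p + fst p *\<^sub>R square_stretch (snd p)" for p :: "real \<times> real \<times> real"
  define h where "h p = f (m p)" for p
  have in_sq: "(1 - t) *\<^sub>R z + t *\<^sub>R square_stretch z \<in> unit_square" if "t \<in> {0..1}" "z \<in> unit_square" for t z
  proof -
    have "convex unit_square" by (intro convex_Times convex_real_interval)
    then show ?thesis
      using convexD_alt[of unit_square z "square_stretch z" t] that square_stretch_in[of z] by simp
  qed
  have cm: "continuous_on S m" for S
    unfolding m_def
    by (intro continuous_intros continuous_on_compose2[OF continuous_square_stretch[of UNIV]]) auto
  have "m p \<in> unit_square" if "p \<in> {0..1} \<times> unit_square" for p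
    unfolding m_def by (rule in_sq) (use that in \<open>simp_all only: mem_Times_iff\<close>)
  then have "m ` ({0..1} \<times> unit_square) \<subseteq> unit_square"
    by blast
  then have "continuous_map (top_of_set ({0..1} \<times> unit_square)) X h"
    unfolding h_def
    using continuous_map_compose_top_of_set[OF f[unfolded square_def] cm] by blast
  then show "continuous_map (prod_topology (top_of_set {0..1}) square) X h"
    by (simp add: square_def)
  show "h (0, z) = f z" "h (1, z) = f (square_stretch z)" for z
    by (simp_all add: h_def m_def)
  fix t :: real assume t: "t \<in> {0..1}"
  have "(1 - t) *\<^sub>R z + t *\<^sub>R square_stretch z \<in> square_boundary" if z: "z \<in> square_boundary" for z
  proof -
    have zin: "z \<in> unit_square" using z square_boundary_subset by blast
    have "fst z = 0 \<or> fst z = 1 \<or> snd z = 0 \<or> snd z = 1"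
      using z by (auto simp: square_boundary_def)
    then have "fst ((1 - t) *\<^sub>R z + t *\<^sub>R square_stretch z) \<in> {0, 1} \<or> snd ((1 - t) *\<^sub>R z + t *\<^sub>R square_stretch z) \<in> {0, 1}"
      by (auto simp: square_stretch_def)
    then show ?thesis
      using in_sq[OF t zin] unfolding square_boundary_def mem_Collect_eq case_prod_unfold prod.collapse by blast
  qed
  then show "(\<lambda>z. h (t, z)) ` square_boundary \<subseteq> {b}"
    using b by (auto simp: h_def m_def)
qed

text \<open>The correspondence between \<open>\<pi>\<^sub>2(BG)\<close> and
  \<open>\<pi>\<^sub>1(G)\<close>. It is kept as a relation because \<open>w\<close> is determined
  only up to \<open>boundary_equiv\<close>.\<close>

definition represents ::
    "('g, 'm) tgroup_scheme \<Rightarrow> ('e, 'x, 'g, 'z) pbundle_scheme \<Rightarrow> 'x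
      \<Rightarrow> (real \<times> real \<Rightarrow> 'x) set \<Rightarrow> (real \<times> real \<Rightarrow> 'g) \<Rightarrow> bool" where
  "represents G \<zeta> b c w \<longleftrightarrow>
    (\<exists>f. continuous_map square (base_space \<zeta>) f \<and> (\<forall>z\<in>square_boundary. f z = b) \<and>
     clutching G \<zeta> f w \<and> c = Collect (square_homotopic (base_space \<zeta>) b f))"

context abelian_topological_group
begin

context
  fixes \<zeta> :: "('e, 'x, 'g, 'z) pbundle_scheme"
  assumes universal: "universal_bundle G \<zeta>"
begin

lemma universal_principal: "principal_bundle G \<zeta>"
  using universal by (simp add: universal_bundle_def)

lemma universal_contraction:
  shows "\<exists>k a. continuous_map (prod_topology (top_of_set {0..1::real}) (total_space \<zeta>)) (total_space \<zeta>) k \<and>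
    (\<forall>x. k (0, x) = x) \<and> (\<forall>x. k (1, x) = a)"
  using universal unfolding universal_bundle_def contractible_space_def homotopic_with_def by auto

text \<open>Two lifts that agree on the boundary are joined by contracting the total space, slowed down
  to a halt on a collar; stretching makes the lifts agree on that collar.\<close>

lemma square_homotopic_of_clutching:
  assumes f: "continuous_map square (base_space \<zeta>) f" "\<And>z. z \<in> square_boundary \<Longrightarrow> f z = b"
    and f': "continuous_map square (base_space \<zeta>) f'" "\<And>z. z \<in> square_boundary \<Longrightarrow> f' z = b"
    and w: "clutching G \<zeta> f w" "clutching G \<zeta> f' w"
  shows "square_homotopic (base_space \<zeta>) b f f'"
proof -
  note pb = universal_principal
  note cw = clutching_continuous[OF w(1)]
  obtain F e where F: "lifts \<zeta> square f F" "e \<in> topspace (total_space \<zeta>)"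
    "\<forall>z\<in>square_boundary. F z = ract \<zeta> e (w z)"
    using w(1) by (auto simp: clutching_def)
  have "bproj \<zeta> e = f (0, 0)"
    using bproj_ract[OF pb F(2) boundary_carrier[OF cw corner_in_boundary]] F(3) lifts_bproj[OF F(1), of "(0, 0)"]
    by simp
  then obtain F' where F': "lifts \<zeta> square f' F'" "\<forall>z\<in>square_boundary. F' z = ract \<zeta> e (w z)"
    using clutching_at[OF pb w(2) F(2)] f(2) f'(2) by (metis corner_in_boundary)
  obtain k a where k: "continuous_map (prod_topology (top_of_set {0..1::real}) (total_space \<zeta>)) (total_space \<zeta>) k"
    "\<And>x. k (0, x) = x" "\<And>x. k (1, x) = a"
    using universal_contraction by blast
  \<comment> \<open>Until time 1/2 the contraction is run along \<open>F\<close>, afterwards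
    backwards along \<open>F'\<close>. Where the collar function is 1, both halves meet in the point
    \<open>a\<close>; where it is smaller, the stretched point lies on the boundary and
    \<open>F\<close> and \<open>F'\<close> agree there. On the boundary the factor is 0 and nothing
    moves.\<close>
  define K where "K p = (if p \<in> {0..1/2} \<times> unit_square
      then k (2 * fst p * square_collar (snd p), F (square_stretch (snd p)))
      else k ((2 - 2 * fst p) * square_collar (snd p), F' (square_stretch (snd p))))" for p :: "real \<times> real \<times> real"
  have part: "continuous_map (top_of_set S) (total_space \<zeta>) (\<lambda>p. k (c p * square_collar (snd p), L (square_stretch (snd p))))"
    if "lifts \<zeta> square g L" "continuous_on S c" "\<And>p. p \<in> S \<Longrightarrow> c p \<in> {0..1} \<and> snd p \<in> unit_square"
    for S :: "(real \<times> real \<times> real) set" and c g L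
  proof -
    have "continuous_map (top_of_set S) (top_of_set {0..1}) (\<lambda>p. c p * square_collar (snd p))"
      using that square_collar_range
      by (auto intro!: continuous_intros continuous_on_compose2[OF continuous_square_collar[of UNIV]] mult_le_one simp: mult_nonneg_nonneg)
    moreover have "continuous_map (top_of_set S) (total_space \<zeta>) (\<lambda>p. L (square_stretch (snd p)))"
      by (rule continuous_map_compose_top_of_set[OF lifts_continuous[OF that(1), unfolded square_def]])
        (simp_all only: image_subset_iff square_stretch_in, auto intro!: continuous_intros continuous_on_compose2[OF continuous_square_stretch[of UNIV]])
    ultimately have "continuous_map (top_of_set S) (prod_topology (top_of_set {0..1::real}) (total_space \<zeta>))
        (\<lambda>p. (c p * square_collar (snd p), L (square_stretch (snd p))))"
      by (rule continuous_map_pairedI)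
    from continuous_map_compose[OF this k(1)] show ?thesis
      by (simp add: o_def)
  qed
  have cK: "continuous_map (top_of_set ({0..1} \<times> unit_square)) (total_space \<zeta>) K"
    unfolding K_def
  proof (rule continuous_map_paste[where B = "{1/2..1} \<times> unit_square"])
    show "closedin (top_of_set ({0..1} \<times> unit_square)) ({0..1/2 :: real} \<times> unit_square)"
      "closedin (top_of_set ({0..1} \<times> unit_square)) ({1/2..1 :: real} \<times> unit_square)"
      by (auto intro!: closed_subset closed_Times)
    have "continuous_map (top_of_set ({0..1/2} \<times> unit_square)) (total_space \<zeta>) (\<lambda>p. k (2 * fst p * square_collar (snd p), F (square_stretch (snd p))))"
      by (rule part[OF F(1)]) (auto intro!: continuous_intros)
    moreover have "continuous_map (top_of_set ({1/2..1} \<times> unit_square)) (total_space \<zeta>) (\<lambda>p. k ((2 - 2 * fst p) * square_collar (snd p), F' (square_stretch (snd p))))"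
      by (rule part[OF F'(1)]) (auto intro!: continuous_intros)
    moreover have "({0..1::real} \<times> unit_square) \<inter> {0..1/2} \<times> unit_square = {0..1/2} \<times> unit_square"
      "({0..1::real} \<times> unit_square) \<inter> {1/2..1} \<times> unit_square = {1/2..1} \<times> unit_square"
      by auto
    ultimately show "continuous_map (subtopology (top_of_set ({0..1} \<times> unit_square)) ({0..1/2} \<times> unit_square)) (total_space \<zeta>)
        (\<lambda>p. k (2 * fst p * square_collar (snd p), F (square_stretch (snd p))))"
      "continuous_map (subtopology (top_of_set ({0..1} \<times> unit_square)) ({1/2..1} \<times> unit_square)) (total_space \<zeta>)
        (\<lambda>p. k ((2 - 2 * fst p) * square_collar (snd p), F' (square_stretch (snd p))))"
      by (simp_all only: subtopology_subtopology)
    show "k (2 * fst p * square_collar (snd p), F (square_stretch (snd p))) = k ((2 - 2 * fst p) * square_collar (snd p), F' (square_stretch (snd p)))"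
      if pp: "p \<in> {0..1/2} \<times> unit_square" "p \<in> {1/2..1} \<times> unit_square" for p
    proof -
      obtain z where p: "p = (1/2, z)" "z \<in> unit_square"
        using pp by (cases p) auto
      show ?thesis
      proof (cases "square_collar z = 1")
        case True
        then show ?thesis using p k(3) by simp
      next
        case False
        then have "square_stretch z \<in> square_boundary"
          using square_stretch_collar p by blast
        then show ?thesis using p F(3) F'(2) by simp
      qed
    qed
  qed auto
  have kE: "k (t, x) \<in> topspace (total_space \<zeta>)" if "t \<in> {0..1}" "x \<in> topspace (total_space \<zeta>)" for t x
    using continuous_map_image_subset_topspace[OF k(1)] that by auto
  have "square_homotopic (base_space \<zeta>) b (\<lambda>z. f (square_stretch z)) (\<lambda>z. f' (square_stretch z))"
    unfolding square_homotopic_def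
  proof (subst homotopic_with)
    show "(h ` square_boundary \<subseteq> {b}) = (h' ` square_boundary \<subseteq> {b})"
      if eq: "\<And>x. x \<in> topspace square \<Longrightarrow> h x = h' x" for h h' :: "real \<times> real \<Rightarrow> 'x"
    proof -
      have "h z = h' z" if "z \<in> square_boundary" for z
        using eq[of z] subsetD[OF square_boundary_subset that] by simp
      then show ?thesis by (simp add: image_subset_iff)
    qed
    show "\<exists>h. continuous_map (prod_topology (top_of_set {0..1::real}) square) (base_space \<zeta>) h \<and>
        (\<forall>x\<in>topspace square. h (0, x) = f (square_stretch x)) \<and>
        (\<forall>x\<in>topspace square. h (1, x) = f' (square_stretch x)) \<and>
        (\<forall>t\<in>{0..1}. (\<lambda>x. h (t, x)) ` square_boundary \<subseteq> {b})"
    proof (intro exI[of _ "\<lambda>p. bproj \<zeta> (K p)"] conjI ballI image_subsetI)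
      show "continuous_map (prod_topology (top_of_set {0..1::real}) square) (base_space \<zeta>) (\<lambda>p. bproj \<zeta> (K p))"
        using continuous_map_compose[OF cK continuous_bproj[OF pb]] by (simp add: square_def o_def)
      show "bproj \<zeta> (K (0, z)) = f (square_stretch z)" if "z \<in> topspace square" for z
        using that lifts_bproj[OF F(1), of "square_stretch z"] square_stretch_in[of z] k(2) by (simp add: K_def)
      show "bproj \<zeta> (K (1, z)) = f' (square_stretch z)" if "z \<in> topspace square" for z
        using that lifts_bproj[OF F'(1), of "square_stretch z"] square_stretch_in[of z] k(2) by (simp add: K_def)
      fix t :: real and z :: "real \<times> real" assume t: "t \<in> {0..1}" and z: "z \<in> square_boundary"
      have zin: "z \<in> unit_square" using z square_boundary_subset by blast
      have sz: "square_stretch z \<in> square_boundary"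
        using square_stretch_collar[OF zin] square_collar_boundary[OF z] by simp
      have "bproj \<zeta> (F (square_stretch z)) = b" "bproj \<zeta> (F' (square_stretch z)) = b"
        using lifts_bproj[OF F(1), of "square_stretch z"] lifts_bproj[OF F'(1), of "square_stretch z"]
          square_stretch_in[of z] f(2)[OF sz] f'(2)[OF sz] by simp_all
      then show "bproj \<zeta> (K (t, z)) \<in> {b}"
        using k(2) square_collar_boundary[OF z] by (simp add: K_def)
    qed
  qed
  moreover have "square_homotopic (base_space \<zeta>) b f (\<lambda>z. f (square_stretch z))"
    "square_homotopic (base_space \<zeta>) b f' (\<lambda>z. f' (square_stretch z))"
    using square_homotopic_stretch[OF f] square_homotopic_stretch[OF f'] by simp_all
  ultimately show ?thesis
    unfolding square_homotopic_def by (meson homotopic_with_sym homotopic_with_trans)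
qed

text \<open>The contraction of the total space, run backwards, starts at the constant
  \<open>a\<close> and is therefore a cone over \<open>H0\<close>.\<close>

lemma universal_extension:
  assumes H0: "continuous_map (top_of_set square_boundary) (total_space \<zeta>) H0"
  shows "\<exists>F. continuous_map square (total_space \<zeta>) F \<and> (\<forall>z\<in>square_boundary. F z = H0 z)"
proof -
  obtain k a where k: "continuous_map (prod_topology (top_of_set {0..1::real}) (total_space \<zeta>)) (total_space \<zeta>) k"
    "\<And>x. k (0, x) = x" "\<And>x. k (1, x) = a"
    using universal_contraction by blast
  have "continuous_map (top_of_set (square_boundary \<times> {0..1::real})) (total_space \<zeta>) (\<lambda>p. H0 (fst p))"
    by (rule continuous_map_compose_top_of_set[OF H0]) (auto intro!: continuous_intros)
  moreover have "continuous_map (top_of_set (square_boundary \<times> {0..1::real})) (top_of_set {0..1}) (\<lambda>p. 1 - snd p)"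
    by (auto intro!: continuous_intros)
  ultimately have "continuous_map (top_of_set (square_boundary \<times> {0..1::real}))
      (prod_topology (top_of_set {0..1::real}) (total_space \<zeta>)) (\<lambda>p. (1 - snd p, H0 (fst p)))"
    by (intro continuous_map_pairedI)
  from continuous_map_compose[OF this k(1)]
  have "continuous_map (top_of_set (square_boundary \<times> {0..1::real})) (total_space \<zeta>) (\<lambda>p. k (1 - snd p, H0 (fst p)))"
    by (simp add: o_def)
  from square_cone_extension[OF this, of a] show ?thesis
    using k by simp
qed

text \<open>Surjectivity of the passage from \<open>\<pi>\<^sub>2(BG)\<close> to
  \<open>\<pi>\<^sub>1(G)\<close>: the boundary map with values in a single fibre is filled in the
  contractible total space, and the filling is projected to the base.\<close>

lemma clutching_realize:
  assumes w: "continuous_map (top_of_set square_boundary) (gtop G) w" and b: "b \<in> topspace (base_space \<zeta>)"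
  shows "\<exists>f. continuous_map square (base_space \<zeta>) f \<and> (\<forall>z\<in>square_boundary. f z = b) \<and> clutching G \<zeta> f w"
proof -
  note pb = universal_principal
  obtain U s where Us: "b \<in> U" "openin (base_space \<zeta>) U"
      "continuous_map (subtopology (base_space \<zeta>) U) (total_space \<zeta>) s" "\<forall>u\<in>U. bproj \<zeta> (s u) = u"
    using local_section[OF pb b] by blast
  define e where "e = s b"
  have e: "e \<in> topspace (total_space \<zeta>)" "bproj \<zeta> e = b"
    using continuous_map_image_subset_topspace[OF Us(3)] openin_subset[OF Us(2)] Us(1,4) by (auto simp: e_def)
  have "continuous_map (top_of_set square_boundary) (total_space \<zeta>) (\<lambda>z. ract \<zeta> e (w z))"
    by (rule continuous_ract[OF pb _ w]) (use e in simp)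
  then obtain F where F: "continuous_map square (total_space \<zeta>) F" "\<forall>z\<in>square_boundary. F z = ract \<zeta> e (w z)"
    using universal_extension by blast
  have "continuous_map square (base_space \<zeta>) (\<lambda>z. bproj \<zeta> (F z))"
    using continuous_map_compose[OF F(1) continuous_bproj[OF pb]] by (simp add: o_def)
  moreover have "bproj \<zeta> (F z) = b" if "z \<in> square_boundary" for z
    using F(2) that bproj_ract[OF pb e(1) boundary_carrier[OF w that]] e(2) by simp
  moreover have "clutching G \<zeta> (\<lambda>z. bproj \<zeta> (F z)) w"
    unfolding clutching_def lifts_def using F e w by auto
  ultimately show ?thesis by blast
qed

lemma represents_continuous:
  "represents G \<zeta> b c w \<Longrightarrow> continuous_map (top_of_set square_boundary) (gtop G) w"
  by (auto simp: represents_def clutching_def)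

lemma square_homotopic_class_eq:
  assumes "square_homotopic X b f f'"
  shows "Collect (square_homotopic X b f) = Collect (square_homotopic X b f')"
  using assms unfolding square_homotopic_def
  by (auto intro: homotopic_with_trans dest: homotopic_with_sym[THEN iffD1])

lemma square_homotopicD:
  assumes "square_homotopic X b f f'"
  shows "continuous_map square X f" "continuous_map square X f'"
    "\<And>z. z \<in> square_boundary \<Longrightarrow> f z = b" "\<And>z. z \<in> square_boundary \<Longrightarrow> f' z = b"
  using homotopic_with_imp_continuous_maps[OF assms[unfolded square_homotopic_def]]
    homotopic_with_imp_property[OF assms[unfolded square_homotopic_def]] by auto

lemma represents_closed:
  "represents G \<zeta> b c w \<Longrightarrow> c \<in> carrier (pi2 (base_space \<zeta>) b)"
  unfolding represents_def pi2_def by (auto simp: image_subset_iff)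

lemma represents_ex:
  assumes "c \<in> carrier (pi2 (base_space \<zeta>) b)"
  shows "\<exists>w. represents G \<zeta> b c w"
proof -
  obtain f where f: "continuous_map square (base_space \<zeta>) f" "\<forall>z\<in>square_boundary. f z = b"
    "c = Collect (square_homotopic (base_space \<zeta>) b f)"
    using assms unfolding pi2_def by (auto simp: image_subset_iff)
  then show ?thesis
    using clutching_exists[OF universal_principal f(1), of b] unfolding represents_def by blast
qed

lemma represents_realize:
  assumes "continuous_map (top_of_set square_boundary) (gtop G) w" "b \<in> topspace (base_space \<zeta>)"
  shows "\<exists>c. represents G \<zeta> b c w"
  using clutching_realize[OF assms] unfolding represents_def by blast

text \<open>Injectivity of the passage from \<open>\<pi>\<^sub>2(BG)\<close> to
  \<open>\<pi>\<^sub>1(G)\<close>; the contraction of the total space enters through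
  \<open>square_homotopic_of_clutching\<close>.\<close>

lemma represents_unique:
  assumes "represents G \<zeta> b c w" "represents G \<zeta> b c' w'" "boundary_equiv G w w'"
  shows "c = c'"
proof -
  obtain f where f: "continuous_map square (base_space \<zeta>) f" "\<forall>z\<in>square_boundary. f z = b"
     "clutching G \<zeta> f w" "c = Collect (square_homotopic (base_space \<zeta>) b f)"
    using assms(1) unfolding represents_def by blast
  obtain f' where f': "continuous_map square (base_space \<zeta>) f'" "\<forall>z\<in>square_boundary. f' z = b"
     "clutching G \<zeta> f' w'" "c' = Collect (square_homotopic (base_space \<zeta>) b f')"
    using assms(2) unfolding represents_def by blast
  have "clutching G \<zeta> f' w"
    using clutching_cong_equiv[OF universal_principal f'(3) assms(3)] .
  then have "square_homotopic (base_space \<zeta>) b f f'"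
    using square_homotopic_of_clutching f f' by blast
  then show ?thesis
    using f(4) f'(4) square_homotopic_class_eq[of "base_space \<zeta>" b f f'] by simp
qed

text \<open>The defining property of \<open>represents\<close> speaks of one map in the class; a
  homotopy relative to the boundary transfers the clutching map to every other.\<close>

lemma represents_member:
  assumes "represents G \<zeta> b c w" "f \<in> c"
  shows "continuous_map square (base_space \<zeta>) f" "\<forall>z\<in>square_boundary. f z = b" "clutching G \<zeta> f w"
proof -
  note pb = universal_principal
  obtain f0 where f0: "continuous_map square (base_space \<zeta>) f0" "\<forall>z\<in>square_boundary. f0 z = b"
     "clutching G \<zeta> f0 w" "c = Collect (square_homotopic (base_space \<zeta>) b f0)"
    using assms(1) unfolding represents_def by blast
  have hom: "square_homotopic (base_space \<zeta>) b f0 f"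
    using assms(2) f0 by simp
  show f: "continuous_map square (base_space \<zeta>) f" "\<forall>z\<in>square_boundary. f z = b"
    using square_homotopicD[OF hom] by auto
  obtain w' where w': "clutching G \<zeta> f w'"
    using clutching_exists[OF pb f(1), of b] f(2) by auto
  obtain h where h: "continuous_map (prod_topology (top_of_set {0..1::real}) square) (base_space \<zeta>) h"
    "\<forall>x. h (0, x) = f0 x" "\<forall>x. h (1, x) = f x" "\<forall>t\<in>{0..1}. (\<lambda>x. h (t, x)) ` square_boundary \<subseteq> {b}"
    using hom unfolding square_homotopic_def homotopic_with_def by meson
  have ends: "(\<lambda>z. h (0, z)) = f0" "(\<lambda>z. h (1, z)) = f"
    using h(2,3) by (auto intro!: ext)
  define H where "H p = h (snd p, fst p)" for p :: "(real \<times> real) \<times> real"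
  have "continuous_map (top_of_set (unit_square \<times> {0..1})) (base_space \<zeta>) H"
    unfolding H_def
    by (rule continuous_map_compose_top_of_set[of "{0..1} \<times> unit_square"])
      (use h(1) in \<open>auto simp: square_def intro!: continuous_intros\<close>)
  then have "boundary_equiv G w' w"
    by (rule clutching_homotopy[OF pb, of H "\<lambda>_. b"])
      (use h(4) f0(3) w' in \<open>simp_all add: H_def image_subset_iff ends\<close>)
  then have "boundary_equiv G w w'"
    using boundary_equiv_sym clutching_continuous[OF f0(3)] by blast
  then show "clutching G \<zeta> f w"
    using clutching_cong_equiv[OF pb w'] by blast
qed

lemma represents_refl_member:
  assumes "represents G \<zeta> b c w" "continuous_map square (base_space \<zeta>) f" "\<And>z. z \<in> square_boundary \<Longrightarrow> f z = b" "clutching G \<zeta> f w"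
  shows "f \<in> c"
proof -
  obtain f0 where f0: "continuous_map square (base_space \<zeta>) f0" "\<forall>z\<in>square_boundary. f0 z = b"
     "clutching G \<zeta> f0 w" "c = Collect (square_homotopic (base_space \<zeta>) b f0)"
    using assms(1) unfolding represents_def by blast
  then show ?thesis
    using square_homotopic_of_clutching[OF f0(1) _ assms(2,3) f0(3) assms(4)] by simp
qed

text \<open>The product in \<open>pi2\<close> is a union over all representatives. The class
  \<open>c'\<close> that realizes the pointwise product is chosen beforehand; by
  \<open>clutching_concat\<close> every concatenation lies in it, so the union is exactly
  \<open>c'\<close>.\<close>

lemma represents_mult:
  assumes c: "represents G \<zeta> b c w" and d: "represents G \<zeta> b d v" and b: "b \<in> topspace (base_space \<zeta>)"
  shows "represents G \<zeta> b (c \<otimes>\<^bsub>pi2 (base_space \<zeta>) b\<^esub> d) (\<lambda>z. w z \<otimes> v z)"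
proof -
  note pb = universal_principal
  have cwv: "continuous_map (top_of_set square_boundary) (gtop G) (\<lambda>z. w z \<otimes> v z)"
    using continuous_mult c d represents_continuous by blast
  obtain c' where c': "represents G \<zeta> b c' (\<lambda>z. w z \<otimes> v z)"
    using represents_realize[OF cwv b] by blast
  have concat: "square_concat f g \<in> c'" if "f \<in> c" "g \<in> d" for f g
  proof (rule represents_refl_member[OF c'])
    note f = represents_member[OF c that(1)] and g = represents_member[OF d that(2)]
    show cl: "clutching G \<zeta> (square_concat f g) (\<lambda>z. w z \<otimes> v z)"
      using clutching_concat[OF pb _ _ f(3) g(3), of b] f g by auto
    then obtain F where F: "lifts \<zeta> square (square_concat f g) F"
      by (auto simp: clutching_def)
    have "continuous_map square (base_space \<zeta>) (\<lambda>z. bproj \<zeta> (F z))"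
      using continuous_map_compose[OF lifts_continuous[OF F] continuous_bproj[OF pb]] by (simp add: o_def)
    \<comment> \<open>Continuity of the concatenation is read off its lift.\<close>
    then show "continuous_map square (base_space \<zeta>) (square_concat f g)"
      by (rule continuous_map_eq) (rule lifts_bproj[OF F])
    fix z :: "real \<times> real" assume z: "z \<in> square_boundary"
    obtain s t where [simp]: "z = (s, t)" by (cases z)
    show "square_concat f g z = b"
    proof (cases "s \<le> 1/2")
      case True
      then have "(2 * s, t) \<in> square_boundary"
        using z by (auto simp: square_boundary_def)
      then show ?thesis using f(2) True by (simp add: square_concat_def)
    next
      case False
      then have "(2 * s - 1, t) \<in> square_boundary"
        using z by (auto simp: square_boundary_def)
      then show ?thesis using g(2) False by (simp add: square_concat_def)
    qed
  qed
  obtain f0 where f0: "c' = Collect (square_homotopic (base_space \<zeta>) b f0)"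
    using c' unfolding represents_def by blast
  have ne: "\<exists>f. f \<in> c" "\<exists>f. f \<in> d"
    using c d represents_refl_member[OF c] represents_refl_member[OF d] unfolding represents_def by metis+
  have "c \<otimes>\<^bsub>pi2 (base_space \<zeta>) b\<^esub> d = {h. \<exists>f\<in>c. \<exists>g\<in>d. square_homotopic (base_space \<zeta>) b (square_concat f g) h}"
    by (simp add: pi2_def)
  also have "\<dots> = c'"
  proof -
    have "Collect (square_homotopic (base_space \<zeta>) b (square_concat f g)) = c'" if "f \<in> c" "g \<in> d" for f g
      using square_homotopic_class_eq[of "base_space \<zeta>" b f0 "square_concat f g"] concat[OF that] f0 by simp
    then show ?thesis using ne by blast
  qed
  finally show ?thesis using c' by simp
qed

lemma represents_one:
  assumes b: "b \<in> topspace (base_space \<zeta>)"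
  shows "represents G \<zeta> b \<one>\<^bsub>pi2 (base_space \<zeta>) b\<^esub> (\<lambda>_. \<one>)"
proof -
  note pb = universal_principal
  have "continuous_map square (base_space \<zeta>) (\<lambda>_. b)"
    using b by simp
  moreover have "clutching G \<zeta> (\<lambda>_. b) (\<lambda>_. \<one>)"
  proof -
    obtain U s where Us: "b \<in> U" "openin (base_space \<zeta>) U"
      "continuous_map (subtopology (base_space \<zeta>) U) (total_space \<zeta>) s" "\<forall>u\<in>U. bproj \<zeta> (s u) = u"
      using local_section[OF pb b] by blast
    have e: "s b \<in> topspace (total_space \<zeta>)" "bproj \<zeta> (s b) = b"
      using continuous_map_image_subset_topspace[OF Us(3)] openin_subset[OF Us(2)] Us(1,4) by auto
    then show ?thesis
      unfolding clutching_def lifts_def using ract_one[OF pb e(1)] e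
      by (intro conjI exI[of _ "\<lambda>_. s b"] bexI[of _ "s b"]) simp_all
  qed
  ultimately show ?thesis
    unfolding represents_def by (auto simp: pi2_def intro!: exI[of _ "\<lambda>_. b"])
qed

text \<open>Each law is inherited from pointwise multiplication in \<open>G\<close>: both sides are
  represented by equal maps on the boundary, so no homotopies of squares have to be written
  down.\<close>

lemma pi2_comm_group:
  assumes b: "b \<in> topspace (base_space \<zeta>)"
  shows "comm_group (pi2 (base_space \<zeta>) b)"
proof (rule comm_groupI)
  let ?P = "pi2 (base_space \<zeta>) b"
  show one: "\<one>\<^bsub>?P\<^esub> \<in> carrier ?P"
    using represents_closed represents_one[OF b] by blast
  fix x assume x: "x \<in> carrier ?P"
  obtain u where u: "represents G \<zeta> b x u" using represents_ex x by blast
  note cu = represents_continuous[OF u]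
  show "\<one>\<^bsub>?P\<^esub> \<otimes>\<^bsub>?P\<^esub> x = x"
    by (rule represents_unique[OF represents_mult[OF represents_one[OF b] u b] u], rule boundary_equiv_eq)
      (use boundary_carrier[OF cu] cu in \<open>auto intro!: continuous_mult\<close>)
  show "\<exists>y\<in>carrier ?P. y \<otimes>\<^bsub>?P\<^esub> x = \<one>\<^bsub>?P\<^esub>"
  proof -
    obtain y where y: "represents G \<zeta> b y (\<lambda>z. inv (u z))"
      using represents_realize[OF continuous_inv[OF cu] b] by blast
    have "y \<otimes>\<^bsub>?P\<^esub> x = \<one>\<^bsub>?P\<^esub>"
      by (rule represents_unique[OF represents_mult[OF y u b] represents_one[OF b]], rule boundary_equiv_eq)
        (use boundary_carrier[OF cu] cu in \<open>auto intro!: continuous_mult continuous_inv\<close>)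
    then show ?thesis using y represents_closed by blast
  qed
  fix y assume y: "y \<in> carrier ?P"
  obtain v where v: "represents G \<zeta> b y v" using represents_ex y by blast
  note cv = represents_continuous[OF v]
  show "x \<otimes>\<^bsub>?P\<^esub> y \<in> carrier ?P"
    using represents_closed represents_mult[OF u v b] by blast
  show "x \<otimes>\<^bsub>?P\<^esub> y = y \<otimes>\<^bsub>?P\<^esub> x"
    by (rule represents_unique[OF represents_mult[OF u v b] represents_mult[OF v u b]], rule boundary_equiv_eq)
      (use boundary_carrier[OF cu] boundary_carrier[OF cv] cu cv in \<open>auto intro!: continuous_mult simp: m_comm\<close>)
  fix z assume z: "z \<in> carrier ?P"
  obtain w where w: "represents G \<zeta> b z w" using represents_ex z by blast
  note cw = represents_continuous[OF w]
  show "x \<otimes>\<^bsub>?P\<^esub> y \<otimes>\<^bsub>?P\<^esub> z = x \<otimes>\<^bsub>?P\<^esub> (y \<otimes>\<^bsub>?P\<^esub> z)"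
    by (rule represents_unique[OF represents_mult[OF represents_mult[OF u v b] w b] represents_mult[OF u represents_mult[OF v w b] b]],
        rule boundary_equiv_eq)
      (use boundary_carrier[OF cu] boundary_carrier[OF cv] boundary_carrier[OF cw] cu cv cw in \<open>auto intro!: continuous_mult simp: m_assoc\<close>)
qed

lemma represents_pow:
  assumes c: "represents G \<zeta> b c w" and b: "b \<in> topspace (base_space \<zeta>)"
  shows "represents G \<zeta> b (c [^]\<^bsub>pi2 (base_space \<zeta>) b\<^esub> n) (\<lambda>z. w z [^] (n::nat))"
proof -
  interpret P: comm_group "pi2 (base_space \<zeta>) b" by (rule pi2_comm_group[OF b])
  show ?thesis
    by (induction n) (use represents_one[OF b] represents_mult[OF _ c b] in auto)
qed

lemma represents_inv:
  assumes c: "represents G \<zeta> b c w" and b: "b \<in> topspace (base_space \<zeta>)"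
  shows "represents G \<zeta> b (inv\<^bsub>pi2 (base_space \<zeta>) b\<^esub> c) (\<lambda>z. inv (w z))"
proof -
  interpret P: comm_group "pi2 (base_space \<zeta>) b" by (rule pi2_comm_group[OF b])
  note cw = represents_continuous[OF c]
  obtain y where y: "represents G \<zeta> b y (\<lambda>z. inv (w z))"
    using represents_realize[OF continuous_inv[OF cw] b] by blast
  have "y \<otimes>\<^bsub>pi2 (base_space \<zeta>) b\<^esub> c = \<one>\<^bsub>pi2 (base_space \<zeta>) b\<^esub>"
    by (rule represents_unique[OF represents_mult[OF y c b] represents_one[OF b]], rule boundary_equiv_eq)
      (use boundary_carrier[OF cw] cw in \<open>auto intro!: continuous_mult continuous_inv\<close>)
  then have "inv\<^bsub>pi2 (base_space \<zeta>) b\<^esub> c = y"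
    using P.inv_equality represents_closed c y by blast
  then show ?thesis using y by simp
qed

end

end

section \<open>Hemispheres and the Chern class\<close>

definition sphere_point :: "complex \<Rightarrow> real \<Rightarrow> real^3" where
  "sphere_point z h = Re z *\<^sub>R axis 1 1 + Im z *\<^sub>R axis 2 1 + h *\<^sub>R axis 3 1"

definition horizontal :: "real^3 \<Rightarrow> complex" where
  "horizontal x = Complex (x $ 1) (x $ 2)"

definition upper :: "complex \<Rightarrow> real^3" where
  "upper z = sphere_point z (sqrt (1 - (cmod z)\<^sup>2))"

definition lower :: "complex \<Rightarrow> real^3" where
  "lower z = sphere_point z (- sqrt (1 - (cmod z)\<^sup>2))"

lemma sphere_point_nth [simp]:
  "sphere_point z h $ 1 = Re z" "sphere_point z h $ 2 = Im z" "sphere_point z h $ 3 = h"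
  by (simp_all add: sphere_point_def axis_def)

lemma sphere_point_horizontal: "sphere_point (horizontal x) (x $ 3) = x"
  by (simp add: vec_eq_iff forall_3 horizontal_def)

lemma horizontal_sphere_point [simp]: "horizontal (sphere_point z h) = z"
  by (simp add: horizontal_def)

lemma norm_sphere_point: "(norm (sphere_point z h))\<^sup>2 = (cmod z)\<^sup>2 + h\<^sup>2"
  by (simp add: norm_vec_def L2_set_def sum_3 cmod_power2)

lemma sphere_point_in_sphere: "sphere_point z h \<in> sphere 0 1 \<longleftrightarrow> (cmod z)\<^sup>2 + h\<^sup>2 = 1"
  using norm_sphere_point[of z h] power2_eq_iff_nonneg[of "norm (sphere_point z h)" 1] by simp

lemma horizontal_height:
  assumes "x \<in> sphere 0 1"
  shows "(cmod (horizontal x))\<^sup>2 + (x $ 3)\<^sup>2 = 1"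
  using assms sphere_point_horizontal[of x] sphere_point_in_sphere by metis

lemma horizontal_in_disc:
  assumes "x \<in> sphere 0 1" shows "horizontal x \<in> cball 0 1"
proof -
  have "(cmod (horizontal x))\<^sup>2 \<le> 1"
    using horizontal_height[OF assms] by (smt (verit) zero_le_power2)
  then show ?thesis
    using abs_square_le_1[of "cmod (horizontal x)"] by simp
qed

lemma upper_horizontal:
  assumes "x \<in> sphere 0 1" "x $ 3 \<ge> 0" shows "upper (horizontal x) = x"
proof -
  have "1 - (cmod (horizontal x))\<^sup>2 = (x $ 3)\<^sup>2"
    using horizontal_height[OF assms(1)] by simp
  then show ?thesis
    unfolding upper_def using assms(2) sphere_point_horizontal[of x] by simp
qed

lemma lower_horizontal:
  assumes "x \<in> sphere 0 1" "x $ 3 \<le> 0" shows "lower (horizontal x) = x"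
proof -
  have "1 - (cmod (horizontal x))\<^sup>2 = (x $ 3)\<^sup>2"
    using horizontal_height[OF assms(1)] by simp
  then show ?thesis
    unfolding lower_def using assms(2) sphere_point_horizontal[of x] by simp
qed

lemma upper_in_sphere: "z \<in> cball 0 1 \<Longrightarrow> upper z \<in> sphere 0 1"
  and lower_in_sphere: "z \<in> cball 0 1 \<Longrightarrow> lower z \<in> sphere 0 1"
  unfolding upper_def lower_def sphere_point_in_sphere by (simp_all add: abs_square_le_1)

lemma upper_eq_lower: "z \<in> sphere 0 1 \<Longrightarrow> upper z = lower z"
  by (simp add: upper_def lower_def)

lemma continuous_upper: "continuous_on S upper"
  and continuous_lower: "continuous_on S lower"
  unfolding upper_def lower_def sphere_point_def by (intro continuous_intros)+

lemma continuous_horizontal: "continuous_on S horizontal"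
  unfolding horizontal_def Complex_eq by (intro continuous_intros)

abbreviation disc :: "complex set" where "disc \<equiv> cball 0 1"

lemma topspace_S2 [simp]: "topspace S2 = sphere 0 1"
  by (simp add: S2_def)

lemma continuous_map_horizontal:
  assumes "continuous_map X S2 \<pi>"
  shows "continuous_map X (top_of_set disc) (\<lambda>p. horizontal (\<pi> p))"
proof -
  have "continuous_map S2 (top_of_set disc) horizontal"
    using horizontal_in_disc by (auto simp: S2_def continuous_horizontal)
  from continuous_map_compose[OF assms this] show ?thesis by (simp add: o_def)
qed

lemma hemisphere_paste:
  assumes \<pi>: "continuous_map X S2 \<pi>"
    and "continuous_map (subtopology X {p \<in> topspace X. \<pi> p $ 3 \<ge> 0}) Y f"
    and "continuous_map (subtopology X {p \<in> topspace X. \<pi> p $ 3 \<le> 0}) Y g"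
    and eq: "\<And>p. p \<in> topspace X \<Longrightarrow> \<pi> p $ 3 = 0 \<Longrightarrow> f p = g p"
  shows "continuous_map X Y (\<lambda>p. if \<pi> p $ 3 \<ge> 0 then f p else g p)"
proof -
  have "continuous_map X euclideanreal (\<lambda>p. \<pi> p $ 3)"
  proof -
    have "continuous_map S2 euclideanreal (\<lambda>x. x $ 3)"
      by (auto simp: S2_def intro: continuous_intros)
    from continuous_map_compose[OF \<pi> this] show ?thesis by (simp add: o_def)
  qed
  then have "closedin X {p \<in> topspace X. \<pi> p $ 3 \<in> {0..}}" "closedin X {p \<in> topspace X. \<pi> p $ 3 \<in> {..0}}"
    by (rule closedin_continuous_map_preimage; simp)+
  then have cl: "closedin X {p \<in> topspace X. \<pi> p $ 3 \<ge> 0}" "closedin X {p \<in> topspace X. \<pi> p $ 3 \<le> 0}"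
    by simp_all
  have "continuous_map X Y (\<lambda>p. if p \<in> {p \<in> topspace X. \<pi> p $ 3 \<ge> 0} then f p else g p)"
    by (rule continuous_map_paste[OF cl _ assms(2,3)]) (use eq in auto)
  then show ?thesis
    by (rule continuous_map_eq) simp
qed

section \<open>The parametrization of the sphere by the square\<close>

lemma square_to_S2_coordinates:
  fixes s t :: real
  defines "x \<equiv> 2 * s - 1" and "y \<equiv> 2 * t - 1"
  defines "m \<equiv> (1 - x\<^sup>2) * (1 - y\<^sup>2)"
  shows "m\<^sup>2 + x\<^sup>2 + y\<^sup>2 > 0"
    "horizontal (square_to_S2 (s, t)) = of_real (2 * m / (m\<^sup>2 + x\<^sup>2 + y\<^sup>2)) * Complex x y"
    "square_to_S2 (s, t) $ 3 = (m\<^sup>2 - x\<^sup>2 - y\<^sup>2) / (m\<^sup>2 + x\<^sup>2 + y\<^sup>2)"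
proof -
  show "m\<^sup>2 + x\<^sup>2 + y\<^sup>2 > 0"
  proof (cases "x = 0 \<and> y = 0")
    case True
    then show ?thesis by (simp add: m_def)
  next
    case False
    then have "x\<^sup>2 + y\<^sup>2 > 0"
      using sum_power2_gt_zero_iff by blast
    then show ?thesis by (smt (verit) zero_le_power2)
  qed
  have *: "square_to_S2 (s, t) = (1 / (m\<^sup>2 + x\<^sup>2 + y\<^sup>2)) *\<^sub>R vector [2 * m * x, 2 * m * y, m\<^sup>2 - x\<^sup>2 - y\<^sup>2]"
    by (simp add: square_to_S2_def x_def y_def m_def Let_def)
  show "horizontal (square_to_S2 (s, t)) = of_real (2 * m / (m\<^sup>2 + x\<^sup>2 + y\<^sup>2)) * Complex x y"
    unfolding * horizontal_def by (simp add: complex_eq_iff)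
  show "square_to_S2 (s, t) $ 3 = (m\<^sup>2 - x\<^sup>2 - y\<^sup>2) / (m\<^sup>2 + x\<^sup>2 + y\<^sup>2)"
    unfolding * by simp
qed

lemma square_to_S2_in_sphere: "square_to_S2 z \<in> sphere 0 1"
proof -
  obtain s t where z: "z = (s, t)" by (cases z)
  define x y where "x = 2 * s - 1" and "y = 2 * t - 1"
  define m where "m = (1 - x\<^sup>2) * (1 - y\<^sup>2)"
  define d where "d = m\<^sup>2 + x\<^sup>2 + y\<^sup>2"
  note c = square_to_S2_coordinates[of s t, folded x_def y_def m_def, folded d_def]
  have "(cmod (horizontal (square_to_S2 (s, t))))\<^sup>2 + (square_to_S2 (s, t) $ 3)\<^sup>2 =
      (4 * m\<^sup>2 * (x\<^sup>2 + y\<^sup>2) + (m\<^sup>2 - x\<^sup>2 - y\<^sup>2)\<^sup>2) / d\<^sup>2"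
    unfolding c(2,3) norm_mult power_mult_distrib cmod_power2
    by (simp add: power_divide power_mult_distrib add_divide_distrib)
  also have "4 * m\<^sup>2 * (x\<^sup>2 + y\<^sup>2) + (m\<^sup>2 - x\<^sup>2 - y\<^sup>2)\<^sup>2 = d\<^sup>2"
    unfolding d_def by algebra
  finally have "(cmod (horizontal (square_to_S2 (s, t))))\<^sup>2 + (square_to_S2 (s, t) $ 3)\<^sup>2 = 1"
    using c(1) by simp
  then show ?thesis
    unfolding z using sphere_point_in_sphere[of "horizontal (square_to_S2 (s, t))" "square_to_S2 (s, t) $ 3"]
    by (simp add: sphere_point_horizontal)
qed

lemma continuous_square_to_S2: "continuous_on S square_to_S2"
proof -
  define d where "d z = ((1 - (2 * fst z - 1)\<^sup>2) * (1 - (2 * snd z - 1)\<^sup>2))\<^sup>2 + (2 * fst z - 1)\<^sup>2 + (2 * snd z - 1)\<^sup>2" for z :: "real \<times> real"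
  have d: "d z \<noteq> 0" for z
    using square_to_S2_coordinates(1)[of "fst z" "snd z"] by (simp add: d_def)
  have "square_to_S2 = (\<lambda>z. sphere_point (of_real (2 * ((1 - (2 * fst z - 1)\<^sup>2) * (1 - (2 * snd z - 1)\<^sup>2)) / d z) * (of_real (2 * fst z - 1) + \<i> * of_real (2 * snd z - 1)))
      ((((1 - (2 * fst z - 1)\<^sup>2) * (1 - (2 * snd z - 1)\<^sup>2))\<^sup>2 - (2 * fst z - 1)\<^sup>2 - (2 * snd z - 1)\<^sup>2) / d z))"
  proof
    fix z :: "real \<times> real"
    obtain s t where z: "z = (s, t)" by (cases z)
    show "square_to_S2 z = sphere_point (of_real (2 * ((1 - (2 * fst z - 1)\<^sup>2) * (1 - (2 * snd z - 1)\<^sup>2)) / d z) * (of_real (2 * fst z - 1) + \<i> * of_real (2 * snd z - 1)))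
      ((((1 - (2 * fst z - 1)\<^sup>2) * (1 - (2 * snd z - 1)\<^sup>2))\<^sup>2 - (2 * fst z - 1)\<^sup>2 - (2 * snd z - 1)\<^sup>2) / d z)"
      using square_to_S2_coordinates(2,3)[of s t] sphere_point_horizontal[of "square_to_S2 z"]
      unfolding z d_def fst_conv snd_conv Complex_eq by metis
  qed
  moreover have "continuous_on S (\<lambda>z. sphere_point (of_real (2 * ((1 - (2 * fst z - 1)\<^sup>2) * (1 - (2 * snd z - 1)\<^sup>2)) / d z) * (of_real (2 * fst z - 1) + \<i> * of_real (2 * snd z - 1)))
      ((((1 - (2 * fst z - 1)\<^sup>2) * (1 - (2 * snd z - 1)\<^sup>2))\<^sup>2 - (2 * fst z - 1)\<^sup>2 - (2 * snd z - 1)\<^sup>2) / d z))"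
    using d unfolding sphere_point_def d_def by (intro continuous_intros) auto
  ultimately show ?thesis by (rule ssubst[where P = "continuous_on S"])
qed

lemma continuous_map_square_to_S2: "continuous_map square S2 square_to_S2"
  using square_to_S2_in_sphere by (auto simp: square_def S2_def continuous_square_to_S2)

lemma square_to_S2_boundary:
  assumes "z \<in> square_boundary" shows "square_to_S2 z = sphere_point 0 (-1)"
proof -
  obtain s t where z: "z = (s, t)" by (cases z)
  define x y where "x = 2 * s - 1" and "y = 2 * t - 1"
  have "x\<^sup>2 = 1 \<or> y\<^sup>2 = 1"
    using square_boundary_cases[OF assms] by (auto simp: z x_def y_def)
  then have m: "(1 - x\<^sup>2) * (1 - y\<^sup>2) = 0" by auto
  note c = square_to_S2_coordinates[of s t, folded x_def y_def, unfolded m]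
  have "horizontal (square_to_S2 z) = 0" "square_to_S2 z $ 3 = -1"
    unfolding z c(2,3) using c(1) by (auto simp: divide_eq_minus_1_iff)
  then show ?thesis
    by (metis sphere_point_horizontal)
qed

text \<open>The direction seen from the centre of the square. It is used only over the southern
  hemisphere, where the centre does not occur; it is the horizontal part on the equator and
  \<open>square_to_disc\<close> on the boundary.\<close>

definition square_direction :: "real \<times> real \<Rightarrow> complex" where
  "square_direction z = sgn (Complex (2 * fst z - 1) (2 * snd z - 1))"

lemma square_direction_boundary:
  assumes "z \<in> square_boundary" shows "square_direction z = square_to_disc z"
proof -
  obtain s t where z: "z = (s, t)" by (cases z)
  define x y where "x = 2 * s - 1" and "y = 2 * t - 1"
  have "x\<^sup>2 = 1 \<or> y\<^sup>2 = 1"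
    using square_boundary_cases[OF assms] by (auto simp: z x_def y_def)
  then have "cmod (Complex x y) = sqrt (1 + x\<^sup>2 * y\<^sup>2)"
    by (auto simp: cmod_def add.commute)
  then show ?thesis
    by (simp add: square_direction_def square_to_disc_def z sgn_eq flip: x_def y_def)
qed

lemma square_lower_nonzero:
  assumes "square_to_S2 z $ 3 \<le> 0"
  shows "Complex (2 * fst z - 1) (2 * snd z - 1) \<noteq> 0"
proof
  assume a: "Complex (2 * fst z - 1) (2 * snd z - 1) = 0"
  obtain s t where z: "z = (s, t)" by (cases z)
  have "2 * s - 1 = 0" "2 * t - 1 = 0" using a z by (auto simp: complex_eq_iff)
  then show False
    using assms square_to_S2_coordinates(3)[of s t] unfolding z by simp
qed

lemma square_direction_equator:
  assumes z: "z \<in> unit_square" "square_to_S2 z $ 3 = 0"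
  shows "square_direction z = horizontal (square_to_S2 z)" "square_direction z \<in> sphere 0 1"
proof -
  obtain s t where st: "z = (s, t)" by (cases z)
  define x y where "x = 2 * s - 1" and "y = 2 * t - 1"
  define m where "m = (1 - x\<^sup>2) * (1 - y\<^sup>2)"
  note c = square_to_S2_coordinates[of s t, folded x_def y_def m_def]
  have dir: "square_direction z = sgn (Complex x y)"
    by (simp add: square_direction_def st x_def y_def)
  have nz: "Complex x y \<noteq> 0"
    using square_lower_nonzero[of z] z(2) by (simp add: st x_def y_def)
  show "square_direction z \<in> sphere 0 1"
    using nz by (simp add: square_direction_def st x_def y_def norm_sgn)
  have "\<bar>x\<bar> \<le> 1" "\<bar>y\<bar> \<le> 1" using z(1) by (auto simp: st x_def y_def)
  then have "m \<ge> 0" by (simp add: m_def abs_square_le_1)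
  have e: "m\<^sup>2 = x\<^sup>2 + y\<^sup>2"
    using z(2) c(1) unfolding st c(3) by simp
  then have cm: "cmod (Complex x y) = m"
    using \<open>m \<ge> 0\<close> by (simp add: cmod_def flip: e)
  have "m \<noteq> 0" using cm nz by auto
  have "m\<^sup>2 + x\<^sup>2 + y\<^sup>2 = 2 * m\<^sup>2"
    using e by simp
  then have "2 * m / (m\<^sup>2 + x\<^sup>2 + y\<^sup>2) = 2 * m / (2 * m\<^sup>2)"
    by (rule arg_cong)
  also have "\<dots> = 1 / m"
    using \<open>m \<noteq> 0\<close> by (simp add: power2_eq_square)
  finally have "horizontal (square_to_S2 z) = of_real (1 / m) * Complex x y"
    unfolding st c(2) by simp
  then show "square_direction z = horizontal (square_to_S2 z)"
    using dir by (simp add: sgn_eq cm divide_inverse mult.commute)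
qed

context abelian_topological_group
begin

context
  fixes \<xi> :: "('e, real^3, 'g, 'z) pbundle_scheme"
  assumes pb: "principal_bundle G \<xi>"
begin

text \<open>Over the southern hemisphere \<open>\<sigma>S\<close> is translated by \<open>t\<close>
  of the direction from the centre. It fits \<open>\<sigma>N\<close> on the equator, and on the
  boundary, which collapses to the south pole, it is \<open>\<sigma>S 0\<close> translated by
  \<open>t\<close>. So the transition function is a clutching map. The frame \<open>R\<close> allows
  the poles to be put on any axis.\<close>

lemma clutching_hemispheres:
  assumes N: "lifts \<xi> (top_of_set disc) (\<lambda>z. R *v upper z) \<sigma>N"
    and S: "lifts \<xi> (top_of_set disc) (\<lambda>z. R *v lower z) \<sigma>S"
    and t: "continuous_map (top_of_set (sphere 0 1)) (gtop G) t"
    and NS: "\<And>z. z \<in> sphere 0 1 \<Longrightarrow> \<sigma>N z = ract \<xi> (\<sigma>S z) (t z)"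
  shows "clutching G \<xi> (\<lambda>z. R *v square_to_S2 z) (\<lambda>z. t (square_to_disc z))"
proof -
  define F where "F z = (if square_to_S2 z $ 3 \<ge> 0 then \<sigma>N (horizontal (square_to_S2 z))
    else ract \<xi> (\<sigma>S (horizontal (square_to_S2 z))) (t (square_direction z)))" for z
  have ch: "continuous_map square (top_of_set disc) (\<lambda>z. horizontal (square_to_S2 z))"
    by (rule continuous_map_horizontal[OF continuous_map_square_to_S2])
  have cN: "continuous_map square (total_space \<xi>) (\<lambda>z. \<sigma>N (horizontal (square_to_S2 z)))"
    using continuous_map_compose[OF ch lifts_continuous[OF N]] by (simp add: o_def)
  have cS: "continuous_map square (total_space \<xi>) (\<lambda>z. \<sigma>S (horizontal (square_to_S2 z)))"
    using continuous_map_compose[OF ch lifts_continuous[OF S]] by (simp add: o_def)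
  define B where "B = {z \<in> unit_square. square_to_S2 z $ 3 \<le> 0}"
  have dir_sphere: "square_direction z \<in> sphere 0 1" if "square_to_S2 z $ 3 \<le> 0" for z
    using square_lower_nonzero[OF that] by (simp add: square_direction_def norm_sgn)
  have cd: "continuous_on B square_direction"
    unfolding square_direction_def Complex_eq
    by (intro continuous_intros) (use square_lower_nonzero in \<open>auto simp: B_def Complex_eq\<close>)
  have ct: "continuous_map (top_of_set B) (gtop G) (\<lambda>z. t (square_direction z))"
    by (rule continuous_map_compose_top_of_set[OF t cd]) (use dir_sphere in \<open>auto simp: B_def\<close>)
  have B: "subtopology square {z \<in> topspace square. square_to_S2 z $ 3 \<le> 0} = top_of_set B"
    by (auto simp: square_def subtopology_subtopology B_def intro!: arg_cong[where f = top_of_set])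
  have "continuous_map square (total_space \<xi>) F"
    unfolding F_def
  proof (rule hemisphere_paste[OF continuous_map_square_to_S2])
    show "continuous_map (subtopology square {z \<in> topspace square. square_to_S2 z $ 3 \<ge> 0}) (total_space \<xi>) (\<lambda>z. \<sigma>N (horizontal (square_to_S2 z)))"
      by (rule continuous_map_from_subtopology[OF cN])
    show "continuous_map (subtopology square {z \<in> topspace square. square_to_S2 z $ 3 \<le> 0}) (total_space \<xi>)
       (\<lambda>z. ract \<xi> (\<sigma>S (horizontal (square_to_S2 z))) (t (square_direction z)))"
      by (rule continuous_ract[OF pb continuous_map_from_subtopology[OF cS]]) (simp only: B ct)
    fix z assume z: "z \<in> topspace square" "square_to_S2 z $ 3 = 0"
    have "z \<in> unit_square" using z(1) by simp
    note d = square_direction_equator[OF this z(2)]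
    show "\<sigma>N (horizontal (square_to_S2 z)) = ract \<xi> (\<sigma>S (horizontal (square_to_S2 z))) (t (square_direction z))"
      using NS[OF d(2)] unfolding d(1) .
  qed
  moreover have "bproj \<xi> (F z) = R *v square_to_S2 z" if "z \<in> unit_square" for z
  proof (cases "square_to_S2 z $ 3 \<ge> 0")
    case True
    then show ?thesis
      unfolding F_def
      using lifts_bproj[OF N, of "horizontal (square_to_S2 z)"] horizontal_in_disc[OF square_to_S2_in_sphere]
        upper_horizontal[OF square_to_S2_in_sphere, of z] by simp
  next
    case False
    have "t (square_direction z) \<in> carrier G"
      using continuous_carrier[OF t] dir_sphere[of z] False by simp
    then show ?thesis
      unfolding F_def
      using False lifts_bproj[OF S, of "horizontal (square_to_S2 z)"] lifts_closed[OF S, of "horizontal (square_to_S2 z)"]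
        horizontal_in_disc[OF square_to_S2_in_sphere, of z] bproj_ract[OF pb]
        lower_horizontal[OF square_to_S2_in_sphere, of z] by simp
  qed
  ultimately have "lifts \<xi> square (\<lambda>z. R *v square_to_S2 z) F"
    by (simp add: lifts_def)
  moreover have "F z = ract \<xi> (\<sigma>S 0) (t (square_to_disc z))" if "z \<in> square_boundary" for z
    using square_to_S2_boundary[OF that] square_direction_boundary[OF that] by (simp add: F_def)
  moreover have "\<sigma>S 0 \<in> topspace (total_space \<xi>)"
    using lifts_closed[OF S, of 0] by simp
  moreover have "continuous_map (top_of_set square_boundary) (gtop G) (\<lambda>z. t (square_to_disc z))"
    by (rule continuous_map_compose_top_of_set[OF t continuous_square_to_disc]) (use square_to_disc_boundary in blast)
  ultimately show ?thesis
    unfolding clutching_def by blast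
qed

lemma disc_lift_exists:
  assumes "continuous_map (top_of_set disc) (base_space \<xi>) f"
  shows "\<exists>\<sigma>. lifts \<xi> (top_of_set disc) f \<sigma>"
  by (rule lift_exists_starlike[OF pb _ _ _ assms, of 0]) (auto simp: mult_le_one)

end

end

section \<open>Clutching maps determine bundles over the sphere and their Chern classes\<close>

context abelian_topological_group
begin

text \<open>Lifts of \<open>g\<close> over the hemispheres are local sections of the pullback.
  Sending \<open>\<tau>\<close> to \<open>\<sigma>\<close> gives an isomorphism over each
  hemisphere, and the two agree over the equator because both pairs of sections have the same
  transition \<open>t\<close>.\<close>

lemma isomorphism_of_transition:
  fixes \<xi> :: "('f, real^3, 'g, 'w) pbundle_scheme" and \<zeta> :: "('e, 'b, 'g, 'z) pbundle_scheme"
  assumes \<xi>: "principal_bundle G \<xi>" "base_space \<xi> = S2" and \<zeta>: "principal_bundle G \<zeta>"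
    and g: "continuous_map S2 (base_space \<zeta>) g"
    and \<sigma>: "lifts \<xi> (top_of_set disc) upper \<sigma>N" "lifts \<xi> (top_of_set disc) lower \<sigma>S"
    and \<tau>: "lifts \<zeta> (top_of_set disc) (\<lambda>z. g (upper z)) \<tau>N" "lifts \<zeta> (top_of_set disc) (\<lambda>z. g (lower z)) \<tau>S"
    and eq: "\<And>z. z \<in> sphere 0 1 \<Longrightarrow> \<exists>t\<in>carrier G. \<sigma>N z = ract \<xi> (\<sigma>S z) t \<and> \<tau>N z = ract \<zeta> (\<tau>S z) t"
  shows "bundle_iso G (pullback_bundle (base_space \<xi>) g \<zeta>) \<xi>"
proof -
  let ?P = "pullback_bundle (base_space \<xi>) g \<zeta>"
  define T where "T = total_space ?P"
  have T: "T = subtopology (prod_topology S2 (total_space \<zeta>)) {(x, e). g x = bproj \<zeta> e}"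
    by (simp add: T_def pullback_bundle_def \<xi>)
  have topT: "p \<in> topspace T \<longleftrightarrow> fst p \<in> sphere 0 1 \<and> snd p \<in> topspace (total_space \<zeta>) \<and> g (fst p) = bproj \<zeta> (snd p)" for p
    by (cases p) (auto simp: T)
  define \<sigma> where "\<sigma> x = (if x $ 3 \<ge> 0 then \<sigma>N (horizontal x) else \<sigma>S (horizontal x))" for x :: "real^3"
  define \<tau> where "\<tau> x = (if x $ 3 \<ge> 0 then \<tau>N (horizontal x) else \<tau>S (horizontal x))" for x :: "real^3"
  have up: "\<sigma>N (horizontal x) \<in> topspace (total_space \<xi>)" "\<tau>N (horizontal x) \<in> topspace (total_space \<zeta>)"
      "\<sigma>S (horizontal x) \<in> topspace (total_space \<xi>)" "\<tau>S (horizontal x) \<in> topspace (total_space \<zeta>)"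
    if "x \<in> sphere 0 1" for x
    using lifts_closed[OF \<sigma>(1)] lifts_closed[OF \<sigma>(2)] lifts_closed[OF \<tau>(1)] lifts_closed[OF \<tau>(2)] horizontal_in_disc[OF that]
    by auto
  have pN: "bproj \<xi> (\<sigma>N (horizontal x)) = x" "bproj \<zeta> (\<tau>N (horizontal x)) = g x" if "x \<in> sphere 0 1" "x $ 3 \<ge> 0" for x
    using lifts_bproj[OF \<sigma>(1), of "horizontal x"] lifts_bproj[OF \<tau>(1), of "horizontal x"] horizontal_in_disc[OF that(1)] upper_horizontal[OF that]
    by auto
  have pS: "bproj \<xi> (\<sigma>S (horizontal x)) = x" "bproj \<zeta> (\<tau>S (horizontal x)) = g x" if "x \<in> sphere 0 1" "x $ 3 \<le> 0" for x
    using lifts_bproj[OF \<sigma>(2), of "horizontal x"] lifts_bproj[OF \<tau>(2), of "horizontal x"] horizontal_in_disc[OF that(1)] lower_horizontal[OF that]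
    by auto
  have st: "\<sigma> x \<in> topspace (total_space \<xi>)" "\<tau> x \<in> topspace (total_space \<zeta>)" "bproj \<xi> (\<sigma> x) = x" "bproj \<zeta> (\<tau> x) = g x"
    if "x \<in> sphere 0 1" for x
    unfolding \<sigma>_def \<tau>_def using up[OF that] pN[OF that] pS[OF that] by auto
  \<comment> \<open>The reference point is exchanged and the group coordinate kept. \<open>K\<close>
    does the same backwards and, paired with the projection, is the inverse map into the
    pullback.\<close>
  define \<Theta> where "\<Theta> p = ract \<xi> (\<sigma> (fst p)) (translation G \<zeta> (\<tau> (fst p)) (snd p))" for p
  define K where "K y = ract \<zeta> (\<tau> (bproj \<xi> y)) (translation G \<xi> (\<sigma> (bproj \<xi> y)) y)" for y
  have By: "bproj \<xi> y \<in> sphere 0 1" if "y \<in> topspace (total_space \<xi>)" for y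
    using bproj_closed[OF \<xi>(1) that] \<xi>(2) by simp
  have tr\<zeta>: "translation G \<zeta> (\<tau> (fst p)) (snd p) \<in> carrier G" "ract \<zeta> (\<tau> (fst p)) (translation G \<zeta> (\<tau> (fst p)) (snd p)) = snd p"
    if "p \<in> topspace T" for p
    using that translation_closed[OF \<zeta>, of "\<tau> (fst p)" "snd p"] ract_translation[OF \<zeta>, of "\<tau> (fst p)" "snd p"] st[of "fst p"]
    unfolding topT by auto
  have tr\<xi>: "translation G \<xi> (\<sigma> (bproj \<xi> y)) y \<in> carrier G" "ract \<xi> (\<sigma> (bproj \<xi> y)) (translation G \<xi> (\<sigma> (bproj \<xi> y)) y) = y"
    if "y \<in> topspace (total_space \<xi>)" for y
    using that translation_closed[OF \<xi>(1), of "\<sigma> (bproj \<xi> y)" y] ract_translation[OF \<xi>(1), of "\<sigma> (bproj \<xi> y)" y] st[OF By[OF that]]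
    by auto
  \<comment> \<open>Passing from north to south multiplies the group coordinate by \<open>t\<close>
    and the reference point by its inverse, with the same \<open>t\<close> in both bundles.\<close>
  have change: "ract \<xi> (\<sigma>N z) (translation G \<zeta> (\<tau>N z) e) = ract \<xi> (\<sigma>S z) (translation G \<zeta> (\<tau>S z) e)"
     "ract \<zeta> (\<tau>N z) (translation G \<xi> (\<sigma>N z) y) = ract \<zeta> (\<tau>S z) (translation G \<xi> (\<sigma>S z) y)"
    if z: "z \<in> sphere 0 1" and e: "e \<in> topspace (total_space \<zeta>)" "bproj \<zeta> e = bproj \<zeta> (\<tau>N z)"
      and y: "y \<in> topspace (total_space \<xi>)" "bproj \<xi> y = bproj \<xi> (\<sigma>N z)" for z e y
  proof -
    obtain t where t: "t \<in> carrier G" "\<sigma>N z = ract \<xi> (\<sigma>S z) t" "\<tau>N z = ract \<zeta> (\<tau>S z) t"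
      using eq[OF z] by blast
    have E: "\<sigma>S z \<in> topspace (total_space \<xi>)" "\<tau>S z \<in> topspace (total_space \<zeta>)" "\<sigma>N z \<in> topspace (total_space \<xi>)" "\<tau>N z \<in> topspace (total_space \<zeta>)"
      using lifts_closed[OF \<sigma>(1)] lifts_closed[OF \<sigma>(2)] lifts_closed[OF \<tau>(1)] lifts_closed[OF \<tau>(2)] z by auto
    obtain u where u: "u \<in> carrier G" "e = ract \<zeta> (\<tau>N z) u"
      using ract_transitive[OF \<zeta> E(4) e(1)] e(2) by auto
    obtain v where v: "v \<in> carrier G" "y = ract \<xi> (\<sigma>N z) v"
      using ract_transitive[OF \<xi>(1) E(3) y(1)] y(2) by auto
    have "e = ract \<zeta> (\<tau>S z) (t \<otimes> u)" "y = ract \<xi> (\<sigma>S z) (t \<otimes> v)"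
      using u v t ract_mult[OF \<zeta> E(2)] ract_mult[OF \<xi>(1) E(1)] by auto
    then have tr: "translation G \<zeta> (\<tau>S z) e = t \<otimes> u" "translation G \<xi> (\<sigma>S z) y = t \<otimes> v"
      using translation_ract[OF \<zeta> E(2)] translation_ract[OF \<xi>(1) E(1)] t u v by auto
    have trN: "translation G \<zeta> (\<tau>N z) e = u" "translation G \<xi> (\<sigma>N z) y = v"
      using translation_ract[OF \<zeta> E(4)] translation_ract[OF \<xi>(1) E(3)] u v by auto
    show "ract \<xi> (\<sigma>N z) (translation G \<zeta> (\<tau>N z) e) = ract \<xi> (\<sigma>S z) (translation G \<zeta> (\<tau>S z) e)"
      "ract \<zeta> (\<tau>N z) (translation G \<xi> (\<sigma>N z) y) = ract \<zeta> (\<tau>S z) (translation G \<xi> (\<sigma>S z) y)"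
      unfolding tr trN
      using ract_mult[OF \<zeta> E(2) t(1) v(1)] ract_mult[OF \<xi>(1) E(1) t(1) u(1)] t(2,3) by simp_all
  qed
  have eqr: "horizontal x \<in> sphere 0 1" if "x \<in> sphere 0 1" "x $ 3 = 0" for x
    using horizontal_height[OF that(1)] that(2) power2_eq_iff_nonneg[of "cmod (horizontal x)" 1] by simp
  have \<pi>T: "continuous_map T S2 fst" "continuous_map T (total_space \<zeta>) snd"
    unfolding T by (auto intro: continuous_map_from_subtopology simp: continuous_map_fst continuous_map_snd)
  have \<pi>E: "continuous_map (total_space \<xi>) S2 (bproj \<xi>)"
    using continuous_bproj[OF \<xi>(1)] \<xi>(2) by simp
  have comp: "continuous_map X Y (\<lambda>p. f (horizontal (\<pi> p)))" if "continuous_map X S2 \<pi>" "continuous_map (top_of_set disc) Y f"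
    for X Y \<pi> f
    using continuous_map_compose[OF continuous_map_horizontal[OF that(1)] that(2)] by (simp add: o_def)
  have c\<Theta>: "continuous_map T (total_space \<xi>) \<Theta>"
  proof -
    have "continuous_map T (total_space \<xi>) (\<lambda>p. if fst p $ 3 \<ge> 0
        then ract \<xi> (\<sigma>N (horizontal (fst p))) (translation G \<zeta> (\<tau>N (horizontal (fst p))) (snd p))
        else ract \<xi> (\<sigma>S (horizontal (fst p))) (translation G \<zeta> (\<tau>S (horizontal (fst p))) (snd p)))"
    proof (rule hemisphere_paste[OF \<pi>T(1)])
      show "continuous_map (subtopology T {p \<in> topspace T. fst p $ 3 \<ge> 0}) (total_space \<xi>)
         (\<lambda>p. ract \<xi> (\<sigma>N (horizontal (fst p))) (translation G \<zeta> (\<tau>N (horizontal (fst p))) (snd p)))"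
        by (intro continuous_ract[OF \<xi>(1)] continuous_translation[OF \<zeta>] continuous_map_from_subtopology
              comp[OF \<pi>T(1)] \<pi>T(2) lifts_continuous[OF \<sigma>(1)] lifts_continuous[OF \<tau>(1)])
          (use pN topT in auto)
      show "continuous_map (subtopology T {p \<in> topspace T. fst p $ 3 \<le> 0}) (total_space \<xi>)
         (\<lambda>p. ract \<xi> (\<sigma>S (horizontal (fst p))) (translation G \<zeta> (\<tau>S (horizontal (fst p))) (snd p)))"
        by (intro continuous_ract[OF \<xi>(1)] continuous_translation[OF \<zeta>] continuous_map_from_subtopology
              comp[OF \<pi>T(1)] \<pi>T(2) lifts_continuous[OF \<sigma>(2)] lifts_continuous[OF \<tau>(2)])
          (use pS topT in auto)
      fix p assume p: "p \<in> topspace T" "fst p $ 3 = 0"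
      then have x: "fst p \<in> sphere 0 1" "fst p $ 3 \<ge> 0" using topT by auto
      show "ract \<xi> (\<sigma>N (horizontal (fst p))) (translation G \<zeta> (\<tau>N (horizontal (fst p))) (snd p)) =
        ract \<xi> (\<sigma>S (horizontal (fst p))) (translation G \<zeta> (\<tau>S (horizontal (fst p))) (snd p))"
        by (rule change(1)[OF eqr[OF x(1) p(2)] _ _ up(1)[OF x(1)]]) (use p pN[OF x] topT in auto)
    qed
    then show ?thesis
      by (rule continuous_map_eq) (simp add: \<Theta>_def \<sigma>_def \<tau>_def)
  qed
  have cK: "continuous_map (total_space \<xi>) (total_space \<zeta>) K"
  proof -
    have "continuous_map (total_space \<xi>) (total_space \<zeta>) (\<lambda>y. if bproj \<xi> y $ 3 \<ge> 0
        then ract \<zeta> (\<tau>N (horizontal (bproj \<xi> y))) (translation G \<xi> (\<sigma>N (horizontal (bproj \<xi> y))) y)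
        else ract \<zeta> (\<tau>S (horizontal (bproj \<xi> y))) (translation G \<xi> (\<sigma>S (horizontal (bproj \<xi> y))) y))"
    proof (rule hemisphere_paste[OF \<pi>E])
      have id: "continuous_map (total_space \<xi>) (total_space \<xi>) (\<lambda>y. y)" by simp
      show "continuous_map (subtopology (total_space \<xi>) {p \<in> topspace (total_space \<xi>). bproj \<xi> p $ 3 \<ge> 0}) (total_space \<zeta>)
         (\<lambda>y. ract \<zeta> (\<tau>N (horizontal (bproj \<xi> y))) (translation G \<xi> (\<sigma>N (horizontal (bproj \<xi> y))) y))"
        by (intro continuous_ract[OF \<zeta>] continuous_translation[OF \<xi>(1)] continuous_map_from_subtopology
              comp[OF \<pi>E] id lifts_continuous[OF \<sigma>(1)] lifts_continuous[OF \<tau>(1)])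
          (use pN By in auto)
      show "continuous_map (subtopology (total_space \<xi>) {p \<in> topspace (total_space \<xi>). bproj \<xi> p $ 3 \<le> 0}) (total_space \<zeta>)
         (\<lambda>y. ract \<zeta> (\<tau>S (horizontal (bproj \<xi> y))) (translation G \<xi> (\<sigma>S (horizontal (bproj \<xi> y))) y))"
        by (intro continuous_ract[OF \<zeta>] continuous_translation[OF \<xi>(1)] continuous_map_from_subtopology
              comp[OF \<pi>E] id lifts_continuous[OF \<sigma>(2)] lifts_continuous[OF \<tau>(2)])
          (use pS By in auto)
      fix y assume y: "y \<in> topspace (total_space \<xi>)" "bproj \<xi> y $ 3 = 0"
      then have x: "bproj \<xi> y \<in> sphere 0 1" "bproj \<xi> y $ 3 \<ge> 0" using By by auto
      show "ract \<zeta> (\<tau>N (horizontal (bproj \<xi> y))) (translation G \<xi> (\<sigma>N (horizontal (bproj \<xi> y))) y) =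
        ract \<zeta> (\<tau>S (horizontal (bproj \<xi> y))) (translation G \<xi> (\<sigma>S (horizontal (bproj \<xi> y))) y)"
        by (rule change(2)[OF eqr[OF x(1) y(2)] up(2)[OF x(1)] refl y(1)]) (use pN[OF x] in simp)
    qed
    then show ?thesis
      by (rule continuous_map_eq) (simp add: K_def \<sigma>_def \<tau>_def)
  qed
  have bK: "bproj \<zeta> (K y) = g (bproj \<xi> y)" "K y \<in> topspace (total_space \<zeta>)" if "y \<in> topspace (total_space \<xi>)" for y
    unfolding K_def using bproj_ract[OF \<zeta> st(2)[OF By[OF that]] tr\<xi>(1)[OF that]] st(4)[OF By[OF that]]
      ract_closed[OF \<zeta> st(2)[OF By[OF that]] tr\<xi>(1)[OF that]] by auto
  have b\<Theta>: "bproj \<xi> (\<Theta> p) = fst p" if "p \<in> topspace T" for p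
    unfolding \<Theta>_def using bproj_ract[OF \<xi>(1) st(1) tr\<zeta>(1)[OF that]] st(3) topT that by simp
  have "homeomorphic_maps T (total_space \<xi>) \<Theta> (\<lambda>y. (bproj \<xi> y, K y))"
    unfolding homeomorphic_maps_def
  proof (intro conjI ballI)
    show "continuous_map T (total_space \<xi>) \<Theta>" by (rule c\<Theta>)
    have "continuous_map (total_space \<xi>) (prod_topology S2 (total_space \<zeta>)) (\<lambda>y. (bproj \<xi> y, K y))"
      using \<pi>E cK by (intro continuous_map_pairedI)
    then show "continuous_map (total_space \<xi>) T (\<lambda>y. (bproj \<xi> y, K y))"
      unfolding T continuous_map_in_subtopology using bK by auto
    show "(bproj \<xi> (\<Theta> p), K (\<Theta> p)) = p" if p: "p \<in> topspace T" for p
    proof -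
      have "K (\<Theta> p) = ract \<zeta> (\<tau> (fst p)) (translation G \<xi> (\<sigma> (fst p)) (\<Theta> p))"
        unfolding K_def b\<Theta>[OF p] ..
      also have "translation G \<xi> (\<sigma> (fst p)) (\<Theta> p) = translation G \<zeta> (\<tau> (fst p)) (snd p)"
        unfolding \<Theta>_def by (rule translation_ract[OF \<xi>(1) st(1) tr\<zeta>(1)[OF p]]) (use p topT in auto)
      finally show ?thesis
        using b\<Theta>[OF p] tr\<zeta>(2)[OF p] by simp
    qed
    show "\<Theta> (bproj \<xi> y, K y) = y" if y: "y \<in> topspace (total_space \<xi>)" for y
    proof -
      have "translation G \<zeta> (\<tau> (bproj \<xi> y)) (K y) = translation G \<xi> (\<sigma> (bproj \<xi> y)) y"
        unfolding K_def by (rule translation_ract[OF \<zeta> st(2)[OF By[OF y]] tr\<xi>(1)[OF y]])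
      then show ?thesis
        unfolding \<Theta>_def using tr\<xi>(2)[OF y] by simp
    qed
  qed
  then have hom: "homeomorphic_map (total_space ?P) (total_space \<xi>) \<Theta>"
    using homeomorphic_map_maps T_def by blast
  have "\<Theta> (ract ?P p h) = ract \<xi> (\<Theta> p) h" if p: "p \<in> topspace T" and h: "h \<in> carrier G" for p h
  proof -
    have r: "ract ?P p h = (fst p, ract \<zeta> (snd p) h)"
      by (cases p) (simp add: pullback_bundle_def)
    have s: "fst p \<in> sphere 0 1" using p topT by blast
    have "ract \<zeta> (snd p) h = ract \<zeta> (\<tau> (fst p)) (translation G \<zeta> (\<tau> (fst p)) (snd p) \<otimes> h)"
      using ract_mult[OF \<zeta> st(2)[OF s] tr\<zeta>(1)[OF p] h] tr\<zeta>(2)[OF p] by simp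
    then have "translation G \<zeta> (\<tau> (fst p)) (ract \<zeta> (snd p) h) = translation G \<zeta> (\<tau> (fst p)) (snd p) \<otimes> h"
      using translation_ract[OF \<zeta> st(2)[OF s]] tr\<zeta>(1)[OF p] h by simp
    then show ?thesis
      unfolding r \<Theta>_def using ract_mult[OF \<xi>(1) st(1)[OF s] tr\<zeta>(1)[OF p] h] by simp
  qed
  moreover have "bproj ?P p = fst p" for p
    by (simp add: pullback_bundle_def)
  moreover have "base_space ?P = base_space \<xi>"
    by (simp add: pullback_bundle_def)
  ultimately show ?thesis
    unfolding bundle_iso_def using hom b\<Theta> by (intro conjI exI[of _ \<Theta>]) (simp_all flip: T_def)
qed

text \<open>A lift of \<open>g\<close> along the square, paired with the point of the sphere, is a
  lift to the pullback; the isomorphism carries it to \<open>\<xi>\<close> without changing its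
  displacement.\<close>

lemma clutching_of_classifying_map:
  fixes \<xi> :: "('f, real^3, 'g, 'w) pbundle_scheme" and \<zeta> :: "('e, 'b, 'g, 'z) pbundle_scheme"
  assumes \<zeta>: "principal_bundle G \<zeta>" and "classifying_map G \<zeta> \<xi> g" "base_space \<xi> = S2"
    and w: "clutching G \<zeta> (\<lambda>z. g (square_to_S2 z)) w"
  shows "clutching G \<xi> square_to_S2 w"
proof -
  let ?P = "pullback_bundle (base_space \<xi>) g \<zeta>"
  obtain \<Theta> where hom: "homeomorphic_map (total_space ?P) (total_space \<xi>) \<Theta>"
    and \<Theta>: "\<forall>e\<in>topspace (total_space ?P). bproj \<xi> (\<Theta> e) = bproj ?P e \<and>
           (\<forall>g\<in>carrier G. \<Theta> (ract ?P e g) = ract \<xi> (\<Theta> e) g)"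
    using assms(2) unfolding classifying_map_def bundle_iso_def by blast
  have T: "total_space ?P = subtopology (prod_topology S2 (total_space \<zeta>)) {(x, e). g x = bproj \<zeta> e}"
    by (simp add: pullback_bundle_def assms(3))
  obtain F e where F: "lifts \<zeta> square (\<lambda>z. g (square_to_S2 z)) F" "e \<in> topspace (total_space \<zeta>)"
    "\<forall>z\<in>square_boundary. F z = ract \<zeta> e (w z)"
    using w by (auto simp: clutching_def)
  note cw = clutching_continuous[OF w]
  define c where "c = sphere_point 0 (-1)"
  have "continuous_map square (prod_topology S2 (total_space \<zeta>)) (\<lambda>z. (square_to_S2 z, F z))"
    using continuous_map_square_to_S2 lifts_continuous[OF F(1)] by (intro continuous_map_pairedI)
  then have cFT: "continuous_map square (total_space ?P) (\<lambda>z. (square_to_S2 z, F z))"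
    unfolding T continuous_map_in_subtopology using lifts_bproj[OF F(1)] by auto
  have inT: "(square_to_S2 z, F z) \<in> topspace (total_space ?P)" if "z \<in> unit_square" for z
    using continuous_map_image_subset_topspace[OF cFT] that by (auto simp: image_subset_iff)
  have "bproj \<zeta> e = g c"
    using bproj_ract[OF \<zeta> F(2) boundary_carrier[OF cw corner_in_boundary]] F(3) lifts_bproj[OF F(1), of "(0, 0)"]
      square_to_S2_boundary[OF corner_in_boundary] by (simp add: c_def)
  moreover have "c \<in> sphere 0 1"
    unfolding c_def using sphere_point_in_sphere[of 0 "-1"] by simp
  ultimately have ce: "(c, e) \<in> topspace (total_space ?P)"
    using F(2) by (simp add: T)
  have "continuous_map square (total_space \<xi>) (\<lambda>z. \<Theta> (square_to_S2 z, F z))"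
    using continuous_map_compose[OF cFT homeomorphic_imp_continuous_map[OF hom]] by (simp add: o_def)
  moreover have "bproj \<xi> (\<Theta> (square_to_S2 z, F z)) = square_to_S2 z" if "z \<in> unit_square" for z
    using \<Theta> inT[OF that] by (simp add: pullback_bundle_def)
  ultimately have "lifts \<xi> square square_to_S2 (\<lambda>z. \<Theta> (square_to_S2 z, F z))"
    by (simp add: lifts_def)
  moreover have "\<Theta> (square_to_S2 z, F z) = ract \<xi> (\<Theta> (c, e)) (w z)" if z: "z \<in> square_boundary" for z
  proof -
    have "(square_to_S2 z, F z) = ract ?P (c, e) (w z)"
      using square_to_S2_boundary[OF z] F(3) z by (simp add: pullback_bundle_def c_def)
    then show ?thesis
      using \<Theta> ce boundary_carrier[OF cw z] by simp
  qed
  moreover have "\<Theta> (c, e) \<in> topspace (total_space \<xi>)"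
    using continuous_map_image_subset_topspace[OF homeomorphic_imp_continuous_map[OF hom]] ce by auto
  ultimately show ?thesis
    unfolding clutching_def using cw by blast
qed

text \<open>The classifying map is constant on the northern hemisphere.\<close>

lemma classifying_map_exists:
  fixes \<xi> :: "('f, real^3, 'g, 'w) pbundle_scheme" and \<zeta> :: "('e, 'b, 'g, 'z) pbundle_scheme"
  assumes \<xi>: "principal_bundle G \<xi>" "base_space \<xi> = S2" and \<zeta>: "universal_bundle G \<zeta>"
    and b: "b \<in> topspace (base_space \<zeta>)"
  shows "\<exists>g. classifying_map G \<zeta> \<xi> g \<and> g (sphere_point 0 (-1)) = b"
proof -
  note pb = universal_principal[OF \<zeta>]
  have "continuous_map (top_of_set disc) (base_space \<xi>) upper" "continuous_map (top_of_set disc) (base_space \<xi>) lower"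
    using upper_in_sphere lower_in_sphere by (auto simp: \<xi>(2) S2_def continuous_upper continuous_lower)
  then obtain \<sigma>N \<sigma>S where \<sigma>: "lifts \<xi> (top_of_set disc) upper \<sigma>N" "lifts \<xi> (top_of_set disc) lower \<sigma>S"
    using disc_lift_exists[OF \<xi>(1)] by meson
  define t where "t z = translation G \<xi> (\<sigma>S z) (\<sigma>N z)" for z
  have sph: "lifts \<xi> (top_of_set (sphere 0 1)) upper \<sigma>N" "lifts \<xi> (top_of_set (sphere 0 1)) upper \<sigma>S"
    using lifts_compose[OF \<sigma>(1), of "sphere 0 1" "\<lambda>z. z"] lifts_compose[OF \<sigma>(2), of "sphere 0 1" "\<lambda>z. z"] upper_eq_lower
    by (auto simp: lifts_def)
  have ct: "continuous_map (top_of_set (sphere 0 1)) (gtop G) t"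
    unfolding t_def by (rule continuous_translation_lifts[OF \<xi>(1) sph(2,1)])
  have \<sigma>t: "\<sigma>N z = ract \<xi> (\<sigma>S z) (t z)" "t z \<in> carrier G" if "z \<in> sphere 0 1" for z
    unfolding t_def using ract_translation_lifts[OF \<xi>(1) sph(2,1)] continuous_carrier[OF ct] that by (auto simp: t_def)
  obtain U s where Us: "b \<in> U" "openin (base_space \<zeta>) U"
      "continuous_map (subtopology (base_space \<zeta>) U) (total_space \<zeta>) s" "\<forall>u\<in>U. bproj \<zeta> (s u) = u"
    using local_section[OF pb b] by blast
  define e where "e = s b"
  have e: "e \<in> topspace (total_space \<zeta>)" "bproj \<zeta> e = b"
    using continuous_map_image_subset_topspace[OF Us(3)] openin_subset[OF Us(2)] Us(1,4) by (auto simp: e_def)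
  obtain k a where k: "continuous_map (prod_topology (top_of_set {0..1::real}) (total_space \<zeta>)) (total_space \<zeta>) k"
    "\<And>x. k (0, x) = x" "\<And>x. k (1, x) = a"
    using universal_contraction[OF \<zeta>] by blast
  \<comment> \<open>Radially, first contract \<open>e t\<^sup>-\<^sup>1\<close> to the point \<open>a\<close>, then follow the path from \<open>a\<close> to \<open>e\<close>.\<close>
  define q where "q z = ract \<zeta> e (inv (t z))" for z
  have cq: "continuous_map (top_of_set (sphere 0 1)) (total_space \<zeta>) q"
    unfolding q_def by (rule continuous_ract[OF pb _ continuous_inv[OF ct]]) (use e in simp)
  define h where "h p = (if p \<in> {0..1} \<times> {0..1/2} then k (2 * snd p, e)
     else k (2 - 2 * snd p, q (cis (2 * pi * fst p))))" for p :: "real \<times> real"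
  have "continuous_map (top_of_set unit_square) (total_space \<zeta>) h"
    unfolding h_def
  proof (rule continuous_map_paste[where B = "{0..1} \<times> {1/2..1}"])
    show "closedin (top_of_set unit_square) ({0..1::real} \<times> {0..1/2 :: real})"
      "closedin (top_of_set unit_square) ({0..1::real} \<times> {1/2..1 :: real})"
      by (auto intro!: closed_subset closed_Times)
    have "continuous_map (top_of_set ({0..1::real} \<times> {0..1/2})) (prod_topology (top_of_set {0..1::real}) (total_space \<zeta>)) (\<lambda>p. (2 * snd p, e))"
      using e by (intro continuous_map_pairedI) (auto intro!: continuous_intros)
    from continuous_map_compose[OF this k(1)]
    have "continuous_map (top_of_set ({0..1::real} \<times> {0..1/2})) (total_space \<zeta>) (\<lambda>p. k (2 * snd p, e))"
      by (simp add: o_def)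
    moreover have "continuous_map (top_of_set ({0..1::real} \<times> {1/2..1::real})) (total_space \<zeta>) (\<lambda>p. q (cis (2 * pi * fst p)))"
      by (rule continuous_map_compose_top_of_set[OF cq]) (auto intro!: continuous_intros)
    then have "continuous_map (top_of_set ({0..1::real} \<times> {1/2..1})) (prod_topology (top_of_set {0..1::real}) (total_space \<zeta>)) (\<lambda>p. (2 - 2 * snd p, q (cis (2 * pi * fst p))))"
      by (intro continuous_map_pairedI) (auto intro!: continuous_intros)
    from continuous_map_compose[OF this k(1)]
    have "continuous_map (top_of_set ({0..1::real} \<times> {1/2..1})) (total_space \<zeta>) (\<lambda>p. k (2 - 2 * snd p, q (cis (2 * pi * fst p))))"
      by (simp add: o_def)
    moreover have "unit_square \<inter> {0..1::real} \<times> {0..1/2::real} = {0..1} \<times> {0..1/2}"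
      "unit_square \<inter> {0..1::real} \<times> {1/2..1::real} = {0..1} \<times> {1/2..1}"
      by auto
    ultimately show "continuous_map (subtopology (top_of_set unit_square) ({0..1::real} \<times> {0..1/2::real})) (total_space \<zeta>) (\<lambda>p. k (2 * snd p, e))"
      "continuous_map (subtopology (top_of_set unit_square) ({0..1::real} \<times> {1/2..1::real})) (total_space \<zeta>) (\<lambda>p. k (2 - 2 * snd p, q (cis (2 * pi * fst p))))"
      by (simp_all only: subtopology_subtopology)
    show "k (2 * snd p, e) = k (2 - 2 * snd p, q (cis (2 * pi * fst p)))"
      if "p \<in> {0..1::real} \<times> {0..1/2::real}" "p \<in> {0..1} \<times> {1/2..1}" for p
    proof -
      have "2 * snd p = 1" "2 - 2 * snd p = 1" using that by (auto simp: mem_Times_iff)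
      then show ?thesis by (simp only: k(3))
    qed
  qed auto
  moreover have "h (0, r) = h (1, r)" if "r \<in> {0..1}" for r
    using that by (simp add: h_def)
  moreover have "h (\<theta>, 0) = e" if "\<theta> \<in> {0..1}" for \<theta>
    using that k(2) by (simp add: h_def)
  ultimately obtain \<tau>S where \<tau>S: "continuous_map (top_of_set disc) (total_space \<zeta>) \<tau>S"
    "\<forall>\<theta>\<in>{0..1}. \<forall>r\<in>{0..1}. \<tau>S (of_real r * cis (2 * pi * \<theta>)) = h (\<theta>, r)"
    using disc_extension[of "total_space \<zeta>" h e] by blast
  have \<tau>S0: "\<tau>S 0 = e"
    using bspec[OF bspec[OF \<tau>S(2), of 0], of 0] k(2) by (simp add: h_def)
  have \<tau>S1: "\<tau>S z = q z" if z: "z \<in> sphere 0 1" for z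
  proof -
    obtain \<theta> where \<theta>: "\<theta> \<in> {0..1}" "z = of_real (cmod z) * cis (2 * pi * \<theta>)"
      by (rule polar_coordinates)
    then have "z = cis (2 * pi * \<theta>)" using z by simp
    then show ?thesis
      using bspec[OF bspec[OF \<tau>S(2) \<theta>(1)], of 1] k(2) by (simp add: h_def)
  qed
  have q: "bproj \<zeta> (q z) = b" "ract \<zeta> (q z) (t z) = e" "q z \<in> topspace (total_space \<zeta>)" if "z \<in> sphere 0 1" for z
  proof -
    note c = \<sigma>t(2)[OF that]
    show "bproj \<zeta> (q z) = b" "q z \<in> topspace (total_space \<zeta>)"
      unfolding q_def using bproj_ract[OF pb e(1)] ract_closed[OF pb e(1)] e(2) c by auto
    have "ract \<zeta> (q z) (t z) = ract \<zeta> e (inv (t z) \<otimes> t z)"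
      unfolding q_def using ract_mult[OF pb e(1), of "inv (t z)" "t z"] c by simp
    then show "ract \<zeta> (q z) (t z) = e"
      using c ract_one[OF pb e(1)] by simp
  qed
  \<comment> \<open>At the centre \<open>\<tau>S\<close> is \<open>e\<close>, which puts the south
    pole at the base point \<open>b\<close>. On the circle it is \<open>q\<close>, and
    \<open>e\<close> is \<open>q\<close> translated by \<open>t\<close>: the constant northern lift
    \<open>e\<close> and \<open>\<tau>S\<close> have the transition function of
    \<open>\<xi>\<close>.\<close>
  define g where "g x = (if x $ 3 \<ge> 0 then b else bproj \<zeta> (\<tau>S (horizontal x)))" for x :: "real^3"
  have cg: "continuous_map S2 (base_space \<zeta>) g"
    unfolding g_def
  proof (rule hemisphere_paste[where \<pi> = "\<lambda>x. x"])
    show "continuous_map S2 S2 (\<lambda>x. x)" by simp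
    show "continuous_map (subtopology S2 {p \<in> topspace S2. 0 \<le> p $ 3}) (base_space \<zeta>) (\<lambda>x. b)"
      using b by simp
    have "continuous_map S2 (top_of_set disc) horizontal"
      using continuous_map_horizontal[of S2 "\<lambda>x. x"] by simp
    from continuous_map_compose[OF this continuous_map_compose[OF \<tau>S(1) continuous_bproj[OF pb]]]
    show "continuous_map (subtopology S2 {p \<in> topspace S2. p $ 3 \<le> 0}) (base_space \<zeta>) (\<lambda>x. bproj \<zeta> (\<tau>S (horizontal x)))"
      by (intro continuous_map_from_subtopology) (simp add: o_def)
    fix x :: "real^3" assume x: "x \<in> topspace S2" "x $ 3 = 0"
    then have "horizontal x \<in> sphere 0 1"
      using horizontal_height[of x] power2_eq_iff_nonneg[of "cmod (horizontal x)" 1] by simp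
    then show "b = bproj \<zeta> (\<tau>S (horizontal x))"
      using \<tau>S1 q by simp
  qed
  have "bundle_iso G (pullback_bundle (base_space \<xi>) g \<zeta>) \<xi>"
  proof (rule isomorphism_of_transition[OF \<xi> pb cg \<sigma>])
    have nn: "upper z $ 3 \<ge> 0" if "z \<in> disc" for z
      using that by (simp add: upper_def abs_square_le_1)
    show "lifts \<zeta> (top_of_set disc) (\<lambda>z. g (upper z)) (\<lambda>_. e)"
      using e nn by (simp add: lifts_def g_def)
    have "bproj \<zeta> (\<tau>S z) = g (lower z)" if z: "z \<in> disc" for z
    proof (cases "cmod z = 1")
      case True
      then have "lower z $ 3 = 0" by (simp add: lower_def)
      then show ?thesis using True \<tau>S1 q by (simp add: g_def)
    next
      case False
      then have "(cmod z)\<^sup>2 < 1"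
        using z abs_square_less_1[of "cmod z"] by simp
      then have "lower z $ 3 < 0" by (simp add: lower_def)
      then show ?thesis by (simp add: g_def lower_def)
    qed
    then show "lifts \<zeta> (top_of_set disc) (\<lambda>z. g (lower z)) \<tau>S"
      using \<tau>S(1) by (simp add: lifts_def)
    show "\<exists>t\<in>carrier G. \<sigma>N z = ract \<xi> (\<sigma>S z) t \<and> e = ract \<zeta> (\<tau>S z) t" if "z \<in> sphere 0 1" for z
      using \<sigma>t[OF that] \<tau>S1[OF that] q(2)[OF that] by metis
  qed
  moreover have "g (sphere_point 0 (-1)) = b"
    using \<tau>S0 e by (simp add: g_def)
  ultimately show ?thesis
    using cg by (auto simp: classifying_map_def \<xi>(2))
qed

text \<open>The description in \<open>chern_class_def\<close> singles out one class: every
  classifying map has the clutching map of \<open>\<xi>\<close>, free homotopies preserve it, and a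
  class of \<open>\<pi>\<^sub>2\<close> is determined by it.\<close>

lemma chern_class_represents:
  fixes \<xi> :: "('f, real^3, 'g, 'w) pbundle_scheme" and \<zeta> :: "('e, 'b, 'g, 'z) pbundle_scheme"
  assumes \<xi>: "principal_bundle G \<xi>" "base_space \<xi> = S2" and \<zeta>: "universal_bundle G \<zeta>"
    and b: "b \<in> topspace (base_space \<zeta>)" and w: "clutching G \<xi> square_to_S2 w"
  shows "represents G \<zeta> b (chern_class G \<zeta> b \<xi>) w"
proof -
  note pb = universal_principal[OF \<zeta>]
  note cw = clutching_continuous[OF w]
  obtain c where c: "represents G \<zeta> b c w"
    using represents_realize[OF \<zeta> cw b] by blast
  have c\<phi>: "continuous_map square (base_space \<xi>) square_to_S2"
    using continuous_map_square_to_S2 \<xi>(2) by simp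
  have classifying: "clutching G \<zeta> (\<lambda>z. g (square_to_S2 z)) w" if g: "classifying_map G \<zeta> \<xi> g" for g
  proof -
    have "continuous_map square (base_space \<zeta>) (\<lambda>z. g (square_to_S2 z))"
      using continuous_map_compose[OF c\<phi>] g unfolding classifying_map_def by (auto simp: o_def)
    then obtain w' where w': "clutching G \<zeta> (\<lambda>z. g (square_to_S2 z)) w'"
      using clutching_exists[OF pb, of "\<lambda>z. g (square_to_S2 z)" "g (sphere_point 0 (-1))"] square_to_S2_boundary by auto
    then have "clutching G \<xi> square_to_S2 w'"
      using clutching_of_classifying_map[OF pb g \<xi>(2)] by blast
    then have "boundary_equiv G w w'"
      using clutching_unique[OF \<xi>(1) c\<phi> _ _ w] square_to_S2_boundary by blast
    then show ?thesis
      using clutching_cong_equiv[OF pb w'] by blast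
  qed
  have "chern_class G \<zeta> b \<xi> = c"
    unfolding chern_class_def
  proof (rule the_equality)
    \<comment> \<open>Existence needs a map in a class based at \<open>b\<close>, hence a
      classifying map that sends the south pole to \<open>b\<close>.\<close>
    obtain g where g: "classifying_map G \<zeta> \<xi> g" "g (sphere_point 0 (-1)) = b"
      using classifying_map_exists[OF \<xi> \<zeta> b] by blast
    have cg: "continuous_map S2 (base_space \<zeta>) g"
      using g(1) \<xi>(2) by (simp add: classifying_map_def)
    have "(\<lambda>z. g (square_to_S2 z)) \<in> c"
      by (rule represents_refl_member[OF \<zeta> c _ _ classifying[OF g(1)]])
        (use continuous_map_compose[OF continuous_map_square_to_S2 cg] g(2) square_to_S2_boundary in \<open>auto simp: o_def\<close>)
    then have "g \<circ> square_to_S2 \<in> c"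
      by (simp add: o_def)
    moreover have "homotopic_with (\<lambda>_. True) S2 (base_space \<zeta>) g g"
      using cg by simp
    ultimately show "c \<in> carrier (pi2 (base_space \<zeta>) b) \<and>
        (\<exists>f g. f \<circ> square_to_S2 \<in> c \<and> homotopic_with (\<lambda>_. True) S2 (base_space \<zeta>) f g \<and> classifying_map G \<zeta> \<xi> g)"
      using represents_closed[OF \<zeta> c] g(1) by blast
  next
    fix c' assume "c' \<in> carrier (pi2 (base_space \<zeta>) b) \<and>
        (\<exists>f g. f \<circ> square_to_S2 \<in> c' \<and> homotopic_with (\<lambda>_. True) S2 (base_space \<zeta>) f g \<and> classifying_map G \<zeta> \<xi> g)"
    then obtain f g where c': "c' \<in> carrier (pi2 (base_space \<zeta>) b)" and fc: "f \<circ> square_to_S2 \<in> c'"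
      and hom: "homotopic_with (\<lambda>_. True) S2 (base_space \<zeta>) f g" and g: "classifying_map G \<zeta> \<xi> g"
      by blast
    obtain w' where w': "represents G \<zeta> b c' w'"
      using represents_ex[OF \<zeta> c'] by blast
    have cf: "clutching G \<zeta> (\<lambda>z. f (square_to_S2 z)) w'"
      using represents_member(3)[OF \<zeta> w' fc] by (simp add: o_def)
    obtain h where h: "continuous_map (prod_topology (top_of_set {0..1::real}) S2) (base_space \<zeta>) h"
      "\<forall>x. h (0, x) = f x" "\<forall>x. h (1, x) = g x"
      using hom unfolding homotopic_with_def by meson
    \<comment> \<open>The homotopy is free: the boundary of the square follows the path of the south
      pole, which \<open>clutching_homotopy\<close> permits.\<close>
    define H where "H p = h (snd p, square_to_S2 (fst p))" for p :: "(real \<times> real) \<times> real"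
    have "continuous_map (top_of_set (unit_square \<times> {0..1})) (base_space \<zeta>) H"
      unfolding H_def
      by (rule continuous_map_compose_top_of_set[of "{0..1} \<times> sphere 0 1"])
        (use h(1) square_to_S2_in_sphere in
          \<open>auto simp: S2_def simp del: mem_sphere_0 intro!: continuous_intros continuous_on_compose2[OF continuous_square_to_S2[of UNIV]]\<close>)
    then have "boundary_equiv G w w'"
      by (rule clutching_homotopy[OF pb, of H "\<lambda>t. h (t, sphere_point 0 (-1))"])
        (use cf classifying[OF g] square_to_S2_boundary h(2,3) in \<open>simp_all add: H_def\<close>)
    then show "c' = c"
      using represents_unique[OF \<zeta> c w'] by simp
  qed
  then show ?thesis using c by simp
qed

end

section \<open>Invariant loops are powers\<close>

text \<open>A null-homotopy in the polar coordinates of \<open>disc_extension\<close>, with the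
  radius as second coordinate. The constant \<open>c\<close> is left free, so constant loops are
  trivial, as they are for \<open>boundary_equiv\<close>.\<close>

definition loop_null :: "('g, 'm) tgroup_scheme \<Rightarrow> (real \<Rightarrow> 'g) \<Rightarrow> bool" where
  "loop_null G u \<longleftrightarrow> (\<exists>h c. continuous_map (top_of_set unit_square) (gtop G) h \<and>
     (\<forall>r\<in>{0..1}. h (0, r) = h (1, r)) \<and> (\<forall>\<theta>\<in>{0..1}. h (\<theta>, 0) = c) \<and> (\<forall>\<theta>\<in>{0..1}. h (\<theta>, 1) = u \<theta>))"

definition disc_null :: "('g, 'm) tgroup_scheme \<Rightarrow> (complex \<Rightarrow> 'g) \<Rightarrow> bool" where
  "disc_null G t \<longleftrightarrow>
    (\<exists>T. continuous_map (top_of_set disc) (gtop G) T \<and> (\<forall>z\<in>sphere 0 1. T z = t z))"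

lemma loop_nullI:
  assumes "continuous_map (top_of_set unit_square) (gtop G) h"
    "\<And>r. r \<in> {0..1} \<Longrightarrow> h (0, r) = h (1, r)" "\<And>\<theta>. \<theta> \<in> {0..1} \<Longrightarrow> h (\<theta>, 0) = c"
    "\<And>\<theta>. \<theta> \<in> {0..1} \<Longrightarrow> h (\<theta>, 1) = u \<theta>"
  shows "loop_null G u"
  unfolding loop_null_def by (intro exI[of _ h] exI[of _ c] conjI ballI) (use assms in simp_all)

lemma loop_null_cong:
  assumes "loop_null G u" "\<And>\<theta>. \<theta> \<in> {0..1} \<Longrightarrow> u' \<theta> = u \<theta>"
  shows "loop_null G u'"
  using assms unfolding loop_null_def by simp

lemma disc_null_of_loop:
  assumes "loop_null G (\<lambda>\<theta>. t (cis (2 * pi * \<theta>)))"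
  shows "disc_null G t"
proof -
  obtain h c where h: "continuous_map (top_of_set unit_square) (gtop G) h"
     "\<forall>r\<in>{0..1}. h (0, r) = h (1, r)" "\<forall>\<theta>\<in>{0..1}. h (\<theta>, 0) = c" "\<forall>\<theta>\<in>{0..1}. h (\<theta>, 1) = t (cis (2 * pi * \<theta>))"
    using assms unfolding loop_null_def by blast
  obtain T where T: "continuous_map (top_of_set disc) (gtop G) T"
    "\<forall>\<theta>\<in>{0..1}. \<forall>r\<in>{0..1}. T (of_real r * cis (2 * pi * \<theta>)) = h (\<theta>, r)"
    using disc_extension[OF h(1), of c] h(2,3) by blast
  have "T z = t z" if z: "z \<in> sphere 0 1" for z
  proof -
    obtain \<theta> where \<theta>: "\<theta> \<in> {0..1}" "z = of_real (cmod z) * cis (2 * pi * \<theta>)"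
      by (rule polar_coordinates)
    then have "z = cis (2 * pi * \<theta>)" using z by simp
    then show ?thesis
      using bspec[OF bspec[OF T(2) \<theta>(1)], of 1] bspec[OF h(4) \<theta>(1)] by simp
  qed
  then show ?thesis
    using T(1) unfolding disc_null_def by blast
qed

context abelian_topological_group
begin

lemma mult_inv_cancel_left: "x \<in> carrier G \<Longrightarrow> y \<in> carrier G \<Longrightarrow> x \<otimes> (inv x \<otimes> y) = y"
  by (simp flip: m_assoc)

lemma boundary_equiv_of_disc_null:
  assumes "disc_null G (\<lambda>z. s z \<otimes> inv (t z))"
    and s: "continuous_map (top_of_set (sphere 0 1)) (gtop G) s" and t: "continuous_map (top_of_set (sphere 0 1)) (gtop G) t"
  shows "boundary_equiv G (\<lambda>z. s (square_to_disc z)) (\<lambda>z. t (square_to_disc z))"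
proof -
  obtain T where T: "continuous_map (top_of_set disc) (gtop G) T" "\<forall>z\<in>sphere 0 1. T z = s z \<otimes> inv (t z)"
    using assms unfolding disc_null_def by blast
  have "continuous_map square (gtop G) (\<lambda>z. T (square_to_disc z))"
    unfolding square_def
    by (rule continuous_map_compose_top_of_set[OF T(1) continuous_square_to_disc]) (use square_to_disc_in in blast)
  moreover have "s (square_to_disc z) = t (square_to_disc z) \<otimes> T (square_to_disc z)" if "z \<in> square_boundary" for z
  proof -
    note b = square_to_disc_boundary[OF that]
    have "s (square_to_disc z) \<in> carrier G" "t (square_to_disc z) \<in> carrier G"
      using continuous_carrier[OF s] continuous_carrier[OF t] b by auto
    then show ?thesis
      using bspec[OF T(2) b] by (simp add: m_lcomm[of "t (square_to_disc z)"])
  qed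
  ultimately show ?thesis
    unfolding boundary_equiv_def by blast
qed

lemma loop_null_mult:
  assumes "loop_null G u" "loop_null G v"
  shows "loop_null G (\<lambda>\<theta>. u \<theta> \<otimes> v \<theta>)"
proof -
  obtain h c where h: "continuous_map (top_of_set unit_square) (gtop G) h"
     "\<forall>r\<in>{0..1}. h (0, r) = h (1, r)" "\<forall>\<theta>\<in>{0..1}. h (\<theta>, 0) = c" "\<forall>\<theta>\<in>{0..1}. h (\<theta>, 1) = u \<theta>"
    using assms(1) unfolding loop_null_def by blast
  obtain k d where k: "continuous_map (top_of_set unit_square) (gtop G) k"
     "\<forall>r\<in>{0..1}. k (0, r) = k (1, r)" "\<forall>\<theta>\<in>{0..1}. k (\<theta>, 0) = d" "\<forall>\<theta>\<in>{0..1}. k (\<theta>, 1) = v \<theta>"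
    using assms(2) unfolding loop_null_def by blast
  show ?thesis
    by (rule loop_nullI[OF continuous_mult[OF h(1) k(1)], of "c \<otimes> d"]) (use h k in simp_all)
qed

lemma loop_null_inv:
  assumes "loop_null G u"
  shows "loop_null G (\<lambda>\<theta>. inv (u \<theta>))"
proof -
  obtain h c where h: "continuous_map (top_of_set unit_square) (gtop G) h"
     "\<forall>r\<in>{0..1}. h (0, r) = h (1, r)" "\<forall>\<theta>\<in>{0..1}. h (\<theta>, 0) = c" "\<forall>\<theta>\<in>{0..1}. h (\<theta>, 1) = u \<theta>"
    using assms(1) unfolding loop_null_def by blast
  show ?thesis
    by (rule loop_nullI[OF continuous_inv[OF h(1)], of "inv c"]) (use h in simp_all)
qed

lemma loop_null_const:
  assumes "c \<in> carrier G" shows "loop_null G (\<lambda>_. c)"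
  by (rule loop_nullI[of _ "\<lambda>_. c" c]) (use assms in auto)

lemma loop_null_pow:
  assumes "loop_null G u" shows "loop_null G (\<lambda>\<theta>. u \<theta> [^] (n::nat))"
  by (induction n) (auto intro: loop_null_const loop_null_mult assms)

text \<open>\<open>v((n+1)\<theta>)\<close> and \<open>v(n\<theta>) v(\<theta>)\<close> are the images under \<open>(p, q) \<mapsto> v(p) v(q)\<close> of two paths in the plane
  from \<open>(0, 0)\<close> to \<open>(n, 1)\<close>.\<close>

lemma loop_power:
  assumes v: "continuous_map (top_of_set UNIV) (gtop G) v" and per: "\<And>x. v (x + 1) = v x" and v0: "v 0 = \<one>"
  shows "loop_null G (\<lambda>\<theta>. v (real n * \<theta>) \<otimes> inv (v \<theta> [^] n))"
proof (induction n)
  case 0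
  then show ?case using loop_null_const[of \<one>] by (simp add: v0)
next
  case (Suc n)
  have vG: "v x \<in> carrier G" for x
    using continuous_carrier[OF v] by simp
  have vn: "v (real k) = \<one>" for k
    by (induction k) (use v0 per[of "real k" for k] in \<open>simp_all add: add.commute[of 1]\<close>)
  have cv: "continuous_map (top_of_set S) (gtop G) (\<lambda>x. v (f x))" if "continuous_on S f" for S :: "(real \<times> real) set" and f
    by (rule continuous_map_compose_top_of_set[OF v that]) simp
  \<comment> \<open>For \<open>snd z = 0\<close> the pair \<open>p\<close>, \<open>q\<close> follows
    the straight segment from \<open>(0, 0)\<close> to \<open>(n, 1)\<close>; for
    \<open>snd z = 1\<close> it goes to \<open>(n, 0)\<close> first and then up, at speed
    \<open>n + 1\<close>.\<close>
  define p where "p z = (1 - snd z) * (real n * fst z) + snd z * min (real (Suc n) * fst z) (real n)" for z :: "real \<times> real"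
  define q where "q z = (1 - snd z) * fst z + snd z * max (real (Suc n) * fst z - real n) 0" for z :: "real \<times> real"
  have "loop_null G (\<lambda>\<theta>. v (real (Suc n) * \<theta>) \<otimes> inv (v (real n * \<theta>) \<otimes> v \<theta>))"
  \<comment> \<open>The division by the value for \<open>snd z = 0\<close> makes the homotopy start
    at the constant \<open>\<one>\<close>.\<close>
  proof (rule loop_nullI[of _ "\<lambda>z. (v (p z) \<otimes> v (q z)) \<otimes> inv (v (real n * fst z) \<otimes> v (fst z))" \<one>])
    show "continuous_map (top_of_set unit_square) (gtop G) (\<lambda>z. (v (p z) \<otimes> v (q z)) \<otimes> inv (v (real n * fst z) \<otimes> v (fst z)))"
      unfolding p_def q_def by (intro continuous_mult continuous_inv cv continuous_intros)
    show "(v (p (0, r)) \<otimes> v (q (0, r))) \<otimes> inv (v (real n * fst (0, r)) \<otimes> v (fst (0, r))) =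
      (v (p (1, r)) \<otimes> v (q (1, r))) \<otimes> inv (v (real n * fst (1, r)) \<otimes> v (fst (1, r)))" for r :: real
    proof -
      have "p (0, r) = 0" "q (0, r) = 0" "p (1, r) = real n" "q (1, r) = 1"
        by (simp_all add: p_def q_def algebra_simps)
      then show ?thesis
        using vn[of n] vn[of 1] v0 by simp
    qed
    show "(v (p (\<theta>, 0)) \<otimes> v (q (\<theta>, 0))) \<otimes> inv (v (real n * fst (\<theta>, 0)) \<otimes> v (fst (\<theta>, 0))) = \<one>" for \<theta> :: real
      using vG by (simp add: p_def q_def)
    show "(v (p (\<theta>, 1)) \<otimes> v (q (\<theta>, 1))) \<otimes> inv (v (real n * fst (\<theta>, 1)) \<otimes> v (fst (\<theta>, 1))) =
        v (real (Suc n) * \<theta>) \<otimes> inv (v (real n * \<theta>) \<otimes> v \<theta>)" for \<theta> :: real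
    proof (cases "real (Suc n) * \<theta> \<le> real n")
      case True
      then have "p (\<theta>, 1) = real (Suc n) * \<theta>" "q (\<theta>, 1) = 0" by (auto simp: p_def q_def)
      then show ?thesis using v0 vG by simp
    next
      case False
      then have pq: "p (\<theta>, 1) = real n" "q (\<theta>, 1) = real (Suc n) * \<theta> - real n" by (auto simp: p_def q_def)
      have "v (x + real k) = v x" for x k
      proof (induction k)
        case (Suc k)
        then show ?case using per[of "x + real k"] by (simp add: add_ac)
      qed simp
      from this[of "real (Suc n) * \<theta> - real n" n] show ?thesis
        using pq vn vG by simp
    qed
  qed
  then have "loop_null G (\<lambda>\<theta>. (v (real (Suc n) * \<theta>) \<otimes> inv (v (real n * \<theta>) \<otimes> v \<theta>)) \<otimes> (v (real n * \<theta>) \<otimes> inv (v \<theta> [^] n)))"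
    using Suc.IH by (rule loop_null_mult)
  then show ?case
  proof (rule loop_null_cong)
    fix \<theta> :: real
    define x y z where "x = v (real (Suc n) * \<theta>)" and "y = v (real n * \<theta>)" and "z = v \<theta>"
    have c: "x \<in> carrier G" "y \<in> carrier G" "z \<in> carrier G" "z [^] n \<in> carrier G" using vG by (auto simp: x_def y_def z_def)
    have "(x \<otimes> inv (y \<otimes> z)) \<otimes> (y \<otimes> inv (z [^] n)) = (y \<otimes> inv y) \<otimes> (x \<otimes> inv (z [^] n \<otimes> z))"
      using c by (simp add: inv_mult m_ac mult_inv_cancel_left del: nat_pow_Suc)
    then show "v (real (Suc n) * \<theta>) \<otimes> inv (v \<theta> [^] Suc n) =
       (v (real (Suc n) * \<theta>) \<otimes> inv (v (real n * \<theta>) \<otimes> v \<theta>)) \<otimes> (v (real n * \<theta>) \<otimes> inv (v \<theta> [^] n))"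
      unfolding x_def[symmetric] y_def[symmetric] z_def[symmetric] using c by simp
  qed
qed

text \<open>The loop consists of \<open>y\<close> followed by the pointwise inverse of
  \<open>y\<close> run backwards. Reversal and pointwise inversion both invert a class, so each half
  represents \<open>y\<close>, and concatenation agrees with the product.\<close>

lemma loop_reflection:
  assumes y: "continuous_map (top_of_set {0..1}) (gtop G) y" and y01: "y 0 = \<one>" "y 1 = \<one>"
  shows "loop_null G (\<lambda>\<theta>. (y (min 1 (2 * \<theta>)) \<otimes> inv (y (min 1 (2 - 2 * \<theta>)))) \<otimes> inv (y \<theta> [^] (2::nat)))"
proof -
  have yG: "y x \<in> carrier G" if "x \<in> {0..1}" for x
    using continuous_carrier[OF y] that by simp
  have cy: "continuous_map (top_of_set unit_square) (gtop G) (\<lambda>z. y (f z))"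
    if "continuous_on unit_square f" "\<And>z. z \<in> unit_square \<Longrightarrow> f z \<in> {0..1}" for f
    by (rule continuous_map_compose_top_of_set[OF y that(1)]) (use that(2) in blast)
  have convex: "(1 - r) * a + r * b \<in> {0..1}" if "r \<in> {0..1}" "a \<in> {0..1}" "b \<in> {0..1}" for r a b :: real
    using convexD_alt[of "{0..1::real}" a b r] that by simp
  \<comment> \<open>These reparametrizations deform the product of \<open>y\<close> with its
    reversed inverse into their concatenation.\<close>
  define p where "p z = (1 - snd z) * fst z + snd z * min 1 (2 * fst z)" for z :: "real \<times> real"
  define q where "q z = (1 - snd z) * (1 - fst z) + snd z * min 1 (2 - 2 * fst z)" for z :: "real \<times> real"
  have pq: "p z \<in> {0..1}" "q z \<in> {0..1}" "fst z \<in> {0..1}" "1 - fst z \<in> {0..1}" "snd z * min (fst z) (1 - fst z) \<in> {0..1}"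
    "1 - snd z * min (fst z) (1 - fst z) \<in> {0..1}" if "z \<in> unit_square" for z
  proof -
    have z: "fst z \<in> {0..1}" "snd z \<in> {0..1}" using that by (auto simp: mem_Times_iff)
    show "fst z \<in> {0..1}" "1 - fst z \<in> {0..1}" using z by auto
    show "p z \<in> {0..1}" "q z \<in> {0..1}"
      unfolding p_def q_def by (rule convex; use z in auto)+
    have "0 \<le> snd z * min (fst z) (1 - fst z)" using z by auto
    moreover have "snd z * min (fst z) (1 - fst z) \<le> 1"
      using z by (intro mult_le_one) auto
    ultimately show "snd z * min (fst z) (1 - fst z) \<in> {0..1}" "1 - snd z * min (fst z) (1 - fst z) \<in> {0..1}"
      by auto
  qed
  have 1: "loop_null G (\<lambda>\<theta>. (y (min 1 (2 * \<theta>)) \<otimes> inv (y (min 1 (2 - 2 * \<theta>)))) \<otimes> inv (y \<theta> \<otimes> inv (y (1 - \<theta>))))"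
  proof (rule loop_nullI[of _ "\<lambda>z. (y (p z) \<otimes> inv (y (q z))) \<otimes> inv (y (fst z) \<otimes> inv (y (1 - fst z)))" \<one>])
    show "continuous_map (top_of_set unit_square) (gtop G) (\<lambda>z. (y (p z) \<otimes> inv (y (q z))) \<otimes> inv (y (fst z) \<otimes> inv (y (1 - fst z))))"
      by (intro continuous_mult continuous_inv cy pq) (auto simp: p_def q_def intro!: continuous_intros)
  qed (use yG y01 in \<open>auto simp: p_def q_def algebra_simps\<close>)
  have 2: "loop_null G (\<lambda>\<theta>. y \<theta> \<otimes> y (1 - \<theta>))"
  \<comment> \<open>The product of \<open>y\<close> and its reverse takes the same value at
    \<open>\<theta>\<close> and \<open>1 - \<theta>\<close>, since \<open>G\<close> is commutative.
    It is thus a path run forth and back, and shrinks along itself.\<close>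
  proof (rule loop_nullI[of _ "\<lambda>z. y (snd z * min (fst z) (1 - fst z)) \<otimes> y (1 - snd z * min (fst z) (1 - fst z))" \<one>])
    show "continuous_map (top_of_set unit_square) (gtop G) (\<lambda>z. y (snd z * min (fst z) (1 - fst z)) \<otimes> y (1 - snd z * min (fst z) (1 - fst z)))"
      by (intro continuous_mult cy pq continuous_intros)
    show "y (snd (\<theta>, 1) * min (fst (\<theta>, 1)) (1 - fst (\<theta>, 1))) \<otimes> y (1 - snd (\<theta>, 1) * min (fst (\<theta>, 1)) (1 - fst (\<theta>, 1))) = y \<theta> \<otimes> y (1 - \<theta>)"
      if "\<theta> \<in> {0..1}" for \<theta> :: real
      using that yG by (cases "\<theta> \<le> 1 - \<theta>") (auto simp: min_def m_comm)
  qed (use y01 in auto)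
  show ?thesis
  proof (rule loop_null_cong[OF loop_null_mult[OF 1 loop_null_inv[OF 2]]])
    fix \<theta> :: real assume \<theta>: "\<theta> \<in> {0..1}"
    define a b where "a = y \<theta>" and "b = y (1 - \<theta>)"
    define v where "v = y (min 1 (2 * \<theta>)) \<otimes> inv (y (min 1 (2 - 2 * \<theta>)))"
    have c: "a \<in> carrier G" "b \<in> carrier G" "v \<in> carrier G"
      using \<theta> yG by (auto simp: a_def b_def v_def)
    have "(v \<otimes> inv (a \<otimes> inv b)) \<otimes> inv (a \<otimes> b) = (b \<otimes> inv b) \<otimes> (v \<otimes> inv (a \<otimes> a))"
      using c by (simp add: inv_mult m_ac del: r_inv l_inv Units_r_inv Units_l_inv)
    then have "v \<otimes> inv (a [^] (2::nat)) = (v \<otimes> inv (a \<otimes> inv b)) \<otimes> inv (a \<otimes> b)"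
      using c by (simp add: numeral_2_eq_2)
    then show "(y (min 1 (2 * \<theta>)) \<otimes> inv (y (min 1 (2 - 2 * \<theta>)))) \<otimes> inv (y \<theta> [^] (2::nat)) =
       ((y (min 1 (2 * \<theta>)) \<otimes> inv (y (min 1 (2 - 2 * \<theta>)))) \<otimes> inv (y \<theta> \<otimes> inv (y (1 - \<theta>)))) \<otimes> inv (y \<theta> \<otimes> y (1 - \<theta>))"
      unfolding a_def b_def v_def .
  qed
qed

lemma continuous_map_circle_loop:
  assumes "continuous_map (top_of_set (sphere 0 1)) (gtop G) t"
  shows "continuous_map (top_of_set S) (gtop G) (\<lambda>x. t (cis (c * x)))"
  by (rule continuous_map_compose_top_of_set[OF assms]) (auto intro!: continuous_intros)

text \<open>By invariance the restriction \<open>v\<close> of \<open>t\<close> to one arc of length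
  \<open>2 * pi / n\<close> closes up, and the whole circle runs through it \<open>n\<close>
  times.\<close>

lemma rotation_invariant_power:
  assumes t: "continuous_map (top_of_set (sphere 0 1)) (gtop G) t" and n: "n > 0"
    and inv: "\<And>z. z \<in> sphere 0 1 \<Longrightarrow> t (cis (2 * pi / real n) * z) = t z"
  shows "\<exists>V. continuous_map (top_of_set (sphere 0 1)) (gtop G) V \<and> disc_null G (\<lambda>z. t z \<otimes> inv (V z [^] n))"
proof -
  have tG: "t (cis x) \<in> carrier G" for x
    using continuous_carrier[OF t] by simp
  \<comment> \<open>Normalized because \<open>loop_power\<close> asks for
    \<open>v 0 = \<one>\<close>; the constant \<open>t 1\<close> returns as a null loop.\<close>
  define v where "v x = t (cis (2 * pi / real n * x)) \<otimes> inv (t 1)" for x :: real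
  have cv: "continuous_map (top_of_set S) (gtop G) v" for S
    unfolding v_def using tG[of 0] by (intro continuous_mult continuous_map_circle_loop[OF t]) simp
  have per: "v (x + 1) = v x" for x
  proof -
    have "cis (2 * pi / real n * (x + 1)) = cis (2 * pi / real n) * cis (2 * pi / real n * x)"
      by (simp add: cis_mult distrib_left add.commute)
    then show ?thesis
      using inv[of "cis (2 * pi / real n * x)"] by (simp add: v_def)
  qed
  have v0: "v 0 = \<one>"
    using tG[of 0] by (simp add: v_def)
  obtain V where V: "continuous_map (top_of_set (sphere 0 1)) (gtop G) V" "\<forall>\<theta>\<in>{0..1}. V (cis (2 * pi * \<theta>)) = v \<theta>"
    using circle_extension[OF cv] per[of 0] by auto
  have "loop_null G (\<lambda>\<theta>. t (cis (2 * pi * \<theta>)) \<otimes> inv (V (cis (2 * pi * \<theta>)) [^] n))"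
  proof (rule loop_null_cong[OF loop_null_mult[OF loop_null_const loop_power[OF cv per v0, of n]]])
    show "t 1 \<in> carrier G" using tG[of 0] by simp
    fix \<theta> :: real assume \<theta>: "\<theta> \<in> {0..1}"
    have vG: "v \<theta> \<in> carrier G" using continuous_carrier[OF cv[of UNIV]] by simp
    have "v (real n * \<theta>) = t (cis (2 * pi * \<theta>)) \<otimes> inv (t 1)"
      using n by (simp add: v_def mult.assoc)
    then show "t (cis (2 * pi * \<theta>)) \<otimes> inv (V (cis (2 * pi * \<theta>)) [^] n) = t 1 \<otimes> (v (real n * \<theta>) \<otimes> inv (v \<theta> [^] n))"
      using V(2) \<theta> vG tG[of 0] tG[of "2 * pi * \<theta>"] m_assoc[of "t (cis (2 * pi * \<theta>))" "inv (t 1)"]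
        m_comm[of "t (cis (2 * pi * \<theta>))" "inv (t 1)"] by (simp flip: m_assoc)
  qed
  then show ?thesis
    by (intro exI[of _ V] conjI V(1) disc_null_of_loop)
qed

text \<open>The symmetry under \<open>cnj\<close> together with rotation invariance makes one arc
  \<open>v\<close> a half arc \<open>y\<close> followed by its reflected inverse. As
  \<open>t\<close> is trivial at both ends of the half arc, \<open>y\<close> is a loop with square
  \<open>v\<close>, and \<open>t\<close> runs through \<open>v\<close> \<open>n\<close>
  times.\<close>

lemma dihedral_invariant_power:
  assumes t: "continuous_map (top_of_set (sphere 0 1)) (gtop G) t" and n: "n > 0"
    and inv: "\<And>z. z \<in> sphere 0 1 \<Longrightarrow> t (cis (2 * pi / real n) * z) = t z"
    and cnj: "\<And>z. z \<in> sphere 0 1 \<Longrightarrow> t (cnj z) = inv (t z)" and t1: "t 1 = \<one>" "t (cis (pi / real n)) = \<one>"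
  shows "\<exists>V. continuous_map (top_of_set (sphere 0 1)) (gtop G) V \<and> disc_null G (\<lambda>z. t z \<otimes> inv (V z [^] (2 * n)))"
proof -
  have tG: "t (cis x) \<in> carrier G" for x
    using continuous_carrier[OF t] by simp
  define v where "v x = t (cis (2 * pi / real n * x))" for x :: real
  \<comment> \<open>Half of an arc: \<open>y\<close> follows \<open>t\<close> from 1 to
    \<open>cis (pi / n)\<close>, the two points where \<open>t\<close> is assumed trivial.\<close>
  define y where "y x = v (1/2 * x)" for x :: real
  have cv: "continuous_map (top_of_set S) (gtop G) v" for S
    unfolding v_def by (rule continuous_map_circle_loop[OF t])
  have cy: "continuous_map (top_of_set S) (gtop G) y" for S
    unfolding y_def by (rule continuous_map_compose_top_of_set[OF cv[of UNIV]]) (auto intro!: continuous_intros)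
  have vG: "v x \<in> carrier G" for x using tG by (simp add: v_def)
  have per: "v (x + 1) = v x" for x
  proof -
    have "cis (2 * pi / real n * (x + 1)) = cis (2 * pi / real n) * cis (2 * pi / real n * x)"
      by (simp add: cis_mult distrib_left add.commute)
    then show ?thesis
      using inv[of "cis (2 * pi / real n * x)"] by (simp add: v_def)
  qed
  have v0: "v 0 = \<one>" and y01: "y 0 = \<one>" "y 1 = \<one>"
    using t1 by (simp_all add: v_def y_def)
  have vneg: "v (- x) = inv (v x)" for x
    using cnj[of "cis (2 * pi / real n * x)"] by (simp add: v_def cis_cnj)
  have vy: "v \<theta> = y (min 1 (2 * \<theta>)) \<otimes> inv (y (min 1 (2 - 2 * \<theta>)))" if "\<theta> \<in> {0..1}" for \<theta>
  proof (cases "2 * \<theta> \<le> 1")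
    case True
    then have "min 1 (2 * \<theta>) = 2 * \<theta>" "min 1 (2 - 2 * \<theta>) = 1" by auto
    then show ?thesis using y01 vG by (simp add: y_def)
  next
    case False
    then have "min 1 (2 * \<theta>) = 1" "min 1 (2 - 2 * \<theta>) = 2 - 2 * \<theta>" by auto
    moreover have "y (2 - 2 * \<theta>) = v (- (\<theta> - 1))"
      unfolding y_def by (rule arg_cong[where f = v]) simp
    ultimately have "y (min 1 (2 * \<theta>)) \<otimes> inv (y (min 1 (2 - 2 * \<theta>))) = inv (inv (v (\<theta> - 1)))"
      using vneg[of "\<theta> - 1"] y01(2) vG by simp
    then show ?thesis using per[of "\<theta> - 1"] vG by simp
  qed
  obtain V where V: "continuous_map (top_of_set (sphere 0 1)) (gtop G) V" "\<forall>\<theta>\<in>{0..1}. V (cis (2 * pi * \<theta>)) = y \<theta>"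
    using circle_extension[OF cy] y01 by auto
  have "loop_null G (\<lambda>\<theta>. v \<theta> \<otimes> inv (y \<theta> [^] (2::nat)))"
    by (rule loop_null_cong[OF loop_reflection[OF cy y01]]) (use vy in simp)
  then have N: "loop_null G (\<lambda>\<theta>. (v (real n * \<theta>) \<otimes> inv (v \<theta> [^] n)) \<otimes> (v \<theta> \<otimes> inv (y \<theta> [^] (2::nat))) [^] n)"
    by (rule loop_null_mult[OF loop_power[OF cv per v0] loop_null_pow])
  have "loop_null G (\<lambda>\<theta>. t (cis (2 * pi * \<theta>)) \<otimes> inv (V (cis (2 * pi * \<theta>)) [^] (2 * n)))"
  proof (rule loop_null_cong[OF N])
    fix \<theta> :: real assume \<theta>: "\<theta> \<in> {0..1}"
    have c: "v \<theta> \<in> carrier G" "y \<theta> \<in> carrier G" "v (real n * \<theta>) \<in> carrier G" using vG by (auto simp: y_def)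
    have e: "v (real n * \<theta>) = t (cis (2 * pi * \<theta>))"
      using n by (simp add: v_def mult.assoc)
    have "(v \<theta> \<otimes> inv (y \<theta> [^] (2::nat))) [^] n = v \<theta> [^] n \<otimes> inv (y \<theta> [^] (2 * n))"
      using c by (simp add: nat_pow_distrib nat_pow_inv nat_pow_pow)
    then have "(v (real n * \<theta>) \<otimes> inv (v \<theta> [^] n)) \<otimes> (v \<theta> \<otimes> inv (y \<theta> [^] (2::nat))) [^] n =
        v (real n * \<theta>) \<otimes> inv (y \<theta> [^] (2 * n))"
      using c by (simp add: m_assoc) (simp flip: m_assoc)
    then show "t (cis (2 * pi * \<theta>)) \<otimes> inv (V (cis (2 * pi * \<theta>)) [^] (2 * n)) =
       (v (real n * \<theta>) \<otimes> inv (v \<theta> [^] n)) \<otimes> (v \<theta> \<otimes> inv (y \<theta> [^] (2::nat))) [^] n"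
      using V(2) \<theta> e by simp
  qed
  then show ?thesis
    by (intro exI[of _ V] conjI V(1) disc_null_of_loop)
qed

text \<open>On the sector \<open>z = r cis (2\<pi>(k + x)/n)\<close> with \<open>x \<in> [0,1]\<close> the solution is
  \<open>a\<^sub>1(r x) a\<^sub>k(r cis (2\<pi> x/n))\<close>; the cocycle identity makes adjacent sectors fit.\<close>

lemma cocycle_trivial:
  assumes n: "n > 0" and a: "\<And>k. continuous_map (top_of_set disc) (gtop G) (a k)"
    and a0: "\<And>k. a k 0 = \<one>" and an: "\<And>z. z \<in> disc \<Longrightarrow> a 0 z = \<one>" "\<And>z. z \<in> disc \<Longrightarrow> a n z = \<one>"
    and cocycle: "\<And>j k z. z \<in> disc \<Longrightarrow> a (j + k) z = a j (cis (2 * pi / real n) ^ k * z) \<otimes> a k z"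
  shows "\<exists>f. continuous_map (top_of_set disc) (gtop G) f \<and>
    (\<forall>z\<in>disc. f (cis (2 * pi / real n) * z) = f z \<otimes> a 1 z)"
proof -
  let ?\<zeta> = "cis (2 * pi / real n)"
  have aG: "a k z \<in> carrier G" if "z \<in> disc" for k z
    using continuous_carrier[OF a] that by simp
  \<comment> \<open>The sectors in coordinates angle (in turns) and radius;
    \<open>real n * fst p - real k\<close> is the relative angle in sector \<open>k\<close>, between
    0 and 1.\<close>
  define T where "T k = {real k / real n..real (Suc k) / real n} \<times> {0..1::real}" for k
  define h where "h k p = a 1 (of_real (snd p * (real n * fst p - real k))) \<otimes>
     a k (of_real (snd p) * cis (2 * pi / real n * (real n * fst p - real k)))" for k and p :: "real \<times> real"
  have x01: "real n * fst p - real k \<in> {0..1}" "snd p \<in> {0..1}" if "p \<in> T k" for p k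
    using that n by (auto simp: T_def mem_Times_iff field_simps)
  have inD: "of_real (r * x) \<in> disc" "of_real r * cis \<phi> \<in> disc" if "x \<in> {0..1}" "r \<in> {0..1}" for r x \<phi> :: real
    using that by (auto simp: norm_mult mult_le_one simp del: of_real_mult)
  have Tsub: "T k \<subseteq> unit_square" if "k < n" for k
  proof -
    have "0 \<le> real k / real n" "real (Suc k) / real n \<le> 1"
      using that by auto
    then have "fst p \<in> {0..1} \<and> snd p \<in> {0..1}" if "p \<in> T k" for p
      using that unfolding T_def mem_Times_iff atLeastAtMost_iff by linarith
    then show ?thesis by (auto simp: mem_Times_iff)
  qed
  have ch: "continuous_map (top_of_set (T k)) (gtop G) (h k)" for k
  proof -
    have "continuous_map (top_of_set (T k)) (gtop G) (\<lambda>p. a 1 (of_real (snd p * (real n * fst p - real k))))"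
    proof (rule continuous_map_compose_top_of_set[OF a])
      show "continuous_on (T k) (\<lambda>p. complex_of_real (snd p * (real n * fst p - real k)))"
        by (intro continuous_intros)
      show "(\<lambda>p. complex_of_real (snd p * (real n * fst p - real k))) ` T k \<subseteq> disc"
        by (rule image_subsetI, rule inD(1)[OF x01])
    qed
    moreover have "continuous_map (top_of_set (T k)) (gtop G)
        (\<lambda>p. a k (of_real (snd p) * cis (2 * pi / real n * (real n * fst p - real k))))"
    proof (rule continuous_map_compose_top_of_set[OF a])
      show "continuous_on (T k) (\<lambda>p. of_real (snd p) * cis (2 * pi / real n * (real n * fst p - real k)))"
        by (intro continuous_intros)
      show "(\<lambda>p. of_real (snd p) * cis (2 * pi / real n * (real n * fst p - real k))) ` T k \<subseteq> disc"
        by (rule image_subsetI, rule inD(2)[OF x01])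
    qed
    ultimately show ?thesis
      unfolding h_def by (rule continuous_mult)
  qed
  \<comment> \<open>On the common ray the relative angle is 1 seen from sector \<open>k\<close> and
    0 seen from the next one. The values there are \<open>a 1 r \<otimes> a k (\<zeta> * r)\<close>
    and \<open>a (Suc k) r\<close>, where \<open>\<zeta>\<close> is the basic rotation.\<close>
  have succ: "h k p = h (Suc k) p" if p: "p \<in> T k" "p \<in> T (Suc k)" for k p
  proof -
    have e: "real n * fst p - real k = 1" "real n * fst p - real (Suc k) = 0"
      using x01[OF p(1)] x01[OF p(2)] by auto
    have d: "complex_of_real (snd p) \<in> disc" using inD(1)[of 1 "snd p"] x01(2)[OF p(1)] by simp
    have "a (Suc k) (of_real (snd p)) = a k (?\<zeta> * of_real (snd p)) \<otimes> a 1 (of_real (snd p))"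
      using cocycle[OF d, of k 1] by simp
    moreover have "a k (?\<zeta> * of_real (snd p)) \<in> carrier G"
      by (rule aG) (use x01(2)[OF p(1)] in \<open>simp add: norm_mult\<close>)
    ultimately show ?thesis
      unfolding h_def e using a0[of 1] aG[OF d] by (simp add: m_comm mult.commute)
  qed
  have agree: "h i p = h j p" if ij: "p \<in> T i" "p \<in> T j" for i j p
  proof -
    have *: "h i p = h j p" if "i < j" "p \<in> T i" "p \<in> T j" for i j
    proof -
      have "real j \<le> real i + 1" using x01[OF that(2)] x01[OF that(3)] by auto
      then have "j = Suc i" using that(1) by linarith
      then show ?thesis using succ that by simp
    qed
    show ?thesis
    proof (cases i j rule: linorder_cases)
      case less
      then show ?thesis using * ij by blast
    next
      case equal
      then show ?thesis by simp
    next
      case greater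
      then show ?thesis using *[OF greater ij(2,1)] by simp
    qed
  qed
  have cover: "\<exists>k<n. p \<in> T k" if "p \<in> unit_square" for p
  proof -
    have \<theta>: "0 \<le> fst p" "fst p \<le> 1" "snd p \<in> {0..1}" using that by (auto simp: mem_Times_iff)
    show ?thesis
    \<comment> \<open>The floor would give the sector \<open>n\<close>, which does not exist; the
      closing ray belongs to the sector \<open>n - 1\<close>.\<close>
    proof (cases "fst p = 1")
      case True
      then have "p \<in> T (n - 1)" using n \<theta> by (auto simp: T_def mem_Times_iff of_nat_diff)
      then show ?thesis using n by (intro exI[of _ "n - 1"]) simp
    next
      case False
      define k where "k = nat \<lfloor>real n * fst p\<rfloor>"
      have k: "real k \<le> real n * fst p" "real n * fst p < real k + 1"
        unfolding k_def using \<theta> by (auto simp: of_nat_nat)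
      have "real n * fst p < real n" using False \<theta> n by simp
      then have "k < n" using k by linarith
      moreover have "p \<in> T k"
        using k \<theta> n by (auto simp: T_def mem_Times_iff field_simps)
      ultimately show ?thesis by blast
    qed
  qed
  obtain g where g: "continuous_map (top_of_set unit_square) (gtop G) g"
    "\<And>p i. i \<in> {..<n} \<Longrightarrow> p \<in> topspace (top_of_set unit_square) \<inter> T i \<Longrightarrow> g p = h i p"
  proof (rule pasting_lemma_exists_closed[of "{..<n}" "top_of_set unit_square" T "gtop G" h])
    show "topspace (top_of_set unit_square) \<subseteq> \<Union> (T ` {..<n})"
      using cover by auto
    show "closedin (top_of_set unit_square) (T i)" if "i \<in> {..<n}" for i
      using Tsub that by (intro closed_subset) (auto simp: T_def intro!: closed_Times)
    show "continuous_map (subtopology (top_of_set unit_square) (T i)) (gtop G) (h i)" if "i \<in> {..<n}" for i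
      using ch[of i] Tsub[of i] that by (simp add: subtopology_subtopology Int_absorb1)
    show "h i p = h j p" if "i \<in> {..<n}" "j \<in> {..<n}" "p \<in> topspace (top_of_set unit_square) \<inter> T i \<inter> T j" for i j p
      using agree that by blast
  qed auto
  have gh: "g p = h k p" if "k < n" "p \<in> T k" for p k
    using g(2)[of k p] that Tsub by auto
  have g0: "g (0, r) = \<one>" if "r \<in> {0..1}" for r
  proof -
    have "(0, r) \<in> T 0" using that n by (simp add: T_def)
    then show ?thesis
      using gh[OF n, of "(0, r)"] a0 an(1)[of "of_real r"] that by (simp add: h_def)
  qed
  have g1: "g (1, r) = \<one>" if "r \<in> {0..1}" for r
  proof -
    obtain m where m: "n = Suc m" using n by (cases n) auto
    have "(1, r) \<in> T m" using that by (simp add: T_def m)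
    then have "g (1, r) = h m (1, r)" using gh[of m] m by simp
    also have "\<dots> = a 1 (of_real r) \<otimes> a m (of_real r * ?\<zeta>)"
      by (simp add: h_def m)
    also have "\<dots> = a m (?\<zeta> ^ 1 * of_real r) \<otimes> a 1 (of_real r)"
      using aG[of "of_real r"] aG[of "of_real r * ?\<zeta>"] that by (simp add: m_comm mult.commute norm_mult)
    also have "\<dots> = a n (of_real r)"
      using cocycle[of "of_real r" m 1] that by (simp add: m)
    finally show ?thesis using an(2)[of "of_real r"] that by simp
  qed
  have "g (\<theta>, 0) = \<one>" if \<theta>: "\<theta> \<in> {0..1}" for \<theta>
  proof -
    obtain k where "k < n" "(\<theta>, 0) \<in> T k" using cover[of "(\<theta>, 0)"] \<theta> by auto
    then show ?thesis using gh[of k "(\<theta>, 0)"] a0 by (simp add: h_def)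
  qed
  then obtain f where f: "continuous_map (top_of_set disc) (gtop G) f"
    "\<forall>\<theta>\<in>{0..1}. \<forall>r\<in>{0..1}. f (of_real r * cis (2 * pi * \<theta>)) = g (\<theta>, r)"
    using disc_extension[OF g(1), of \<one>] g0 g1 by auto
  have "f (?\<zeta> * z) = f z \<otimes> a 1 z" if z: "z \<in> disc" for z
  proof -
    obtain \<theta> where \<theta>: "\<theta> \<in> {0..1}" "z = of_real (cmod z) * cis (2 * pi * \<theta>)"
      by (rule polar_coordinates)
    define r where "r = cmod z"
    have r: "r \<in> {0..1}" using z by (simp add: r_def)
    obtain k where k: "k < n" "(\<theta>, r) \<in> T k" using cover[of "(\<theta>, r)"] \<theta> r by auto
    define x where "x = real n * \<theta> - real k"
    have x: "x \<in> {0..1}" using x01(1)[OF k(2)] by (simp add: x_def)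
    define w where "w = of_real r * cis (2 * pi / real n * x)"
    have w: "w \<in> disc" unfolding w_def using inD(2)[OF x r] .
    have rx: "complex_of_real (r * x) \<in> disc" using inD(1)[OF x r] .
    have fz: "f z = a 1 (of_real (r * x)) \<otimes> a k w"
      using bspec[OF bspec[OF f(2) \<theta>(1)] r] gh[OF k] \<theta>(2) by (simp add: h_def x_def w_def r_def)
    have "?\<zeta> ^ k * w = of_real r * (cis (real k * (2 * pi / real n)) * cis (2 * pi / real n * x))"
      unfolding w_def Complex.DeMoivre by (simp only: mult_ac)
    also have "\<dots> = of_real r * cis (2 * pi * \<theta>)"
      unfolding cis_mult using n by (simp add: x_def field_simps)
    finally have zw: "?\<zeta> ^ k * w = z" using \<theta>(2) by (simp add: r_def)
    \<comment> \<open>Multiplication by the basic rotation leads to the next sector with the same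
      \<open>x\<close> and the same \<open>w\<close>. Afterwards the cocycle identity splits
      \<open>a (Suc k) w\<close> into \<open>a 1 z \<otimes> a k w\<close>.\<close>
    have "f (?\<zeta> * z) = a 1 (of_real (r * x)) \<otimes> a (Suc k) w"
    proof (cases "Suc k < n")
      case True
      define \<theta>' where "\<theta>' = \<theta> + 1 / real n"
      have T': "(\<theta>', r) \<in> T (Suc k)" using k(2) by (auto simp: T_def \<theta>'_def add_divide_distrib)
      then have \<theta>': "\<theta>' \<in> {0..1}" using Tsub[OF True] by auto
      have "?\<zeta> * z = of_real r * (cis (2 * pi / real n) * cis (2 * pi * \<theta>))"
        by (subst \<theta>(2)) (simp add: r_def)
      also have "\<dots> = of_real r * cis (2 * pi * \<theta>')"
        unfolding cis_mult by (simp add: \<theta>'_def algebra_simps)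
      finally have fg: "f (?\<zeta> * z) = g (\<theta>', r)"
        using bspec[OF bspec[OF f(2) \<theta>'] r] by simp
      have e: "real n * \<theta>' - real (Suc k) = x"
        using n by (simp add: \<theta>'_def x_def field_simps)
      show ?thesis
        using fg gh[OF True T'] unfolding h_def fst_conv snd_conv e w_def by simp
    next
      case False
      then have kn: "Suc k = n" using k by simp
      \<comment> \<open>Behind the last sector comes sector 0, hence the full turn subtracted. There
        the factor is \<open>a 0\<close> instead of \<open>a n\<close>; both are trivial.\<close>
      define \<theta>' where "\<theta>' = \<theta> + 1 / real n - 1"
      have x': "real n * \<theta>' = x"
      proof -
        have "real n = real k + 1" using kn by linarith
        moreover have "real n * \<theta>' = real n * \<theta> + 1 - real n"
          using n by (simp add: \<theta>'_def algebra_simps)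
        ultimately show ?thesis by (simp add: x_def)
      qed
      then have \<theta>'e: "\<theta>' = x / real n" using n by (simp add: field_simps)
      have T': "(\<theta>', r) \<in> T 0" unfolding \<theta>'e using x r n by (auto simp: T_def divide_right_mono)
      then have \<theta>': "\<theta>' \<in> {0..1}" using Tsub[OF n] by auto
      have "?\<zeta> * z = of_real r * (cis (2 * pi / real n) * cis (2 * pi * \<theta>))"
        by (subst \<theta>(2)) (simp add: r_def)
      also have "cis (2 * pi / real n) * cis (2 * pi * \<theta>) = cis (2 * pi * \<theta>') * cis (2 * pi)"
        unfolding cis_mult by (simp add: \<theta>'_def algebra_simps)
      finally have "f (?\<zeta> * z) = g (\<theta>', r)"
        using bspec[OF bspec[OF f(2) \<theta>'] r] by simp
      also have "\<dots> = a 1 (of_real (r * x))"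
        using gh[OF n T'] x' an(1)[OF inD(2)[OF x r]] aG[OF rx] by (simp add: h_def)
      finally show ?thesis
        using kn an(2)[OF w] aG[OF rx] by simp
    qed
    also have "a (Suc k) w = a 1 z \<otimes> a k w"
      using cocycle[OF w, of 1 k] zw by simp
    also have "a 1 (of_real (r * x)) \<otimes> (a 1 z \<otimes> a k w) = f z \<otimes> a 1 z"
      unfolding fz using aG[OF rx, of 1] aG[OF w, of k] aG[OF z, of 1] by (simp add: m_ac)
    finally show ?thesis .
  qed
  then show ?thesis using f(1) by blast
qed

end

section \<open>Equivariant bundles over rotated hemispheres\<close>

lemma top_subgroup_SO3 [simp]:
  "carrier (top_subgroup SO3 \<Gamma>) = \<Gamma>" "x \<otimes>\<^bsub>top_subgroup SO3 \<Gamma>\<^esub> y = x ** y" "\<one>\<^bsub>top_subgroup SO3 \<Gamma>\<^esub> = mat 1"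
  by (simp_all add: top_subgroup_def SO3_def)

definition matrix_power :: "real^3^3 \<Rightarrow> nat \<Rightarrow> real^3^3" where
  "matrix_power A k = ((**) A ^^ k) (mat 1)"

lemma matrix_power_simps [simp]:
  "matrix_power A 0 = mat 1" "matrix_power A (Suc k) = A ** matrix_power A k"
  by (simp_all add: matrix_power_def)

lemma matrix_power_add: "matrix_power A (j + k) = matrix_power A j ** matrix_power A k"
  by (induction j) (auto simp: matrix_mul_assoc)

locale equivariant_pair = abelian_topological_group G for G :: "('g, 'm) tgroup_scheme" (structure) +
  fixes \<Gamma> :: "(real^3^3) set"
    and \<xi>1 :: "('e1, real^3, 'g, real^3^3, 'w1) eqbundle_scheme"
    and \<xi>2 :: "('e2, real^3, 'g, real^3^3, 'w2) eqbundle_scheme"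
  assumes mat_1: "mat 1 \<in> \<Gamma>" and mult_closed: "\<And>\<gamma> \<delta>. \<gamma> \<in> \<Gamma> \<Longrightarrow> \<delta> \<in> \<Gamma> \<Longrightarrow> \<gamma> ** \<delta> \<in> \<Gamma>"
    and equivariant1: "equivariant_bundle G (top_subgroup SO3 \<Gamma>) (*v) \<xi>1" and base1: "base_space \<xi>1 = S2"
    and equivariant2: "equivariant_bundle G (top_subgroup SO3 \<Gamma>) (*v) \<xi>2" and base2: "base_space \<xi>2 = S2"
    and isotropy: "same_isotropy_reps G (top_subgroup SO3 \<Gamma>) (*v) \<xi>1 \<xi>2"
begin

lemma matrix_power_closed: "\<gamma> \<in> \<Gamma> \<Longrightarrow> matrix_power \<gamma> k \<in> \<Gamma>"
  by (induction k) (auto simp: mat_1 mult_closed)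

lemma
  fixes \<xi> :: "('e, real^3, 'g, real^3^3, 'w) eqbundle_scheme"
  assumes "equivariant_bundle G (top_subgroup SO3 \<Gamma>) (*v) \<xi>"
  shows equivariant_principal: "principal_bundle G \<xi>"
    and lact_continuous: "\<gamma> \<in> \<Gamma> \<Longrightarrow> continuous_map (total_space \<xi>) (total_space \<xi>) (lact \<xi> \<gamma>)"
    and lact_closed: "\<gamma> \<in> \<Gamma> \<Longrightarrow> e \<in> topspace (total_space \<xi>) \<Longrightarrow> lact \<xi> \<gamma> e \<in> topspace (total_space \<xi>)"
    and bproj_lact: "\<gamma> \<in> \<Gamma> \<Longrightarrow> e \<in> topspace (total_space \<xi>) \<Longrightarrow> bproj \<xi> (lact \<xi> \<gamma> e) = \<gamma> *v bproj \<xi> e"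
    and lact_ract: "\<gamma> \<in> \<Gamma> \<Longrightarrow> e \<in> topspace (total_space \<xi>) \<Longrightarrow> g \<in> carrier G \<Longrightarrow>
      lact \<xi> \<gamma> (ract \<xi> e g) = ract \<xi> (lact \<xi> \<gamma> e) g"
    and lact_mult: "\<gamma> \<in> \<Gamma> \<Longrightarrow> \<delta> \<in> \<Gamma> \<Longrightarrow> e \<in> topspace (total_space \<xi>) \<Longrightarrow> lact \<xi> (\<gamma> ** \<delta>) e = lact \<xi> \<gamma> (lact \<xi> \<delta> e)"
    and lact_one: "e \<in> topspace (total_space \<xi>) \<Longrightarrow> lact \<xi> (mat 1) e = e"
proof -
  show "principal_bundle G \<xi>"
    using assms by (simp add: equivariant_bundle_def)
  have ls: "left_space (top_subgroup SO3 \<Gamma>) (total_space \<xi>) (lact \<xi>)"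
    using assms by (simp add: equivariant_bundle_def)
  have top: "topspace (gtop (top_subgroup SO3 \<Gamma>)) = \<Gamma>"
    using assms by (simp add: equivariant_bundle_def topological_group_def)
  have cont: "continuous_map (total_space \<xi>) (total_space \<xi>) (lact \<xi> \<gamma>)" if "\<gamma> \<in> \<Gamma>" for \<gamma>
  proof -
    have "continuous_map (total_space \<xi>) (prod_topology (gtop (top_subgroup SO3 \<Gamma>)) (total_space \<xi>)) (\<lambda>e. (\<gamma>, e))"
      using that top by (intro continuous_map_pairedI) auto
    moreover have "continuous_map (prod_topology (gtop (top_subgroup SO3 \<Gamma>)) (total_space \<xi>)) (total_space \<xi>) (\<lambda>(\<gamma>, e). lact \<xi> \<gamma> e)"
      using ls by (simp add: left_space_def)
    ultimately show ?thesis
      using continuous_map_compose[of "total_space \<xi>" _ "\<lambda>e. (\<gamma>, e)" "total_space \<xi>" "\<lambda>(\<gamma>, e). lact \<xi> \<gamma> e"]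
      by (simp add: o_def)
  qed
  show "\<gamma> \<in> \<Gamma> \<Longrightarrow> continuous_map (total_space \<xi>) (total_space \<xi>) (lact \<xi> \<gamma>)" by (rule cont)
  show "\<gamma> \<in> \<Gamma> \<Longrightarrow> e \<in> topspace (total_space \<xi>) \<Longrightarrow> lact \<xi> \<gamma> e \<in> topspace (total_space \<xi>)"
    using continuous_map_image_subset_topspace[OF cont] by blast
  show "\<gamma> \<in> \<Gamma> \<Longrightarrow> e \<in> topspace (total_space \<xi>) \<Longrightarrow> bproj \<xi> (lact \<xi> \<gamma> e) = \<gamma> *v bproj \<xi> e"
    "\<gamma> \<in> \<Gamma> \<Longrightarrow> e \<in> topspace (total_space \<xi>) \<Longrightarrow> g \<in> carrier G \<Longrightarrow>
      lact \<xi> \<gamma> (ract \<xi> e g) = ract \<xi> (lact \<xi> \<gamma> e) g"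
    using assms by (simp_all add: equivariant_bundle_def)
  show "\<gamma> \<in> \<Gamma> \<Longrightarrow> \<delta> \<in> \<Gamma> \<Longrightarrow> e \<in> topspace (total_space \<xi>) \<Longrightarrow> lact \<xi> (\<gamma> ** \<delta>) e = lact \<xi> \<gamma> (lact \<xi> \<delta> e)"
    "e \<in> topspace (total_space \<xi>) \<Longrightarrow> lact \<xi> (mat 1) e = e"
    using ls by (simp_all add: left_space_def)
qed

lemmas pb1 = equivariant_principal[OF equivariant1] and pb2 = equivariant_principal[OF equivariant2]

text \<open>Conjugation is trivial in an abelian group, so conjugate representations are equal,
  whatever the points \<open>e1\<close> and \<open>e2\<close> of the fibres.\<close>

lemma isotropy_translation:
  assumes \<gamma>: "\<gamma> \<in> \<Gamma>" and e: "e1 \<in> topspace (total_space \<xi>1)" "e2 \<in> topspace (total_space \<xi>2)"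
    and x: "bproj \<xi>1 e1 = x" "bproj \<xi>2 e2 = x" "\<gamma> *v x = x"
  shows "translation G \<xi>1 e1 (lact \<xi>1 \<gamma> e1) = translation G \<xi>2 e2 (lact \<xi>2 \<gamma> e2)"
proof -
  have "x \<in> topspace (base_space \<xi>1)"
    using bproj_closed[OF pb1 e(1)] x by simp
  moreover have "\<gamma> \<in> stabilizer (top_subgroup SO3 \<Gamma>) (*v) x"
    using \<gamma> x by (simp add: stabilizer_def)
  ultimately obtain h where h: "h \<in> carrier G"
    "isotropy_rep G \<xi>2 e2 \<gamma> = h \<otimes> isotropy_rep G \<xi>1 e1 \<gamma> \<otimes> inv h"
    using isotropy e x unfolding same_isotropy_reps_def by blast
  have r: "isotropy_rep G \<xi>1 e1 \<gamma> = translation G \<xi>1 e1 (lact \<xi>1 \<gamma> e1)"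
    "isotropy_rep G \<xi>2 e2 \<gamma> = translation G \<xi>2 e2 (lact \<xi>2 \<gamma> e2)"
    by (simp_all add: isotropy_rep_def translation_def)
  have "translation G \<xi>1 e1 (lact \<xi>1 \<gamma> e1) \<in> carrier G"
    by (rule translation_closed[OF pb1 e(1) lact_closed[OF equivariant1 \<gamma> e(1)]])
      (use bproj_lact[OF equivariant1 \<gamma> e(1)] x in simp)
  then show ?thesis
    using h unfolding r by (simp add: m_comm[of h] m_assoc)
qed

text \<open>Equivalently, the fibrewise isomorphism that takes \<open>\<sigma>1\<close> to \<open>\<sigma>2\<close> commutes with \<open>\<gamma>\<close>.\<close>

definition matched :: "(real^3^3) \<Rightarrow> complex \<Rightarrow> (complex \<Rightarrow> 'e1) \<Rightarrow> (complex \<Rightarrow> 'e2) \<Rightarrow> bool" where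
  "matched \<gamma> \<omega> \<sigma>1 \<sigma>2 \<longleftrightarrow> (\<forall>z\<in>disc. \<exists>g\<in>carrier G.
     lact \<xi>1 \<gamma> (\<sigma>1 z) = ract \<xi>1 (\<sigma>1 (\<omega> * z)) g \<and> lact \<xi>2 \<gamma> (\<sigma>2 z) = ract \<xi>2 (\<sigma>2 (\<omega> * z)) g)"

lemma lact_lifts:
  fixes \<xi> :: "('e, real^3, 'g, real^3^3, 'w) eqbundle_scheme"
  assumes eqv: "equivariant_bundle G (top_subgroup SO3 \<Gamma>) (*v) \<xi>" and \<gamma>: "\<gamma> \<in> \<Gamma>"
    and \<sigma>: "lifts \<xi> X f \<sigma>"
  shows "lifts \<xi> X (\<lambda>x. \<gamma> *v f x) (\<lambda>x. lact \<xi> \<gamma> (\<sigma> x))"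
  unfolding lifts_def
proof
  show "continuous_map X (total_space \<xi>) (\<lambda>x. lact \<xi> \<gamma> (\<sigma> x))"
    using continuous_map_compose[OF lifts_continuous[OF \<sigma>] lact_continuous[OF eqv \<gamma>]] by (simp add: o_def)
  show "\<forall>x\<in>topspace X. bproj \<xi> (lact \<xi> \<gamma> (\<sigma> x)) = \<gamma> *v f x"
    using bproj_lact[OF eqv \<gamma> lifts_closed[OF \<sigma>]] lifts_bproj[OF \<sigma>] by simp
qed

text \<open>The functions \<open>a k\<close> measure how far the lift \<open>\<sigma>\<close> is
  from being invariant under the powers of \<open>\<gamma>\<close>. The cocycle identity expresses
  that the left action is an action and commutes with the right one. In the parametrization
  \<open>q\<close> the rotation is multiplication by \<open>\<zeta>\<close>.\<close>

lemma rotation_cocycle: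
  fixes \<xi> :: "('e, real^3, 'g, real^3^3, 'w) eqbundle_scheme" and n :: nat and q :: "complex \<Rightarrow> real^3"
  defines "\<zeta> \<equiv> cis (2 * pi / real n)"
  assumes eqv: "equivariant_bundle G (top_subgroup SO3 \<Gamma>) (*v) \<xi>" and \<gamma>: "\<gamma> \<in> \<Gamma>"
    and rot: "\<And>z. \<gamma> *v q z = q (\<zeta> * z)"
    and \<sigma>: "lifts \<xi> (top_of_set disc) q \<sigma>"
  defines "a \<equiv> \<lambda>k z. translation G \<xi> (\<sigma> (\<zeta> ^ k * z)) (lact \<xi> (matrix_power \<gamma> k) (\<sigma> z))"
  shows "continuous_map (top_of_set disc) (gtop G) (a k)"
    and "z \<in> disc \<Longrightarrow> lact \<xi> (matrix_power \<gamma> k) (\<sigma> z) = ract \<xi> (\<sigma> (\<zeta> ^ k * z)) (a k z)"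
    and "z \<in> disc \<Longrightarrow> a (j + k) z = a j (\<zeta> ^ k * z) \<otimes> a k z"
    and "z \<in> disc \<Longrightarrow> matrix_power \<gamma> m = mat 1 \<Longrightarrow> \<zeta> ^ m = 1 \<Longrightarrow> a m z = \<one>"
proof -
  note pb = equivariant_principal[OF eqv]
  have \<zeta>z: "\<zeta> ^ k * z \<in> disc" if "z \<in> disc" for k z
    using that by (simp add: norm_mult norm_power \<zeta>_def)
  have rotk: "matrix_power \<gamma> k *v q z = q (\<zeta> ^ k * z)" for k z
  proof (induction k)
    case (Suc k)
    then show ?case
      using rot[of "\<zeta> ^ k * z"] by (simp add: matrix_vector_mul_assoc[symmetric] mult.assoc)
  qed simp
  have l: "lifts \<xi> (top_of_set disc) (\<lambda>z. q (\<zeta> ^ k * z)) (\<lambda>z. \<sigma> (\<zeta> ^ k * z))" for k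
    by (rule lifts_compose[OF \<sigma>]) (use \<zeta>z in \<open>auto intro!: continuous_intros simp del: mem_cball\<close>)
  have l': "lifts \<xi> (top_of_set disc) (\<lambda>z. q (\<zeta> ^ k * z)) (\<lambda>z. lact \<xi> (matrix_power \<gamma> k) (\<sigma> z))" for k
    using lact_lifts[OF eqv matrix_power_closed[OF \<gamma>] \<sigma>, of k] by (simp add: rotk)
  show c: "continuous_map (top_of_set disc) (gtop G) (a k)" for k
    unfolding a_def by (rule continuous_translation_lifts[OF pb l l'])
  show e: "lact \<xi> (matrix_power \<gamma> k) (\<sigma> z) = ract \<xi> (\<sigma> (\<zeta> ^ k * z)) (a k z)" if "z \<in> disc" for k z
    unfolding a_def using ract_translation_lifts[OF pb l l', of z k] that by simp
  have aG: "a k z \<in> carrier G" if "z \<in> disc" for k z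
    using continuous_carrier[OF c] that by simp
  have \<sigma>E: "\<sigma> z \<in> topspace (total_space \<xi>)" if "z \<in> disc" for z
    using lifts_closed[OF \<sigma>] that by simp
  show "a (j + k) z = a j (\<zeta> ^ k * z) \<otimes> a k z" if z: "z \<in> disc" for j k z
  proof -
    note kz = \<zeta>z[OF z, of k]
    have "ract \<xi> (\<sigma> (\<zeta> ^ (j + k) * z)) (a (j + k) z) = lact \<xi> (matrix_power \<gamma> j) (lact \<xi> (matrix_power \<gamma> k) (\<sigma> z))"
      using e[OF z, of "j + k"] lact_mult[OF eqv matrix_power_closed[OF \<gamma>] matrix_power_closed[OF \<gamma>] \<sigma>E[OF z]]
      by (simp add: matrix_power_add)
    also have "\<dots> = ract \<xi> (lact \<xi> (matrix_power \<gamma> j) (\<sigma> (\<zeta> ^ k * z))) (a k z)"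
      unfolding e[OF z] by (rule lact_ract[OF eqv matrix_power_closed[OF \<gamma>] \<sigma>E[OF kz] aG[OF z]])
    also have "\<dots> = ract \<xi> (\<sigma> (\<zeta> ^ j * (\<zeta> ^ k * z))) (a j (\<zeta> ^ k * z) \<otimes> a k z)"
      unfolding e[OF kz] using ract_mult[OF pb \<sigma>E[OF \<zeta>z[OF kz]] aG[OF kz] aG[OF z]] by simp
    also have "\<zeta> ^ j * (\<zeta> ^ k * z) = \<zeta> ^ (j + k) * z"
      by (simp add: power_add)
    finally show ?thesis
      by (rule ract_right_cancel[OF pb \<sigma>E[OF \<zeta>z[OF z]] aG[OF z] m_closed[OF aG[OF kz] aG[OF z]]])
  qed
  show "a m z = \<one>" if "z \<in> disc" "matrix_power \<gamma> m = mat 1" "\<zeta> ^ m = 1" for m z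
    unfolding a_def that(2,3)
    using translation_ract[OF pb \<sigma>E[OF that(1)], of \<one>] ract_one[OF pb \<sigma>E[OF that(1)]] lact_one[OF eqv \<sigma>E[OF that(1)]]
    by simp
qed

text \<open>The centre of the disc is a fixed point, and equality of the isotropy representations
  there makes the quotient of the two cocycles trivial at 0. Then \<open>cocycle_trivial\<close>
  applies, and its solution \<open>f\<close> corrects \<open>\<sigma>2\<close> so that both lifts
  have the same cocycle.\<close>

lemma matched_exists:
  fixes n :: nat and q :: "complex \<Rightarrow> real^3"
  defines "\<zeta> \<equiv> cis (2 * pi / real n)"
  assumes n: "n > 0" and \<gamma>: "\<gamma> \<in> \<Gamma>" "matrix_power \<gamma> n = mat 1"
    and rot: "\<And>z. \<gamma> *v q z = q (\<zeta> * z)" and q: "continuous_on disc q" "q ` disc \<subseteq> sphere 0 1"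
  shows "\<exists>\<sigma>1 \<sigma>2. lifts \<xi>1 (top_of_set disc) q \<sigma>1 \<and> lifts \<xi>2 (top_of_set disc) q \<sigma>2 \<and> matched \<gamma> \<zeta> \<sigma>1 \<sigma>2"
proof -
  have "continuous_map (top_of_set disc) S2 q"
    using q by (auto simp: S2_def)
  then obtain \<sigma>1 \<sigma>2 where \<sigma>: "lifts \<xi>1 (top_of_set disc) q \<sigma>1" "lifts \<xi>2 (top_of_set disc) q \<sigma>2"
    using disc_lift_exists[OF pb1, of q] disc_lift_exists[OF pb2, of q] base1 base2 by auto
  define a1 where "a1 k z = translation G \<xi>1 (\<sigma>1 (\<zeta> ^ k * z)) (lact \<xi>1 (matrix_power \<gamma> k) (\<sigma>1 z))" for k z
  define a2 where "a2 k z = translation G \<xi>2 (\<sigma>2 (\<zeta> ^ k * z)) (lact \<xi>2 (matrix_power \<gamma> k) (\<sigma>2 z))" for k z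
  note r1 = rotation_cocycle[OF equivariant1 \<gamma>(1), of q n, folded \<zeta>_def, OF rot \<sigma>(1), folded a1_def]
  note r2 = rotation_cocycle[OF equivariant2 \<gamma>(1), of q n, folded \<zeta>_def, OF rot \<sigma>(2), folded a2_def]
  have \<zeta>n: "\<zeta> ^ n = 1"
    using n by (simp add: \<zeta>_def Complex.DeMoivre)
  have \<zeta>z: "\<zeta> ^ k * z \<in> disc" if "z \<in> disc" for k z
    using that by (simp add: norm_mult norm_power \<zeta>_def)
  have aG: "a1 k z \<in> carrier G" "a2 k z \<in> carrier G" if "z \<in> disc" for k z
    using continuous_carrier[OF r1(1)] continuous_carrier[OF r2(1)] that by auto
  have rotk: "matrix_power \<gamma> k *v q 0 = q 0" for k
  proof (induction k)
    case (Suc k)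
    then show ?case
      using rot[of 0] by (simp add: matrix_vector_mul_assoc[symmetric])
  qed simp
  define a where "a k z = a2 k z \<otimes> inv (a1 k z)" for k z
  have "\<exists>f. continuous_map (top_of_set disc) (gtop G) f \<and> (\<forall>z\<in>disc. f (cis (2 * pi / real n) * z) = f z \<otimes> a 1 z)"
  proof (rule cocycle_trivial[OF n, of a])
    show "continuous_map (top_of_set disc) (gtop G) (a k)" for k
      unfolding a_def by (intro continuous_mult continuous_inv r1(1) r2(1))
    show "a k 0 = \<one>" for k
    proof -
      have "a1 k 0 = a2 k 0"
        unfolding a1_def a2_def using isotropy_translation[OF matrix_power_closed[OF \<gamma>(1)] lifts_closed[OF \<sigma>(1)] lifts_closed[OF \<sigma>(2)], of 0 0 "q 0" k]
          lifts_bproj[OF \<sigma>(1), of 0] lifts_bproj[OF \<sigma>(2), of 0] rotk by simp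
      then show ?thesis
        unfolding a_def using aG[of 0 k] by simp
    qed
    show "a 0 z = \<one>" "a n z = \<one>" if "z \<in> disc" for z
      unfolding a_def using r1(4)[OF that] r2(4)[OF that] \<gamma>(2) \<zeta>n by simp_all
    show "a (j + k) z = a j (cis (2 * pi / real n) ^ k * z) \<otimes> a k z" if z: "z \<in> disc" for j k z
    proof -
      note c = aG[OF z, of k] aG[OF \<zeta>z[OF z, of k], of j]
      have "a (j + k) z = (a2 j (\<zeta> ^ k * z) \<otimes> a2 k z) \<otimes> inv (a1 j (\<zeta> ^ k * z) \<otimes> a1 k z)"
        unfolding a_def using r1(3)[OF z] r2(3)[OF z] by simp
      also have "\<dots> = a j (\<zeta> ^ k * z) \<otimes> a k z"
        unfolding a_def using c by (simp add: inv_mult m_ac)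
      finally show ?thesis by (simp add: \<zeta>_def)
    qed
  qed
  then obtain f where f: "continuous_map (top_of_set disc) (gtop G) f" "\<And>z. z \<in> disc \<Longrightarrow> f (\<zeta> * z) = f z \<otimes> a 1 z"
    unfolding \<zeta>_def by blast
  have fG: "f z \<in> carrier G" if "z \<in> disc" for z
    using continuous_carrier[OF f(1)] that by simp
  have "matched \<gamma> \<zeta> \<sigma>1 (\<lambda>z. ract \<xi>2 (\<sigma>2 z) (f z))"
    unfolding matched_def
  proof
    fix z assume z: "z \<in> disc"
    have \<zeta>1: "\<zeta> * z \<in> disc" using \<zeta>z[OF z, of 1] by simp
    have \<sigma>2E: "\<sigma>2 z \<in> topspace (total_space \<xi>2)" "\<sigma>2 (\<zeta> * z) \<in> topspace (total_space \<xi>2)"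
      using lifts_closed[OF \<sigma>(2)] z \<zeta>1 by auto
    have "lact \<xi>1 \<gamma> (\<sigma>1 z) = ract \<xi>1 (\<sigma>1 (\<zeta> * z)) (a1 1 z)"
      using r1(2)[OF z, of 1] by simp
    moreover have "lact \<xi>2 \<gamma> (ract \<xi>2 (\<sigma>2 z) (f z)) = ract \<xi>2 (ract \<xi>2 (\<sigma>2 (\<zeta> * z)) (f (\<zeta> * z))) (a1 1 z)"
    proof -
      have "lact \<xi>2 \<gamma> (ract \<xi>2 (\<sigma>2 z) (f z)) = ract \<xi>2 (lact \<xi>2 \<gamma> (\<sigma>2 z)) (f z)"
        by (rule lact_ract[OF equivariant2 \<gamma>(1) \<sigma>2E(1) fG[OF z]])
      also have "\<dots> = ract \<xi>2 (\<sigma>2 (\<zeta> * z)) (a2 1 z \<otimes> f z)"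
        using r2(2)[OF z, of 1] ract_mult[OF pb2 \<sigma>2E(2) aG(2)[OF z, of 1] fG[OF z]] by simp
      also have "a2 1 z \<otimes> f z = f (\<zeta> * z) \<otimes> a1 1 z"
        unfolding f(2)[OF z] a_def
        using aG[OF z, of 1] fG[OF z] m_comm[of "a2 1 z" "f z"] by (simp add: m_assoc)
      finally show ?thesis
        using ract_mult[OF pb2 \<sigma>2E(2) fG[OF \<zeta>1] aG(1)[OF z, of 1]] by simp
    qed
    ultimately show "\<exists>g\<in>carrier G. lact \<xi>1 \<gamma> (\<sigma>1 z) = ract \<xi>1 (\<sigma>1 (\<zeta> * z)) g \<and>
        lact \<xi>2 \<gamma> (ract \<xi>2 (\<sigma>2 z) (f z)) = ract \<xi>2 (ract \<xi>2 (\<sigma>2 (\<zeta> * z)) (f (\<zeta> * z))) g"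
      using aG(1)[OF z] by blast
  qed
  then show ?thesis
    using \<sigma>(1) lifts_ract[OF pb2 \<sigma>(2) f(1)] by blast
qed

section \<open>Transition functions along the equator\<close>

lemma equator_transition:
  fixes \<xi> :: "('e, real^3, 'g, 'w) pbundle_scheme"
  assumes pb: "principal_bundle G \<xi>"
    and N: "lifts \<xi> (top_of_set disc) (\<lambda>z. R *v upper z) \<sigma>N" and S: "lifts \<xi> (top_of_set disc) (\<lambda>z. R *v lower z) \<sigma>S"
  shows "\<exists>t. continuous_map (top_of_set (sphere 0 1)) (gtop G) t \<and>
    (\<forall>z\<in>sphere 0 1. t z \<in> carrier G \<and> \<sigma>N z = ract \<xi> (\<sigma>S z) (t z))"
proof -
  have l: "lifts \<xi> (top_of_set (sphere 0 1)) (\<lambda>z. R *v upper z) \<sigma>N"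
    by (rule lifts_compose[OF N, of "sphere 0 1" "\<lambda>z. z", simplified])
  have "lifts \<xi> (top_of_set (sphere 0 1)) (\<lambda>z. R *v lower z) \<sigma>S"
    by (rule lifts_compose[OF S, of "sphere 0 1" "\<lambda>z. z", simplified])
  then have l': "lifts \<xi> (top_of_set (sphere 0 1)) (\<lambda>z. R *v upper z) \<sigma>S"
    using upper_eq_lower by (simp add: lifts_def)
  note c = continuous_translation_lifts[OF pb l' l]
  then show ?thesis
    using continuous_carrier[OF c] ract_translation_lifts[OF pb l' l] by (intro exI[of _ "\<lambda>z. translation G \<xi> (\<sigma>S z) (\<sigma>N z)"]) simp
qed

text \<open>Divisibility of the difference of the clutching classes, seen in a frame
  \<open>R\<close> whose pole lies on the axis of a subgroup. The frame is removed by
  \<open>clutching_rotation\<close>.\<close>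

definition divisible_at :: "real^3^3 \<Rightarrow> nat \<Rightarrow> bool" where
  "divisible_at R m \<longleftrightarrow> (\<exists>w1 w2 v. clutching G \<xi>1 (\<lambda>z. R *v square_to_S2 z) w1 \<and>
     clutching G \<xi>2 (\<lambda>z. R *v square_to_S2 z) w2 \<and>
     continuous_map (top_of_set square_boundary) (gtop G) v \<and>
     boundary_equiv G (\<lambda>z. w1 z \<otimes> inv (w2 z)) (\<lambda>z. v z [^] m))"

text \<open>The transition function changes under the rotation by a northern and a southern factor.
  Matching makes these factors common to both bundles, so they cancel in the quotient.\<close>

lemma matched_transition:
  assumes \<gamma>: "\<gamma> \<in> \<Gamma>" and \<omega>: "cmod \<omega> = 1"
    and N: "lifts \<xi>1 (top_of_set disc) (\<lambda>z. R *v upper z) \<sigma>1N" "lifts \<xi>2 (top_of_set disc) (\<lambda>z. R *v upper z) \<sigma>2N"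
      "matched \<gamma> \<omega> \<sigma>1N \<sigma>2N"
    and S: "lifts \<xi>1 (top_of_set disc) (\<lambda>z. R *v lower z) \<sigma>1S" "lifts \<xi>2 (top_of_set disc) (\<lambda>z. R *v lower z) \<sigma>2S"
      "matched \<gamma> \<omega> \<sigma>1S \<sigma>2S"
    and t1: "\<And>z. z \<in> sphere 0 1 \<Longrightarrow> t1 z \<in> carrier G \<and> \<sigma>1N z = ract \<xi>1 (\<sigma>1S z) (t1 z)"
    and t2: "\<And>z. z \<in> sphere 0 1 \<Longrightarrow> t2 z \<in> carrier G \<and> \<sigma>2N z = ract \<xi>2 (\<sigma>2S z) (t2 z)"
    and z: "z \<in> sphere 0 1"
  shows "t1 (\<omega> * z) \<otimes> inv (t2 (\<omega> * z)) = t1 z \<otimes> inv (t2 z)"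
proof -
  have zd: "z \<in> disc" "\<omega> * z \<in> disc" "\<omega> * z \<in> sphere 0 1"
    using z \<omega> by (auto simp: norm_mult)
  obtain m where m: "m \<in> carrier G" "lact \<xi>1 \<gamma> (\<sigma>1N z) = ract \<xi>1 (\<sigma>1N (\<omega> * z)) m" "lact \<xi>2 \<gamma> (\<sigma>2N z) = ract \<xi>2 (\<sigma>2N (\<omega> * z)) m"
    using N(3) zd unfolding matched_def by blast
  obtain l where l: "l \<in> carrier G" "lact \<xi>1 \<gamma> (\<sigma>1S z) = ract \<xi>1 (\<sigma>1S (\<omega> * z)) l" "lact \<xi>2 \<gamma> (\<sigma>2S z) = ract \<xi>2 (\<sigma>2S (\<omega> * z)) l"
    using S(3) zd unfolding matched_def by blast
  \<comment> \<open>The image of \<open>\<sigma>N z\<close> under \<open>\<gamma>\<close> is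
    computed in two ways: with the northern factor \<open>m\<close>, and through
    \<open>\<sigma>S z\<close> with the southern factor \<open>l\<close>.\<close>
  have key: "t (\<omega> * z) \<otimes> m = l \<otimes> t z"
    if eqv: "equivariant_bundle G (top_subgroup SO3 \<Gamma>) (*v) \<xi>" and \<sigma>: "lifts \<xi> (top_of_set disc) (\<lambda>z. R *v lower z) \<sigma>S"
      and t: "\<And>z. z \<in> sphere 0 1 \<Longrightarrow> t z \<in> carrier G \<and> \<sigma>N z = ract \<xi> (\<sigma>S z) (t z)"
      and mm: "lact \<xi> \<gamma> (\<sigma>N z) = ract \<xi> (\<sigma>N (\<omega> * z)) m" and ll: "lact \<xi> \<gamma> (\<sigma>S z) = ract \<xi> (\<sigma>S (\<omega> * z)) l"
    for \<xi> :: "('e, real^3, 'g, real^3^3, 'w) eqbundle_scheme" and \<sigma>N \<sigma>S t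
  proof -
    note pb = equivariant_principal[OF eqv]
    have E: "\<sigma>S z \<in> topspace (total_space \<xi>)" "\<sigma>S (\<omega> * z) \<in> topspace (total_space \<xi>)"
      using lifts_closed[OF \<sigma>] zd by auto
    have tc: "t z \<in> carrier G" "t (\<omega> * z) \<in> carrier G" using t z zd by auto
    have "ract \<xi> (\<sigma>S (\<omega> * z)) (t (\<omega> * z) \<otimes> m) = lact \<xi> \<gamma> (\<sigma>N z)"
      using mm t[OF zd(3)] ract_mult[OF pb E(2) tc(2) m(1)] by simp
    also have "\<dots> = ract \<xi> (lact \<xi> \<gamma> (\<sigma>S z)) (t z)"
      using t[OF z] lact_ract[OF eqv \<gamma> E(1) tc(1)] by simp
    also have "\<dots> = ract \<xi> (\<sigma>S (\<omega> * z)) (l \<otimes> t z)"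
      using ll ract_mult[OF pb E(2) l(1) tc(1)] by simp
    finally show ?thesis
      by (rule ract_right_cancel[OF pb E(2) m_closed[OF tc(2) m(1)] m_closed[OF l(1) tc(1)]])
  qed
  have k1: "t1 (\<omega> * z) \<otimes> m = l \<otimes> t1 z"
    by (rule key[OF equivariant1 S(1) t1 m(2) l(2)])
  have k2: "t2 (\<omega> * z) \<otimes> m = l \<otimes> t2 z"
    by (rule key[OF equivariant2 S(2) t2 m(3) l(3)])
  have c: "t1 z \<in> carrier G" "t2 z \<in> carrier G" "t1 (\<omega> * z) \<in> carrier G" "t2 (\<omega> * z) \<in> carrier G"
    using t1 t2 z zd by auto
  have "t1 (\<omega> * z) = (l \<otimes> inv m) \<otimes> t1 z" "t2 (\<omega> * z) = (l \<otimes> inv m) \<otimes> t2 z"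
    using k1 k2 c m(1) l(1) inv_solve_right[of "t1 (\<omega> * z)" "l \<otimes> t1 z" m] inv_solve_right[of "t2 (\<omega> * z)" "l \<otimes> t2 z" m]
    by (simp_all add: m_ac)
  then have "t1 (\<omega> * z) \<otimes> inv (t2 (\<omega> * z)) = ((l \<otimes> inv m) \<otimes> inv (l \<otimes> inv m)) \<otimes> (t1 z \<otimes> inv (t2 z))"
    using c m(1) l(1) inv_mult[of "l \<otimes> inv m" "t2 z"] by (simp add: m_ac del: r_inv Units_r_inv)
  then show ?thesis
    using c m(1) l(1) by simp
qed

lemma divisible_at_of_power:
  assumes N: "lifts \<xi>1 (top_of_set disc) (\<lambda>z. R *v upper z) \<sigma>1N" "lifts \<xi>2 (top_of_set disc) (\<lambda>z. R *v upper z) \<sigma>2N"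
    and S: "lifts \<xi>1 (top_of_set disc) (\<lambda>z. R *v lower z) \<sigma>1S" "lifts \<xi>2 (top_of_set disc) (\<lambda>z. R *v lower z) \<sigma>2S"
    and t1: "continuous_map (top_of_set (sphere 0 1)) (gtop G) t1" "\<forall>z\<in>sphere 0 1. t1 z \<in> carrier G \<and> \<sigma>1N z = ract \<xi>1 (\<sigma>1S z) (t1 z)"
    and t2: "continuous_map (top_of_set (sphere 0 1)) (gtop G) t2" "\<forall>z\<in>sphere 0 1. t2 z \<in> carrier G \<and> \<sigma>2N z = ract \<xi>2 (\<sigma>2S z) (t2 z)"
    and V: "continuous_map (top_of_set (sphere 0 1)) (gtop G) V"
      "disc_null G (\<lambda>z. (t1 z \<otimes> inv (t2 z)) \<otimes> inv (V z [^] (m::nat)))"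
  shows "divisible_at R m"
  unfolding divisible_at_def
proof (intro exI conjI)
  show "clutching G \<xi>1 (\<lambda>z. R *v square_to_S2 z) (\<lambda>z. t1 (square_to_disc z))"
    by (rule clutching_hemispheres[OF pb1 N(1) S(1) t1(1)]) (use t1(2) in blast)
  show "clutching G \<xi>2 (\<lambda>z. R *v square_to_S2 z) (\<lambda>z. t2 (square_to_disc z))"
    by (rule clutching_hemispheres[OF pb2 N(2) S(2) t2(1)]) (use t2(2) in blast)
  show "continuous_map (top_of_set square_boundary) (gtop G) (\<lambda>z. V (square_to_disc z))"
    by (rule continuous_map_compose_top_of_set[OF V(1) continuous_square_to_disc]) (use square_to_disc_boundary in blast)
  show "boundary_equiv G (\<lambda>z. t1 (square_to_disc z) \<otimes> inv t2 (square_to_disc z)) (\<lambda>z. V (square_to_disc z) [^] m)"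
    by (rule boundary_equiv_of_disc_null[OF V(2)]) (intro continuous_mult continuous_inv continuous_pow t1(1) t2(1) V(1))+
qed

lemma upper_rotate: "cmod \<omega> = 1 \<Longrightarrow> upper (\<omega> * z) = sphere_point (\<omega> * z) (sqrt (1 - (cmod z)\<^sup>2))"
  and lower_rotate: "cmod \<omega> = 1 \<Longrightarrow> lower (\<omega> * z) = sphere_point (\<omega> * z) (- sqrt (1 - (cmod z)\<^sup>2))"
  by (simp_all add: upper_def lower_def norm_mult)

lemma hemisphere_matched:
  fixes n :: nat
  defines "\<zeta> \<equiv> cis (2 * pi / real n)"
  assumes n: "n > 0" and \<gamma>: "\<gamma> \<in> \<Gamma>" "matrix_power \<gamma> n = mat 1"
    and rot: "\<And>z h. \<gamma> *v (R *v sphere_point z h) = R *v sphere_point (\<zeta> * z) h"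
    and R: "\<And>x. x \<in> sphere 0 1 \<Longrightarrow> R *v x \<in> sphere 0 1"
  shows "\<exists>\<sigma>1 \<sigma>2. lifts \<xi>1 (top_of_set disc) (\<lambda>z. R *v upper z) \<sigma>1 \<and> lifts \<xi>2 (top_of_set disc) (\<lambda>z. R *v upper z) \<sigma>2 \<and> matched \<gamma> \<zeta> \<sigma>1 \<sigma>2"
    and "\<exists>\<sigma>1 \<sigma>2. lifts \<xi>1 (top_of_set disc) (\<lambda>z. R *v lower z) \<sigma>1 \<and> lifts \<xi>2 (top_of_set disc) (\<lambda>z. R *v lower z) \<sigma>2 \<and> matched \<gamma> \<zeta> \<sigma>1 \<sigma>2"
proof -
  have \<zeta>: "cmod \<zeta> = 1" by (simp add: \<zeta>_def)
  have cR: "continuous_on disc (\<lambda>z. R *v q z)" if "continuous_on disc q" for q :: "complex \<Rightarrow> real^3"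
    by (rule continuous_on_compose2[OF matrix_vector_mult_linear_continuous_on that subset_UNIV])
  show "\<exists>\<sigma>1 \<sigma>2. lifts \<xi>1 (top_of_set disc) (\<lambda>z. R *v upper z) \<sigma>1 \<and> lifts \<xi>2 (top_of_set disc) (\<lambda>z. R *v upper z) \<sigma>2 \<and> matched \<gamma> \<zeta> \<sigma>1 \<sigma>2"
    unfolding \<zeta>_def
  proof (rule matched_exists[OF n \<gamma>, of "\<lambda>z. R *v upper z"])
    show "\<gamma> *v (R *v upper z) = R *v upper (cis (2 * pi / real n) * z)" for z
      using rot upper_rotate[OF \<zeta>] unfolding \<zeta>_def by (simp add: upper_def)
  qed (use R upper_in_sphere cR[OF continuous_upper] in blast)+
  show "\<exists>\<sigma>1 \<sigma>2. lifts \<xi>1 (top_of_set disc) (\<lambda>z. R *v lower z) \<sigma>1 \<and> lifts \<xi>2 (top_of_set disc) (\<lambda>z. R *v lower z) \<sigma>2 \<and> matched \<gamma> \<zeta> \<sigma>1 \<sigma>2"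
    unfolding \<zeta>_def
  proof (rule matched_exists[OF n \<gamma>, of "\<lambda>z. R *v lower z"])
    show "\<gamma> *v (R *v lower z) = R *v lower (cis (2 * pi / real n) * z)" for z
      using rot lower_rotate[OF \<zeta>] unfolding \<zeta>_def by (simp add: lower_def)
  qed (use R lower_in_sphere cR[OF continuous_lower] in blast)+
qed

lemma cyclic_divisible:
  fixes n :: nat
  defines "\<zeta> \<equiv> cis (2 * pi / real n)"
  assumes n: "n > 0" and \<gamma>: "\<gamma> \<in> \<Gamma>" "matrix_power \<gamma> n = mat 1"
    and rot: "\<And>z h. \<gamma> *v (R *v sphere_point z h) = R *v sphere_point (\<zeta> * z) h"
    and R: "\<And>x. x \<in> sphere 0 1 \<Longrightarrow> R *v x \<in> sphere 0 1"
  shows "divisible_at R n"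
proof -
  note hm = hemisphere_matched[OF n \<gamma>, folded \<zeta>_def, OF rot R]
  obtain \<sigma>1N \<sigma>2N where N: "lifts \<xi>1 (top_of_set disc) (\<lambda>z. R *v upper z) \<sigma>1N" "lifts \<xi>2 (top_of_set disc) (\<lambda>z. R *v upper z) \<sigma>2N"
      "matched \<gamma> \<zeta> \<sigma>1N \<sigma>2N"
    using hm(1) by blast
  obtain \<sigma>1S \<sigma>2S where S: "lifts \<xi>1 (top_of_set disc) (\<lambda>z. R *v lower z) \<sigma>1S" "lifts \<xi>2 (top_of_set disc) (\<lambda>z. R *v lower z) \<sigma>2S"
      "matched \<gamma> \<zeta> \<sigma>1S \<sigma>2S"
    using hm(2) by blast
  obtain t1 where t1: "continuous_map (top_of_set (sphere 0 1)) (gtop G) t1" "\<forall>z\<in>sphere 0 1. t1 z \<in> carrier G \<and> \<sigma>1N z = ract \<xi>1 (\<sigma>1S z) (t1 z)"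
    using equator_transition[OF pb1 N(1) S(1)] by blast
  obtain t2 where t2: "continuous_map (top_of_set (sphere 0 1)) (gtop G) t2" "\<forall>z\<in>sphere 0 1. t2 z \<in> carrier G \<and> \<sigma>2N z = ract \<xi>2 (\<sigma>2S z) (t2 z)"
    using equator_transition[OF pb2 N(2) S(2)] by blast
  have "\<exists>V. continuous_map (top_of_set (sphere 0 1)) (gtop G) V \<and> disc_null G (\<lambda>z. (t1 z \<otimes> inv (t2 z)) \<otimes> inv (V z [^] n))"
  proof (rule rotation_invariant_power[OF _ n])
    show "continuous_map (top_of_set (sphere 0 1)) (gtop G) (\<lambda>z. t1 z \<otimes> inv (t2 z))"
      by (intro continuous_mult continuous_inv t1(1) t2(1))
    show "t1 (cis (2 * pi / real n) * z) \<otimes> inv t2 (cis (2 * pi / real n) * z) = t1 z \<otimes> inv t2 z" if "z \<in> sphere 0 1" for z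
      by (rule matched_transition[OF \<gamma>(1) _ N[unfolded \<zeta>_def] S[unfolded \<zeta>_def] _ _ that]) (use t1(2) t2(2) in auto)
  qed
  then show ?thesis
    using divisible_at_of_power[OF N(1,2) S(1,2) t1 t2] by blast
qed

text \<open>In the disc coordinate the half turn is complex conjugation. Taking
  \<open>\<tau>\<close>-translates as southern lifts costs nothing in matching because of
  \<open>\<gamma> ** \<tau> ** \<gamma> = \<tau>\<close>, and
  \<open>\<tau> ** \<tau> = mat 1\<close> gives the symmetry of the transition functions.\<close>

lemma dihedral_divisible:
  fixes n :: nat
  defines "\<zeta> \<equiv> cis (2 * pi / real n)"
  assumes n: "n > 0" and \<gamma>: "\<gamma> \<in> \<Gamma>" "matrix_power \<gamma> n = mat 1"
    and rot: "\<And>z h. \<gamma> *v (R *v sphere_point z h) = R *v sphere_point (\<zeta> * z) h"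
    and R: "\<And>x. x \<in> sphere 0 1 \<Longrightarrow> R *v x \<in> sphere 0 1"
    and \<tau>: "\<tau> \<in> \<Gamma>" "\<tau> ** \<tau> = mat 1" "\<gamma> ** \<tau> ** \<gamma> = \<tau>"
    and flip: "\<And>z h. \<tau> *v (R *v sphere_point z h) = R *v sphere_point (cnj z) (- h)"
  shows "divisible_at R (2 * n)"
proof -
  have \<zeta>: "cmod \<zeta> = 1" by (simp add: \<zeta>_def)
  note hm = hemisphere_matched[OF n \<gamma>, folded \<zeta>_def, OF rot R]
  obtain \<sigma>1N \<sigma>2N where N: "lifts \<xi>1 (top_of_set disc) (\<lambda>z. R *v upper z) \<sigma>1N" "lifts \<xi>2 (top_of_set disc) (\<lambda>z. R *v upper z) \<sigma>2N"
      "matched \<gamma> \<zeta> \<sigma>1N \<sigma>2N"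
    using hm(1) by blast
  define \<sigma>1S where "\<sigma>1S z = lact \<xi>1 \<tau> (\<sigma>1N (cnj z))" for z
  define \<sigma>2S where "\<sigma>2S z = lact \<xi>2 \<tau> (\<sigma>2N (cnj z))" for z
  have flip_upper: "\<tau> *v (R *v upper (cnj z)) = R *v lower z" for z
    using flip[of "cnj z"] by (simp add: upper_def lower_def)
  have liftS: "lifts \<xi> (top_of_set disc) (\<lambda>z. R *v lower z) (\<lambda>z. lact \<xi> \<tau> (\<sigma> (cnj z)))"
    if "equivariant_bundle G (top_subgroup SO3 \<Gamma>) (*v) \<xi>" "lifts \<xi> (top_of_set disc) (\<lambda>z. R *v upper z) \<sigma>"
    for \<xi> :: "('e, real^3, 'g, real^3^3, 'w) eqbundle_scheme" and \<sigma>
  proof -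
    have "lifts \<xi> (top_of_set disc) (\<lambda>z. R *v upper (cnj z)) (\<lambda>z. \<sigma> (cnj z))"
      by (rule lifts_compose[OF that(2)]) (auto intro!: continuous_intros)
    from lact_lifts[OF that(1) \<tau>(1) this] show ?thesis
      by (simp add: flip_upper)
  qed
  have S: "lifts \<xi>1 (top_of_set disc) (\<lambda>z. R *v lower z) \<sigma>1S" "lifts \<xi>2 (top_of_set disc) (\<lambda>z. R *v lower z) \<sigma>2S"
    unfolding \<sigma>1S_def \<sigma>2S_def by (rule liftS[OF equivariant1 N(1)], rule liftS[OF equivariant2 N(2)])
  \<comment> \<open>By \<open>\<gamma> ** \<tau> ** \<gamma> = \<tau>\<close> the southern factor of
    \<open>\<gamma>\<close> at \<open>z\<close> is the inverse of the northern factor at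
    \<open>cnj (\<zeta> * z)\<close>; a factor shared by both bundles stays shared.\<close>
  have lact_S: "lact \<xi> \<gamma> (lact \<xi> \<tau> (\<sigma> (cnj z))) = ract \<xi> (lact \<xi> \<tau> (\<sigma> (cnj (\<zeta> * z)))) (inv m)"
    if eqv: "equivariant_bundle G (top_subgroup SO3 \<Gamma>) (*v) \<xi>" and \<sigma>: "lifts \<xi> (top_of_set disc) (\<lambda>z. R *v upper z) \<sigma>"
      and z: "z \<in> disc" and m: "m \<in> carrier G" "lact \<xi> \<gamma> (\<sigma> (cnj (\<zeta> * z))) = ract \<xi> (\<sigma> (\<zeta> * cnj (\<zeta> * z))) m"
    for \<xi> :: "('e, real^3, 'g, real^3^3, 'w) eqbundle_scheme" and \<sigma> z m
  proof -
    note pb = equivariant_principal[OF eqv]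
    have "\<zeta> * cnj \<zeta> = 1" using \<zeta> by (simp add: complex_norm_square[symmetric] flip: complex_norm_square)
    then have \<zeta>c: "\<zeta> * cnj (\<zeta> * z) = cnj z" by (simp flip: mult.assoc)
    have E: "\<sigma> (cnj z) \<in> topspace (total_space \<xi>)" "\<sigma> (cnj (\<zeta> * z)) \<in> topspace (total_space \<xi>)"
      using lifts_closed[OF \<sigma>, of "cnj z"] lifts_closed[OF \<sigma>, of "cnj (\<zeta> * z)"] z \<zeta> by (auto simp: norm_mult)
    have c1: "\<gamma> ** \<tau> \<in> \<Gamma>" using mult_closed \<gamma> \<tau> by blast
    have "lact \<xi> \<gamma> (\<sigma> (cnj (\<zeta> * z))) = ract \<xi> (\<sigma> (cnj z)) m"
      using m(2) unfolding \<zeta>c .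
    then have "\<sigma> (cnj z) = ract \<xi> (lact \<xi> \<gamma> (\<sigma> (cnj (\<zeta> * z)))) (inv m)"
      using m(1) ract_mult[OF pb E(1) m(1), of "inv m"] ract_one[OF pb E(1)] by (simp del: complex_cnj_mult)
    then have "lact \<xi> \<gamma> (lact \<xi> \<tau> (\<sigma> (cnj z))) = lact \<xi> (\<gamma> ** \<tau>) (ract \<xi> (lact \<xi> \<gamma> (\<sigma> (cnj (\<zeta> * z)))) (inv m))"
      using lact_mult[OF eqv \<gamma>(1) \<tau>(1) E(1)] by simp
    also have "\<dots> = ract \<xi> (lact \<xi> (\<gamma> ** \<tau>) (lact \<xi> \<gamma> (\<sigma> (cnj (\<zeta> * z))))) (inv m)"
      using lact_ract[OF eqv c1 lact_closed[OF eqv \<gamma>(1) E(2)]] m by simp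
    also have "lact \<xi> (\<gamma> ** \<tau>) (lact \<xi> \<gamma> (\<sigma> (cnj (\<zeta> * z)))) = lact \<xi> \<tau> (\<sigma> (cnj (\<zeta> * z)))"
      using lact_mult[OF eqv c1 \<gamma>(1) E(2)] \<tau>(3) by simp
    finally show ?thesis .
  qed
  have mS: "matched \<gamma> \<zeta> \<sigma>1S \<sigma>2S"
    unfolding matched_def
  proof
    fix z assume z: "z \<in> disc"
    have zc: "cnj (\<zeta> * z) \<in> disc" using z \<zeta> by (simp add: norm_mult)
    then obtain m where m: "m \<in> carrier G" "lact \<xi>1 \<gamma> (\<sigma>1N (cnj (\<zeta> * z))) = ract \<xi>1 (\<sigma>1N (\<zeta> * cnj (\<zeta> * z))) m"
      "lact \<xi>2 \<gamma> (\<sigma>2N (cnj (\<zeta> * z))) = ract \<xi>2 (\<sigma>2N (\<zeta> * cnj (\<zeta> * z))) m"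
      using N(3) unfolding matched_def by blast
    show "\<exists>g\<in>carrier G. lact \<xi>1 \<gamma> (\<sigma>1S z) = ract \<xi>1 (\<sigma>1S (\<zeta> * z)) g \<and> lact \<xi>2 \<gamma> (\<sigma>2S z) = ract \<xi>2 (\<sigma>2S (\<zeta> * z)) g"
      unfolding \<sigma>1S_def \<sigma>2S_def
      using lact_S[OF equivariant1 N(1) z m(1,2)] lact_S[OF equivariant2 N(2) z m(1,3)] m(1) by (intro bexI[of _ "inv m"]) auto
  qed
  obtain t1 where t1: "continuous_map (top_of_set (sphere 0 1)) (gtop G) t1" "\<forall>z\<in>sphere 0 1. t1 z \<in> carrier G \<and> \<sigma>1N z = ract \<xi>1 (\<sigma>1S z) (t1 z)"
    using equator_transition[OF pb1 N(1) S(1)] by blast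
  obtain t2 where t2: "continuous_map (top_of_set (sphere 0 1)) (gtop G) t2" "\<forall>z\<in>sphere 0 1. t2 z \<in> carrier G \<and> \<sigma>2N z = ract \<xi>2 (\<sigma>2S z) (t2 z)"
    using equator_transition[OF pb2 N(2) S(2)] by blast
  \<comment> \<open>Since \<open>\<tau>\<close> is an involution, translating by it the equation
    that defines \<open>t\<close> at \<open>cnj z\<close> gives the equation at \<open>z\<close>
    solved for the other side.\<close>
  have t_cnj: "t (cnj z) = inv (t z)" "lact \<xi> \<tau> (\<sigma> (cnj z)) = ract \<xi> (\<sigma> z) (inv (t z))"
    if eqv: "equivariant_bundle G (top_subgroup SO3 \<Gamma>) (*v) \<xi>" and \<sigma>: "lifts \<xi> (top_of_set disc) (\<lambda>z. R *v upper z) \<sigma>"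
      and t: "\<forall>z\<in>sphere 0 1. t z \<in> carrier G \<and> \<sigma> z = ract \<xi> (lact \<xi> \<tau> (\<sigma> (cnj z))) (t z)" and z: "z \<in> sphere 0 1"
    for \<xi> :: "('e, real^3, 'g, real^3^3, 'w) eqbundle_scheme" and \<sigma> t z
  proof -
    note pb = equivariant_principal[OF eqv]
    have zc: "cnj z \<in> sphere 0 1" using z by simp
    have E: "\<sigma> z \<in> topspace (total_space \<xi>)" "\<sigma> (cnj z) \<in> topspace (total_space \<xi>)"
      using lifts_closed[OF \<sigma>, of z] lifts_closed[OF \<sigma>, of "cnj z"] z by auto
    have tc: "t z \<in> carrier G" "t (cnj z) \<in> carrier G" using t z zc by auto
    have \<tau>E: "lact \<xi> \<tau> (\<sigma> z) \<in> topspace (total_space \<xi>)" "lact \<xi> \<tau> (\<sigma> (cnj z)) \<in> topspace (total_space \<xi>)"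
      using lact_closed[OF eqv \<tau>(1)] E by auto
    show e: "lact \<xi> \<tau> (\<sigma> (cnj z)) = ract \<xi> (\<sigma> z) (inv (t z))"
    proof -
      have \<sigma>z: "\<sigma> z = ract \<xi> (lact \<xi> \<tau> (\<sigma> (cnj z))) (t z)"
        using t z by blast
      have "ract \<xi> (lact \<xi> \<tau> (\<sigma> (cnj z))) (t z \<otimes> inv (t z)) = ract \<xi> (\<sigma> z) (inv (t z))"
        unfolding ract_mult[OF pb \<tau>E(2) tc(1) inv_closed[OF tc(1)]] by (simp flip: \<sigma>z)
      then show ?thesis
        using tc ract_one[OF pb \<tau>E(2)] by simp
    qed
    have "\<sigma> (cnj z) = ract \<xi> (lact \<xi> \<tau> (\<sigma> z)) (t (cnj z))"
      using t zc by fastforce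
    then have "lact \<xi> \<tau> (\<sigma> (cnj z)) = ract \<xi> (lact \<xi> \<tau> (lact \<xi> \<tau> (\<sigma> z))) (t (cnj z))"
      using lact_ract[OF eqv \<tau>(1) \<tau>E(1) tc(2)] by simp
    also have "lact \<xi> \<tau> (lact \<xi> \<tau> (\<sigma> z)) = \<sigma> z"
      using lact_mult[OF eqv \<tau>(1) \<tau>(1) E(1)] \<tau>(2) lact_one[OF eqv E(1)] by simp
    finally have "ract \<xi> (\<sigma> z) (t (cnj z)) = ract \<xi> (\<sigma> z) (inv (t z))"
      using e by simp
    then show "t (cnj z) = inv (t z)"
      using ract_right_cancel[OF pb E(1) tc(2), of "inv (t z)"] tc by simp
  qed
  note c1 = t_cnj[OF equivariant1 N(1) t1(2)[unfolded \<sigma>1S_def]]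
  note c2 = t_cnj[OF equivariant2 N(2) t2(2)[unfolded \<sigma>2S_def]]
  have tG: "t1 z \<in> carrier G" "t2 z \<in> carrier G" if "z \<in> sphere 0 1" for z
    using t1(2) t2(2) that by auto
  have NE: "\<sigma>1N z \<in> topspace (total_space \<xi>1)" "\<sigma>2N z \<in> topspace (total_space \<xi>2)"
    "bproj \<xi>1 (\<sigma>1N z) = R *v upper z" "bproj \<xi>2 (\<sigma>2N z) = R *v upper z" if "z \<in> sphere 0 1" for z
    using lifts_closed[OF N(1), of z] lifts_closed[OF N(2), of z] lifts_bproj[OF N(1), of z] lifts_bproj[OF N(2), of z] that by auto
  \<comment> \<open>The half turn fixes the equatorial point over 1, and its isotropy value there is
    \<open>inv (t 1)\<close>.\<close>
  have one: "t1 1 = t2 1"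
  proof -
    have s1: "(1::complex) \<in> sphere 0 1" by simp
    have "\<tau> *v (R *v upper 1) = R *v upper 1"
      using flip_upper[of 1] upper_eq_lower[of 1] by simp
    from isotropy_translation[OF \<tau>(1) NE(1,2)[OF s1] NE(3,4)[OF s1] this]
    have "translation G \<xi>1 (\<sigma>1N 1) (ract \<xi>1 (\<sigma>1N 1) (inv (t1 1))) = translation G \<xi>2 (\<sigma>2N 1) (ract \<xi>2 (\<sigma>2N 1) (inv (t2 1)))"
      using c1(2)[OF s1] c2(2)[OF s1] by simp
    then have "inv (t1 1) = inv (t2 1)"
      using translation_ract[OF pb1 NE(1)[OF s1]] translation_ract[OF pb2 NE(2)[OF s1]] tG[OF s1] by simp
    then show ?thesis using tG[OF s1] by (metis inv_inv)
  qed
  \<comment> \<open>The equatorial point over \<open>\<eta>\<close> is fixed by the half turn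
    \<open>\<gamma> ** \<tau>\<close>: conjugation sends \<open>\<eta>\<close> to
    \<open>cnj \<eta>\<close> and the rotation by twice its angle brings it back.\<close>
  define \<eta> where "\<eta> = cis (pi / real n)"
  have \<eta>: "\<eta> \<in> sphere 0 1" "cnj \<eta> \<in> sphere 0 1" "cnj \<eta> \<in> disc" by (simp_all add: \<eta>_def)
  have \<zeta>\<eta>: "\<zeta> * cnj \<eta> = \<eta>"
    by (simp add: \<zeta>_def \<eta>_def cis_cnj cis_mult)
  have half: "t1 \<eta> = t2 \<eta>"
  proof -
    have up0: "upper \<eta> = sphere_point \<eta> 0" using \<eta> by (simp add: upper_def)
    have "(\<gamma> ** \<tau>) *v (R *v upper \<eta>) = R *v upper \<eta>"
      using flip[of \<eta> 0] rot[of "cnj \<eta>" 0] by (simp add: up0 \<zeta>\<eta> flip: matrix_vector_mul_assoc)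
    note iso = isotropy_translation[OF mult_closed[OF \<gamma>(1) \<tau>(1)] NE(1,2)[OF \<eta>(1)] NE(3,4)[OF \<eta>(1)] this]
    \<comment> \<open>The isotropy value of \<open>\<gamma> ** \<tau>\<close> at this point is
      \<open>inv (t \<eta>) \<otimes> m\<close>, with the southern factor \<open>m\<close> common to
      both bundles by matching.\<close>
    obtain m where m: "m \<in> carrier G" "lact \<xi>1 \<gamma> (\<sigma>1S (cnj \<eta>)) = ract \<xi>1 (\<sigma>1S \<eta>) m" "lact \<xi>2 \<gamma> (\<sigma>2S (cnj \<eta>)) = ract \<xi>2 (\<sigma>2S \<eta>) m"
      using mS \<eta>(3) \<zeta>\<eta> unfolding matched_def by metis
    have e1: "lact \<xi>1 (\<gamma> ** \<tau>) (\<sigma>1N \<eta>) = ract \<xi>1 (\<sigma>1N \<eta>) (inv (t1 \<eta>) \<otimes> m)"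
      using lact_mult[OF equivariant1 \<gamma>(1) \<tau>(1) NE(1)[OF \<eta>(1)]] m(2) c1(2)[OF \<eta>(1)] tG[OF \<eta>(1)]
        ract_mult[OF pb1 NE(1)[OF \<eta>(1)] _ m(1), of "inv (t1 \<eta>)"] by (simp add: \<sigma>1S_def)
    have e2: "lact \<xi>2 (\<gamma> ** \<tau>) (\<sigma>2N \<eta>) = ract \<xi>2 (\<sigma>2N \<eta>) (inv (t2 \<eta>) \<otimes> m)"
      using lact_mult[OF equivariant2 \<gamma>(1) \<tau>(1) NE(2)[OF \<eta>(1)]] m(3) c2(2)[OF \<eta>(1)] tG[OF \<eta>(1)]
        ract_mult[OF pb2 NE(2)[OF \<eta>(1)] _ m(1), of "inv (t2 \<eta>)"] by (simp add: \<sigma>2S_def)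
    have "inv (t1 \<eta>) \<otimes> m = inv (t2 \<eta>) \<otimes> m"
      using iso unfolding e1 e2
      using translation_ract[OF pb1 NE(1)[OF \<eta>(1)]] translation_ract[OF pb2 NE(2)[OF \<eta>(1)]] tG[OF \<eta>(1)] m(1) by simp
    then have "inv (t1 \<eta>) = inv (t2 \<eta>)"
      using tG[OF \<eta>(1)] m(1) by simp
    then show ?thesis using tG[OF \<eta>(1)] by (metis inv_inv)
  qed
  have "\<exists>V. continuous_map (top_of_set (sphere 0 1)) (gtop G) V \<and> disc_null G (\<lambda>z. (t1 z \<otimes> inv (t2 z)) \<otimes> inv (V z [^] (2 * n)))"
  proof (rule dihedral_invariant_power[OF _ n])
    show "continuous_map (top_of_set (sphere 0 1)) (gtop G) (\<lambda>z. t1 z \<otimes> inv (t2 z))"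
      by (intro continuous_mult continuous_inv t1(1) t2(1))
    show "t1 (cis (2 * pi / real n) * z) \<otimes> inv t2 (cis (2 * pi / real n) * z) = t1 z \<otimes> inv t2 z" if "z \<in> sphere 0 1" for z
      by (rule matched_transition[OF \<gamma>(1) _ N[unfolded \<zeta>_def] S mS[unfolded \<zeta>_def] _ _ that]) (use t1(2) t2(2) in auto)
    show "t1 (cnj z) \<otimes> inv (t2 (cnj z)) = inv (t1 z \<otimes> inv (t2 z))" if "z \<in> sphere 0 1" for z
      using c1(1)[OF that] c2(1)[OF that] tG[OF that] by (simp add: inv_mult)
    show "t1 1 \<otimes> inv (t2 1) = \<one>" using one tG[of 1] by simp
    show "t1 (cis (pi / real n)) \<otimes> inv (t2 (cis (pi / real n))) = \<one>"
      using half tG[OF \<eta>(1)] by (simp flip: \<eta>_def)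
  qed
  then show ?thesis
    using divisible_at_of_power[OF N(1,2) S t1 t2] by blast
qed

end

section \<open>Finite rotation groups\<close>

definition rotation_z :: "real \<Rightarrow> real^3^3" where
  "rotation_z a = vector [vector [cos a, - sin a, 0], vector [sin a, cos a, 0], vector [0, 0, 1]]"

definition rotation_y :: "real \<Rightarrow> real^3^3" where
  "rotation_y b = vector [vector [cos b, 0, sin b], vector [0, 1, 0], vector [- sin b, 0, cos b]]"

lemma rotation_z_vector: "rotation_z a *v x = sphere_point (cis a * horizontal x) (x $ 3)"
  by (simp add: rotation_z_def vec_eq_iff forall_3 matrix_vector_mult_def sum_3 horizontal_def)

lemma rotation_y_vector:
  "rotation_y b *v x = sphere_point (Complex (cos b * x $ 1 + sin b * x $ 3) (x $ 2)) (cos b * x $ 3 - sin b * x $ 1)"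
  by (simp add: rotation_y_def vec_eq_iff forall_3 matrix_vector_mult_def sum_3)

lemma rotation_matrix_z: "rotation_matrix (rotation_z a)"
  by (simp add: rotation_matrix_def orthogonal_matrix rotation_z_def vec_eq_iff forall_3 matrix_matrix_mult_def
      transpose_def sum_3 mat_def det_3 power2_eq_square[symmetric])

lemma rotation_matrix_y: "rotation_matrix (rotation_y b)"
  by (simp add: rotation_matrix_def orthogonal_matrix rotation_y_def vec_eq_iff forall_3 matrix_matrix_mult_def
      transpose_def sum_3 mat_def det_3 power2_eq_square[symmetric])

lemma rotation_matrix_mult: "rotation_matrix A \<Longrightarrow> rotation_matrix B \<Longrightarrow> rotation_matrix (A ** B)"
  for A B :: "real^3^3"
  by (simp add: rotation_matrix_def orthogonal_matrix_mul det_mul)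

lemma rotation_matrix_transpose: "rotation_matrix A \<Longrightarrow> rotation_matrix (transpose A)"
  for A :: "real^3^3"
  by (simp add: rotation_matrix_def orthogonal_matrix_def)

lemma rotation_inverse:
  fixes A :: "real^3^3"
  assumes "rotation_matrix A"
  shows "transpose A *v (A *v x) = x" "A *v (transpose A *v x) = x"
  unfolding matrix_vector_mul_assoc using assms by (simp_all add: rotation_matrix_def orthogonal_matrix_def)

lemma rotation_sphere:
  fixes A :: "real^3^3"
  assumes "rotation_matrix A" "x \<in> sphere 0 1"
  shows "A *v x \<in> sphere 0 1"
proof -
  have "orthogonal_transformation ((*v) A)"
    using assms(1) by (simp add: rotation_matrix_def orthogonal_transformation_matrix)
  then show ?thesis
    using orthogonal_transformation_norm[of "(*v) A" x] assms(2) by simp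
qed

definition north_pole :: "real^3" where "north_pole = sphere_point 0 1"

lemma north_pole_axis: "north_pole = axis 3 1"
  by (simp add: north_pole_def sphere_point_def)

text \<open>The image of the pole is the third column; orthogonality clears the third row, and the
  remaining block has determinant \<open>c\<close>. Then
  \<open>(p - s)\<^sup>2 + (q + r)\<^sup>2 = 0\<close> if \<open>c = 1\<close>, and
  \<open>(p + s)\<^sup>2 + (q - r)\<^sup>2 = 0\<close> if \<open>c = -1\<close>, so the block is a
  rotation or a reflection of the plane.\<close>

lemma rotation_fixing_pole:
  fixes M :: "real^3^3"
  assumes M: "rotation_matrix M" and c: "M *v north_pole = c *\<^sub>R north_pole" "c = 1 \<or> c = -1"
  shows "\<exists>\<omega>. cmod \<omega> = 1 \<and> (\<forall>z h. M *v sphere_point z h = sphere_point (\<omega> * (if c = 1 then z else cnj z)) (c * h))"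
proof -
  have col3: "M $ 1 $ 3 = 0" "M $ 2 $ 3 = 0" "M $ 3 $ 3 = c"
    using c(1) by (auto simp: north_pole_def vec_eq_iff forall_3 matrix_vector_mult_def sum_3)
  have orth: "transpose M ** M = mat 1" and det: "det M = 1"
    using M by (simp_all add: rotation_matrix_def orthogonal_matrix)
  have o: "(\<Sum>i\<in>UNIV. M $ i $ j * M $ i $ k) = (if j = k then 1 else 0)" for j k
    using orth by (simp add: vec_eq_iff matrix_matrix_mult_def transpose_def mat_def)
  have row3: "M $ 3 $ 1 = 0" "M $ 3 $ 2 = 0"
    using o[of 1 3] o[of 2 3] col3 c(2) by (auto simp: sum_3)
  define p q r s where "p = M $ 1 $ 1" and "q = M $ 1 $ 2" and "r = M $ 2 $ 1" and "s = M $ 2 $ 2"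
  have e: "p * p + r * r = 1" "q * q + s * s = 1"
    using o[of 1 1] o[of 2 2] row3 by (simp_all add: sum_3 p_def q_def r_def s_def)
  have d: "c * (p * s - q * r) = 1"
    using det col3 row3 by (simp add: det_3 p_def q_def r_def s_def algebra_simps)
  have act: "M *v sphere_point z h = sphere_point (Complex (p * Re z + q * Im z) (r * Re z + s * Im z)) (c * h)" for z h
    using col3 row3 by (simp add: vec_eq_iff forall_3 matrix_vector_mult_def sum_3 p_def q_def r_def s_def)
  have norm: "cmod (Complex p r) = 1"
    using e(1) by (simp add: cmod_def power2_eq_square)
  show ?thesis
  proof (cases "c = 1")
    case True
    have "(p - s)\<^sup>2 + (q + r)\<^sup>2 = (p * p + r * r) + (q * q + s * s) - 2 * (p * s - q * r)"
      by (simp add: power2_eq_square algebra_simps)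
    then have "(p - s)\<^sup>2 + (q + r)\<^sup>2 = 0" using e d True by simp
    then have "s = p" "q = - r" using sum_power2_eq_zero_iff[of "p - s" "q + r"] by auto
    then show ?thesis
      using norm True by (intro exI[of _ "Complex p r"]) (auto simp: act complex_eq_iff intro!: arg_cong2[where f = sphere_point])
  next
    case False
    then have c': "c = -1" using c by blast
    have "(p + s)\<^sup>2 + (q - r)\<^sup>2 = (p * p + r * r) + (q * q + s * s) + 2 * (p * s - q * r)"
      by (simp add: power2_eq_square algebra_simps)
    then have "(p + s)\<^sup>2 + (q - r)\<^sup>2 = 0" using e d c' by simp
    then have "s = - p" "q = r" using sum_power2_eq_zero_iff[of "p + s" "q - r"] by auto
    then show ?thesis
      using norm c' by (intro exI[of _ "Complex p r"]) (auto simp: act complex_eq_iff intro!: arg_cong2[where f = sphere_point])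
  qed
qed

lemma rotation_in_frame:
  fixes \<gamma> R :: "real^3^3"
  assumes \<gamma>: "rotation_matrix \<gamma>" and R: "rotation_matrix R"
    and c: "\<gamma> *v (R *v north_pole) = c *\<^sub>R (R *v north_pole)" "c = 1 \<or> c = -1"
  shows "\<exists>\<omega>. cmod \<omega> = 1 \<and>
    (\<forall>z h. \<gamma> *v (R *v sphere_point z h) = R *v sphere_point (\<omega> * (if c = 1 then z else cnj z)) (c * h))"
proof -
  define M where "M = transpose R ** \<gamma> ** R"
  have M: "rotation_matrix M"
    unfolding M_def by (intro rotation_matrix_mult rotation_matrix_transpose assms)
  have act: "M *v x = transpose R *v (\<gamma> *v (R *v x))" for x
    by (simp only: M_def matrix_vector_mul_assoc matrix_mul_assoc)
  have "M *v north_pole = c *\<^sub>R north_pole"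
    unfolding act c(1) using rotation_inverse(1)[OF R] by (simp add: matrix_vector_mult_scaleR)
  then obtain \<omega> where \<omega>: "cmod \<omega> = 1" "\<forall>z h. M *v sphere_point z h = sphere_point (\<omega> * (if c = 1 then z else cnj z)) (c * h)"
    using rotation_fixing_pole[OF M _ c(2)] by blast
  have "\<gamma> *v (R *v sphere_point z h) = R *v (M *v sphere_point z h)" for z h
    unfolding act using rotation_inverse(2)[OF R] by simp
  then show ?thesis using \<omega> by auto
qed

lemma frame_cover:
  fixes R :: "real^3^3"
  assumes "rotation_matrix R"
  shows "\<exists>z h. x = R *v sphere_point z h"
  using rotation_inverse(2)[OF assms, of x] sphere_point_horizontal[of "transpose R *v x"] by metis

lemma matrix_eq_in_frame:
  fixes A B R :: "real^3^3"
  assumes "rotation_matrix R" "\<And>z h. A *v (R *v sphere_point z h) = B *v (R *v sphere_point z h)"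
  shows "A = B"
  unfolding matrix_eq using frame_cover[OF assms(1)] assms(2) by metis

text \<open>Wanted because scaling the angles gives a path of rotations from the identity to
  \<open>R\<close>. The first two angles bring the pole to its image under \<open>R\<close>; what
  remains fixes the pole.\<close>

lemma euler_angles:
  fixes R :: "real^3^3"
  assumes R: "rotation_matrix R"
  shows "\<exists>\<alpha> \<beta> \<gamma>. R = rotation_z \<alpha> ** rotation_y \<beta> ** rotation_z \<gamma>"
proof -
  define a where "a = R *v north_pole"
  have "north_pole \<in> sphere 0 1"
    unfolding north_pole_def sphere_point_in_sphere by simp
  then have a: "a \<in> sphere 0 1"
    unfolding a_def by (rule rotation_sphere[OF R])
  have ha: "(cmod (horizontal a))\<^sup>2 + (a $ 3)\<^sup>2 = 1" by (rule horizontal_height[OF a])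
  define \<beta> where "\<beta> = arccos (a $ 3)"
  have "(a $ 3)\<^sup>2 \<le> 1" using ha by (smt (verit) zero_le_power2)
  then have a3: "\<bar>a $ 3\<bar> \<le> 1" by (simp add: abs_square_le_1)
  have cb: "cos \<beta> = a $ 3" "sin \<beta> = cmod (horizontal a)"
  proof -
    show "cos \<beta> = a $ 3" using a3 by (simp add: \<beta>_def cos_arccos_abs)
    have "sin \<beta> = sqrt (1 - (a $ 3)\<^sup>2)" using a3 by (simp add: \<beta>_def sin_arccos_abs)
    also have "1 - (a $ 3)\<^sup>2 = (cmod (horizontal a))\<^sup>2" using ha by simp
    finally show "sin \<beta> = cmod (horizontal a)" by simp
  qed
  obtain \<theta> where \<theta>: "horizontal a = of_real (cmod (horizontal a)) * cis (2 * pi * \<theta>)"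
    by (rule polar_coordinates)
  define Q where "Q = rotation_z (2 * pi * \<theta>) ** rotation_y \<beta>"
  have Q: "rotation_matrix Q"
    unfolding Q_def by (intro rotation_matrix_mult rotation_matrix_z rotation_matrix_y)
  have "Q *v north_pole = sphere_point (cis (2 * pi * \<theta>) * Complex (sin \<beta>) 0) (cos \<beta>)"
    by (simp add: Q_def matrix_vector_mul_assoc[symmetric] rotation_z_vector rotation_y_vector north_pole_def)
  also have "cis (2 * pi * \<theta>) * Complex (sin \<beta>) 0 = horizontal a"
    unfolding cb(2) by (subst (2) \<theta>) (simp add: complex_of_real_def mult.commute)
  finally have Qa: "Q *v north_pole = a"
    unfolding cb(1) sphere_point_horizontal .
  define M where "M = transpose Q ** R"
  have M: "rotation_matrix M"
    unfolding M_def by (intro rotation_matrix_mult rotation_matrix_transpose Q R)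
  have "M *v north_pole = 1 *\<^sub>R north_pole"
    using rotation_inverse(1)[OF Q, of north_pole] Qa by (simp add: M_def matrix_vector_mul_assoc[symmetric] a_def)
  then obtain \<omega> where \<omega>: "cmod \<omega> = 1" "\<And>z h. M *v sphere_point z h = sphere_point (\<omega> * z) h"
    using rotation_fixing_pole[OF M, of 1] by auto
  obtain \<phi> where "\<omega> = of_real (cmod \<omega>) * cis (2 * pi * \<phi>)"
    by (rule polar_coordinates)
  then have \<phi>: "\<omega> = cis (2 * pi * \<phi>)" using \<omega>(1) by simp
  have "M = rotation_z (2 * pi * \<phi>)"
    unfolding matrix_eq using \<omega>(2) \<phi> sphere_point_horizontal rotation_z_vector by metis
  moreover have "Q ** M = R"
    using Q by (simp add: M_def matrix_mul_assoc rotation_matrix_def orthogonal_matrix_def)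
  ultimately show ?thesis unfolding Q_def by metis
qed

text \<open>\<open>det (A - mat 1) = det (mat 1 - A)\<close> for a rotation, and in odd dimension
  these are opposite; so 1 is an eigenvalue.\<close>

lemma rotation_axis_exists:
  fixes A :: "real^3^3"
  assumes A: "rotation_matrix A"
  shows "\<exists>a. norm a = 1 \<and> A *v a = a"
proof -
  have o: "A ** transpose A = mat 1" "det A = 1"
    using A by (simp_all add: rotation_matrix_def orthogonal_matrix_def)
  have "det (A - mat 1) = det (A ** transpose (mat 1 - A))"
  proof -
    have "transpose (mat 1 - A) = mat 1 - transpose A"
      by (simp add: vec_eq_iff transpose_def mat_def)
    moreover have "A ** (mat 1 - transpose A) = A ** mat 1 - A ** transpose A"
      by (simp add: vec_eq_iff matrix_matrix_mult_def sum_subtractf algebra_simps)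
    ultimately show ?thesis using o(1) by simp
  qed
  also have "\<dots> = det (mat 1 - A)"
    using o(2) by (simp add: det_mul det_transpose)
  also have "\<dots> = - det (A - mat 1)"
    by (simp add: det_3 algebra_simps)
  finally have "det (A - mat 1) = 0" by simp
  then obtain x where x: "x \<noteq> 0" "(A - mat 1) *v x = 0"
    using invertible_det_nz[of "A - mat 1"] invertible_left_inverse[of "A - mat 1"] matrix_left_invertible_ker[of "A - mat 1"]
    by blast
  then have "A *v x = x"
    by (simp add: matrix_vector_mult_diff_rdistrib)
  then show ?thesis
    using x(1) by (intro exI[of _ "(1 / norm x) *\<^sub>R x"]) (simp add: matrix_vector_mult_scaleR)
qed

text \<open>With \<open>a\<close> as pole, \<open>A\<close> multiplies the horizontal coordinate by
  some \<open>\<omega>\<close>, which differs from 1; a fixed point therefore has horizontal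
  coordinate 0.\<close>

lemma rotation_axis_unique:
  fixes A :: "real^3^3"
  assumes A: "rotation_matrix A" "A \<noteq> mat 1" and a: "norm a = 1" "A *v a = a" and b: "norm b = 1" "A *v b = b"
  shows "b = a \<or> b = - a"
proof -
  obtain R where R: "rotation_matrix R" "R *v north_pole = a"
    using rotation_matrix_exists_basis[of a 3] a(1) unfolding north_pole_axis by auto
  obtain \<omega> where \<omega>: "\<And>z h. A *v (R *v sphere_point z h) = R *v sphere_point (\<omega> * z) h"
    using rotation_in_frame[OF A(1) R(1), of 1] a R by auto
  obtain z h where zh: "b = R *v sphere_point z h"
    using frame_cover[OF R(1)] by blast
  have "R *v sphere_point (\<omega> * z) h = R *v sphere_point z h"
    using b(2) \<omega> zh by simp
  then have "sphere_point (\<omega> * z) h = sphere_point z h"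
    using rotation_inverse(1)[OF R(1)] by metis
  then have \<omega>z: "\<omega> * z = z"
    using horizontal_sphere_point by metis
  have "z = 0"
  proof (rule ccontr)
    assume "z \<noteq> 0"
    then have "\<omega> = 1" using \<omega>z by simp
    then have "A = mat 1"
      using matrix_eq_in_frame[OF R(1), of A "mat 1"] \<omega> by simp
    then show False using A(2) by blast
  qed
  have "transpose R *v b \<in> sphere 0 1"
    by (rule rotation_sphere[OF rotation_matrix_transpose[OF R(1)]]) (use b in simp)
  then have "sphere_point 0 h \<in> sphere 0 1"
    using rotation_inverse(1)[OF R(1)] zh \<open>z = 0\<close> by simp
  then have "h = 1 \<or> h = -1"
    unfolding sphere_point_in_sphere by (simp add: power2_eq_1_iff)
  moreover have "sphere_point 0 (-1) = - north_pole"
    by (simp add: north_pole_def sphere_point_def)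
  moreover have "R *v (- x) = - (R *v x)" for x
    using matrix_vector_mult_scaleR[of R "-1" x] by simp
  ultimately show ?thesis
    using zh \<open>z = 0\<close> R(2) by (auto simp: north_pole_def)
qed

text \<open>The class equation: if only the neutral element were central, all other conjugacy
  classes would have size divisible by \<open>p\<close>, and \<open>p ^ k\<close> would be 1 modulo
  \<open>p\<close>.\<close>

lemma (in group) p_group_center:
  assumes p: "prime p" and ord: "order G = p ^ k" "k > 0"
  shows "\<exists>z\<in>carrier G. z \<noteq> \<one> \<and> (\<forall>x\<in>carrier G. x \<otimes> z = z \<otimes> x)"
proof (rule ccontr)
  assume no: "\<not> ?thesis"
  let ?\<phi> = "\<lambda>g. \<lambda>h\<in>carrier G. g \<otimes> h \<otimes> inv g"
  interpret A: group_action G "carrier G" ?\<phi> by (rule action_by_conjugation)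
  have fin: "finite (carrier G)"
    using ord p prime_gt_0_nat[OF p] by (metis card.infinite order_def power_not_zero not_less_zero)
  have orb: "orbit G ?\<phi> x = {g \<otimes> x \<otimes> inv g | g. g \<in> carrier G}" if "x \<in> carrier G" for x
    using that by (auto simp: orbit_def)
  have orb1: "orbit G ?\<phi> \<one> = {\<one>}"
    by (subst orb) (auto intro: exI[of _ \<one>])
  have finO: "finite (orbits G (carrier G) ?\<phi>)"
    unfolding orbits_def using fin by simp
  have dvd: "p dvd card Q" if Q: "Q \<in> orbits G (carrier G) ?\<phi> - {{\<one>}}" for Q
  proof -
    obtain x where x: "x \<in> carrier G" "Q = orbit G ?\<phi> x"
      using Q by (auto simp: orbits_def)
    have "x \<noteq> \<one>" using Q x orb1 by auto
    then obtain y where y: "y \<in> carrier G" "y \<otimes> x \<noteq> x \<otimes> y"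
      using no x by blast
    have xQ: "x \<in> Q" unfolding x(2) orb[OF x(1)] using x(1) by (force intro: exI[of _ \<one>])
    have yQ: "y \<otimes> x \<otimes> inv y \<in> Q" unfolding x(2) orb[OF x(1)] using y by blast
    have "y \<otimes> x \<otimes> inv y \<noteq> x"
    proof
      assume "y \<otimes> x \<otimes> inv y = x"
      then have "y \<otimes> x = x \<otimes> y" using x y inv_solve_right'[of x "y \<otimes> x" y] by simp
      then show False using y by blast
    qed
    then have "card Q \<noteq> 1" using xQ yQ by (auto simp: card_1_singleton_iff)
    moreover have "card Q dvd p ^ k"
    proof -
      have "card Q * card (stabilizer G ?\<phi> x) = p ^ k"
        using A.orbit_stabilizer_theorem[OF x(1)] ord x(2) by simp
      from this[symmetric] show ?thesis by (rule dvdI)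
    qed
    ultimately obtain j where "card Q = p ^ j" "j > 0"
      using divides_primepow_nat[OF p] by (metis gr0I power_0)
    then show ?thesis by (simp add: dvd_power)
  qed
  have "(\<Sum>Q\<in>orbits G (carrier G) ?\<phi>. card Q) = (\<Sum>x\<in>carrier G. 1)"
    using A.disjoint_sum[OF fin, of "\<lambda>_. 1::nat"] by simp
  then have sum: "(\<Sum>Q\<in>orbits G (carrier G) ?\<phi>. card Q) = p ^ k"
    using ord by (simp add: order_def)
  have "{\<one>} \<in> orbits G (carrier G) ?\<phi>"
    unfolding orbits_def using orb1 by blast
  then have "p ^ k = 1 + (\<Sum>Q\<in>orbits G (carrier G) ?\<phi> - {{\<one>}}. card Q)"
    using sum sum.remove[OF finO, of "{\<one>}" card] by simp
  moreover have "p dvd (\<Sum>Q\<in>orbits G (carrier G) ?\<phi> - {{\<one>}}. card Q)"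
    by (rule dvd_sum) (use dvd in blast)
  moreover have "p dvd p ^ k" using ord(2) by (simp add: dvd_power)
  ultimately have "p dvd 1"
    using dvd_add_left_iff[of p "\<Sum>Q\<in>orbits G (carrier G) ?\<phi> - {{\<one>}}. card Q" 1] by simp
  then show False using p by simp
qed

lemma (in comm_group) coprime_powers:
  assumes c: "x \<in> carrier G" "y \<in> carrier G" "x [^] m = y [^] (k::nat)" and mk: "coprime m k"
  shows "\<exists>z\<in>carrier G. x [^] m = z [^] (m * k :: nat)"
proof -
  obtain u v :: int where uv: "u * int m + v * int k = 1"
    using bezout_int[of "int m" "int k"] mk by (metis coprime_imp_gcd_eq_1 coprime_int_iff)
  define d where "d = x [^] m"
  have d: "d = x [^] int m" "d = y [^] int k" "d \<in> carrier G"
    using c by (simp_all add: d_def int_pow_int)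
  \<comment> \<open>The exponents are crossed: in the power \<open>m * k\<close>, both
    \<open>x\<close> and \<open>y\<close> turn into powers of the common value \<open>d\<close>,
    with total exponent \<open>u * m + v * k = 1\<close>.\<close>
  define z where "z = y [^] u \<otimes> x [^] v"
  have "z [^] (int m * int k) = y [^] (u * (int m * int k)) \<otimes> x [^] (v * (int m * int k))"
    unfolding z_def using c by (simp add: int_pow_distrib int_pow_pow)
  also have "\<dots> = (y [^] int k) [^] (u * int m) \<otimes> (x [^] int m) [^] (v * int k)"
    using c by (simp add: int_pow_pow mult_ac)
  also have "\<dots> = d [^] (u * int m + v * int k)"
    unfolding d(1)[symmetric] d(2)[symmetric] using int_pow_mult[OF d(3)] by simp
  also have "\<dots> = d" using uv d(3) by simp
  finally have "d = z [^] (m * k)"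
    by (simp flip: int_pow_int)
  then show ?thesis
    unfolding d_def z_def using c by blast
qed

text \<open>The prime powers in \<open>n\<close> are pairwise coprime, so being a power for each of
  them accumulates, one prime at a time.\<close>

lemma (in comm_group) power_of_prime_powers:
  assumes c: "c \<in> carrier G" and n: "n > 0"
    and div: "\<And>p. prime p \<Longrightarrow> p dvd n \<Longrightarrow> \<exists>z\<in>carrier G. c = z [^] (p ^ multiplicity p n)"
  shows "\<exists>z\<in>carrier G. c = z [^] (n::nat)"
proof -
  have "\<exists>z\<in>carrier G. c = z [^] (\<Prod>p\<in>S. p ^ multiplicity p n)" if "finite S" "S \<subseteq> prime_factors n" for S
    using that
  proof (induction S rule: finite_induct)
    case empty
    then show ?case using c by (intro bexI[of _ c]) auto
  next
    case (insert q S)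
    obtain y where y: "y \<in> carrier G" "c = y [^] (\<Prod>p\<in>S. p ^ multiplicity p n)"
      using insert by blast
    have q: "prime q" "q dvd n" using insert.prems by (auto simp: in_prime_factors_iff)
    obtain x where x: "x \<in> carrier G" "c = x [^] (q ^ multiplicity q n)"
      using div[OF q] by blast
    have "coprime (q ^ multiplicity q n) (\<Prod>p\<in>S. p ^ multiplicity p n)"
    proof (rule prod_coprime_right)
      fix p assume "p \<in> S"
      then have "prime p" "p \<noteq> q" using insert by (auto simp: in_prime_factors_iff)
      then show "coprime (q ^ multiplicity q n) (p ^ multiplicity p n)"
        using q(1) primes_coprime[of q p] by simp
    qed
    from coprime_powers[OF x(1) y(1) _ this] x(2) y(2) show ?case
      using insert.hyps by simp
  qed
  from this[of "prime_factors n"] show ?thesis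
    using prime_factorization_nat[OF n] by simp
qed

text \<open>Multiplication by \<open>w\<close> permutes \<open>W\<close>; comparing the product over
  \<open>W\<close> before and after gives the exponent.\<close>

lemma finite_unit_group_roots:
  fixes W :: "complex set"
  assumes W: "finite W" "\<And>x y. x \<in> W \<Longrightarrow> y \<in> W \<Longrightarrow> x * y \<in> W" "\<And>x. x \<in> W \<Longrightarrow> x \<noteq> 0" "w \<in> W"
  shows "w ^ card W = 1"
proof -
  have inj: "inj_on ((*) w) W"
    using W(3)[OF W(4)] by (auto simp: inj_on_def)
  have "(*) w ` W = W"
    by (rule endo_inj_surj[OF W(1) _ inj]) (use W in auto)
  then have "\<Prod>W = (\<Prod>x\<in>W. w * x)"
    using prod.reindex[OF inj, of "\<lambda>x. x"] by simp
  also have "\<dots> = w ^ card W * \<Prod>W"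
    by (simp add: prod.distrib)
  finally show ?thesis
    using W(1,3) by (simp add: prod_zero_iff)
qed

definition matrix_monoid :: "(real^3^3) set \<Rightarrow> (real^3^3) monoid" where
  "matrix_monoid H = \<lparr>carrier = H, monoid.mult = (**), one = mat 1\<rparr>"

lemma matrix_monoid_simps [simp]:
  "carrier (matrix_monoid H) = H" "x \<otimes>\<^bsub>matrix_monoid H\<^esub> y = x ** y" "\<one>\<^bsub>matrix_monoid H\<^esub> = mat 1"
  by (simp_all add: matrix_monoid_def)

lemma group_SO3: "group SO3"
proof (rule groupI)
  show "\<exists>y\<in>carrier SO3. y \<otimes>\<^bsub>SO3\<^esub> x = \<one>\<^bsub>SO3\<^esub>" if "x \<in> carrier SO3" for x
    using that rotation_matrix_transpose[of x]
    by (intro bexI[of _ "transpose x"]) (auto simp: SO3_def rotation_matrix_def orthogonal_matrix_def)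
  show "x \<otimes>\<^bsub>SO3\<^esub> y \<in> carrier SO3" if "x \<in> carrier SO3" "y \<in> carrier SO3" for x y
    using that rotation_matrix_mult[of x y] by (simp add: SO3_def)
qed (auto simp: SO3_def matrix_mul_assoc rotation_matrix_def orthogonal_matrix_def transpose_mat)

lemma group_matrix_monoid:
  assumes "subgroup \<Gamma> SO3"
  shows "group (matrix_monoid \<Gamma>)"
proof (rule groupI)
  interpret S: group SO3 by (rule group_SO3)
  have ops: "x \<otimes>\<^bsub>SO3\<^esub> y = x ** y" "\<one>\<^bsub>SO3\<^esub> = mat 1" for x y
    by (simp_all add: SO3_def)
  show "x \<otimes>\<^bsub>matrix_monoid \<Gamma>\<^esub> y \<in> carrier (matrix_monoid \<Gamma>)"
    if "x \<in> carrier (matrix_monoid \<Gamma>)" "y \<in> carrier (matrix_monoid \<Gamma>)" for x y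
    using subgroup.m_closed[OF assms] that by (simp add: ops)
  show "\<one>\<^bsub>matrix_monoid \<Gamma>\<^esub> \<in> carrier (matrix_monoid \<Gamma>)"
    using subgroup.one_closed[OF assms] by (simp add: ops)
  show "\<exists>y\<in>carrier (matrix_monoid \<Gamma>). y \<otimes>\<^bsub>matrix_monoid \<Gamma>\<^esub> x = \<one>\<^bsub>matrix_monoid \<Gamma>\<^esub>"
    if "x \<in> carrier (matrix_monoid \<Gamma>)" for x
  proof -
    have "x \<in> carrier SO3" using subgroup.subset[OF assms] that by auto
    then have "inv\<^bsub>SO3\<^esub> x ** x = mat 1"
      using S.l_inv[of x] by (simp add: ops)
    moreover have "inv\<^bsub>SO3\<^esub> x \<in> \<Gamma>"
      using subgroup.m_inv_closed[OF assms] that by simp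
    ultimately show ?thesis by auto
  qed
qed (simp_all add: matrix_mul_assoc)

lemma p_group_axis:
  assumes H: "group (matrix_monoid H)" "\<And>\<gamma>. \<gamma> \<in> H \<Longrightarrow> rotation_matrix \<gamma>" and p: "prime p" "card H = p ^ k"
  shows "\<exists>a. norm a = 1 \<and> (\<forall>\<gamma>\<in>H. \<gamma> *v a = a \<or> \<gamma> *v a = - a)"
proof (cases "k = 0")
  case True
  then obtain x where "H = {x}" using p(2) by (auto simp: card_1_singleton_iff)
  moreover have "mat 1 \<in> H"
    using group.is_monoid[OF H(1)] monoid.one_closed by fastforce
  ultimately have "H = {mat 1}" by simp
  then show ?thesis
    by (intro exI[of _ "axis 3 1"]) simp
next
  case False
  interpret M: group "matrix_monoid H" by (rule H(1))
  obtain z where z: "z \<in> H" "z \<noteq> mat 1" "\<forall>x\<in>H. x ** z = z ** x"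
    using M.p_group_center[OF p(1), of k] p(2) False by (auto simp: order_def)
  obtain a where a: "norm a = 1" "z *v a = a"
    using rotation_axis_exists[OF H(2)[OF z(1)]] by blast
  have "\<gamma> *v a = a \<or> \<gamma> *v a = - a" if "\<gamma> \<in> H" for \<gamma>
  proof (rule rotation_axis_unique[OF H(2)[OF z(1)] z(2) a])
    show "norm (\<gamma> *v a) = 1"
      using rotation_sphere[OF H(2)[OF that], of a] a by simp
    have "z *v (\<gamma> *v a) = (z ** \<gamma>) *v a"
      by (rule matrix_vector_mul_assoc)
    also have "\<dots> = \<gamma> *v (z *v a)"
      using z(3) that by (simp add: matrix_vector_mul_assoc)
    finally show "z *v (\<gamma> *v a) = \<gamma> *v a" using a by simp
  qed
  then show ?thesis using a(1) by blast
qed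

lemma frame_cancel:
  fixes R :: "real^3^3"
  assumes "rotation_matrix R" "R *v sphere_point z h = R *v sphere_point z' h'"
  shows "z = z'" "h = h'"
proof -
  have "sphere_point z h = sphere_point z' h'"
    using rotation_inverse(1)[OF assms(1)] assms(2) by metis
  then show "z = z'" "h = h'"
    using horizontal_sphere_point sphere_point_nth(3) by metis+
qed

section \<open>The contribution of a subgroup that preserves an axis\<close>

context equivariant_pair
begin

text \<open>The part \<open>C\<close> that fixes the axis embeds into the unit circle by its
  rotation factor \<open>\<omega>\<close>, hence is cyclic. If \<open>H\<close> is larger, any
  element that reverses the axis supplies the half turn, and it doubles the order.\<close>

lemma divisible_by_axial_subgroup:
  assumes H: "H \<subseteq> \<Gamma>" "finite H" "mat 1 \<in> H" "\<And>x y. x \<in> H \<Longrightarrow> y \<in> H \<Longrightarrow> x ** y \<in> H"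
    "\<And>\<gamma>. \<gamma> \<in> H \<Longrightarrow> rotation_matrix \<gamma>"
    and a: "norm a = 1" "\<And>\<gamma>. \<gamma> \<in> H \<Longrightarrow> \<gamma> *v a = a \<or> \<gamma> *v a = - a"
  shows "\<exists>R. rotation_matrix R \<and> divisible_at R (card H)"
proof -
  obtain R where R: "rotation_matrix R" "R *v north_pole = a"
    using rotation_matrix_exists_basis[of a 3] a(1) unfolding north_pole_axis by auto
  define C where "C = {\<gamma>\<in>H. \<gamma> *v a = a}"
  have CH: "C \<subseteq> H" "finite C" using H(2) by (auto simp: C_def)
  have "\<exists>\<omega>. cmod \<omega> = 1 \<and> (\<forall>z h. \<gamma> *v (R *v sphere_point z h) = R *v sphere_point (\<omega> * z) h)" if "\<gamma> \<in> C" for \<gamma>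
    using rotation_in_frame[OF H(5) R(1), of \<gamma> 1] that R(2) by (auto simp: C_def)
  then obtain \<omega> where \<omega>: "\<And>\<gamma>. \<gamma> \<in> C \<Longrightarrow> cmod (\<omega> \<gamma>) = 1"
    "\<And>\<gamma> z h. \<gamma> \<in> C \<Longrightarrow> \<gamma> *v (R *v sphere_point z h) = R *v sphere_point (\<omega> \<gamma> * z) h"
    by metis
  have Cmult: "\<gamma> ** \<delta> \<in> C" if "\<gamma> \<in> C" "\<delta> \<in> C" for \<gamma> \<delta>
    using that H(4) by (simp add: C_def matrix_vector_mul_assoc[symmetric])
  have \<omega>mult: "\<omega> (\<gamma> ** \<delta>) = \<omega> \<gamma> * \<omega> \<delta>" if "\<gamma> \<in> C" "\<delta> \<in> C" for \<gamma> \<delta>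
  proof (rule frame_cancel(1)[OF R(1)])
    have "R *v sphere_point (\<omega> (\<gamma> ** \<delta>) * 1) 0 = (\<gamma> ** \<delta>) *v (R *v sphere_point 1 0)"
      using \<omega>(2)[OF Cmult[OF that], of 1 0] by simp
    also have "\<dots> = \<gamma> *v (\<delta> *v (R *v sphere_point 1 0))"
      by (rule matrix_vector_mul_assoc[symmetric])
    finally show "R *v sphere_point (\<omega> (\<gamma> ** \<delta>)) 0 = R *v sphere_point (\<omega> \<gamma> * \<omega> \<delta>) 0"
      using \<omega>(2) that by simp
  qed
  have inj: "inj_on \<omega> C"
  proof (rule inj_onI)
    fix \<gamma> \<delta> assume "\<gamma> \<in> C" "\<delta> \<in> C" "\<omega> \<gamma> = \<omega> \<delta>"
    then show "\<gamma> = \<delta>"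
      by (intro matrix_eq_in_frame[OF R(1)]) (simp add: \<omega>(2))
  qed
  define n where "n = card C"
  have "mat 1 \<in> C" using H(3) by (simp add: C_def)
  then have n: "n > 0" using CH(2) by (auto simp: n_def card_gt_0_iff)
  have card: "card (\<omega> ` C) = n" using inj by (simp add: card_image n_def)
  have "x ^ n = 1" if x: "x \<in> \<omega> ` C" for x
  proof -
    have "x ^ card (\<omega> ` C) = 1"
    proof (rule finite_unit_group_roots)
      show "finite (\<omega> ` C)" using CH(2) by simp
      show "u * v \<in> \<omega> ` C" if "u \<in> \<omega> ` C" "v \<in> \<omega> ` C" for u v
        using that \<omega>mult Cmult by (auto simp flip: \<omega>mult)
      show "u \<noteq> 0" if "u \<in> \<omega> ` C" for u
        using that \<omega>(1) by force
    qed (rule x)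
    then show ?thesis using card by simp
  qed
  \<comment> \<open>The image consists of \<open>n\<close> distinct roots of
    \<open>z ^ n = 1\<close>, hence of all of them; in particular it contains the basic rotation
    factor.\<close>
  then have img: "\<omega> ` C = {z. z ^ n = 1}"
    using card card_roots_unity_eq[OF n] finite_roots_unity[of n] n
    by (intro card_subset_eq) auto
  define \<zeta> where "\<zeta> = cis (2 * pi / real n)"
  have "\<zeta> ^ n = 1" using n by (simp add: \<zeta>_def Complex.DeMoivre)
  then have "\<zeta> \<in> \<omega> ` C" using img by simp
  then obtain \<gamma> where \<gamma>: "\<gamma> \<in> C" "\<omega> \<gamma> = \<zeta>" by blast
  have \<gamma>\<Gamma>: "\<gamma> \<in> \<Gamma>" using \<gamma>(1) CH(1) H(1) by blast
  have rot: "\<gamma> *v (R *v sphere_point z h) = R *v sphere_point (\<zeta> * z) h" for z h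
    using \<omega>(2)[OF \<gamma>(1)] \<gamma>(2) by simp
  have "matrix_power \<gamma> k *v (R *v sphere_point z h) = R *v sphere_point (\<zeta> ^ k * z) h" for k z h
    by (induction k) (simp_all add: matrix_vector_mul_assoc[symmetric] rot mult.assoc)
  then have \<gamma>n: "matrix_power \<gamma> n = mat 1"
    by (intro matrix_eq_in_frame[OF R(1)]) (simp add: \<open>\<zeta> ^ n = 1\<close>)
  show ?thesis
  proof (cases "H = C")
    case True
    have "divisible_at R n"
      by (rule cyclic_divisible[OF n \<gamma>\<Gamma> \<gamma>n]) (use rot rotation_sphere[OF R(1)] in \<open>auto simp: \<zeta>_def\<close>)
    then show ?thesis using R(1) True by (auto simp: n_def)
  next
    case False
    then obtain \<tau> where \<tau>: "\<tau> \<in> H" "\<tau> *v a = - a"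
      using a(2) CH(1) by (auto simp: C_def)
    then obtain \<epsilon> where \<epsilon>: "cmod \<epsilon> = 1" "\<And>z h. \<tau> *v (R *v sphere_point z h) = R *v sphere_point (\<epsilon> * cnj z) (- h)"
      using rotation_in_frame[OF H(5) R(1), of \<tau> "-1"] R(2) by auto
    \<comment> \<open>In the frame \<open>R\<close> the reversing rotation acts by
      \<open>\<epsilon> * cnj z\<close>. Turning the frame about the axis by a square root
      \<open>\<mu>\<close> of \<open>\<epsilon>\<close> makes this plain conjugation, since
      \<open>\<epsilon> * cnj (\<mu> * z) = \<mu> * cnj z\<close>; the factor of
      \<open>\<gamma>\<close> is unchanged.\<close>
    obtain \<theta> where "csqrt \<epsilon> = of_real (cmod (csqrt \<epsilon>)) * cis (2 * pi * \<theta>)"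
      by (rule polar_coordinates)
    moreover define \<mu> where "\<mu> = cis (2 * pi * \<theta>)"
    ultimately have "csqrt \<epsilon> = \<mu>"
      using \<epsilon>(1) by (simp add: norm_csqrt)
    then have \<mu>: "\<epsilon> = \<mu> * \<mu>"
      using power2_csqrt[of \<epsilon>] by (simp add: power2_eq_square)
    have \<mu>c: "\<mu> * cnj \<mu> = 1" by (simp add: \<mu>_def cis_cnj cis_mult)
    define R' where "R' = R ** rotation_z (2 * pi * \<theta>)"
    have R': "rotation_matrix R'"
      unfolding R'_def by (intro rotation_matrix_mult R rotation_matrix_z)
    have act: "R' *v sphere_point z h = R *v sphere_point (\<mu> * z) h" for z h
      by (simp add: R'_def matrix_vector_mul_assoc[symmetric] rotation_z_vector \<mu>_def)
    have rot': "\<gamma> *v (R' *v sphere_point z h) = R' *v sphere_point (\<zeta> * z) h" for z h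
      unfolding act rot by (simp add: mult.left_commute)
    have flip': "\<tau> *v (R' *v sphere_point z h) = R' *v sphere_point (cnj z) (- h)" for z h
    proof -
      have "\<epsilon> * cnj (\<mu> * z) = \<mu> * (\<mu> * cnj \<mu>) * cnj z" by (simp add: \<mu> mult_ac)
      then have "\<epsilon> * cnj (\<mu> * z) = \<mu> * cnj z" unfolding \<mu>c by simp
      then show ?thesis unfolding act \<epsilon>(2) by (simp only:)
    qed
    have \<tau>\<tau>: "\<tau> ** \<tau> = mat 1"
      by (rule matrix_eq_in_frame[OF R']) (simp add: matrix_vector_mul_assoc[symmetric] flip')
    have "\<zeta> * cnj \<zeta> = 1" by (simp add: \<zeta>_def cis_cnj cis_mult)
    then have \<zeta>c: "\<zeta> * (cnj \<zeta> * x) = x" for x by (simp flip: mult.assoc)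
    have \<gamma>\<tau>\<gamma>: "\<gamma> ** \<tau> ** \<gamma> = \<tau>"
      by (rule matrix_eq_in_frame[OF R']) (simp add: matrix_vector_mul_assoc[symmetric] flip' rot' \<zeta>c)
    have div: "divisible_at R' (2 * n)"
      by (rule dihedral_divisible[OF n \<gamma>\<Gamma> \<gamma>n _ _ _ \<tau>\<tau> \<gamma>\<tau>\<gamma>])
        (use rot' flip' rotation_sphere[OF R'] \<tau>(1) H(1) in \<open>auto simp: \<zeta>_def\<close>)
    have neg: "\<gamma> *v (- x) = - (\<gamma> *v x)" for \<gamma> :: "real^3^3" and x
      using matrix_vector_mult_scaleR[of \<gamma> "-1" x] by simp
    have a0: "a \<noteq> - a"
    proof
      assume "a = - a"
      then have "a = 0" by (simp add: vec_eq_iff)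
      then show False using a(1) by simp
    qed
    have "(**) \<tau> ` C = H - C"
    proof (intro equalityI subsetI)
      fix x assume "x \<in> (**) \<tau> ` C"
      then obtain \<delta> where \<delta>: "\<delta> \<in> C" "x = \<tau> ** \<delta>" by blast
      then have "x *v a = - a" using \<tau>(2) by (simp add: C_def matrix_vector_mul_assoc[symmetric])
      then show "x \<in> H - C" using \<delta> H(4)[OF \<tau>(1)] CH(1) a0 by (auto simp: C_def)
    next
      fix x assume x: "x \<in> H - C"
      then have "x *v a = - a" using a(2) by (auto simp: C_def)
      then have "\<tau> ** x \<in> C"
        using x \<tau> H(4) by (simp add: C_def matrix_vector_mul_assoc[symmetric] neg)
      moreover have "x = \<tau> ** (\<tau> ** x)" by (simp add: matrix_mul_assoc \<tau>\<tau>)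
      ultimately show "x \<in> (**) \<tau> ` C" by blast
    qed
    moreover have "inj_on ((**) \<tau>) C"
    proof (rule inj_onI)
      fix x y assume "\<tau> ** x = \<tau> ** y"
      then have "\<tau> ** (\<tau> ** x) = \<tau> ** (\<tau> ** y)" by simp
      then show "x = y" by (simp add: matrix_mul_assoc \<tau>\<tau>)
    qed
    ultimately have "card (H - C) = n" by (metis card_image n_def)
    then have "card H = 2 * n"
      using card_Diff_subset[OF CH(2,1)] card_mono[OF H(2) CH(1)] by (simp add: n_def)
    then show ?thesis using div R' by metis
  qed
qed

end

section \<open>From clutching maps in a rotated frame to Chern classes\<close>

context abelian_topological_group
begin

text \<open>A path of rotations from the identity to \<open>R\<close> is a homotopy between the two
  parametrizations of the sphere. It moves the south pole, but the boundary of the square stays over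
  one point at every time.\<close>

lemma clutching_rotation:
  fixes \<xi> :: "('e, real^3, 'g, 'z) pbundle_scheme"
  assumes \<xi>: "principal_bundle G \<xi>" "base_space \<xi> = S2" and R: "rotation_matrix R"
    and w: "clutching G \<xi> (\<lambda>z. R *v square_to_S2 z) w"
  shows "clutching G \<xi> square_to_S2 w"
proof -
  obtain \<alpha> \<beta> \<gamma> where e: "R = rotation_z \<alpha> ** rotation_y \<beta> ** rotation_z \<gamma>"
    using euler_angles[OF R] by blast
  define Q where "Q t = rotation_z (t * \<alpha>) ** rotation_y (t * \<beta>) ** rotation_z (t * \<gamma>)" for t :: real
  have Q: "rotation_matrix (Q t)" for t
    unfolding Q_def by (intro rotation_matrix_mult rotation_matrix_z rotation_matrix_y)
  define H where "H p = Q (snd p) *v square_to_S2 (fst p)" for p :: "(real \<times> real) \<times> real"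
  have cz: "continuous_on S (\<lambda>p. rotation_z (c p) *v f p)" if "continuous_on S c" "continuous_on S f"
    for S :: "((real \<times> real) \<times> real) set" and c f
    unfolding rotation_z_vector sphere_point_def horizontal_def Complex_eq cis_conv_exp
    by (intro continuous_intros that)
  have cy: "continuous_on S (\<lambda>p. rotation_y (c p) *v f p)" if "continuous_on S c" "continuous_on S f"
    for S :: "((real \<times> real) \<times> real) set" and c f
    unfolding rotation_y_vector sphere_point_def complex.sel
    by (intro continuous_intros that)
  have "continuous_on (unit_square \<times> {0..1}) (\<lambda>p. rotation_z (snd p * \<alpha>) *v (rotation_y (snd p * \<beta>) *v (rotation_z (snd p * \<gamma>) *v square_to_S2 (fst p))))"
    by (intro cz cy continuous_intros continuous_on_compose2[OF continuous_square_to_S2[of UNIV]]) auto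
  then have "continuous_on (unit_square \<times> {0..1}) H"
    by (simp only: H_def[abs_def] Q_def matrix_vector_mul_assoc matrix_mul_assoc)
  moreover have "H p \<in> sphere 0 1" for p
    unfolding H_def by (rule rotation_sphere[OF Q square_to_S2_in_sphere])
  ultimately have cH: "continuous_map (top_of_set (unit_square \<times> {0..1})) (base_space \<xi>) H"
    unfolding \<xi>(2) S2_def by (auto simp del: mem_sphere_0)
  have Q0: "Q 0 = mat 1"
    unfolding matrix_eq
    by (simp add: Q_def matrix_vector_mul_assoc[symmetric] rotation_z_vector rotation_y_vector vec_eq_iff forall_3 horizontal_def)
  have Q1: "Q 1 = R"
    by (simp add: Q_def e)
  have "continuous_map square (base_space \<xi>) square_to_S2"
    using continuous_map_square_to_S2 \<xi>(2) by simp
  then obtain w0 where w0: "clutching G \<xi> square_to_S2 w0"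
    using clutching_exists[OF \<xi>(1)] square_to_S2_boundary by blast
  have "boundary_equiv G w w0"
    by (rule clutching_homotopy[OF \<xi>(1) cH, of "\<lambda>t. Q t *v sphere_point 0 (-1)"])
      (use w w0 square_to_S2_boundary in \<open>simp_all add: H_def Q0 Q1\<close>)
  then show ?thesis
    using clutching_cong_equiv[OF \<xi>(1) w0] by blast
qed

end

lemma (in equivariant_pair) divisible_chern_class:
  fixes \<zeta> :: "('e, 'b, 'g, 'z) pbundle_scheme"
  assumes \<zeta>: "universal_bundle G \<zeta>" and b: "b \<in> topspace (base_space \<zeta>)"
    and R: "rotation_matrix R" "divisible_at R m"
  shows "\<exists>d\<in>carrier (pi2 (base_space \<zeta>) b). chern_class G \<zeta> b \<xi>1 \<otimes>\<^bsub>pi2 (base_space \<zeta>) b\<^esub>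
    inv\<^bsub>pi2 (base_space \<zeta>) b\<^esub> chern_class G \<zeta> b \<xi>2 = d [^]\<^bsub>pi2 (base_space \<zeta>) b\<^esub> m"
proof -
  obtain w1 w2 v where w: "clutching G \<xi>1 (\<lambda>z. R *v square_to_S2 z) w1" "clutching G \<xi>2 (\<lambda>z. R *v square_to_S2 z) w2"
    "continuous_map (top_of_set square_boundary) (gtop G) v"
    "boundary_equiv G (\<lambda>z. w1 z \<otimes> inv (w2 z)) (\<lambda>z. v z [^] m)"
    using R(2) unfolding divisible_at_def by blast
  have r1: "represents G \<zeta> b (chern_class G \<zeta> b \<xi>1) w1"
    by (rule chern_class_represents[OF pb1 base1 \<zeta> b clutching_rotation[OF pb1 base1 R(1) w(1)]])
  have r2: "represents G \<zeta> b (chern_class G \<zeta> b \<xi>2) w2"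
    by (rule chern_class_represents[OF pb2 base2 \<zeta> b clutching_rotation[OF pb2 base2 R(1) w(2)]])
  obtain d where d: "represents G \<zeta> b d v"
    using represents_realize[OF \<zeta> w(3) b] by blast
  have "chern_class G \<zeta> b \<xi>1 \<otimes>\<^bsub>pi2 (base_space \<zeta>) b\<^esub> inv\<^bsub>pi2 (base_space \<zeta>) b\<^esub> chern_class G \<zeta> b \<xi>2
      = d [^]\<^bsub>pi2 (base_space \<zeta>) b\<^esub> m"
    by (rule represents_unique[OF \<zeta> represents_mult[OF \<zeta> r1 represents_inv[OF \<zeta> r2 b] b] represents_pow[OF \<zeta> d b] w(4)])
  then show ?thesis
    using represents_closed[OF \<zeta> d] by blast
qed

theorem corollary1p2:
  fixes G :: "'g tgroup"
    and \<Gamma> :: "(real^3^3) set"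
    and \<xi>1 :: "('e1, real^3, 'g, real^3^3) eqbundle"
    and \<xi>2 :: "('e2, real^3, 'g, real^3^3) eqbundle"
    and \<zeta> :: "('eg, 'bg, 'g) pbundle"
    and b :: 'bg
  assumes "lie_group G" and "compact_space (gtop G)" and "connected_space (gtop G)"
    and "comm_group G"
    and "subgroup \<Gamma> SO3" and "finite \<Gamma>"
    and "equivariant_bundle G (top_subgroup SO3 \<Gamma>) (*v) \<xi>1" and "base_space \<xi>1 = S2"
    and "equivariant_bundle G (top_subgroup SO3 \<Gamma>) (*v) \<xi>2" and "base_space \<xi>2 = S2"
    and "universal_bundle G \<zeta>" and "b \<in> topspace (base_space \<zeta>)"
    and "same_isotropy_reps G (top_subgroup SO3 \<Gamma>) (*v) \<xi>1 \<xi>2"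
  shows "chern_class G \<zeta> b \<xi>1 \<otimes>\<^bsub>pi2 (base_space \<zeta>) b\<^esub>
           m_inv (pi2 (base_space \<zeta>) b) (chern_class G \<zeta> b \<xi>2)
         \<in> {d [^]\<^bsub>pi2 (base_space \<zeta>) b\<^esub> card \<Gamma> | d. d \<in> carrier (pi2 (base_space \<zeta>) b)}"
proof -
  interpret C: comm_group G by (rule assms(4))
  interpret M: group "matrix_monoid \<Gamma>" by (rule group_matrix_monoid[OF assms(5)])
  interpret E: equivariant_pair G \<Gamma> \<xi>1 \<xi>2
  proof unfold_locales
    show "topological_group G" using assms(1) by (simp add: lie_group_def)
    show "mat 1 \<in> \<Gamma>" using M.one_closed by simp
    show "\<gamma> ** \<delta> \<in> \<Gamma>" if "\<gamma> \<in> \<Gamma>" "\<delta> \<in> \<Gamma>" for \<gamma> \<delta> using M.m_closed that by simp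
  qed (use assms in auto)
  let ?P = "pi2 (base_space \<zeta>) b"
  let ?c = "chern_class G \<zeta> b \<xi>1 \<otimes>\<^bsub>?P\<^esub> inv\<^bsub>?P\<^esub> chern_class G \<zeta> b \<xi>2"
  interpret P: comm_group ?P by (rule E.pi2_comm_group[OF assms(11,12)])
  have rot: "rotation_matrix \<gamma>" if "\<gamma> \<in> \<Gamma>" for \<gamma>
    using subgroup.subset[OF assms(5)] that by (auto simp: SO3_def)
  have div: "\<exists>d\<in>carrier ?P. ?c = d [^]\<^bsub>?P\<^esub> card H"
    if H: "subgroup H (matrix_monoid \<Gamma>)" and p: "prime p" "card H = p ^ k" for H and p k :: nat
  proof -
    have H\<Gamma>: "H \<subseteq> \<Gamma>" using subgroup.subset[OF H] by simp
    have "group (matrix_monoid \<Gamma>\<lparr>carrier := H\<rparr>)"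
      using subgroup.subgroup_is_group[OF H M.is_group] .
    then have grp: "group (matrix_monoid H)" by (simp add: matrix_monoid_def)
    obtain a where a: "norm a = 1" "\<forall>\<gamma>\<in>H. \<gamma> *v a = a \<or> \<gamma> *v a = - a"
      using p_group_axis[OF grp _ p] rot H\<Gamma> by blast
    have "\<exists>R. rotation_matrix R \<and> E.divisible_at R (card H)"
    proof (rule E.divisible_by_axial_subgroup[OF H\<Gamma> finite_subset[OF H\<Gamma> assms(6)] _ _ _ a(1)])
      show "mat 1 \<in> H" using subgroup.one_closed[OF H] by simp
      show "x ** y \<in> H" if "x \<in> H" "y \<in> H" for x y
        using subgroup.m_closed[OF H that] by simp
      show "rotation_matrix \<gamma>" "\<gamma> *v a = a \<or> \<gamma> *v a = - a" if "\<gamma> \<in> H" for \<gamma>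
        using rot H\<Gamma> a(2) that by blast+
    qed
    then obtain R where "rotation_matrix R" "E.divisible_at R (card H)"
      by blast
    then show ?thesis
      by (rule E.divisible_chern_class[OF assms(11,12)])
  qed
  have card: "card \<Gamma> > 0"
    using assms(6) E.mat_1 by (auto simp: card_gt_0_iff)
  have c: "?c \<in> carrier ?P"
  proof -
    \<comment> \<open>Membership of the difference comes from the trivial subgroup, of order
      \<open>2 ^ 0\<close>: there the power in question is the first.\<close>
    have "subgroup {\<one>\<^bsub>matrix_monoid \<Gamma>\<^esub>} (matrix_monoid \<Gamma>)" by (rule M.triv_subgroup)
    from div[OF this two_is_prime_nat, of 0] obtain d where "d \<in> carrier ?P" "?c = d [^]\<^bsub>?P\<^esub> (1::nat)"
      by auto
    then show ?thesis by simp
  qed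
  have "\<exists>d\<in>carrier ?P. ?c = d [^]\<^bsub>?P\<^esub> card \<Gamma>"
  proof (rule P.power_of_prime_powers[OF c card])
    fix p :: nat assume p: "prime p" "p dvd card \<Gamma>"
    \<comment> \<open>The full multiplicity, so that a Sylow subgroup accounts for the whole
      \<open>p\<close>-part of \<open>card \<Gamma>\<close>.\<close>
    define k where "k = multiplicity p (card \<Gamma>)"
    have "p ^ k dvd card \<Gamma>" by (simp add: k_def multiplicity_dvd)
    then obtain m where "card \<Gamma> = p ^ k * m" by (rule dvdE)
    then have "order (matrix_monoid \<Gamma>) = p ^ k * m" by (simp add: order_def)
    then obtain H where "subgroup H (matrix_monoid \<Gamma>)" "card H = p ^ k"
      using sylow_thm[OF p(1) M.is_group] assms(6) by auto
    then show "\<exists>z\<in>carrier ?P. ?c = z [^]\<^bsub>?P\<^esub> (p ^ multiplicity p (card \<Gamma>))"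
      using div p(1) by (auto simp: k_def)
  qed
  then show ?thesis by blast
qed

end
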